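(* Let $T>0$, let $L$ be a linear operator on $\mathbb{R}^m=E_0\oplus E_1$ ($\dim E_0=m_0$, $\dim E_1=m_1$) which is the direct sum of $L_0$ on $E_0$ (diagonalizable) and $L_1$ on $E_1$, and let $\ell\ge1$ be an integer. Let $\lambda^{(0)}_1,\dots,\lambda^{(0)}_{m_0}$ and $\lambda^{(1)}_1,\dots,\lambda^{(1)}_{m_1}$ be the eigenvalues of $L_0$ and $L_1$, and assume there are $\gamma,\tau>0$ such that for all $a\in\mathbb{N}^{m_0}$, $k\in\mathbb{Z}$, $1\le j\le m_1$, $$\Big|\langle a,\lambda^{(0)}\rangle+ik\tfrac{2\pi}{T}-\lambda^{(1)}_j\Big|\ge\frac{\gamma}{(|a|+|k|)^\tau},$$ this condition being read as $\lambda^{(1)}_j\neq0$ when $(a,k)=(0,0)$. Let $\nu$ be the maximal size of the Jordan blocks of $L_1$ and assume $\tau\nu\le\ell$. Consider the system $\frac{du}{dt}=Lu+V_\varepsilon(u,t)$ depending on a parameter $\varepsilon$, where $$V_\varepsilon(u,t)=A(u)+\varepsilon B(u,\varepsilon,t)+\varepsilon^2C(\varepsilon,t),\qquad A(0)=0,\ DA(0)=0,\ B(0,\cdot,\cdot)=0,$$ and where, as functions of $U=(u,\varepsilon)\in\mathbb{R}^{m+1}$ and $t$, $A,B,C$ belong to $\mathcal{A}(\mathbb{R}^{m+1},H^\ell(\mathbb{R}/T\mathbb{Z},\mathbb{R}^m))$. Write $u=u_0+u_1$ along $E_0\oplus E_1$, and set $b=\frac{1}{\ell+\tau\nu+1}$.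 Then there exist $\delta_0,M,M_0,\omega>0$ such that for all $\delta\in\,]0,\delta_0[$ there exist an integer $p_\delta$, with $p_\delta=O(\delta^{-b})$ as $\delta\to0$, and $\Phi\in\mathcal{P}_{p_\delta}(E_0\times\mathbb{R},H^{\ell+1}(\mathbb{R}/T\mathbb{Z},E_1))$ with $\Phi(0,0,\cdot)=0$ and $D_{(u_0,\varepsilon)}\Phi(0,0,\cdot)=0$ such that the change of variables $u_1=v_1+\Phi(u_0,\varepsilon,t)$ transforms the system into $$\frac{du_0}{dt}=L_0u_0+V^0(u_0,\varepsilon,v_1,t),\qquad\frac{dv_1}{dt}=L_1v_1+V^1(u_0,\varepsilon,v_1,t)+R(u_0,\varepsilon,t),$$ with $V^0,V^1,R$ analytic, $$|V^1(u_0,\varepsilon,v_1,\cdot)|_{H^\ell}\le M_0|v_1|\big(|(u_0,\varepsilon)|+|v_1|\big)\ \text{ for }|(u_0,\varepsilon)|,|v_1|\le\delta_0,\qquad \sup_{|(u_0,\varepsilon)|\le\delta}|R(u_0,\varepsilon,\cdot)|_{H^\ell}\le Me^{-\omega/\delta^b}.$$ Moreover $$\Phi(u_0,\varepsilon,t)=\Phi_A(u_0)+\varepsilon\,\Phi_{B,C}(u_0,\varepsilon,t),$$ where $\Phi_A$ does not depend on $t$ and is the change of variables for the system at $\varepsilon=0$; that is, $\Phi_A$ is a polynomial of degree at most $p_\delta$ with $\Phi_A(0)=0$, $D\Phi_A(0)=0$, and $u_1=v_1+\Phi_A(u_0)$ transforms $\frac{du}{dt}=Lu+A(u)$ into a system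 of the form $$\frac{du_0}{dt}=L_0u_0+V_A^0(u_0,v_1),\qquad\frac{dv_1}{dt}=L_1v_1+V_A^1(u_0,v_1)+R_A(u_0),$$ with $V_A^0,V_A^1,R_A$ analytic and $$|V_A^1(u_0,v_1)|\le M_0|v_1|\big(|u_0|+|v_1|\big)\ \text{ for }|u_0|,|v_1|\le\delta_0,\qquad \sup_{|u_0|\le\delta}|R_A(u_0)|\le Me^{-\omega/\delta^b}.$$
   Context: $H^\ell(\mathbb{R}/T\mathbb{Z},\mathbb{R}^m)$ is the Sobolev space of functions $f:\mathbb{R}/T\mathbb{Z}\to\mathbb{R}^m$ whose Fourier coefficients $f^{(k)}$ (with respect to $e^{ik\frac{2\pi}{T}t}$) satisfy $|f|_{H^\ell}^2:=\sum_{k\in\mathbb{Z}}(1+k^2)^\ell|f^{(k)}|^2<\infty$. $\mathcal{A}(\mathbb{R}^{m+1},H^\ell(\mathbb{R}/T\mathbb{Z},\mathbb{R}^m))$ is the space of maps $W(U,t)$ for which there are symmetric $q$-linear maps $W_q(t)$ from $(\mathbb{R}^{m+1})^q$ to $\mathbb{R}^m$, $q\ge0$, a radius of convergence $\rho>0$ and a constant $c>0$ such that $W(U,t)=\sum_{q\ge0}W_q(t)[U,\dots,U]$ and $|W_q(\cdot)[U_1,\dots,U_q]|_{H^\ell}\le\frac{c}{\rho^q}|U_1|\cdots|U_q|$ for all $U_1,\dots,U_q\in\mathbb{R}^{m+1}$. $\mathcal{P}_p(E_0\times\mathbb{R},H^{\ell+1}(\mathbb{R}/T\mathbb{Z},E_1))$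 is the space of polynomials of degree at most $p$ in the coordinates of $(u_0,\varepsilon)\in E_0\times\mathbb{R}$, with coefficients in $H^{\ell+1}(\mathbb{R}/T\mathbb{Z},E_1)$. For a multi-index $a$, $|a|=\sum_ia_i$ and $\langle a,\lambda\rangle=\sum_ia_i\lambda_i$. Eigenvalues and Jordan blocks are over $\mathbb{C}$. The parameter $\varepsilon$ is regarded as an additional variable with $\frac{d\varepsilon}{dt}=0$, adjoined to $u_0$.
   Formalization: The transformed systems and analyticity of V^0, V^1, R (and the ε=0 versions) are asserted only for |(u0,ε)|≤δ, |v1|≤δ0; between δ and δ0 the V^1 bounds concern an extension. On the whole δ0-ball they fail, e.g. for u0'=-u0², u1'=-u1+u0²+u1². *)

theory Defs
  imports "Jordan_Normal_Form.Jordan_Normal_Form" "HOL-Analysis.Analysis"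
    "HOL-Library.Landau_Symbols"
begin

section \<open>Linear algebra\<close>

definition direct_sum_decomp :: "(real ^ 'm) set \<Rightarrow> (real ^ 'm) set \<Rightarrow> bool" where
  "direct_sum_decomp E0 E1 \<longleftrightarrow> subspace E0 \<and> subspace E1 \<and> E0 \<inter> E1 = {0} \<and>
     (\<forall>u. \<exists>u0\<in>E0. \<exists>u1\<in>E1. u = u0 + u1)"

definition basis_list :: "(real ^ 'm) set \<Rightarrow> (real ^ 'm) list \<Rightarrow> bool" where
  "basis_list E bs \<longleftrightarrow> distinct bs \<and> independent (set bs) \<and> span (set bs) = E"

definition coord :: "(real ^ 'm) list \<Rightarrow> real ^ 'm \<Rightarrow> nat \<Rightarrow> real" where
  "coord bs u i = representation (set bs) u (bs ! i)"

text \<open>The matrix, seen over the complex numbers, of the restriction of \<open>L\<close> to the span of \<open>bs\<close>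
  (which is meant to be invariant under \<open>L\<close>). The three notions defined from it below
  do not depend on the choice of the basis.\<close>

definition complex_matrix ::
    "(real ^ 'm \<Rightarrow> real ^ 'm) \<Rightarrow> (real ^ 'm) list \<Rightarrow> complex Matrix.mat" where
  "complex_matrix L bs =
     Matrix.mat (length bs) (length bs) (\<lambda>(i, j). complex_of_real (coord bs (L (bs ! j)) i))"

text \<open>\<open>ev 0, \<dots>, ev (n - 1)\<close> are the eigenvalues of \<open>L\<close> on \<open>E\<close>, with algebraic multiplicity.\<close>

definition eigenvalues_on ::
    "(real ^ 'm) set \<Rightarrow> (real ^ 'm \<Rightarrow> real ^ 'm) \<Rightarrow> nat \<Rightarrow> (nat \<Rightarrow> complex) \<Rightarrow> bool" where
  "eigenvalues_on E L n ev \<longleftrightarrow>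
     (\<exists>bs. basis_list E bs \<and> char_poly (complex_matrix L bs) = (\<Prod>i<n. [:- ev i, 1:]))"

definition diagonalizable_on :: "(real ^ 'm) set \<Rightarrow> (real ^ 'm \<Rightarrow> real ^ 'm) \<Rightarrow> bool" where
  "diagonalizable_on E L \<longleftrightarrow>
     (\<exists>bs D. basis_list E bs \<and> diagonal_mat D \<and> similar_mat (complex_matrix L bs) D)"

text \<open>The inserted \<open>0\<close> only matters for \<open>E = {0}\<close>, where there is no Jordan block.\<close>

definition max_jordan_block_size ::
    "(real ^ 'm) set \<Rightarrow> (real ^ 'm \<Rightarrow> real ^ 'm) \<Rightarrow> nat \<Rightarrow> bool" where
  "max_jordan_block_size E L \<nu> \<longleftrightarrow>
     (\<exists>bs n_as. basis_list E bs \<and> jordan_nf (complex_matrix L bs) n_as \<and>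
        \<nu> = Max (insert 0 (fst ` set n_as)))"

text \<open>A multi-index of \<open>\<nat>\<^sup>n\<close> is a list of length \<open>n\<close>; for \<open>(a, k) = (0, 0)\<close> the right-hand side
  of the small divisor estimate is not defined and is replaced by \<open>ev1 j \<noteq> 0\<close>.\<close>

definition nonresonant ::
    "real \<Rightarrow> nat \<Rightarrow> nat \<Rightarrow> (nat \<Rightarrow> complex) \<Rightarrow> (nat \<Rightarrow> complex) \<Rightarrow> real \<Rightarrow> real \<Rightarrow> bool" where
  "nonresonant T m0 m1 ev0 ev1 \<gamma> \<tau> \<longleftrightarrow>
     (\<forall>(a :: nat list) (k :: int). \<forall>j<m1. length a = m0 \<longrightarrow>
        (if sum_list a = 0 \<and> k = 0 then ev1 j \<noteq> 0
         else cmod ((\<Sum>i<m0. of_nat (a ! i) * ev0 i)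
                    + \<i> * of_int k * of_real (2 * pi / T) - ev1 j)
              \<ge> \<gamma> / (real (sum_list a) + \<bar>real_of_int k\<bar>) powr \<tau>))"


section \<open>Periodic Sobolev spaces\<close>

definition fourier_coeff :: "real \<Rightarrow> (real \<Rightarrow> real ^ 'm) \<Rightarrow> int \<Rightarrow> complex ^ 'm" where
  "fourier_coeff T f k =
     (\<chi> i. integral {0..T} (\<lambda>t. complex_of_real (vec_nth (f t) i) *
              exp (- \<i> * of_real (of_int k * (2 * pi / T) * t))) / of_real T)"

text \<open>\<open>sobolev T l F\<close> is \<open>H\<^sup>l(\<real>/T\<int>, F)\<close> for a subspace \<open>F\<close>. Only \<open>l \<ge> 1\<close> is used; each class
  then has exactly one continuous representative, and it is this representative that is taken.\<close>

definition sobolev :: "real \<Rightarrow> nat \<Rightarrow> (real ^ 'm) set \<Rightarrow> (real \<Rightarrow> real ^ 'm) set" where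
  "sobolev T l F = {f. (\<forall>t. f (t + T) = f t) \<and> continuous_on UNIV f \<and> range f \<subseteq> F \<and>
     (\<lambda>k::int. (1 + (real_of_int k)\<^sup>2) ^ l * (norm (fourier_coeff T f k))\<^sup>2) summable_on UNIV}"

text \<open>Meaningful only for members of \<open>sobolev T l UNIV\<close>.\<close>

definition sobolev_norm :: "real \<Rightarrow> nat \<Rightarrow> (real \<Rightarrow> real ^ 'm) \<Rightarrow> real" where
  "sobolev_norm T l f =
     sqrt (\<Sum>\<^sub>\<infinity>k::int. (1 + (real_of_int k)\<^sup>2) ^ l * (norm (fourier_coeff T f k))\<^sup>2)"


section \<open>Analytic maps\<close>

text \<open>A symmetric \<open>q\<close>-linear map takes its arguments as a list of length \<open>q\<close>.\<close>

definition symmetric_multilinear ::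
    "nat \<Rightarrow> ('a::real_vector list \<Rightarrow> 'b::real_vector) \<Rightarrow> bool" where
  "symmetric_multilinear q w \<longleftrightarrow>
     (\<forall>us. length us = q \<longrightarrow> (\<forall>i<q. linear (\<lambda>x. w (us[i := x])))) \<and>
     (\<forall>us vs. length us = q \<longrightarrow> mset us = mset vs \<longrightarrow> w us = w vs)"

text \<open>\<open>sobolev_analytic T l D F\<close> is \<open>\<A>(D, H\<^sup>l(\<real>/T\<int>, F))\<close>: maps which have an expansion at the
  origin. They are functions on the whole type, but only their values on the part of the
  subspace \<open>D\<close> near the origin are constrained. Taking the \<open>q\<close>-linear maps on the whole type
  loses nothing, since they extend from \<open>D\<close>.\<close>

definition sobolev_analytic ::
    "real \<Rightarrow> nat \<Rightarrow> 'a::real_normed_vector set \<Rightarrow> (real ^ 'm) set \<Rightarrow>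
      ('a \<Rightarrow> real \<Rightarrow> real ^ 'm) set" where
  "sobolev_analytic T l D F = {W. \<exists>w \<rho> c. \<rho> > 0 \<and> c > 0 \<and>
     (\<forall>q t. symmetric_multilinear q (w q t)) \<and>
     (\<forall>q us. length us = q \<longrightarrow> (\<lambda>t. w q t us) \<in> sobolev T l F \<and>
        sobolev_norm T l (\<lambda>t. w q t us) \<le> c / \<rho> ^ q * prod_list (map norm us)) \<and>
     (\<forall>U\<in>D. norm U < \<rho> \<longrightarrow> (\<forall>t. (\<lambda>q. w q t (replicate q U)) sums W U t))}"

text \<open>Analyticity along the subspace \<open>D\<close> at every point of \<open>S \<subseteq> D\<close>.\<close>

definition sobolev_analytic_on ::
    "real \<Rightarrow> nat \<Rightarrow> 'a::real_normed_vector set \<Rightarrow> (real ^ 'm) set \<Rightarrow> 'a set \<Rightarrow>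
      ('a \<Rightarrow> real \<Rightarrow> real ^ 'm) \<Rightarrow> bool" where
  "sobolev_analytic_on T l D F S W \<longleftrightarrow>
     (\<forall>x\<in>S. (\<lambda>h. W (x + h)) \<in> sobolev_analytic T l D F)"

text \<open>The same for maps that do not depend on \<open>t\<close>.\<close>

definition analytic_maps ::
    "'a::real_normed_vector set \<Rightarrow> (real ^ 'm) set \<Rightarrow> ('a \<Rightarrow> real ^ 'm) set" where
  "analytic_maps D F = {W. \<exists>w \<rho> c. \<rho> > 0 \<and> c > 0 \<and>
     (\<forall>q. symmetric_multilinear q (w q)) \<and>
     (\<forall>q us. length us = q \<longrightarrow> w q us \<in> F \<and> norm (w q us) \<le> c / \<rho> ^ q * prod_list (map norm us)) \<and>
     (\<forall>U\<in>D. norm U < \<rho> \<longrightarrow> (\<lambda>q. w q (replicate q U)) sums W U)}"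

definition analytic_maps_on ::
    "'a::real_normed_vector set \<Rightarrow> (real ^ 'm) set \<Rightarrow> 'a set \<Rightarrow> ('a \<Rightarrow> real ^ 'm) \<Rightarrow> bool" where
  "analytic_maps_on D F S W \<longleftrightarrow> (\<forall>x\<in>S. (\<lambda>h. W (x + h)) \<in> analytic_maps D F)"


section \<open>Polynomials in the coordinates of a subspace\<close>

definition monomial :: "(real ^ 'm) list \<Rightarrow> nat list \<Rightarrow> real ^ 'm \<Rightarrow> real" where
  "monomial bs a u = (\<Prod>i<length bs. coord bs u i ^ (a ! i))"

text \<open>\<open>sobolev_polys T l p E0 E1\<close> is \<open>\<P>\<^sub>p(E0 \<times> \<real>, H\<^sup>l(\<real>/T\<int>, E1))\<close>; only the values at
  \<open>u \<in> E0\<close> matter.\<close>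

definition sobolev_polys ::
    "real \<Rightarrow> nat \<Rightarrow> nat \<Rightarrow> (real ^ 'm) set \<Rightarrow> (real ^ 'm) set \<Rightarrow>
      (real ^ 'm \<Rightarrow> real \<Rightarrow> real \<Rightarrow> real ^ 'm) set" where
  "sobolev_polys T l p E0 E1 = {\<Phi>. \<exists>bs c. basis_list E0 bs \<and>
     (\<forall>a j. c a j \<in> sobolev T l E1) \<and>
     (\<forall>u\<in>E0. \<forall>\<epsilon> t. \<Phi> u \<epsilon> t =
        (\<Sum>(a, j) \<in> {(a, j). length a = length bs \<and> sum_list a + j \<le> p}.
           (monomial bs a u * \<epsilon> ^ j) *\<^sub>R c a j t))}"

definition poly_maps ::
    "nat \<Rightarrow> (real ^ 'm) set \<Rightarrow> (real ^ 'm) set \<Rightarrow> (real ^ 'm \<Rightarrow> real ^ 'm) set" where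
  "poly_maps p E0 E1 = {\<Phi>. \<exists>bs c. basis_list E0 bs \<and> (\<forall>a. c a \<in> E1) \<and>
     (\<forall>u\<in>E0. \<Phi> u = (\<Sum>a \<in> {a. length a = length bs \<and> sum_list a \<le> p}. monomial bs a u *\<^sub>R c a))}"

lemma finite_multi_indices:
  "finite {a :: nat list. length a = n \<and> sum_list a \<le> p}"
  "finite {(a :: nat list, j :: nat). length a = n \<and> sum_list a + j \<le> p}"
proof -
  have "{a :: nat list. length a = n \<and> sum_list a \<le> p} \<subseteq> {a. set a \<subseteq> {..p} \<and> length a = n}"
    using member_le_sum_list by (fastforce intro: order_trans)
  then show *: "finite {a :: nat list. length a = n \<and> sum_list a \<le> p}"
    by (rule finite_subset) (simp add: finite_lists_length_eq)
  have "{(a :: nat list, j :: nat). length a = n \<and> sum_list a + j \<le> p}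
      \<subseteq> {a. length a = n \<and> sum_list a \<le> p} \<times> {..p}"
    by auto
  then show "finite {(a :: nat list, j :: nat). length a = n \<and> sum_list a + j \<le> p}"
    by (rule finite_subset) (simp add: *)
qed


section \<open>Changes of variables\<close>

text \<open>The change of variables \<open>u = u0 + u1\<close>, \<open>u1 = v1 + \<Phi>(u0, t)\<close> transforms
  \<open>du/dt = L u + G(u, t)\<close> into \<open>du0/dt = L u0 + G0(u0, v1, t)\<close>, \<open>dv1/dt = L v1 + G1(u0, v1, t)\<close>:
  as long as \<open>(u0, v1)\<close> stays in \<open>S\<close>, the solutions of the two systems correspond. The set \<open>S\<close> is
  needed because the right-hand sides are only meaningful near the origin, and because \<open>\<Phi>\<close> is a
  polynomial of a degree that grows as \<open>\<delta>\<close> decreases, under control only for \<open>u0\<close> of size \<open>\<delta>\<close>.\<close>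

definition transforms_system ::
    "(real ^ 'm) set \<Rightarrow> (real ^ 'm) set \<Rightarrow> (real ^ 'm \<Rightarrow> real ^ 'm) \<Rightarrow>
      (real ^ 'm \<Rightarrow> real \<Rightarrow> real ^ 'm) \<Rightarrow> (real ^ 'm \<Rightarrow> real \<Rightarrow> real ^ 'm) \<Rightarrow>
      ((real ^ 'm) \<times> (real ^ 'm)) set \<Rightarrow>
      (real ^ 'm \<Rightarrow> real ^ 'm \<Rightarrow> real \<Rightarrow> real ^ 'm) \<Rightarrow>
      (real ^ 'm \<Rightarrow> real ^ 'm \<Rightarrow> real \<Rightarrow> real ^ 'm) \<Rightarrow> bool" where
  "transforms_system E0 E1 L G \<Phi> S G0 G1 \<longleftrightarrow>
     (\<forall>a b u u0 v1.
        (\<forall>t\<in>{a<..<b}. u0 t \<in> E0 \<and> v1 t \<in> E1 \<and> (u0 t, v1 t) \<in> S \<and>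
           u t = u0 t + (v1 t + \<Phi> (u0 t) t)) \<longrightarrow>
        ((\<forall>t\<in>{a<..<b}. (u has_vector_derivative L (u t) + G (u t) t) (at t)) \<longleftrightarrow>
         (\<forall>t\<in>{a<..<b}.
            (u0 has_vector_derivative L (u0 t) + G0 (u0 t) (v1 t) t) (at t) \<and>
            (v1 has_vector_derivative L (v1 t) + G1 (u0 t) (v1 t) t) (at t))))"

end

theory Submission
  imports Defs
begin

text \<open>The graph is sought as a formal series of homogeneous polynomials in linear eigenfunctionals of
\<open>L\<close> on \<open>E0\<close>, their conjugates and \<open>\<epsilon>\<close>. In degree \<open>n\<close> the homological equation is solved on the Fourier side;
the Jordan blocks and the small divisors cost a factor \<open>n\<close> to the power \<open>s = \<tau> \<nu>\<close>. A majorant series bounds the truncation at degree \<open>p\<close> on a ball of radius of order \<open>p\<close> to the power \<open>- (s + 1)\<close>,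
where the remainder is at most a constant times \<open>2\<close> to the power \<open>- p\<close>; then \<open>p\<close> is chosen of order \<open>\<delta>\<close> to the power \<open>- b\<close>.\<close>

abbreviation (input) cor :: "real => complex" where "cor == of_real"

abbreviation (input) vn :: "'a ^ 'n => 'n => 'a" where "vn == vec_nth"

section \<open>Periodic functions and their Fourier coefficients\<close>

definition cfc :: "real => (real => complex) => int => complex" where
 "cfc T f k = integral {0..T} (%t. f t *
       exp (- \<i> * of_real (of_int k*(2 * pi / T) * t))) / of_real T"

definition chr :: "real => int => real => complex" where
 "chr T k t = exp (\<i> * of_real (of_int k*(2 * pi / T) * t))"

lemma chr_add: "chr T (j+k) t = chr T j t * chr T k t" unfolding chr_def exp_add[symmetric] by (simp add: algebra_simps add_divide_distrib)

lemma chr_0 [simp]: "chr T 0 t = 1" by (simp add: chr_def)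

lemma chr_minus: "chr T (- k) t = cnj (chr T k t)" unfolding chr_def exp_cnj by (rule arg_cong[where f=exp]) simp

lemma norm_chr [simp]: "norm (chr T k t) = 1" unfolding chr_def norm_exp_eq_Re by simp

lemma continuous_on_chr [continuous_intros]: "continuous_on A (chr T k)" unfolding chr_def by (intro continuous_intros)

lemma cfc_chr: "cfc T f k = integral {0..T} (%t. f t * chr T (- k) t) / of_real T"
 unfolding cfc_def chr_def by (rule arg_cong[where f="%x. x / _"], rule integral_cong) simp

lemma chr_has_vector_derivative:
 "(chr T k has_vector_derivative \<i> * of_real (of_int k*(2 * pi / T)) * chr T k t) (at t within A)"
proof -
 define c where "c = \<i> * cor (of_int k*(2 * pi / T))"
 have "((%z. exp (c * z)) has_field_derivative c * exp (c * of_real t)) (at (of_real t))" by (auto intro!: derivative_eq_intros)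
 from has_vector_derivative_real_field[OF this, of A] show ?thesis by (simp add: chr_def[abs_def] scaleR_conv_of_real c_def mult_ac)
qed

locale period =
 fixes T :: real
 assumes T_pos: "T > 0"
begin

lemma chr_period [simp]: "chr T k (t+T) = chr T k t"
proof -
 have "chr T k (t+T) = chr T k t * exp (\<i> * of_real (of_int k*(2 * pi)))"
  unfolding chr_def exp_add[symmetric] using T_pos by (simp add: field_simps)
 also have "exp (\<i> * of_real (of_int k*(2 * pi))) = 1" using exp_integer_2pi[of "of_int k"] by (simp add: mult_ac)
 finally show ?thesis by simp
qed

lemma integral_chr: "integral {0..T} (chr T k) = (if k = 0 then of_real T else 0)"
proof (cases "k = 0")
 case False
 define c where "c = \<i> * of_real (of_int k*(2 * pi / T))"
 have c: "c ~= 0" using False T_pos by (simp add: c_def)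
 have "((%t. c * chr T k t) has_integral (chr T k T - chr T k 0)) {0..T}" using T_pos chr_has_vector_derivative[of T k] unfolding c_def
  by (intro fundamental_theorem_of_calculus) auto
 moreover have "chr T k T = chr T k 0" using chr_period[of k 0] by simp
 ultimately have "((%t. c * chr T k t) has_integral 0) {0..T}" by simp
 from has_integral_mult_right[OF this, of "inverse c"] c
 have "(chr T k has_integral 0) {0..T}" by (simp add: mult.assoc[symmetric])
 then show ?thesis using False by (simp add: integral_unique)
qed (use T_pos in \<open>simp add: chr_def[abs_def] scaleR_conv_of_real\<close>)

lemma integrable_chr:
 assumes "continuous_on UNIV f"
 shows "(%t. f t * chr T k t) integrable_on {0..T}" by (rule integrable_continuous_real)
  (intro continuous_intros continuous_on_subset[OF assms] subset_UNIV)

lemma cfc_add: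
 assumes "continuous_on UNIV f" "continuous_on UNIV g"
 shows "cfc T (%t. f t+g t) k = cfc T f k+cfc T g k" unfolding cfc_chr distrib_right
 by (subst integral_add) (auto intro!: integrable_chr assms simp: add_divide_distrib)

lemma cfc_cmult: "cfc T (%t. c * f t) k = c * cfc T f k" unfolding cfc_chr mult.assoc by simp

lemma cfc_cnj:
 assumes "continuous_on UNIV f"
 shows "cfc T (%t. cnj (f t)) k = cnj (cfc T f (- k))"
proof -
 have "integral {0..T} (%t. cnj (f t * chr T k t)) = cnj (integral {0..T} (%t. f t * chr T k t))"
  using integral_linear[OF integrable_chr[OF assms] bounded_linear_cnj] by (simp add: o_def)
 then show ?thesis by (simp add: cfc_chr chr_minus)
qed

lemma cfc_shift: "cfc T (%t. chr T j t * f t) k = cfc T f (k - j)" unfolding cfc_chr using chr_add[of T "-k" j]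
 by (intro arg_cong[where f="%x. x / _"] integral_cong) (simp add: mult_ac)

lemma cfc_of_chr: "cfc T (chr T j) k = (if k = j then 1 else 0)"
proof -
 have "cfc T (chr T j) k = cfc T (%t. chr T j t*1) k" by simp
 also have "... = cfc T (%t. 1) (k - j)" by (rule cfc_shift)
 also have "... = integral {0..T} (chr T (j - k)) / of_real T" by (simp add: cfc_chr)
 finally show ?thesis using T_pos by (auto simp: integral_chr)
qed

lemma cfc_const: "cfc T (%t. c) k = (if k = 0 then c else 0)" using cfc_cmult[of c "chr T 0" k] cfc_of_chr[of 0 k] by auto

lemma cfc_infsum:
 fixes F :: "'i => real => complex"
 assumes cont: "!!x. x \<in> X ==> continuous_on UNIV (F x)"
  and le: "!!x t. x \<in> X ==> norm (F x t)<=M x" and M: "M summable_on X"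
 shows "continuous_on UNIV (%t. \<Sum>\<^sub>\<infinity>x\<in>X. F x t)"
  and "((%x. cfc T (F x) k) has_sum cfc T (%t. \<Sum>\<^sub>\<infinity>x\<in>X. F x t) k) X"
proof -
 have u: "uniform_limit UNIV (%X t. \<Sum>x\<in>X. F x t) (%t. \<Sum>\<^sub>\<infinity>x\<in>X. F x t) (finite_subsets_at_top X)"
  by (rule Weierstrass_m_test_general[OF _ M]) (use le in auto)
 show c: "continuous_on UNIV (%t. \<Sum>\<^sub>\<infinity>x\<in>X. F x t)"
 proof (rule uniform_limit_theorem[OF _ u])
  show "\<forall>\<^sub>F Y in finite_subsets_at_top X. continuous_on UNIV (%t. \<Sum>x\<in>Y. F x t)"
   by (rule eventually_finite_subsets_at_top_weakI) (intro continuous_on_sum cont, auto)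
 qed simp
 let ?G = "%Y t. (\<Sum>x\<in>Y. if x \<in> X then F x t * chr T (-k) t else 0)"
 have u2: "uniform_limit {0..T} ?G (%t. (\<Sum>\<^sub>\<infinity>x\<in>X. F x t) * chr T (-k) t) (finite_subsets_at_top X)"
 proof -
  have "uniform_limit {0..T} (%Y t. (\<Sum>x\<in>Y. F x t) * chr T (-k) t)
   (%t. (\<Sum>\<^sub>\<infinity>x\<in>X. F x t) * chr T (-k) t) (finite_subsets_at_top X)"
  proof (intro uniform_lim_mult[OF uniform_limit_on_subset[OF u subset_UNIV] uniform_limit_const])
   show "bounded ((%t. \<Sum>\<^sub>\<infinity>x\<in>X. F x t) ` {0..T})"
    by (intro compact_imp_bounded compact_continuous_image continuous_on_subset[OF c]) auto
   show "bounded (chr T (- k) ` {0..T})" by (intro compact_imp_bounded compact_continuous_image continuous_on_chr) auto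
  qed
  moreover have "\<forall>\<^sub>F Y in finite_subsets_at_top X. \<forall>t\<in>{0..T}. (\<Sum>x\<in>Y. F x t) * chr T (-k) t = ?G Y t"
   by (rule eventually_finite_subsets_at_top_weakI)
    (auto simp: sum_distrib_right intro!: sum.cong)
  ultimately show ?thesis by (subst (asm) uniform_limit_cong) auto
 qed
 have c3: "continuous_on {0..T} (%t. if x \<in> X then F x t * chr T (- k) t else 0)" for x
 proof (cases "x \<in> X")
  case True
  have "continuous_on {0..T} (%t. F x t * chr T (- k) t)"
   by (rule continuous_on_mult[OF continuous_on_subset[OF cont[OF True] subset_UNIV] continuous_on_chr])
  then show ?thesis using True by (simp only: if_True)
 qed simp
 have c2: "continuous_on {0..T} (?G Y)" for Y by (rule continuous_on_sum[OF c3])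
 obtain I J where I: "!!Y. (?G Y has_integral I Y) {0..T}"
  and J: "((%t. (\<Sum>\<^sub>\<infinity>x\<in>X. F x t) * chr T (-k) t) has_integral J) {0..T}"
  and lim: "(I \<longlongrightarrow> J) (finite_subsets_at_top X)"
  by (rule uniform_limit_integral[OF u2 c2 finite_subsets_at_top_neq_bot]) (rule that)
 have "((%Y. I Y / of_real T) \<longlongrightarrow> J / of_real T) (finite_subsets_at_top X)" using T_pos by (intro tendsto_intros lim) auto
 moreover have "\<forall>\<^sub>F Y in finite_subsets_at_top X. I Y / of_real T = (\<Sum>x\<in>Y. cfc T (F x) k)"
 proof (rule eventually_finite_subsets_at_top_weakI)
  fix Y assume Y: "finite Y" "Y \<subseteq> X"
  have "I Y = integral {0..T} (?G Y)" by (rule integral_unique[OF I, symmetric])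
  also have "... = (\<Sum>x\<in>Y. integral {0..T} (%t. if x \<in> X then F x t * chr T (-k) t else 0))"
   using Y(1) by (rule integral_sum) (rule integrable_continuous_real[OF c3])
  also have "... = (\<Sum>x\<in>Y. integral {0..T} (%t. F x t * chr T (-k) t))" using Y by (intro sum.cong) auto
  finally show "I Y / of_real T = (\<Sum>x\<in>Y. cfc T (F x) k)" by (simp add: cfc_chr sum_divide_distrib)
 qed
 ultimately have "((%Y. \<Sum>x\<in>Y. cfc T (F x) k) \<longlongrightarrow> J / of_real T) (finite_subsets_at_top X)"
  by (rule Lim_transform_eventually)
 moreover have "J / of_real T = cfc T (%t. \<Sum>\<^sub>\<infinity>x\<in>X. F x t) k" using J by (simp add: cfc_chr integral_unique)
 ultimately show "((%x. cfc T (F x) k) has_sum cfc T (%t. \<Sum>\<^sub>\<infinity>x\<in>X. F x t) k) X" by (simp add: has_sum_def)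
qed

lemma cfc_synthesis:
 assumes "(%k. norm (a k)) summable_on UNIV"
 shows "continuous_on UNIV (%t. \<Sum>\<^sub>\<infinity>k. a k * chr T k t)"
  and "cfc T (%t. \<Sum>\<^sub>\<infinity>k. a k * chr T k t) j = a j"
  and "(%t. \<Sum>\<^sub>\<infinity>k. a k * chr T k t) (t+T) = (\<Sum>\<^sub>\<infinity>k. a k * chr T k t)"
proof -
 show "continuous_on UNIV (%t. \<Sum>\<^sub>\<infinity>k. a k * chr T k t)" by (rule cfc_infsum(1)[where F="%k t. a k * chr T k t", OF _ _ assms])
   (auto intro!: continuous_intros simp: norm_mult)
 have "((%k. cfc T (%t. a k * chr T k t) j) has_sum cfc T (%t. \<Sum>\<^sub>\<infinity>k. a k * chr T k t) j) UNIV"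
  by (rule cfc_infsum(2)[where F="%k t. a k * chr T k t", OF _ _ assms])
   (auto intro!: continuous_intros simp: norm_mult)
 moreover have "((%k. cfc T (%t. a k * chr T k t) j) has_sum a j) UNIV"
 proof -
  have "((%k. cfc T (%t. a k * chr T k t) j) has_sum a j) {j}" by (rule has_sum_finiteI) (auto simp: cfc_cmult cfc_of_chr)
  moreover have "((%k. cfc T (%t. a k * chr T k t) j) has_sum a j) {j} \<longleftrightarrow> ((%k. cfc T (%t. a k * chr T k t) j) has_sum a j) UNIV"
   by (rule has_sum_cong_neutral) (auto simp: cfc_cmult cfc_of_chr)
  ultimately show ?thesis by simp
 qed
 ultimately show "cfc T (%t. \<Sum>\<^sub>\<infinity>k. a k * chr T k t) j = a j" by (rule has_sum_unique)
 show "(%t. \<Sum>\<^sub>\<infinity>k. a k * chr T k t) (t+T) = (\<Sum>\<^sub>\<infinity>k. a k * chr T k t)" by simp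
qed

lemma cfc_eq_0_trig:
 assumes "continuous_on UNIV g" "!!k. cfc T g k = 0"
 shows "integral {0..T} (%t. g t * chr T k t) = 0" using assms(2)[of "-k"] T_pos by (simp add: cfc_chr)

inductive_set trig :: "(real => complex) set" where
 chr: "chr T k \<in> trig"
| cmult: "f \<in> trig ==> (%t. c * f t) \<in> trig"
| add: "f \<in> trig ==> g \<in> trig ==> (%t. f t+g t) \<in> trig"

lemma trig_continuous: "f \<in> trig ==> continuous_on UNIV f" by (induction rule: trig.induct) (auto intro!: continuous_intros)

lemma trig_mult:
 assumes "f \<in> trig" "g \<in> trig" shows "(%t. f t * g t) \<in> trig" using assms
proof (induction f rule: trig.induct)
 case (chr k)
 from chr show ?case
 proof (induction g rule: trig.induct)
  case (chr j)
  have "(%t. chr T k t * chr T j t) = chr T (k+j)" by (simp add: chr_add fun_eq_iff)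
  then show ?case by (simp add: trig.chr)
 next
  case (cmult f c)
  have "(%t. chr T k t*(c * f t)) = (%t. c*(chr T k t * f t))" by (simp add: fun_eq_iff mult_ac)
  then show ?case using trig.cmult[OF cmult.IH] by simp
 next
  case (add f g)
  then show ?case using trig.add by (simp add: distrib_left)
 qed
next
 case (cmult f c)
 then show ?case using trig.cmult[of "%t. f t * g t" c] by (simp add: mult.assoc)
next
 case (add f g)
 then show ?case using trig.add by (simp add: distrib_right)
qed

lemma trig_const: "(%t. c) \<in> trig" using trig.cmult[OF trig.chr[of 0], of c] by simp

lemma trig_orthogonal:
 assumes "f \<in> trig" "continuous_on UNIV g" "!!k. cfc T g k = 0"
 shows "integral {0..T} (%t. g t * f t) = 0" using assms(1)
proof (induction rule: trig.induct)
 case (chr k) then show ?case using cfc_eq_0_trig assms by blast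
next
 case (cmult f c)
 have "(%t. g t*(c * f t)) = (%t. c*(g t * f t))" by (simp add: fun_eq_iff mult_ac)
 then show ?case using cmult by simp
next
 case (add f h)
 have "(%t. g t * f t) integrable_on {0..T}" "(%t. g t * h t) integrable_on {0..T}"
  using add trig_continuous assms(2) by (auto intro!: integrable_continuous_real continuous_on_mult intro: continuous_on_subset)
 then show ?case using add by (simp add: distrib_left integral_add)
qed

lemma trig_cnj: "f \<in> trig ==> (%t. cnj (f t)) \<in> trig"
proof (induction rule: trig.induct)
 case (chr k)
 have "(%t. cnj (chr T k t)) = chr T (- k)" by (simp add: chr_minus fun_eq_iff)
 then show ?case by (simp add: trig.chr)
qed (auto intro: trig.intros)

lemma chr_1_eq: "chr T 1 t = cis (2 * pi / T * t)" by (simp add: chr_def cis_conv_exp)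

lemma periodic_int:
 assumes per: "!!t. f (t+T) = f t"
 shows "f (t + of_int n * T) = f t"
proof -
 have nat: "f (s+real n * T) = f s" for n s
 proof (induction n)
  case (Suc n)
  then show ?case using per[of "s+real n * T"] by (simp add: algebra_simps)
 qed simp
 show ?thesis
 proof (cases "n >= 0")
  case True then show ?thesis using nat[of t "nat n"] by simp
 next
  case False then show ?thesis using nat[of "t + of_int n * T" "nat (- n)"] by (simp add: algebra_simps)
 qed
qed

lemma periodic_on_circle:
 fixes f :: "real => 'a::topological_space"
 assumes per: "!!t. f (t+T) = f t" and cont: "continuous_on UNIV f"
 obtains h where "continuous_on (sphere 0 1) h" "!!t. h (chr T 1 t) = f t"
proof -
 define h where "h z = f (Arg z * T / (2 * pi))" for z
 have eq: "f s = f t" if "chr T 1 s = chr T 1 t" for s t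
 proof -
  have "cis (2 * pi / T * s) = cis (2 * pi / T * t)" using that by (simp add: chr_1_eq)
  then have "EX n::int. \<i> * of_real (2 * pi / T * s) = \<i> * of_real (2 * pi / T * t)+(of_int (2 * n) * of_real pi) * \<i>"
   unfolding cis_conv_exp exp_eq by simp
  then obtain n :: int where "\<i> * of_real (2 * pi / T * s) = \<i> * of_real (2 * pi / T * t)+(of_int (2 * n) * of_real pi) * \<i>" ..
  then have "Im (\<i> * of_real (2 * pi / T * s)) = Im (\<i> * of_real (2 * pi / T * t)+(of_int (2 * n) * of_real pi) * \<i>)" by (rule arg_cong)
  then have "2 * pi / T * s = 2 * pi / T * t+2 * pi * of_int n" by simp
  then have "2 * pi / T * s = 2 * pi / T*(t + of_int n * T)" using T_pos by (simp add: field_simps)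
  then have "s = t + of_int n * T" using T_pos by (subst (asm) mult_cancel_left) auto
  then show ?thesis using periodic_int[of f t n] per by simp
 qed
 have arg: "chr T 1 (Arg z * T / (2 * pi)) = z" if "norm z = 1" for z using that T_pos rcis_cmod_Arg[of z] by (simp add: chr_1_eq rcis_def)
 have arg2: "chr T 1 (Arg2pi z * T / (2 * pi)) = z" if "norm z = 1" for z
  using that T_pos Arg2pi_eq[of z] by (simp add: chr_1_eq cis_conv_exp mult_ac)
 have h2: "h z = f (Arg2pi z * T / (2 * pi))" if "norm z = 1" for z unfolding h_def using arg arg2 that by (intro eq) auto
 have c: "isCont f t" for t using cont by (simp add: continuous_on_eq_continuous_at)
 have "continuous (at z within sphere 0 1) h" if z: "norm z = 1" for z
 proof (cases "z \<in> \<real>\<^sub>\<le>\<^sub>0")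
  case False
  have "isCont (%z. Arg z*(T / (2 * pi))) z" by (intro continuous_mult continuous_at_Arg False continuous_const)
  then have "isCont (%z. f (Arg z*(T / (2 * pi)))) z" using c by (rule isCont_o2)
  then have "continuous (at z within sphere 0 1) (%z. f (Arg z*(T / (2 * pi))))" by (rule continuous_at_imp_continuous_within)
  then show ?thesis unfolding h_def[abs_def] by (simp only: times_divide_eq_right)
 next
  case True
  then have "z \<notin> \<real>\<^sub>\<ge>\<^sub>0" using z by (auto simp: complex_nonpos_Reals_iff complex_nonneg_Reals_iff cmod_def)
  then have "isCont (%z. Arg2pi z*(T / (2 * pi))) z" by (intro continuous_mult continuous_at_Arg2pi continuous_const)
  then have "isCont (%z. f (Arg2pi z*(T / (2 * pi)))) z" using c by (rule isCont_o2)
  then have "continuous (at z within sphere 0 1) (%z. f (Arg2pi z*(T / (2 * pi))))" by (rule continuous_at_imp_continuous_within)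
  then have "continuous (at z within sphere 0 1) (%z. f (Arg2pi z * T / (2 * pi)))" by (simp only: times_divide_eq_right)
  then show ?thesis
  proof (rule continuous_transform_within[where \<delta>=1])
   show "z \<in> sphere 0 1" using z by simp
   show "f (Arg2pi w * T / (2 * pi)) = h w" if "w \<in> sphere 0 1" for w by (rule h2[symmetric]) (use that in simp)
  qed simp
 qed
 then have "continuous_on (sphere 0 1) h" by (simp add: continuous_on_eq_continuous_within)
 moreover have "h (chr T 1 t) = f t" for t unfolding h_def by (rule eq) (simp add: arg)
 ultimately show ?thesis using that by blast
qed

lemma trig_dense:
 fixes f :: "real => real"
 assumes per: "!!t. f (t+T) = f t" and cont: "continuous_on UNIV f" and e: "e > 0"
 obtains p where "p \<in> trig" "!!t. norm (of_real (f t) - p t)<=e"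
proof -
 obtain h where h: "continuous_on (sphere 0 1) h" "!!t. h (chr T 1 t) = f t" using periodic_on_circle[OF per cont] by blast
 define P where "P g \<longleftrightarrow> continuous_on (sphere 0 1) g & (%t. of_real (g (chr T 1 t))) \<in> trig" for g :: "complex => real"
 have "EX g. P g & (\<forall>z\<in>sphere 0 1. \<bar>h z - g z\<bar> < e)"
 proof (rule Stone_Weierstrass_HOL)
  show "compact (sphere (0::complex) 1)" by simp
  show "P (%x. c)" for c by (simp add: P_def trig_const)
  show "continuous_on (sphere 0 1) g" if "P g" for g using that by (simp add: P_def)
  show "P (%x. f x+g x)" if "P f & P g" for f g using that by (auto simp: P_def intro: continuous_intros trig.add)
  show "P (%x. f x * g x)" if "P f & P g" for f g using that trig_mult by (auto simp: P_def intro!: continuous_intros)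
  have Re: "P Re"
  proof -
   have "(%t. (1/2)*(chr T 1 t+cnj (chr T 1 t))) \<in> trig" by (intro trig.cmult trig.add trig.chr trig_cnj)
   also have "(%t. (1/2)*(chr T 1 t+cnj (chr T 1 t))) = (%t. of_real (Re (chr T 1 t)))" by (simp add: complex_add_cnj fun_eq_iff)
   finally show ?thesis by (auto simp: P_def intro!: continuous_intros)
  qed
  have Im: "P Im"
  proof -
   have "(%t. (-\<i>/2)*(chr T 1 t+(-1) * cnj (chr T 1 t))) \<in> trig" by (intro trig.cmult trig.add trig.chr trig_cnj)
   also have "(%t. (-\<i>/2)*(chr T 1 t+(-1) * cnj (chr T 1 t))) = (%t. of_real (Im (chr T 1 t)))" by (simp add: fun_eq_iff complex_eq_iff)
   finally show ?thesis by (auto simp: P_def intro!: continuous_intros)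
  qed
  show "EX f. P f & f x ~= f y" if "x \<in> sphere 0 1 & y \<in> sphere 0 1 & x ~= y" for x y
  proof (cases "Re x = Re y")
   case True
   then have "Im x ~= Im y" using that by (auto simp: complex_eq_iff)
   then show ?thesis using Im by blast
  qed (use Re in blast)
 qed (use h e in auto)
 then obtain g where g: "P g" "!!z. norm z = 1 ==> \<bar>h z - g z\<bar> < e" by auto
 have "norm (of_real (f t) - cor (g (chr T 1 t)))<=e" for t
  unfolding of_real_diff[symmetric] norm_of_real using g(2)[of "chr T 1 t"] h(2)[of t] by simp
 with g(1) show ?thesis using that unfolding P_def by blast
qed

lemma trig_dense_complex:
 fixes f :: "real => complex"
 assumes per: "!!t. f (t+T) = f t" and cont: "continuous_on UNIV f" and e: "e > 0"
 obtains p where "p \<in> trig" "!!t. norm (f t - p t)<=e"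
proof -
 obtain p where p: "p \<in> trig" "!!t. norm (of_real (Re (f t)) - p t)<=e / 2"
  using trig_dense[of "%t. Re (f t)" "e/2"] e per cont by (auto intro: continuous_intros)
 obtain q where q: "q \<in> trig" "!!t. norm (of_real (Im (f t)) - q t)<=e / 2"
  using trig_dense[of "%t. Im (f t)" "e/2"] e per cont by (auto intro: continuous_intros)
 have "norm (f t - (p t+\<i> * q t))<=e" for t
 proof -
  have "f t - (p t+\<i> * q t) = (of_real (Re (f t)) - p t)+\<i>*(of_real (Im (f t)) - q t)"
   using complex_eq[of "f t"] by (simp add: algebra_simps)
  also have "norm ...<=e / 2+norm (\<i>*(of_real (Im (f t)) - q t))" using p(2) by (intro norm_triangle_le add_right_mono) auto
  also have "...<=e / 2+e / 2" using q(2)[of t] by (simp add: norm_mult)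
  finally show ?thesis by simp
 qed
 moreover have "(%t. p t+\<i> * q t) \<in> trig" using p q by (intro trig.add trig.cmult)
 ultimately show ?thesis using that by blast
qed

lemma cfc_unique:
 fixes g :: "real => complex"
 assumes per: "!!t. g (t+T) = g t" and cont: "continuous_on UNIV g" and z: "!!k. cfc T g k = 0"
 shows "g t = 0"
proof -
 have cont': "continuous_on A g" for A using cont by (rule continuous_on_subset) simp
 define I where "I = integral {0..T} (%t. (norm (g t))\<^sup>2)"
 define S where "S = integral {0..T} (%t. norm (g t))"
 have S0: "S >= 0" unfolding S_def by (rule integral_nonneg) (intro integrable_continuous_real continuous_intros cont' norm_ge_zero)+
 have le: "I<=e * S" if e: "e > 0" for e
 proof -
  have "!!t. cnj (g (t+T)) = cnj (g t)" "continuous_on UNIV (%t. cnj (g t))" using per by simp (intro continuous_intros cont')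
  from trig_dense_complex[OF this e] obtain p where p: "p \<in> trig" "!!t. norm (cnj (g t) - p t)<=e" by metis
  have pc: "continuous_on A p" for A using trig_continuous[OF p(1)] by (rule continuous_on_subset) simp
  have "cor I = integral {0..T} (%t. cor ((norm (g t))\<^sup>2))"
  proof -
   have "(%t. (norm (g t))\<^sup>2) integrable_on {0..T}" by (intro integrable_continuous_real continuous_intros cont')
   from integral_linear[OF this bounded_linear_of_real[where 'a=complex]]
   show ?thesis by (simp add: I_def o_def)
  qed
  also have "... = integral {0..T} (%t. g t*(cnj (g t) - p t)+g t * p t)"
   by (rule integral_cong) (simp add: complex_norm_square algebra_simps flip: of_real_power)
  also have "... = integral {0..T} (%t. g t*(cnj (g t) - p t))+integral {0..T} (%t. g t * p t)"
   by (rule integral_add) (intro integrable_continuous_real continuous_intros cont' pc)+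
  also have "integral {0..T} (%t. g t * p t) = 0" by (rule trig_orthogonal[OF p(1) cont z])
  finally have "cor I = integral {0..T} (%t. g t*(cnj (g t) - p t))" by simp
  moreover have "norm (integral {0..T} (%t. g t*(cnj (g t) - p t)))<=integral {0..T} (%t. norm (g t) * e)"
  proof (rule integral_norm_bound_integral)
   show "(%t. g t*(cnj (g t) - p t)) integrable_on {0..T}" "(%t. norm (g t) * e) integrable_on {0..T}"
    by (intro integrable_continuous_real continuous_intros cont' pc)+
   show "norm (g t*(cnj (g t) - p t))<=norm (g t) * e" for t unfolding norm_mult by (intro mult_left_mono p) auto
  qed
  ultimately have "\<bar>I\<bar><=integral {0..T} (%t. norm (g t) * e)" by (metis norm_of_real)
  then show ?thesis by (simp add: S_def mult.commute)
 qed
 have "I<=0"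
 proof (rule field_le_epsilon)
  fix e :: real assume e: "e > 0"
  have "I<=e / (S+1) * S" using S0 e by (intro le) auto
  also have "...<=e" using S0 e by (simp add: field_simps)
  finally show "I<=0+e" by simp
 qed
 moreover have "I >= 0" unfolding I_def by (rule integral_nonneg) (intro integrable_continuous_real continuous_intros cont' zero_le_power2)+
 ultimately have I0: "I = 0" by simp
 have "((%t. (norm (g t))\<^sup>2) has_integral I) {0..T}"
  unfolding I_def by (intro integrable_integral integrable_continuous_real continuous_intros cont')
 then have int0: "((%t. (norm (g t))\<^sup>2) has_integral 0) (cbox 0 T)" using I0 by simp
 have zero: "g s = 0" if "s \<in> {0..T}" for s
 proof -
  have "(norm (g s))\<^sup>2 = 0"
   by (rule has_integral_0_cbox_imp_0[OF _ _ int0]) (use that T_pos in \<open>auto intro!: continuous_intros cont'\<close>)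
  then show ?thesis by simp
 qed
 define n where "n = \<lfloor>t / T\<rfloor>"
 have "g t = g (t - of_int n * T)" using periodic_int[of g "t - of_int n * T" n] per by simp
 moreover have "t - of_int n * T \<in> {0..T}"
 proof -
  have "of_int n * T<=t / T * T" "t / T * T<=(of_int n+1) * T"
   using T_pos floor_correct[of "t / T"] unfolding n_def by (intro mult_right_mono; simp)+
  then show ?thesis using T_pos by (simp add: algebra_simps)
 qed
 ultimately show ?thesis using zero by simp
qed

lemma fourier_inversion:
 assumes per: "!!t. f (t+T) = f t" and cont: "continuous_on UNIV f"
  and sm: "(%k. norm (cfc T f k)) summable_on UNIV"
 shows "((%k. cfc T f k * chr T k t) has_sum f t) UNIV"
proof -
 define h where "h t = (\<Sum>\<^sub>\<infinity>k. cfc T f k * chr T k t)" for t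
 note s = cfc_synthesis[OF sm, folded h_def]
 have "f t+(-1) * h t = 0"
 proof (rule cfc_unique)
  show "f (t+T)+(-1) * h (t+T) = f t+(-1) * h t" for t using per s(3) by simp
  show "continuous_on UNIV (%t. f t+(- 1) * h t)" by (intro continuous_intros cont s)
  show "cfc T (%t. f t+(- 1) * h t) k = 0" for k
  proof -
   have "cfc T (%t. f t+(- 1) * h t) k = cfc T f k+cfc T (%t. (-1) * h t) k" by (intro cfc_add continuous_intros cont s)
   then show ?thesis by (simp only: cfc_cmult s(2)) simp
  qed
 qed
 then have "f t = h t" by simp
 moreover have "(%k. cfc T f k * chr T k t) summable_on UNIV" by (rule abs_summable_summable) (simp add: norm_mult sm)
 ultimately show ?thesis by (simp add: h_def)
qed

end

section \<open>The Sobolev algebra\<close>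

definition wt :: "nat => int => real" where
 "wt l k = sqrt ((1+(real_of_int k)\<^sup>2) ^ l)"

lemma wt_ge_1: "wt l k >= 1" unfolding wt_def by (simp add: one_le_power)

lemma wt_pos: "wt l k > 0" using wt_ge_1[of l k] by linarith

lemma wt_sq: "(wt l k)\<^sup>2 = (1+(real_of_int k)\<^sup>2) ^ l" unfolding wt_def by (simp add: add_nonneg_nonneg)

lemma wt_Suc: "wt (Suc l) k = sqrt (1+(real_of_int k)\<^sup>2) * wt l k" by (simp add: wt_def real_sqrt_mult)

lemma wt_mono: "l<=l' ==> wt l k<=wt l' k" unfolding wt_def by (intro real_sqrt_le_mono power_increasing) auto

lemma wt_minus [simp]: "wt l (- k) = wt l k" by (simp add: wt_def)

lemma wt_0 [simp]: "wt l 0 = 1" by (simp add: wt_def)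

lemma wt_subadd: "wt l k<=2 ^ l*(wt l j+wt l (k - j))"
proof -
 define x where "x = max \<bar>real_of_int j\<bar> \<bar>real_of_int (k - j)\<bar>"
 have "\<bar>real_of_int k\<bar><=\<bar>real_of_int j\<bar>+\<bar>real_of_int (k - j)\<bar>"
  using abs_triangle_ineq[of "real_of_int j" "real_of_int (k - j)"] by simp
 moreover have "\<bar>real_of_int j\<bar><=x" "\<bar>real_of_int (k - j)\<bar><=x" unfolding x_def by simp_all
 ultimately have "\<bar>real_of_int k\<bar><=2 * x" by linarith
 then have "(real_of_int k)\<^sup>2<=(2 * x)\<^sup>2" by (metis abs_ge_zero power2_abs power_mono)
 then have "1+(real_of_int k)\<^sup>2<=4*(1+x\<^sup>2)" by (simp add: power_mult_distrib)
 then have "wt l k<=sqrt ((4*(1+x\<^sup>2)) ^ l)" unfolding wt_def by (intro real_sqrt_le_mono power_mono) auto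
 also have "... = 2 ^ l * sqrt ((1+x\<^sup>2) ^ l)" by (simp only: real_sqrt_mult real_sqrt_four real_sqrt_power power_mult_distrib)
 also have "sqrt ((1+x\<^sup>2) ^ l)<=wt l j+wt l (k - j)" using wt_pos[of l j] wt_pos[of l "k - j"] unfolding x_def wt_def
  by (auto simp: max_def)
 finally show ?thesis by simp
qed

definition HS :: "real => nat => (real => complex) => bool" where
 "HS T l f \<longleftrightarrow> (ALL t. f (t+T) = f t) & continuous_on UNIV f &
  (%k::int. (1+(real_of_int k)\<^sup>2) ^ l*(norm (cfc T f k))\<^sup>2) summable_on UNIV"

definition hn :: "real => nat => (real => complex) => real" where
 "hn T l f = sqrt (\<Sum>\<^sub>\<infinity>k::int. (1+(real_of_int k)\<^sup>2) ^ l*(norm (cfc T f k))\<^sup>2)"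

lemma HS_periodic: "HS T l f ==> f (t+T) = f t" by (simp add: HS_def)

lemma HS_continuous: "HS T l f ==> continuous_on A f" unfolding HS_def using continuous_on_subset by blast

lemma hn_nonneg [simp]: "hn T l f >= 0" unfolding hn_def by (intro real_sqrt_ge_zero infsum_nonneg) simp

lemma hn_sq: "HS T l f ==> (hn T l f)\<^sup>2 = (\<Sum>\<^sub>\<infinity>k::int. (1+(real_of_int k)\<^sup>2) ^ l*(norm (cfc T f k))\<^sup>2)"
 unfolding hn_def by (intro real_sqrt_pow2 infsum_nonneg) simp

lemma L2_set_wt_sq: "(L2_set (%k. wt l k * a k) K)\<^sup>2 = (\<Sum>k\<in>K. (1+(real_of_int k)\<^sup>2) ^ l*(a k)\<^sup>2)"
 unfolding L2_set_def by (simp add: sum_nonneg power_mult_distrib wt_sq)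

lemma L2_set_le_hn:
 assumes "HS T l f" "finite K"
 shows "L2_set (%k. wt l k * norm (cfc T f k)) K<=hn T l f"
proof (rule power2_le_imp_le)
 show "(L2_set (%k. wt l k * norm (cfc T f k)) K)\<^sup>2<=(hn T l f)\<^sup>2" unfolding L2_set_wt_sq hn_sq[OF assms(1)]
  using assms by (intro finite_sum_le_infsum) (auto simp: HS_def)
qed simp

lemma HSI:
 assumes "!!t. f (t+T) = f t" "continuous_on UNIV f"
  and le: "!!K. finite K ==> L2_set (%k. wt l k * norm (cfc T f k)) K<=M"
 shows "HS T l f" and "hn T l f<=M"
proof -
 have M: "M >= 0" using le[of "{}"] by simp
 have *: "(\<Sum>k\<in>K. (1+(real_of_int k)\<^sup>2) ^ l*(norm (cfc T f k))\<^sup>2)<=M\<^sup>2" if "finite K" for K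
  using power_mono[OF le[OF that], of 2] by (simp add: L2_set_wt_sq)
 show hs: "HS T l f" unfolding HS_def by (intro conjI allI assms nonneg_bdd_above_summable_on bdd_aboveI[where M="M\<^sup>2"]) (auto intro: *)
 show "hn T l f<=M"
 proof (rule power2_le_imp_le[OF _ M])
  show "(hn T l f)\<^sup>2<=M\<^sup>2" unfolding hn_sq[OF hs] using hs * by (intro infsum_le_finite_sums) (auto simp: HS_def)
 qed
qed

lemma wt_cfc_le_hn:
 assumes "HS T l f" shows "wt l k * norm (cfc T f k)<=hn T l f"
proof -
 have "wt l k * norm (cfc T f k)<=L2_set (%k. wt l k * norm (cfc T f k)) {k}" by (rule member_le_L2_set) auto
 also have "...<=hn T l f" using assms by (rule L2_set_le_hn) simp
 finally show ?thesis .
qed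

lemma cfc_le_hn:
 assumes "HS T l f" shows "norm (cfc T f k)<=hn T l f"
proof -
 have "1 * norm (cfc T f k)<=wt l k * norm (cfc T f k)" by (intro mult_right_mono wt_ge_1) simp
 also have "...<=hn T l f" using assms by (rule wt_cfc_le_hn)
 finally show ?thesis by simp
qed

lemma HS_mono:
 assumes "HS T l' f" "l<=l'" shows "HS T l f" and "hn T l f<=hn T l' f"
proof -
 have "L2_set (%k. wt l k * norm (cfc T f k)) K<=hn T l' f" if "finite K" for K
 proof -
  have "L2_set (%k. wt l k * norm (cfc T f k)) K<=L2_set (%k. wt l' k * norm (cfc T f k)) K"
   using assms(2) wt_pos[of l] by (intro L2_set_mono mult_right_mono wt_mono) (auto simp: less_imp_le)
  also have "...<=hn T l' f" using assms(1) that by (rule L2_set_le_hn)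
  finally show ?thesis .
 qed
 from HSI[OF HS_periodic[OF assms(1)] HS_continuous[OF assms(1)] this]
 show "HS T l f" and "hn T l f<=hn T l' f" by auto
qed

definition isum :: real where "isum = (\<Sum>\<^sub>\<infinity>k::int. 1 / (1+(real_of_int k)\<^sup>2))"

lemma summable_isum: "(%k::int. 1 / (1+(real_of_int k)\<^sup>2)) summable_on UNIV"
proof -
 have s: "(%n::nat. 1 / (1+(real n)\<^sup>2)) summable_on UNIV"
 proof -
  have "summable (%n. inverse (real n ^ 2))" by (rule inverse_power_summable) simp
  then have "summable (%n::nat. 1 / (1+(real n)\<^sup>2))"
  proof (rule summable_comparison_test'[where N=1])
   show "norm (1 / (1+(real n)\<^sup>2))<=inverse (real n ^ 2)" if "n >= 1" for n using that by (simp add: divide_simps add_pos_nonneg)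
  qed
  then show ?thesis by (intro summable_nonneg_imp_summable_on) auto
 qed
 have "(%k::int. 1 / (1+(real_of_int k)\<^sup>2)) summable_on (range int)" by (subst summable_on_reindex) (use s in \<open>auto simp: o_def\<close>)
 moreover have "(%k::int. 1 / (1+(real_of_int k)\<^sup>2)) summable_on (range (%n. - int n))"
  by (subst summable_on_reindex) (use s in \<open>auto simp: o_def inj_on_def\<close>)
 ultimately have "(%k::int. 1 / (1+(real_of_int k)\<^sup>2)) summable_on (range int \<union> (range (%n. - int n) - range int))"
  by (intro summable_on_Un_disjoint) (auto elim: summable_on_subset_banach)
 moreover have "range int \<union> (range (%n. - int n) - range int) = UNIV"
 proof -
  have "k \<in> range int \<union> range (%n. - int n)" for k by (cases k rule: int_cases) (auto simp: image_iff intro: exI[of _ "nat (- k)"])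
  then show ?thesis by auto
 qed
 ultimately show ?thesis by simp
qed

lemma isum_ge_1: "isum >= 1" unfolding isum_def using finite_sum_le_infsum[OF summable_isum, of "{0}"] by simp

context period
begin

lemma HS_abs_summable:
 assumes f: "HS T l f" and l: "l >= 1"
 shows "(%k. norm (cfc T f k)) summable_on UNIV"
  and "(\<Sum>\<^sub>\<infinity>k. norm (cfc T f k))<=sqrt isum * hn T l f"
proof -
 have *: "(\<Sum>k\<in>K. norm (cfc T f k))<=sqrt isum * hn T l f" if K: "finite K" for K
 proof -
  have "(\<Sum>k\<in>K. norm (cfc T f k)) = (\<Sum>k\<in>K. \<bar>1 / wt l k\<bar> * \<bar>wt l k * norm (cfc T f k)\<bar>)"
   using wt_pos[of l] by (intro sum.cong) (auto simp: less_imp_neq[symmetric] less_imp_le abs_mult)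
  also have "...<=L2_set (%k. 1 / wt l k) K * L2_set (%k. wt l k * norm (cfc T f k)) K" by (rule L2_set_mult_ineq)
  also have "...<=sqrt isum * hn T l f"
  proof (intro mult_mono L2_set_le_hn f K)
   have "(\<Sum>k\<in>K. (1 / wt l k)\<^sup>2)<=(\<Sum>k\<in>K. 1 / (1+(real_of_int k)\<^sup>2))"
   proof (rule sum_mono)
    fix k
    have "1+(real_of_int k)\<^sup>2<=(wt l k)\<^sup>2" using power_increasing[OF l, of "1+(real_of_int k)\<^sup>2"] by (simp add: wt_sq)
    then show "(1 / wt l k)\<^sup>2<=1 / (1+(real_of_int k)\<^sup>2)" by (simp add: power_divide frac_le add_pos_nonneg)
   qed
   also have "...<=isum" unfolding isum_def using K by (intro finite_sum_le_infsum summable_isum) auto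
   finally show "L2_set (%k. 1 / wt l k) K<=sqrt isum" by (simp add: L2_set_def)
  qed (use isum_ge_1 in auto)
  finally show ?thesis .
 qed
 show s: "(%k. norm (cfc T f k)) summable_on UNIV" by (intro nonneg_bdd_above_summable_on bdd_aboveI[where M="sqrt isum * hn T l f"]) (auto intro: *)
 show "(\<Sum>\<^sub>\<infinity>k. norm (cfc T f k))<=sqrt isum * hn T l f" by (rule infsum_le_finite_sums[OF s *])
qed

lemma HS_has_sum:
 assumes f: "HS T l f" and l: "l >= 1"
 shows "((%k. cfc T f k * chr T k t) has_sum f t) UNIV"
 by (rule fourier_inversion[OF HS_periodic[OF f] HS_continuous[OF f] HS_abs_summable(1)[OF f l]])

lemma HS_sup:
 assumes f: "HS T l f" and l: "l >= 1"
 shows "norm (f t)<=sqrt isum * hn T l f"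
proof -
 have "norm (f t)<=(\<Sum>\<^sub>\<infinity>k. norm (cfc T f k))" by (rule norm_has_sum_bound[OF _ HS_has_sum[OF f l]])
   (use HS_abs_summable(1)[OF f l] in \<open>simp add: norm_mult\<close>)
 then show ?thesis using HS_abs_summable(2)[OF f l] by linarith
qed

lemma L2_set_infsum_le:
 fixes u :: "'i => 'k => real"
 assumes K: "finite K" and u: "!!k. k \<in> K ==> ((%x. u x k) has_sum U k) X"
  and pos: "!!x k. x \<in> X ==> k \<in> K ==> u x k >= 0"
  and le: "!!x. x \<in> X ==> L2_set (u x) K<=M x" and M: "M summable_on X"
 shows "L2_set U K<=infsum M X"
proof -
 have lim: "((%Y. L2_set (%k. \<Sum>x\<in>Y. u x k) K) \<longlongrightarrow> L2_set U K) (finite_subsets_at_top X)"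
  unfolding L2_set_def using u unfolding has_sum_def by (intro tendsto_intros) auto
 show ?thesis
 proof (rule tendsto_upperbound[OF lim])
  show "\<forall>\<^sub>F Y in finite_subsets_at_top X. L2_set (%k. \<Sum>x\<in>Y. u x k) K<=infsum M X"
  proof (rule eventually_finite_subsets_at_top_weakI)
   fix Y assume Y: "finite Y" "Y \<subseteq> X"
   have "L2_set (%k. \<Sum>x\<in>Y. u x k) K<=(\<Sum>x\<in>Y. L2_set (u x) K)" using Y(1)
   proof (induction Y rule: finite_induct)
    case (insert y Y)
    then show ?case using L2_set_triangle_ineq[of "u y" "%k. \<Sum>x\<in>Y. u x k" K] by (simp add: L2_set_0')
   qed (simp add: L2_set_0')
   also have "...<=sum M Y" using Y le by (intro sum_mono) auto
   also have "...<=infsum M X" using Y M le order_trans[OF L2_set_nonneg le] by (intro finite_sum_le_infsum) auto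
   finally show "L2_set (%k. \<Sum>x\<in>Y. u x k) K<=infsum M X" .
  qed
 qed simp
qed

lemma HS_infsum:
 fixes F :: "'i => real => complex"
 assumes l: "l >= 1" and F: "!!x. x \<in> X ==> HS T l (F x)"
  and le: "!!x. x \<in> X ==> hn T l (F x)<=M x" and M: "M summable_on X"
 shows "HS T l (%t. \<Sum>\<^sub>\<infinity>x\<in>X. F x t)" and "hn T l (%t. \<Sum>\<^sub>\<infinity>x\<in>X. F x t)<=infsum M X"
  and "(%x. norm (F x t)) summable_on X"
proof -
 have sup: "norm (F x t)<=sqrt isum * M x" if "x \<in> X" for x t
  using HS_sup[OF F[OF that] l, of t] mult_left_mono[OF le[OF that] real_sqrt_ge_zero, of isum] isum_ge_1 by linarith
 have M': "(%x. sqrt isum * M x) summable_on X" by (intro summable_on_cmult_right M)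
 note c = cfc_infsum[OF HS_continuous[OF F] sup M']
 show "(%x. norm (F x t)) summable_on X" by (rule summable_on_comparison_test[OF M']) (use sup in auto)
 have "L2_set (%k. wt l k * norm (cfc T (%t. \<Sum>\<^sub>\<infinity>x\<in>X. F x t) k)) K<=infsum M X" if K: "finite K" for K
 proof -
  have cf: "norm (cfc T (F x) k)<=M x" if "x \<in> X" for x k using cfc_le_hn[OF F[OF that], of k] le[OF that] by linarith
  have s: "(%x. norm (cfc T (F x) k)) summable_on X" for k by (rule summable_on_comparison_test[OF M]) (use cf in auto)
  have "L2_set (%k. wt l k * norm (cfc T (%t. \<Sum>\<^sub>\<infinity>x\<in>X. F x t) k)) K
   <=L2_set (%k. \<Sum>\<^sub>\<infinity>x\<in>X. wt l k * norm (cfc T (F x) k)) K"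
  proof (rule L2_set_mono)
   fix k
   have "norm (cfc T (%t. \<Sum>\<^sub>\<infinity>x\<in>X. F x t) k)<=(\<Sum>\<^sub>\<infinity>x\<in>X. norm (cfc T (F x) k))"
    by (rule norm_has_sum_bound[OF _ c(2)]) (use s in auto)
   then show "wt l k * norm (cfc T (%t. \<Sum>\<^sub>\<infinity>x\<in>X. F x t) k)<=(\<Sum>\<^sub>\<infinity>x\<in>X. wt l k * norm (cfc T (F x) k))"
    using wt_pos[of l k] by (simp add: infsum_cmult_right')
   show "0<=wt l k * norm (cfc T (%t. \<Sum>\<^sub>\<infinity>x\<in>X. F x t) k)" using wt_pos[of l k] by simp
  qed
  also have "...<=infsum M X"
  proof (rule L2_set_infsum_le[OF K _ _ _ M])
   show "((%x. wt l k * norm (cfc T (F x) k)) has_sum (\<Sum>\<^sub>\<infinity>x\<in>X. wt l k * norm (cfc T (F x) k))) X" for k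
    by (intro has_sum_infsum summable_on_cmult_right s)
   show "L2_set (%k. wt l k * norm (cfc T (F x) k)) K<=M x" if "x \<in> X" for x using L2_set_le_hn[OF F[OF that] K] le[OF that] by linarith
  qed (use wt_pos[of l] in \<open>auto simp: less_imp_le\<close>)
  finally show ?thesis .
 qed
 note bd = HSI[OF _ c(1) this]
 show "HS T l (%t. \<Sum>\<^sub>\<infinity>x\<in>X. F x t)" "hn T l (%t. \<Sum>\<^sub>\<infinity>x\<in>X. F x t)<=infsum M X"
  by (rule bd; auto intro!: infsum_cong simp: HS_periodic[OF F])+
qed

lemma HS_add:
 assumes f: "HS T l f" and g: "HS T l g"
 shows "HS T l (%t. f t+g t)" and "hn T l (%t. f t+g t)<=hn T l f+hn T l g"
proof -
 have "L2_set (%k. wt l k * norm (cfc T (%t. f t+g t) k)) K<=hn T l f+hn T l g" if K: "finite K" for K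
 proof -
  have "L2_set (%k. wt l k * norm (cfc T (%t. f t+g t) k)) K
  <=L2_set (%k. wt l k * norm (cfc T f k)+wt l k * norm (cfc T g k)) K"
   using wt_pos[of l] unfolding cfc_add[OF HS_continuous[OF f] HS_continuous[OF g]] distrib_left[symmetric]
   by (intro L2_set_mono mult_left_mono norm_triangle_ineq) (auto simp: less_imp_le)
  also have "...<=L2_set (%k. wt l k * norm (cfc T f k)) K+L2_set (%k. wt l k * norm (cfc T g k)) K" by (rule L2_set_triangle_ineq)
  finally show ?thesis using L2_set_le_hn[OF f K] L2_set_le_hn[OF g K] by linarith
 qed
 note * = HSI[OF _ continuous_on_add[OF HS_continuous[OF f] HS_continuous[OF g]] this]
 show "HS T l (%t. f t+g t)" and "hn T l (%t. f t+g t)<=hn T l f+hn T l g" by (rule *; simp add: HS_periodic[OF f] HS_periodic[OF g])+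
qed

lemma HS_cmult:
 assumes f: "HS T l f"
 shows "HS T l (%t. c * f t)" and "hn T l (%t. c * f t)<=norm c * hn T l f"
proof -
 have "L2_set (%k. wt l k * norm (cfc T (%t. c * f t) k)) K<=norm c * hn T l f" if K: "finite K" for K
 proof -
  have "L2_set (%k. wt l k * norm (cfc T (%t. c * f t) k)) K = norm c * L2_set (%k. wt l k * norm (cfc T f k)) K"
   by (subst L2_set_right_distrib) (auto simp: cfc_cmult norm_mult mult_ac)
  also have "...<=norm c * hn T l f" by (intro mult_left_mono L2_set_le_hn f K) simp
  finally show ?thesis .
 qed
 note * = HSI[OF _ continuous_on_mult[OF continuous_on_const HS_continuous[OF f]] this]
 show "HS T l (%t. c * f t)" and "hn T l (%t. c * f t)<=norm c * hn T l f" by (rule *; simp add: HS_periodic[OF f])+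
qed

lemma HS_const: "HS T l (%t. c)" "hn T l (%t. c)<=norm c"
proof -
 have "L2_set (%k. wt l k * norm (cfc T (%t. c) k)) K<=norm c" if "finite K" for K
 proof -
  have "L2_set (%k. wt l k * norm (cfc T (%t. c) k)) K<=(\<Sum>k\<in>K. wt l k * norm (cfc T (%t. c) k))"
   using wt_pos[of l] by (intro L2_set_le_sum) (auto simp: less_imp_le)
  also have "... = (\<Sum>k\<in>K. if k = 0 then norm c else 0)" by (intro sum.cong) (auto simp: cfc_const)
  also have "...<=norm c" using that by simp
  finally show ?thesis .
 qed
 note * = HSI[OF _ continuous_on_const this]
 show "HS T l (%t. c)" "hn T l (%t. c)<=norm c" by (rule *; simp)+
qed

lemma HS_cnj:
 assumes f: "HS T l f"
 shows "HS T l (%t. cnj (f t))" and "hn T l (%t. cnj (f t))<=hn T l f"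
proof -
 have "L2_set (%k. wt l k * norm (cfc T (%t. cnj (f t)) k)) K<=hn T l f" if K: "finite K" for K
 proof -
  have "L2_set (%k. wt l k * norm (cfc T (%t. cnj (f t)) k)) K = L2_set (%k. wt l k * norm (cfc T f k)) (uminus ` K)"
   unfolding L2_set_def by (subst sum.reindex) (auto simp: cfc_cnj[OF HS_continuous[OF f]] o_def)
  also have "...<=hn T l f" by (rule L2_set_le_hn[OF f]) (use K in auto)
  finally show ?thesis .
 qed
 note * = HSI[OF _ continuous_on_cnj[OF HS_continuous[OF f]] this]
 show "HS T l (%t. cnj (f t))" and "hn T l (%t. cnj (f t))<=hn T l f" by (rule *; simp add: HS_periodic[OF f])+
qed

definition malg :: "nat => real" where "malg l = 2*2 ^ l * sqrt isum"

lemma malg_ge_1: "malg l >= 1"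
proof -
 have "(1::real)<=2 ^ l" by simp
 then have "1*1<=(2*2 ^ l) * sqrt isum" using isum_ge_1 by (intro mult_mono) (linarith | simp)+
 then show ?thesis by (simp add: malg_def)
qed

lemma HS_mult:
 assumes l: "l >= 1" and f: "HS T l f" and g: "HS T l g"
 shows "HS T l (%t. f t * g t)" and "hn T l (%t. f t * g t)<=malg l * hn T l f * hn T l g"
proof -
 define G where "G = sqrt isum * hn T l g"
 have supg: "norm (g t)<=G" for t unfolding G_def by (rule HS_sup[OF g l])
 have fg: "f t * g t = (\<Sum>\<^sub>\<infinity>j. cfc T f j * chr T j t * g t)" for t
  using has_sum_cmult_left[OF HS_has_sum[OF f l, of t], of "g t"] by (simp add: infsumI)
 have conv: "((%j. cfc T f j * cfc T g (k - j)) has_sum cfc T (%t. f t * g t) k) UNIV" for k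
 proof -
  have "((%j. cfc T (%t. cfc T f j * chr T j t * g t) k) has_sum cfc T (%t. \<Sum>\<^sub>\<infinity>j. cfc T f j * chr T j t * g t) k) UNIV"
  proof (rule cfc_infsum(2))
   show "(%j. norm (cfc T f j) * G) summable_on UNIV" by (intro summable_on_cmult_left HS_abs_summable(1)[OF f l])
   show "norm (cfc T f x * chr T x t * g t)<=norm (cfc T f x) * G" for x t by (auto simp: norm_mult intro!: mult_left_mono supg)
  qed (intro continuous_intros HS_continuous[OF g])
  moreover have "(%t. f t * g t) = (%t. \<Sum>\<^sub>\<infinity>j. cfc T f j * chr T j t * g t)" by (rule ext) (rule fg)
  ultimately show ?thesis by (simp only: mult.assoc cfc_cmult cfc_shift)
 qed
 have swap: "(%j. norm (cfc T f j) * norm (cfc T g (k - j))) summable_on UNIV" for k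
  by (rule summable_on_comparison_test[where f="%j. norm (cfc T f j) * hn T l g"])
   (auto intro!: summable_on_cmult_left HS_abs_summable(1)[OF f l] mult_left_mono cfc_le_hn[OF g])
 have *: "L2_set (%k. wt l k * norm (cfc T (%t. f t * g t) k)) K<=malg l * hn T l f * hn T l g" if K: "finite K" for K
 proof -
  let ?A = "%k. \<Sum>\<^sub>\<infinity>j. norm (cfc T g j)*(wt l (k - j) * norm (cfc T f (k - j)))"
  let ?B = "%k. \<Sum>\<^sub>\<infinity>j. norm (cfc T f j)*(wt l (k - j) * norm (cfc T g (k - j)))"
  have sA: "(%j. norm (cfc T g j)*(wt l (k - j) * norm (cfc T f (k - j)))) summable_on UNIV" for k
   by (rule summable_on_comparison_test[where f="%j. norm (cfc T g j) * hn T l f"])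
    (auto intro!: summable_on_cmult_left HS_abs_summable(1)[OF g l] mult_left_mono wt_cfc_le_hn[OF f]
     mult_nonneg_nonneg less_imp_le[OF wt_pos])
  have sB: "(%j. norm (cfc T f j)*(wt l (k - j) * norm (cfc T g (k - j)))) summable_on UNIV" for k
   by (rule summable_on_comparison_test[where f="%j. norm (cfc T f j) * hn T l g"])
    (auto intro!: summable_on_cmult_left HS_abs_summable(1)[OF f l] mult_left_mono wt_cfc_le_hn[OF g]
     mult_nonneg_nonneg less_imp_le[OF wt_pos])
  have A': "((%j. wt l j * norm (cfc T f j) * norm (cfc T g (k - j))) has_sum ?A k) UNIV" for k
   using has_sum_reindex_bij_witness[of UNIV "%j. k - j" "%j. k - j" UNIV
     "%j. norm (cfc T g j)*(wt l (k - j) * norm (cfc T f (k - j)))"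
     "%j. wt l j * norm (cfc T f j) * norm (cfc T g (k - j))" "?A k" "?A k"] has_sum_infsum[OF sA[of k]] by (simp add: mult_ac)
  have "L2_set (%k. wt l k * norm (cfc T (%t. f t * g t) k)) K<=L2_set (%k. 2 ^ l*(?A k+?B k)) K"
  proof (rule L2_set_mono)
   fix k
   have "norm (cfc T (%t. f t * g t) k)<=(\<Sum>\<^sub>\<infinity>j. norm (cfc T f j) * norm (cfc T g (k - j)))"
    by (rule norm_has_sum_bound[OF _ conv]) (use has_sum_infsum[OF swap[of k]] in \<open>simp add: norm_mult\<close>)
   then have "wt l k * norm (cfc T (%t. f t * g t) k)<=wt l k*(\<Sum>\<^sub>\<infinity>j. norm (cfc T f j) * norm (cfc T g (k - j)))"
    using wt_pos[of l k] by (intro mult_left_mono) auto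
   also have "... = (\<Sum>\<^sub>\<infinity>j. wt l k*(norm (cfc T f j) * norm (cfc T g (k - j))))" by (simp add: infsum_cmult_right')
   also have "...<=2 ^ l*(?A k+?B k)"
   proof (rule has_sum_mono[OF has_sum_infsum])
    show "(%j. wt l k*(norm (cfc T f j) * norm (cfc T g (k - j)))) summable_on UNIV" by (intro summable_on_cmult_right swap)
    show "((%j. 2 ^ l*(wt l j * norm (cfc T f j) * norm (cfc T g (k - j)) +
      norm (cfc T f j)*(wt l (k - j) * norm (cfc T g (k - j))))) has_sum 2 ^ l*(?A k+?B k)) UNIV"
     by (intro has_sum_cmult_right has_sum_add A' has_sum_infsum sB)
    show "wt l k*(norm (cfc T f j) * norm (cfc T g (k - j)))<=2 ^ l*(wt l j * norm (cfc T f j) * norm (cfc T g (k - j)) +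
      norm (cfc T f j)*(wt l (k - j) * norm (cfc T g (k - j))))" for j
     using mult_right_mono[OF wt_subadd[of l k j], of "norm (cfc T f j) * norm (cfc T g (k - j))"] by (simp add: algebra_simps)
   qed
   finally show "wt l k * norm (cfc T (%t. f t * g t) k)<=2 ^ l*(?A k+?B k)" .
  qed (auto intro: mult_nonneg_nonneg less_imp_le[OF wt_pos])
  also have "... = 2 ^ l * L2_set (%k. ?A k+?B k) K" by (simp add: L2_set_right_distrib)
  also have "...<=2 ^ l*(L2_set ?A K+L2_set ?B K)" by (intro mult_left_mono L2_set_triangle_ineq) simp
  also have "L2_set ?A K<=(\<Sum>\<^sub>\<infinity>j. norm (cfc T g j) * hn T l f)"
  proof (rule L2_set_infsum_le[OF K has_sum_infsum[OF sA]])
   show "L2_set (%k. norm (cfc T g x)*(wt l (k - x) * norm (cfc T f (k - x)))) K<=norm (cfc T g x) * hn T l f" for x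
   proof -
    have "L2_set (%k. wt l (k - x) * norm (cfc T f (k - x))) K = L2_set (%k. wt l k * norm (cfc T f k)) ((%k. k - x) ` K)"
     unfolding L2_set_def by (subst sum.reindex) (auto simp: inj_on_def o_def)
    also have "...<=hn T l f" using K by (intro L2_set_le_hn f) auto
    finally show ?thesis by (simp add: L2_set_right_distrib[symmetric] mult_left_mono)
   qed
  qed (auto intro!: summable_on_cmult_left HS_abs_summable(1)[OF g l] mult_nonneg_nonneg less_imp_le[OF wt_pos])
  also have "...<=sqrt isum * hn T l g * hn T l f" unfolding infsum_cmult_left' by (intro mult_right_mono HS_abs_summable(2)[OF g l]) simp
  also have "L2_set ?B K<=(\<Sum>\<^sub>\<infinity>j. norm (cfc T f j) * hn T l g)"
  proof (rule L2_set_infsum_le[OF K has_sum_infsum[OF sB]])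
   show "L2_set (%k. norm (cfc T f x)*(wt l (k - x) * norm (cfc T g (k - x)))) K<=norm (cfc T f x) * hn T l g" for x
   proof -
    have "L2_set (%k. wt l (k - x) * norm (cfc T g (k - x))) K = L2_set (%k. wt l k * norm (cfc T g k)) ((%k. k - x) ` K)"
     unfolding L2_set_def by (subst sum.reindex) (auto simp: inj_on_def o_def)
    also have "...<=hn T l g" using K by (intro L2_set_le_hn g) auto
    finally show ?thesis by (simp add: L2_set_right_distrib[symmetric] mult_left_mono)
   qed
  qed (auto intro!: summable_on_cmult_left HS_abs_summable(1)[OF f l] mult_nonneg_nonneg less_imp_le[OF wt_pos])
  also have "...<=sqrt isum * hn T l f * hn T l g" unfolding infsum_cmult_left' by (intro mult_right_mono HS_abs_summable(2)[OF f l]) simp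
  finally show ?thesis by (simp add: malg_def algebra_simps)
 qed
 note ** = HSI[OF _ continuous_on_mult[OF HS_continuous[OF f] HS_continuous[OF g]] *]
 show "HS T l (%t. f t * g t)" and "hn T l (%t. f t * g t)<=malg l * hn T l f * hn T l g"
  by (rule **; simp add: HS_periodic[OF f] HS_periodic[OF g])+
qed

end

context period
begin

lemma HS_synthesis:
 assumes l: "l >= 1" and le: "!!K. finite K ==> L2_set (%k. wt l k * norm (a k)) K<=M"
 shows "HS T l (%t. \<Sum>\<^sub>\<infinity>k. a k * chr T k t)" and "hn T l (%t. \<Sum>\<^sub>\<infinity>k. a k * chr T k t)<=M"
  and "cfc T (%t. \<Sum>\<^sub>\<infinity>k. a k * chr T k t) j = a j"
  and "(%k. norm (a k)) summable_on UNIV"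
proof -
 have *: "(\<Sum>k\<in>K. norm (a k))<=sqrt isum * M" if K: "finite K" for K
 proof -
  have "(\<Sum>k\<in>K. norm (a k)) = (\<Sum>k\<in>K. \<bar>1 / wt l k\<bar> * \<bar>wt l k * norm (a k)\<bar>)"
   using wt_pos[of l] by (intro sum.cong) (auto simp: less_imp_neq[symmetric] less_imp_le abs_mult)
  also have "...<=L2_set (%k. 1 / wt l k) K * L2_set (%k. wt l k * norm (a k)) K" by (rule L2_set_mult_ineq)
  also have "...<=sqrt isum * M"
  proof (intro mult_mono le K)
   have "(\<Sum>k\<in>K. (1 / wt l k)\<^sup>2)<=(\<Sum>k\<in>K. 1 / (1+(real_of_int k)\<^sup>2))"
   proof (rule sum_mono)
    fix k
    have "1+(real_of_int k)\<^sup>2<=(wt l k)\<^sup>2" using power_increasing[OF l, of "1+(real_of_int k)\<^sup>2"] by (simp add: wt_sq)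
    then show "(1 / wt l k)\<^sup>2<=1 / (1+(real_of_int k)\<^sup>2)" by (simp add: power_divide frac_le add_pos_nonneg)
   qed
   also have "...<=isum" unfolding isum_def using K by (intro finite_sum_le_infsum summable_isum) auto
   finally show "L2_set (%k. 1 / wt l k) K<=sqrt isum" by (simp add: L2_set_def)
  qed (use isum_ge_1 in auto)
  finally show ?thesis .
 qed
 show s: "(%k. norm (a k)) summable_on UNIV" by (intro nonneg_bdd_above_summable_on bdd_aboveI[where M="sqrt isum * M"]) (auto intro: *)
 note c = cfc_synthesis[OF s]
 show "cfc T (%t. \<Sum>\<^sub>\<infinity>k. a k * chr T k t) j = a j" by (rule c)
 have "L2_set (%k. wt l k * norm (cfc T (%t. \<Sum>\<^sub>\<infinity>k. a k * chr T k t) k)) K<=M" if "finite K" for K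
  unfolding c(2) using le that by blast
 note ** = HSI[OF c(3) c(1) this]
 show "HS T l (%t. \<Sum>\<^sub>\<infinity>k. a k * chr T k t)" and "hn T l (%t. \<Sum>\<^sub>\<infinity>k. a k * chr T k t)<=M" by (rule **; simp)+
qed

definition hmul :: "(int => complex) => (real => complex) => real => complex" where
 "hmul m f t = (\<Sum>\<^sub>\<infinity>k. m k * cfc T f k * chr T k t)"

lemma hmul:
 assumes l: "l >= 1" and f: "HS T l f" and m: "!!k. norm (m k)<=C"
 shows "HS T l (hmul m f)" and "hn T l (hmul m f)<=C * hn T l f" and "cfc T (hmul m f) k = m k * cfc T f k"
  and "((%k. m k * cfc T f k * chr T k t) has_sum hmul m f t) UNIV"
proof -
 have C: "C >= 0" using m[of 0] norm_ge_zero order_trans by blast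
 have le: "L2_set (%k. wt l k * norm (m k * cfc T f k)) K<=C * hn T l f" if K: "finite K" for K
 proof -
  have "L2_set (%k. wt l k * norm (m k * cfc T f k)) K<=L2_set (%k. C*(wt l k * norm (cfc T f k))) K"
  proof (rule L2_set_mono)
   fix k
   have "wt l k * norm (m k * cfc T f k) = norm (m k)*(wt l k * norm (cfc T f k))" by (simp add: norm_mult mult_ac)
   also have "...<=C*(wt l k * norm (cfc T f k))" using m wt_pos[of l k] by (intro mult_right_mono) auto
   finally show "wt l k * norm (m k * cfc T f k)<=C*(wt l k * norm (cfc T f k))" .
  qed (use wt_pos[of l] in \<open>auto simp: less_imp_le\<close>)
  also have "... = C * L2_set (%k. wt l k * norm (cfc T f k)) K" using C by (simp add: L2_set_right_distrib)
  also have "...<=C * hn T l f" by (intro mult_left_mono L2_set_le_hn f K C)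
  finally show ?thesis .
 qed
 note s = HS_synthesis[OF l le]
 show "HS T l (hmul m f)" and "hn T l (hmul m f)<=C * hn T l f" and "cfc T (hmul m f) k = m k * cfc T f k"
  unfolding hmul_def[abs_def] by (rule s; assumption)+
 have "(%k. m k * cfc T f k * chr T k t) summable_on UNIV" by (rule abs_summable_summable) (use s(4) in \<open>simp add: norm_mult\<close>)
 then show "((%k. m k * cfc T f k * chr T k t) has_sum hmul m f t) UNIV" unfolding hmul_def by (rule has_sum_infsum)
qed

lemma hmul_Suc:
 assumes l: "l >= 1" and f: "HS T l f" and m: "!!k. sqrt (1+(real_of_int k)\<^sup>2) * norm (m k)<=C"
 shows "HS T (Suc l) (hmul m f)"
proof -
 have "norm (m 0)<=C" using m[of 0] by simp
 then have C: "C >= 0" using norm_ge_zero order_trans by blast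
 have le: "L2_set (%k. wt (Suc l) k * norm (m k * cfc T f k)) K<=C * hn T l f" if K: "finite K" for K
 proof -
  have "L2_set (%k. wt (Suc l) k * norm (m k * cfc T f k)) K<=L2_set (%k. C*(wt l k * norm (cfc T f k))) K"
  proof (rule L2_set_mono)
   fix k
   have "wt (Suc l) k * norm (m k * cfc T f k) = (sqrt (1+(real_of_int k)\<^sup>2) * norm (m k))*(wt l k * norm (cfc T f k))"
    by (simp add: norm_mult mult_ac wt_Suc)
   also have "...<=C*(wt l k * norm (cfc T f k))" using m wt_pos[of l k] by (intro mult_right_mono) auto
   finally show "wt (Suc l) k * norm (m k * cfc T f k)<=C*(wt l k * norm (cfc T f k))" .
  qed (use wt_pos[of "Suc l"] in \<open>auto simp: less_imp_le\<close>)
  also have "... = C * L2_set (%k. wt l k * norm (cfc T f k)) K" using C by (simp add: L2_set_right_distrib)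
  also have "...<=C * hn T l f" by (intro mult_left_mono L2_set_le_hn f K C)
  finally show ?thesis .
 qed
 show ?thesis unfolding hmul_def[abs_def] using l by (intro HS_synthesis(1)[OF _ le]) auto
qed

definition dert :: "(real => complex) => real => complex" where
 "dert f t = (\<Sum>\<^sub>\<infinity>k. (\<i> * of_real (of_int k*(2 * pi / T)) * cfc T f k) * chr T k t)"

lemma dert:
 assumes l: "l >= 1" and f: "HS T (Suc l) f"
 shows "HS T l (dert f)" and "(f has_vector_derivative dert f t) (at t)"
  and "((%k. \<i> * of_real (of_int k*(2 * pi / T)) * cfc T f k * chr T k t) has_sum dert f t) UNIV"
proof -
 define a where "a k = \<i> * of_real (of_int k*(2 * pi / T)) * cfc T f k" for k
 have le: "L2_set (%k. wt l k * norm (a k)) K<=(2 * pi / T) * hn T (Suc l) f" if K: "finite K" for K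
 proof -
  have "L2_set (%k. wt l k * norm (a k)) K<=L2_set (%k. (2 * pi / T)*(wt (Suc l) k * norm (cfc T f k))) K"
  proof (rule L2_set_mono)
   fix k
   have "wt l k * norm (a k) = (\<bar>real_of_int k\<bar>)*((2 * pi / T)*(wt l k * norm (cfc T f k)))"
    using T_pos by (simp add: a_def norm_mult norm_divide abs_mult)
   also have "...<=sqrt (1+(real_of_int k)\<^sup>2)*((2 * pi / T)*(wt l k * norm (cfc T f k)))"
   proof (rule mult_right_mono)
    show "\<bar>real_of_int k\<bar><=sqrt (1+(real_of_int k)\<^sup>2)" by (rule real_le_rsqrt) simp
   qed (use T_pos wt_pos[of l k] in auto)
   finally show "wt l k * norm (a k)<=(2 * pi / T)*(wt (Suc l) k * norm (cfc T f k))" by (simp add: wt_Suc mult_ac)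
  qed (use wt_pos[of l] in \<open>auto simp: less_imp_le\<close>)
  also have "... = (2 * pi / T) * L2_set (%k. wt (Suc l) k * norm (cfc T f k)) K" using T_pos by (intro L2_set_right_distrib[symmetric]) auto
  also have "...<=(2 * pi / T) * hn T (Suc l) f" using T_pos by (intro mult_left_mono L2_set_le_hn f K) auto
  finally show ?thesis .
 qed
 note s = HS_synthesis[OF l le]
 have d: "dert f = (%t. \<Sum>\<^sub>\<infinity>k. a k * chr T k t)" by (simp add: dert_def[abs_def] a_def)
 show g: "HS T l (dert f)" unfolding d by (rule s)
 have hs: "((%k. a k * chr T k t) has_sum dert f t) UNIV" for t
  unfolding d by (rule has_sum_infsum, rule abs_summable_summable) (use s(4) in \<open>simp add: norm_mult\<close>)
 then show "((%k. \<i> * of_real (of_int k*(2 * pi / T)) * cfc T f k * chr T k t) has_sum dert f t) UNIV" by (simp add: a_def)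
 have l': "Suc l >= 1" by simp
 have int: "f x - f y = integral {y..x} (dert f)" if "y<=x" for x y
 proof -
  have u: "uniform_limit {y..x} (%X t. \<Sum>k\<in>X. a k * chr T k t) (dert f) (finite_subsets_at_top UNIV)"
   by (rule Weierstrass_m_test_general'[OF _ hs s(4)]) (simp add: norm_mult)
  have c: "continuous_on {y..x} (%t. \<Sum>k\<in>X. a k * chr T k t)" for X by (intro continuous_intros)
  obtain I J where I: "!!X. ((%t. \<Sum>k\<in>X. a k * chr T k t) has_integral I X) {y..x}"
   and J: "(dert f has_integral J) {y..x}" and lim: "(I \<longlongrightarrow> J) (finite_subsets_at_top UNIV)"
   by (rule uniform_limit_integral[OF u c finite_subsets_at_top_neq_bot]) (rule that)
  have IX: "I X = (\<Sum>k\<in>X. cfc T f k * chr T k x - cfc T f k * chr T k y)" for X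
  proof (rule has_integral_unique[OF I])
   have dk: "((%t. a k * chr T k t) has_integral (cfc T f k * chr T k x - cfc T f k * chr T k y)) {y..x}" for k
   proof (rule fundamental_theorem_of_calculus[OF that])
    fix s
    have "((%t. cfc T f k * chr T k t) has_vector_derivative cfc T f k*(\<i> * of_real (of_int k*(2 * pi / T)) * chr T k s)) (at s within {y..x})"
     by (rule has_vector_derivative_mult_right) (rule chr_has_vector_derivative)
    then show "((%t. cfc T f k * chr T k t) has_vector_derivative a k * chr T k s) (at s within {y..x})" by (simp add: a_def mult_ac)
   qed
   show "((%t. \<Sum>k\<in>X. a k * chr T k t) has_integral (\<Sum>k\<in>X. cfc T f k * chr T k x - cfc T f k * chr T k y)) {y..x}"
   proof (cases "finite X")
    case True then show ?thesis by (intro has_integral_sum dk)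
   qed simp
  qed
  have "I = sum (%k. cfc T f k * chr T k x - cfc T f k * chr T k y)" by (rule ext) (rule IX)
  moreover have "((%k. cfc T f k * chr T k x - cfc T f k * chr T k y) has_sum (f x - f y)) UNIV"
   using has_sum_add[OF HS_has_sum[OF f l', of x] has_sum_cmult_right[OF HS_has_sum[OF f l', of y], of "-1"]] by simp
  ultimately have "(I \<longlongrightarrow> f x - f y) (finite_subsets_at_top UNIV)" by (simp add: has_sum_def)
  with lim have "J = f x - f y" by (rule tendsto_unique[OF finite_subsets_at_top_neq_bot])
  with J show ?thesis by (simp add: integral_unique)
 qed
 have "((%u. integral {t - 1..u} (dert f)) has_vector_derivative dert f t) (at t within {t - 1..t+1})"
  by (rule integral_has_vector_derivative[OF HS_continuous[OF g]]) simp
 then have "((%u. f (t - 1)+integral {t - 1..u} (dert f)) has_vector_derivative dert f t) (at t within {t - 1..t+1})"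
  by (auto intro!: derivative_eq_intros)
 then have "(f has_vector_derivative dert f t) (at t within {t - 1..t+1})"
  by (rule has_vector_derivative_transform[rotated 2]) (use int in \<open>auto simp: algebra_simps\<close>)
 then show "(f has_vector_derivative dert f t) (at t)" by (simp add: at_within_interior[of t "{t - 1..t+1}"])
qed

lemma dert_hmul:
 assumes l: "l >= 1" and f: "HS T l f" and m: "!!k. sqrt (1+(real_of_int k)\<^sup>2) * norm (m k)<=C"
 shows "((%k. \<i> * of_real (of_int k*(2 * pi / T)) * m k * cfc T f k * chr T k t) has_sum dert (hmul m f) t) UNIV"
proof -
 have m': "norm (m k)<=C" for k
 proof -
  have "1 * norm (m k)<=sqrt (1+(real_of_int k)\<^sup>2) * norm (m k)" by (intro mult_right_mono) auto
  then show ?thesis using m[of k] by simp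
 qed
 show ?thesis using dert(3)[OF l hmul_Suc[OF l f m], of t] unfolding hmul(3)[OF l f m'] by (simp add: mult_ac)
qed

lemma HS_0_mean: "HS T l f ==> hn T l (%t. cfc T f 0)<=hn T l f" using HS_const(2)[of l "cfc T f 0"] cfc_le_hn[of T l f 0] by linarith

end

section \<open>Polynomials in linear functionals with coefficients in the Sobolev algebra\<close>

type_synonym terms = "(nat list \<times> (real => complex)) list"

locale sobolev_words = period +
 fixes l N :: nat and \<zeta> :: "nat => 'x::euclidean_space => complex"
 assumes l: "l >= 1" and lin: "linear (\<zeta> i)"
begin

definition nm :: "(real => complex) => real" where "nm f = malg l * hn T l f"

abbreviation "HSl \<equiv> HS T l"

lemma malg_pos: "malg l > 0" using malg_ge_1[of l] by linarith

lemma nm_nonneg [simp]: "nm f >= 0" using malg_pos by (simp add: nm_def)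

lemma hn_le_nm: "hn T l f<=nm f" unfolding nm_def using mult_right_mono[OF malg_ge_1 hn_nonneg] by simp

lemma nm_mult: "HSl f ==> HSl g ==> nm (%t. f t * g t)<=nm f * nm g"
 unfolding nm_def using mult_left_mono[OF HS_mult(2)[OF l, of f g], of "malg l"] malg_pos by (simp add: mult_ac)

lemma nm_add: "HSl f ==> HSl g ==> nm (%t. f t+g t)<=nm f+nm g"
 unfolding nm_def distrib_left[symmetric] using malg_pos by (intro mult_left_mono HS_add(2)) auto

lemma nm_cmult: "HSl f ==> nm (%t. c * f t)<=norm c * nm f" unfolding nm_def using mult_left_mono[OF HS_cmult(2)[of l f c], of "malg l"] malg_pos
 by (simp add: mult_ac)

lemma nm_const: "nm (%t. c)<=malg l * norm c" unfolding nm_def using malg_pos by (intro mult_left_mono HS_const(2)) auto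

lemma nm_cnj: "HSl f ==> nm (%t. cnj (f t))<=nm f" unfolding nm_def using malg_pos by (intro mult_left_mono HS_cnj(2)) auto

lemma sup_le_nm: assumes "HSl f" shows "norm (f t)<=nm f"
proof -
 have "sqrt isum<=malg l"
 proof -
  have "(1::real)<=2 ^ l" by simp
  then have "(1::real)<=2*2 ^ l" by linarith
  then show ?thesis unfolding malg_def using isum_ge_1 mult_right_mono[of 1 "2*2 ^ l" "sqrt isum"] by simp
 qed
 then show ?thesis using HS_sup[OF assms l, of t] mult_right_mono[of "sqrt isum" "malg l" "hn T l f"] by (simp add: nm_def)
qed

lemma HS_sum:
 assumes "!!i. i \<in> A ==> HSl (f i)"
 shows "HSl (%t. \<Sum>i\<in>A. f i t)" and "nm (%t. \<Sum>i\<in>A. f i t)<=(\<Sum>i\<in>A. nm (f i))"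
proof -
 have "HSl (%t. \<Sum>i\<in>A. f i t) & nm (%t. \<Sum>i\<in>A. f i t)<=(\<Sum>i\<in>A. nm (f i))" using assms
 proof (induction A rule: infinite_finite_induct)
  case (insert a A)
  then have *: "HSl (%t. \<Sum>i\<in>A. f i t)" "nm (%t. \<Sum>i\<in>A. f i t)<=(\<Sum>i\<in>A. nm (f i))" by auto
  have "nm (%t. f a t+(\<Sum>i\<in>A. f i t))<=nm (f a)+nm (%t. \<Sum>i\<in>A. f i t)" using insert.prems *(1) by (intro nm_add) auto
  then show ?case using insert HS_add(1)[of l "f a" "%t. \<Sum>i\<in>A. f i t"] * by auto
 qed (use HS_const(1)[of l 0] nm_const[of 0] in auto)
 then show "HSl (%t. \<Sum>i\<in>A. f i t)" and "nm (%t. \<Sum>i\<in>A. f i t)<=(\<Sum>i\<in>A. nm (f i))" by auto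
qed

definition mon :: "nat list => 'x => complex" where
 "mon w x = prod_list (map (%i. \<zeta> i x) w)"

lemma mon_simps [simp]: "mon [] x = 1" "mon (i # w) x = \<zeta> i x * mon w x"
  "mon (v @ w) x = mon v x * mon w x" by (simp_all add: mon_def)

fun dmono :: "nat list => 'x => 'x => complex" where
 "dmono [] x y = 0"
| "dmono (i # w) x y = \<zeta> i y * mon w x+\<zeta> i x * dmono w x y"

definition ev :: "terms => 'x => real => complex" where
 "ev ps x t = (\<Sum>(w, c)\<leftarrow>ps. mon w x * c t)"

definition pd :: "terms => 'x => 'x => real => complex" where
 "pd ps x y t = (\<Sum>(w, c)\<leftarrow>ps. dmono w x y * c t)"

definition et :: "terms => 'x => real => complex" where
 "et ps x t = (\<Sum>(w, c)\<leftarrow>ps. mon w x * dert c t)"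

definition nrm :: "terms => real" where "nrm ps = (\<Sum>(w, c)\<leftarrow>ps. nm c)"

lemma ev_simps [simp]: "ev [] x t = 0" "ev ((w, c) # ps) x t = mon w x * c t+ev ps x t"
  "ev (ps @ qs) x t = ev ps x t+ev qs x t" by (simp_all add: ev_def)

lemma pd_simps [simp]: "pd [] x y t = 0" "pd ((w, c) # ps) x y t = dmono w x y * c t+pd ps x y t"
  "pd (ps @ qs) x y t = pd ps x y t+pd qs x y t" by (simp_all add: pd_def)

lemma et_simps [simp]: "et [] x t = 0" "et ((w, c) # ps) x t = mon w x * dert c t+et ps x t"
  "et (ps @ qs) x t = et ps x t+et qs x t" by (simp_all add: et_def)

lemma nrm_simps [simp]: "nrm [] = 0" "nrm ((w, c) # ps) = nm c+nrm ps" "nrm (ps @ qs) = nrm ps+nrm qs" by (simp_all add: nrm_def)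

lemma nrm_nonneg [simp]: "nrm ps >= 0" by (induction ps) auto

definition hom :: "nat => terms => bool" where
 "hom n ps \<longleftrightarrow> (\<forall>(w, c)\<in>set ps. length w = n & set w \<subseteq> {..<N} & HSl c)"

lemma hom_simps [simp]: "hom n []"
  "hom n ((w, c) # ps) \<longleftrightarrow> length w = n & set w \<subseteq> {..<N} & HSl c & hom n ps"
  "hom n (ps @ qs) \<longleftrightarrow> hom n ps & hom n qs" by (auto simp: hom_def)

definition H :: "nat => real => ('x => real => complex) => bool" where
 "H n M P \<longleftrightarrow> (EX ps. hom n ps & nrm ps<=M & P = ev ps)"

lemma H_nonneg: "H n M P ==> M >= 0" unfolding H_def using nrm_nonneg order_trans by blast

lemma H_mono: "H n M P ==> M<=M' ==> H n M' P" unfolding H_def using order_trans by blast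

lemma H_zero: "M >= 0 ==> H n M (%x t. 0)" unfolding H_def by (rule exI[of _ "[]"]) (auto simp: fun_eq_iff)

lemma H_add:
 assumes "H n M P" "H n M' Q" shows "H n (M+M') (%x t. P x t+Q x t)"
proof -
 obtain ps qs where "hom n ps" "nrm ps<=M" "P = ev ps" "hom n qs" "nrm qs<=M'" "Q = ev qs" using assms unfolding H_def by auto
 then show ?thesis unfolding H_def by (intro exI[of _ "ps @ qs"]) (auto simp: fun_eq_iff)
qed

lemma H_sum:
 assumes "!!i. i \<in> A ==> H n (M i) (P i)"
 shows "H n (\<Sum>i\<in>A. M i) (%x t. \<Sum>i\<in>A. P i x t)" using assms by (induction A rule: infinite_finite_induct) (auto intro: H_zero H_add)

lemma H_letter:
 assumes "H n M P" "i < N" shows "H (Suc n) M (%x t. \<zeta> i x * P x t)"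
proof -
 obtain ps where ps: "hom n ps" "nrm ps<=M" "P = ev ps" using assms unfolding H_def by auto
 define qs where "qs = map (%(w, c). (i # w, c)) ps"
 have "hom (Suc n) qs" using ps(1) assms(2) unfolding qs_def hom_def by fastforce
 moreover have "nrm qs = nrm ps" unfolding qs_def by (induction ps) auto
 moreover have "ev qs x t = \<zeta> i x * ev ps x t" for x t unfolding qs_def by (induction ps) (auto simp: algebra_simps)
 ultimately show ?thesis using ps unfolding H_def by (intro exI[of _ qs]) (auto simp: fun_eq_iff)
qed

lemma H_coef_mult:
 assumes "H n M P" "HSl f" shows "H n (nm f * M) (%x t. f t * P x t)"
proof -
 obtain ps where ps: "hom n ps" "nrm ps<=M" "P = ev ps" using assms unfolding H_def by auto
 define qs where "qs = map (%(w, c). (w, %t. f t * c t)) ps"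
 have "hom n qs" using ps(1) assms(2) HS_mult(1)[OF l] unfolding qs_def hom_def by auto
 moreover have "nrm qs<=nm f * nrm ps" using ps(1) assms(2) unfolding qs_def
 proof (induction ps)
  case (Cons p ps)
  then show ?case using nm_mult[of f "snd p"] by (cases p) (auto simp: algebra_simps)
 qed simp
 moreover have "ev qs x t = f t * ev ps x t" for x t unfolding qs_def by (induction ps) (auto simp: algebra_simps)
 moreover have "nm f * nrm ps<=nm f * M" using ps by (intro mult_left_mono) auto
 ultimately show ?thesis using ps unfolding H_def by (intro exI[of _ qs]) (auto simp: fun_eq_iff)
qed

lemma H_cmult:
 assumes "H n M P" shows "H n (norm a * M) (%x t. a * P x t)"
proof -
 obtain ps where ps: "hom n ps" "nrm ps<=M" "P = ev ps" using assms unfolding H_def by auto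
 define qs where "qs = map (%(w, c). (w, %t. a * c t)) ps"
 have "hom n qs" using ps(1) HS_cmult(1) unfolding qs_def hom_def by auto
 moreover have "nrm qs<=norm a * nrm ps" using ps(1) unfolding qs_def
 proof (induction ps)
  case (Cons p ps)
  then show ?case using nm_cmult[of "snd p" a] by (cases p) (auto simp: algebra_simps)
 qed simp
 moreover have "ev qs x t = a * ev ps x t" for x t unfolding qs_def by (induction ps) (auto simp: algebra_simps)
 moreover have "norm a * nrm ps<=norm a * M" using ps by (intro mult_left_mono) auto
 ultimately show ?thesis using ps unfolding H_def by (intro exI[of _ qs]) (auto simp: fun_eq_iff)
qed

lemma H_uminus: "H n M P ==> H n M (%x t. - P x t)" using H_cmult[of n M P "-1"] by simp

lemma H_diff: "H n M P ==> H n M' Q ==> H n (M+M') (%x t. P x t - Q x t)" using H_add[of n M P M' "%x t. - Q x t"] H_uminus by simp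

lemma H_coef: "HSl f ==> H 0 (nm f) (%x t. f t)" unfolding H_def by (rule exI[of _ "[([], f)]"]) (auto simp: fun_eq_iff)

lemma H_const: "H 0 (malg l * norm a) (%x t. a)" by (rule H_mono[OF H_coef[OF HS_const(1)] nm_const])

lemma H_functional: "H 1 (malg l*(\<Sum>i<N. norm (a i))) (%x t. \<Sum>i<N. a i * \<zeta> i x)"
proof -
 have "H 1 (\<Sum>i<N. malg l * norm (a i)) (%x t. \<Sum>i<N. \<zeta> i x * a i)" by (rule H_sum) (use H_letter[OF H_const] in auto)
 then show ?thesis by (simp add: sum_distrib_left mult_ac)
qed

lemma H_term: "length w = n ==> set w \<subseteq> {..<N} ==> HSl c ==> H n (nm c) (%x t. mon w x * c t)"
 unfolding H_def by (rule exI[of _ "[(w, c)]"]) (auto simp: fun_eq_iff)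

lemma H_word_mult:
 assumes "H n M P" "set w \<subseteq> {..<N}" shows "H (length w+n) M (%x t. mon w x * P x t)" using assms(2)
proof (induction w)
 case (Cons i w)
 then have "H (Suc (length w+n)) M (%x t. \<zeta> i x*(mon w x * P x t))" by (intro H_letter) auto
 then show ?case by (simp add: mult.assoc)
qed (use assms in simp)

lemma H_mult:
 assumes "H n M P" "H n' M' Q" shows "H (n+n') (M * M') (%x t. P x t * Q x t)"
proof -
 obtain ps where ps: "hom n ps" "nrm ps<=M" "P = ev ps" using assms unfolding H_def by auto
 have "H (n+n') (nrm ps * M') (%x t. ev ps x t * Q x t)" using ps(1)
 proof (induction ps)
  case Nil then show ?case by (simp add: H_zero)
 next
  case (Cons p ps)
  obtain w c where p: "p = (w, c)" by (cases p)
  have "H (length w+n') (nm c * M') (%x t. mon w x*(c t * Q x t))" using Cons.prems p by (intro H_word_mult H_coef_mult assms) auto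
  then have "H (n+n') (nm c * M'+nrm ps * M') (%x t. mon w x*(c t * Q x t)+ev ps x t * Q x t)" using Cons p by (intro H_add) auto
  then show ?case by (simp add: p algebra_simps)
 qed
 then show ?thesis using H_mono[OF _ mult_right_mono[OF ps(2) H_nonneg[OF assms(2)]]] ps(3) by blast
qed

lemma H_dmono:
 assumes w: "set w \<subseteq> {..<N}" and c: "HSl c" and W: "!!i. i < N ==> H n' M' (%x t. \<zeta> i (W x t))" and M': "M' >= 0"
 shows "H (length w - 1+n') (real (length w) * nm c * M') (%x t. dmono w x (W x t) * c t)" using w
proof (induction w)
 case Nil then show ?case by (simp add: H_zero)
next
 case (Cons i w)
 have 1: "H (n'+length w) (M' * nm c) (%x t. \<zeta> i (W x t)*(mon w x * c t))" using Cons.prems c by (intro H_mult W H_term) auto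
 have 2: "H (n'+length w) (real (length w) * nm c * M') (%x t. \<zeta> i x*(dmono w x (W x t) * c t))"
 proof (cases w)
  case Nil then show ?thesis by (simp add: H_zero)
 next
  case (Cons j v)
  have "H (Suc (length w - 1+n')) (real (length w) * nm c * M') (%x t. \<zeta> i x*(dmono w x (W x t) * c t))"
   using Cons.IH Cons.prems by (intro H_letter) auto
  then show ?thesis using Cons by (simp add: add.commute)
 qed
 from H_add[OF 1 2] show ?case by (simp add: algebra_simps)
qed

lemma H_pd:
 assumes ps: "hom n ps" and W: "!!i. i < N ==> H n' M' (%x t. \<zeta> i (W x t))" and M': "M' >= 0"
 shows "H (n - 1+n') (real n * nrm ps * M') (%x t. pd ps x (W x t) t)" using ps
proof (induction ps)
 case Nil then show ?case by (simp add: H_zero)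
next
 case (Cons p ps)
 obtain w c where p: "p = (w, c)" by (cases p)
 have "H (n - 1+n') (real n * nm c * M'+real n * nrm ps * M')
   (%x t. dmono w x (W x t) * c t+pd ps x (W x t) t)" using Cons p H_dmono[OF _ _ W M', of w c] by (intro H_add) auto
 then show ?case by (simp add: p algebra_simps)
qed

lemma norm_mon_le:
 assumes "!!i. i < N ==> norm (\<zeta> i x)<=rh" "set w \<subseteq> {..<N}"
 shows "norm (mon w x)<=rh ^ length w" using assms(2)
proof (induction w)
 case (Cons i w)
 have "norm (mon (i # w) x) = norm (\<zeta> i x) * norm (mon w x)" by (simp add: norm_mult)
 also have "...<=rh * rh ^ length w" using Cons assms(1)[of i] order_trans[OF norm_ge_zero assms(1)[of i]] by (intro mult_mono) auto
 finally show ?case by simp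
qed simp

lemma H_bound:
 assumes H: "H n M P" and x: "!!i. i < N ==> norm (\<zeta> i x)<=rh" and rh: "rh >= 0"
 shows "HSl (P x)" and "nm (P x)<=M * rh ^ n"
proof -
 obtain ps where ps: "hom n ps" "nrm ps<=M" "P = ev ps" using H unfolding H_def by auto
 have "HSl (ev ps x) & nm (ev ps x)<=nrm ps * rh ^ n" using ps(1)
 proof (induction ps)
  case Nil
  have "ev [] x = (%t. 0)" by (simp add: fun_eq_iff)
  then show ?case using HS_const(1)[of l 0] nm_const[of 0] by simp
 next
  case (Cons p ps)
  obtain w c where p: "p = (w, c)" by (cases p)
  have e: "ev (p # ps) x = (%t. mon w x * c t+ev ps x t)" by (simp add: p fun_eq_iff)
  have c: "HSl c" "length w = n" "set w \<subseteq> {..<N}" using Cons.prems p by auto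
  have "nm (%t. mon w x * c t)<=norm (mon w x) * nm c" by (rule nm_cmult[OF c(1)])
  also have "...<=rh ^ n * nm c" using norm_mon_le[OF x c(3)] c(2) by (intro mult_right_mono) auto
  finally have n: "nm (%t. mon w x * c t)<=rh ^ n * nm c" .
  have IH: "HSl (ev ps x)" "nm (ev ps x)<=nrm ps * rh ^ n" using Cons p by auto
  have "nm (%t. mon w x * c t+ev ps x t)<=rh ^ n * nm c+nrm ps * rh ^ n"
   using nm_add[OF HS_cmult(1)[OF c(1), of "mon w x"] IH(1)] n IH(2) by linarith
  then show ?case unfolding e using HS_add(1)[OF HS_cmult(1)[OF c(1), of "mon w x"] IH(1)] by (simp add: p algebra_simps)
 qed
 moreover have "nrm ps * rh ^ n<=M * rh ^ n" using ps(2) rh by (intro mult_right_mono) auto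
 ultimately show "HSl (P x)" and "nm (P x)<=M * rh ^ n" using ps(3) by auto
qed

lemma bounded_linear_\<zeta>: "bounded_linear (\<zeta> i)" using lin by (simp add: linear_conv_bounded_linear)

lemma mon_has_vector_derivative:
 assumes "(u has_vector_derivative u') (at t)"
 shows "((%s. mon w (u s)) has_vector_derivative dmono w (u t) u') (at t)"
proof (induction w)
 case (Cons i w)
 have "((%s. \<zeta> i (u s)) has_vector_derivative \<zeta> i u') (at t)"
  by (rule bounded_linear.has_vector_derivative[OF bounded_linear_\<zeta> assms])
 from has_vector_derivative_mult[OF this Cons] show ?case by (simp add: algebra_simps)
qed simp

lemma ev_has_vector_derivative:
 assumes u: "(u has_vector_derivative u') (at t)" and ps: "!!w c. (w, c) \<in> set ps ==> HS T (Suc l) c"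
 shows "((%s. ev ps (u s) s) has_vector_derivative pd ps (u t) u' t+et ps (u t) t) (at t)" using ps
proof (induction ps)
 case (Cons p ps)
 obtain w c where p: "p = (w, c)" by (cases p)
 have "((%s. mon w (u s) * c s) has_vector_derivative mon w (u t) * dert c t+dmono w (u t) u' * c t) (at t)"
  using Cons.prems p by (intro has_vector_derivative_mult mon_has_vector_derivative u dert(2)[OF l]) auto
 moreover have "((%s. ev ps (u s) s) has_vector_derivative pd ps (u t) u' t+et ps (u t) t) (at t)" by (rule Cons.IH) (use Cons.prems in auto)
 ultimately have "((%s. mon w (u s) * c s+ev ps (u s) s) has_vector_derivative
  (mon w (u t) * dert c t+dmono w (u t) u' * c t)+(pd ps (u t) u' t+et ps (u t) t)) (at t)" by (rule has_vector_derivative_add)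
 then show ?case by (simp add: p algebra_simps)
qed simp

lemma linear_dmono: "linear (dmono w x)"
proof (induction w)
 case (Cons i w)
 then show ?case using lin[of i] by (auto simp: linear_iff algebra_simps scaleR_conv_of_real)
qed (simp add: linear_iff)

lemma linear_pd: "linear (%y. pd ps x y t)"
proof (induction ps)
 case (Cons p ps)
 obtain w c where p: "p = (w, c)" by (cases p)
 show ?case using Cons linear_dmono[of w x] by (auto simp: p linear_iff algebra_simps scaleR_conv_of_real)
qed (simp add: linear_iff)

end

section \<open>Coordinates, eigenfunctionals and the resolvent\<close>

lemma linear_component:
 fixes F :: "real ^ 'm => real ^ 'm"
 assumes "linear F"
 shows "vn (F v) a = (\<Sum>c\<in>UNIV. vn (F (axis c 1)) a * vn v c)"
proof -
 have "F v = F (\<Sum>c\<in>UNIV. vn v c *\<^sub>R axis c 1)" using basis_expansion[of v] by (simp add: scalar_mult_eq_scaleR)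
 also have "... = (\<Sum>c\<in>UNIV. vn v c *\<^sub>R F (axis c 1))" using assms by (simp add: linear_sum linear_scale)
 finally show ?thesis by (simp add: mult.commute)
qed

context
 fixes E :: "(real ^ 'm) set" and bs :: "(real ^ 'm) list"
 assumes bs: "basis_list E bs"
begin

lemma basis_list_mem: "i < length bs ==> bs ! i \<in> E" using bs span_base[of "bs ! i" "set bs"] by (auto simp: basis_list_def)

lemma coord_add: "u \<in> E ==> v \<in> E ==> coord bs (u+v) i = coord bs u i+coord bs v i"
 using bs by (auto simp: basis_list_def coord_def real_vector.representation_add)

lemma coord_scale: "u \<in> E ==> coord bs (c *\<^sub>R u) i = c * coord bs u i"
 using bs by (auto simp: basis_list_def coord_def real_vector.representation_scale)

lemma coord_sum:
 assumes "!!k. k \<in> A ==> v k \<in> E"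
 shows "coord bs (\<Sum>k\<in>A. c k *\<^sub>R v k) i = (\<Sum>k\<in>A. c k * coord bs (v k) i)"
proof -
 have E: "subspace E" using bs by (auto simp: basis_list_def)
 show ?thesis using assms
 proof (induction A rule: infinite_finite_induct)
  case (insert k A)
  then have "(\<Sum>k\<in>A. c k *\<^sub>R v k) \<in> E" "c k *\<^sub>R v k \<in> E" using E by (auto intro!: subspace_sum subspace_scale)
  then show ?case using insert by (simp add: coord_add coord_scale)
 qed (use bs in \<open>auto simp: coord_def real_vector.representation_zero\<close>)
qed

lemma coord_expand:
 assumes "u \<in> E" shows "u = (\<Sum>i<length bs. coord bs u i *\<^sub>R bs ! i)"
proof -
 have "u = (\<Sum>b\<in>set bs. representation (set bs) u b *\<^sub>R b)"
  using real_vector.sum_representation_eq[of "set bs" u "set bs"] bs assms by (auto simp: basis_list_def)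
 also have "... = (\<Sum>i<length bs. representation (set bs) u (bs ! i) *\<^sub>R bs ! i)"
  using bs sum.reindex_bij_betw[OF bij_betw_nth[of bs "{..<length bs}" "set bs"], of "%b. representation (set bs) u b *\<^sub>R b"]
  by (simp add: basis_list_def)
 finally show ?thesis by (simp add: coord_def)
qed

lemma coord_basis: "i < length bs ==> j < length bs ==> coord bs (bs ! j) i = (if i = j then 1 else 0)"
 using bs by (auto simp: basis_list_def coord_def real_vector.representation_basis nth_eq_iff_index_eq)

lemma length_basis_list: "length bs = dim E" using bs dim_span_eq_card_independent[of "set bs"] by (auto simp: basis_list_def distinct_card)

lemma coord_linear_map:
 assumes "linear F" "F ` E \<subseteq> E'" "basis_list E' bs'" "u \<in> E"
 shows "coord bs' (F u) i = (\<Sum>j<length bs. coord bs' (F (bs ! j)) i * coord bs u j)"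
proof -
 have "F u = (\<Sum>j<length bs. coord bs u j *\<^sub>R F (bs ! j))"
  by (subst coord_expand[OF assms(4)]) (use assms(1) in \<open>simp add: linear_sum linear_scale\<close>)
 then show ?thesis using Submission.coord_sum[OF assms(3), of "{..<length bs}" "%j. F (bs ! j)" "coord bs u" i]
   assms(2) basis_list_mem by (auto simp: mult.commute)
qed

end

lemma linear_coord_proj:
 assumes "basis_list E bs" "linear P" "!!u. P u \<in> E"
 shows "linear (%u. coord bs (P u) i)" using assms by (auto simp: linear_iff coord_add coord_scale)

lemma mat_mult_mat:
 "Matrix.mat n n f * Matrix.mat n n g = Matrix.mat n n (%(i, j). \<Sum>k<n. f (i, k)*(g (k, j) :: complex))"
 by (intro eq_matI) (auto simp: scalar_prod_def lessThan_atLeast0)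

lemma mult_mat_index:
 assumes "A \<in> carrier_mat n n" "B \<in> carrier_mat n n" "i < n" "j < n"
 shows "(A * B) $$ (i, j) = (\<Sum>k<n. A $$ (i, k) * B $$ (k, j))" using assms by (auto simp: scalar_prod_def lessThan_atLeast0 intro!: sum.cong)

lemma complex_matrix_carrier: "complex_matrix L bs \<in> carrier_mat (length bs) (length bs)" by (simp add: complex_matrix_def)

lemma similar_complex_matrix:
 assumes b: "basis_list E bs" and b': "basis_list E bs'" and L: "linear L" "L ` E \<subseteq> E"
 shows "similar_mat (complex_matrix L bs') (complex_matrix L bs)"
proof -
 define n where "n = length bs"
 have n': "length bs' = n" unfolding n_def using b b' by (simp add: length_basis_list)
 define S where "S = Matrix.mat n n (%(i, j). cor (coord bs' (bs ! j) i))"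
 define S' where "S' = Matrix.mat n n (%(i, j). cor (coord bs (bs' ! j) i))"
 have id: "linear (%u::real^'m. u)" by (simp add: linear_iff)
 have m: "bs ! j \<in> E" "bs' ! j \<in> E" if "j < n" for j using basis_list_mem[OF b] basis_list_mem[OF b'] that n' n_def by auto
 show ?thesis
 proof (rule similar_matI)
  show "{complex_matrix L bs', complex_matrix L bs, S, S'} \<subseteq> carrier_mat n n"
   using complex_matrix_carrier[of L bs] complex_matrix_carrier[of L bs'] n' n_def by (auto simp: S_def S'_def)
  have ch1: "(\<Sum>k<n. coord bs' (bs ! k) i * coord bs u k) = coord bs' u i" if "u \<in> E" for u i
   using coord_linear_map[OF b id _ b' that, of i] n_def by auto
  have ch2: "(\<Sum>k<n. coord bs (bs' ! k) i * coord bs' u k) = coord bs u i" if "u \<in> E" for u i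
   using coord_linear_map[OF b' id _ b that, of i] n' by auto
  show "S * S' = 1\<^sub>m n" unfolding S_def S'_def mat_mult_mat
   using m n' by (intro eq_matI) (auto simp: ch1 coord_basis[OF b'] simp flip: of_real_mult of_real_sum)
  show "S' * S = 1\<^sub>m n" unfolding S_def S'_def mat_mult_mat
   using m by (intro eq_matI) (auto simp: ch2 coord_basis[OF b, folded n_def] simp flip: of_real_mult of_real_sum)
  have LE: "L (bs ! k) \<in> E" if "k < n" for k using L m that by auto
  have "S * complex_matrix L bs = Matrix.mat n n (%(i, j). cor (coord bs' (L (bs ! j)) i))"
   unfolding S_def complex_matrix_def n_def[symmetric] mat_mult_mat by (intro eq_matI) (auto simp: ch1 LE simp flip: of_real_mult of_real_sum)
  then have "S * complex_matrix L bs * S' = Matrix.mat n n (%(i, j). cor (coord bs' (L (bs' ! j)) i))" unfolding S'_def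
   using coord_linear_map[OF b L(1,2) b'] m n_def by (auto simp: mat_mult_mat simp flip: of_real_mult of_real_sum intro!: eq_matI)
  then show "complex_matrix L bs' = S * complex_matrix L bs * S'" by (simp add: complex_matrix_def n')
 qed
qed

lemma char_poly_root_eigenvalue:
 assumes ev: "eigenvalues_on E L n ev" and b: "basis_list E bs" and L: "linear L" "L ` E \<subseteq> E"
 shows "poly (char_poly (complex_matrix L bs)) z = 0 \<longleftrightarrow> z \<in> ev ` {..<n}"
proof -
 obtain bs' where b': "basis_list E bs'" and c: "char_poly (complex_matrix L bs') = (\<Prod>i<n. [:- ev i, 1:])"
  using ev by (auto simp: eigenvalues_on_def)
 have "char_poly (complex_matrix L bs) = (\<Prod>i<n. [:- ev i, 1:])" using char_poly_similar[OF similar_complex_matrix[OF b b' L]] c by simp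
 then show ?thesis by (auto simp: poly_prod)
qed

lemma cnj_root_complex_matrix:
 assumes "poly (char_poly (complex_matrix L bs)) z = 0"
 shows "poly (char_poly (complex_matrix L bs)) (cnj z) = 0"
proof -
 define R where "R = Matrix.mat (length bs) (length bs) (%(i, j). coord bs (L (bs ! j)) i)"
 have "complex_matrix L bs = map_mat cor R" by (auto simp: complex_matrix_def R_def intro!: eq_matI)
 then have c: "char_poly (complex_matrix L bs) = map_poly of_real (char_poly R)"
  using of_real_hom.char_poly_hom[of R "length bs"] by (simp add: R_def)
 have "poly (map_poly of_real p) (cnj w) = cnj (poly (map_poly of_real p) w)" for p :: "real poly" and w by (induction p) (auto simp: map_poly_pCons)
 then show ?thesis using assms c by simp
qed

lemma poly_prod_list_root:
 fixes a :: complex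
 shows "a \<in> set as ==> poly (\<Prod>a\<leftarrow>as. [:- a, 1:]) a = 0" by (induction as) auto

lemma poly_prod_list_power_root:
 fixes a :: complex
 shows "(m, a) \<in> set n_as ==> m > 0 ==> poly (\<Prod>(n, a)\<leftarrow>n_as. [:- a, 1:] ^ n) a = 0" by (induction n_as) auto

lemma eigen_functionals:
 fixes L P0 :: "real ^ 'm => real ^ 'm"
 assumes diag: "diagonalizable_on E L" and ev: "eigenvalues_on E L n ev" and L: "linear L" "L ` E \<subseteq> E"
  and P0: "linear P0" "!!u. P0 u \<in> E" "!!u. u \<in> E ==> P0 u = u" "!!u. P0 (L u) = L (P0 u)"
 obtains N :: nat and z :: "nat => real ^ 'm => complex" and \<mu> :: "nat => complex" and e :: "nat => 'm => complex"
  where "!!i. linear (z i)" "!!i u. z i (P0 u) = z i u"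
  "!!i u. i < N ==> z i (L u) = \<mu> i * z i u"
  "!!u a. cor (vn (P0 u) a) = (\<Sum>i<N. z i u * e i a)"
  "!!i. i < N ==> \<mu> i \<in> ev ` {..<n} & cnj (\<mu> i) \<in> ev ` {..<n}"
proof -
 obtain bs D where b: "basis_list E bs" and D: "diagonal_mat D" and sim: "similar_mat (complex_matrix L bs) D"
  using diag by (auto simp: diagonalizable_on_def)
 define A where "A = complex_matrix L bs"
 define k where "k = length bs"
 have Ac: "A \<in> carrier_mat k k" by (simp add: A_def k_def complex_matrix_carrier)
 obtain P Q where w: "similar_mat_wit A D P Q" using sim by (auto simp: A_def similar_mat_def)
 note wit = similar_mat_witD2[OF Ac w]
 define z where "z i u = (\<Sum>j<k. Q $$ (i, j) * of_real (coord bs (P0 u) j))" for i u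
 define e where "e i a = (\<Sum>j<k. P $$ (j, i) * of_real (vn (bs ! j) a))" for i a
 have PP: "P0 (P0 u) = P0 u" for u by (simp add: P0)
 show thesis
 proof (rule that[of z k "%i. D $$ (i, i)" e])
  show "linear (z i)" for i using linear_coord_proj[OF b P0(1,2)] unfolding z_def linear_iff
   by (auto simp: algebra_simps sum.distrib scaleR_sum_right scaleR_conv_of_real sum_distrib_left)
  show "z i (P0 u) = z i u" for i u by (simp add: z_def PP)
  have QA: "Q * A = D * Q"
  proof -
   have "Q * A = Q*(P*(D * Q))" using wit by (simp add: assoc_mult_mat[of P k k D k Q k])
   also have "... = (Q * P)*(D * Q)" using wit by (intro assoc_mult_mat[symmetric]) auto
   finally show ?thesis using wit by simp
  qed
  have QAi: "(\<Sum>j<k. Q $$ (i, j) * A $$ (j, m)) = D $$ (i, i) * Q $$ (i, m)" if "i < k" "m < k" for i m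
  proof -
   have "(\<Sum>j<k. Q $$ (i, j) * A $$ (j, m)) = (Q * A) $$ (i, m)" by (rule mult_mat_index[OF wit(7) Ac that, symmetric])
   also have "... = (D * Q) $$ (i, m)" by (simp only: QA)
   also have "... = (\<Sum>j<k. D $$ (i, j) * Q $$ (j, m))" by (rule mult_mat_index[OF wit(5) wit(7) that])
   also have "... = (\<Sum>j<k. if j = i then D $$ (i, i) * Q $$ (i, m) else 0)" using D wit that by (intro sum.cong) (auto simp: diagonal_mat_def)
   finally show ?thesis using that by simp
  qed
  show "z i (L u) = D $$ (i, i) * z i u" if i: "i < k" for i u
  proof -
   have "z i (L u) = (\<Sum>j<k. Q $$ (i, j)*(\<Sum>m<k. A $$ (j, m) * of_real (coord bs (P0 u) m)))" unfolding z_def P0(4)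
    by (intro sum.cong refl, subst coord_linear_map[OF b L b P0(2)])
     (auto simp: A_def complex_matrix_def k_def)
   also have "... = (\<Sum>m<k. (\<Sum>j<k. Q $$ (i, j) * A $$ (j, m)) * of_real (coord bs (P0 u) m))"
    unfolding sum_distrib_left sum_distrib_right by (subst sum.swap) (simp add: mult.assoc)
   also have "... = (\<Sum>m<k. D $$ (i, i) * Q $$ (i, m) * of_real (coord bs (P0 u) m))" using QAi i by (intro sum.cong) auto
   finally show ?thesis by (simp add: z_def sum_distrib_left mult.assoc)
  qed
  show "cor (vn (P0 u) a) = (\<Sum>i<k. z i u * e i a)" for u a
  proof -
   have PQ: "(\<Sum>i<k. P $$ (j, i) * Q $$ (i, m)) = (if j = m then 1 else 0)" if "j < k" "m < k" for j m
    using mult_mat_index[of P k Q j m] wit that by simp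
   have "(\<Sum>i<k. z i u * e i a) = (\<Sum>i<k. \<Sum>j<k. \<Sum>m<k. P $$ (j, i) * Q $$ (i, m) * of_real (coord bs (P0 u) m) * of_real (vn (bs ! j) a))"
    unfolding z_def e_def sum_distrib_left sum_distrib_right by (simp add: mult_ac)
   also have "... = (\<Sum>j<k. \<Sum>m<k. \<Sum>i<k. P $$ (j, i) * Q $$ (i, m) * of_real (coord bs (P0 u) m) * of_real (vn (bs ! j) a))"
    by (subst sum.swap) (rule sum.cong[OF refl], rule sum.swap)
   also have "... = (\<Sum>m<k. \<Sum>j<k. \<Sum>i<k. P $$ (j, i) * Q $$ (i, m) * of_real (coord bs (P0 u) m) * of_real (vn (bs ! j) a))"
    by (rule sum.swap)
   also have "... = (\<Sum>m<k. \<Sum>j<k. if j = m then of_real (coord bs (P0 u) m) * of_real (vn (bs ! j) a) else 0)"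
    by (intro sum.cong refl) (use PQ in \<open>auto simp flip: sum_distrib_right\<close>)
   also have "... = (\<Sum>m<k. of_real (coord bs (P0 u) m) * of_real (vn (bs ! m) a))" by simp
   also have "... = of_real (vn (\<Sum>m<k. coord bs (P0 u) m *\<^sub>R bs ! m) a)" by simp
   also have "(\<Sum>m<k. coord bs (P0 u) m *\<^sub>R bs ! m) = P0 u" using coord_expand[OF b P0(2)] k_def by simp
   finally show ?thesis by simp
  qed
  show "D $$ (i, i) \<in> ev ` {..<n} & cnj (D $$ (i, i)) \<in> ev ` {..<n}" if i: "i < k" for i
  proof -
   have "upper_triangular D" using D wit by (auto simp: diagonal_mat_def)
   then have "char_poly D = (\<Prod>a\<leftarrow>diag_mat D. [:- a, 1:])" using char_poly_upper_triangular[of D k] wit by auto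
   moreover have "char_poly A = char_poly D" using char_poly_similar sim A_def by blast
   moreover have "D $$ (i, i) \<in> set (diag_mat D)" using wit i by (auto simp: diag_mat_def)
   ultimately have "poly (char_poly A) (D $$ (i, i)) = 0" by (simp add: poly_prod_list_root)
   then show ?thesis using cnj_root_complex_matrix[of L bs] char_poly_root_eigenvalue[OF ev b L] by (auto simp: A_def)
  qed
 qed
qed

lemma jordan_block_inverse:
 fixes z a :: complex
 assumes "z ~= a" "i < n" "j < n"
 defines "X \<equiv> %i j. if i<=j then (1 / (z - a)) ^ (j - i+1) else 0"
 shows "z * X i j - (\<Sum>k<n. jordan_block n a $$ (i, k) * X k j) = (if i = j then 1 else 0)"
proof -
 have "(\<Sum>k<n. jordan_block n a $$ (i, k) * X k j)
   = (\<Sum>k<n. (if k = i then a * X i j else 0)+(if k = Suc i then X (Suc i) j else 0))" using assms by (intro sum.cong) auto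
 also have "... = a * X i j+(if Suc i < n then X (Suc i) j else 0)" using assms by (simp add: sum.distrib)
 finally have s: "z * X i j - (\<Sum>k<n. jordan_block n a $$ (i, k) * X k j)
   = (z - a) * X i j - (if Suc i < n then X (Suc i) j else 0)" by (simp add: algebra_simps)
 consider "i = j" | "i < j" | "j < i" by linarith
 then show ?thesis
 proof cases
  case 1 then show ?thesis unfolding s using assms(1) by (simp add: X_def)
 next
  case 2
  then have "j - i = Suc (j - Suc i)" "Suc i < n" "Suc i<=j" using assms by auto
  then show ?thesis unfolding s using assms(1) 2 by (simp add: X_def)
 next
  case 3 then show ?thesis unfolding s by (simp add: X_def)
 qed
qed

lemma jordan_matrix_inverse:
 fixes z :: complex
 assumes "!!n a. (n, a) \<in> set n_as ==> n<=\<nu> & (n > 0 --> norm (z - a) >= d)" "d > 0"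
  and B: "!!k. 1<=k ==> k<=\<nu> ==> (1 / d) ^ k<=B" "B >= 0"
 shows "EX X. ALL i<sum_list (map fst n_as). ALL j<sum_list (map fst n_as).
  z * X i j - (\<Sum>k<sum_list (map fst n_as). jordan_matrix n_as $$ (i, k) * X k j) = (if i = j then 1 else 0)
  & norm (X i j)<=B" using assms(1)
proof (induction n_as)
 case Nil then show ?case by simp
next
 case (Cons p n_as)
 obtain n a where p: "p = (n, a)" by (cases p)
 define s where "s = sum_list (map fst n_as)"
 obtain X where X: "!!i j. i < s ==> j < s ==>
  z * X i j - (\<Sum>k<s. jordan_matrix n_as $$ (i, k) * X k j) = (if i = j then 1 else 0) & norm (X i j)<=B"
 proof -
  have "EX X. ALL i<s. ALL j<s. z * X i j - (\<Sum>k<s. jordan_matrix n_as $$ (i, k) * X k j) = (if i = j then 1 else 0) & norm (X i j)<=B"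
   unfolding s_def by (rule Cons.IH) (use Cons.prems in auto)
  then show ?thesis using that by blast
 qed
 define Y where "Y i j = (if i<=j then (1 / (z - a)) ^ (j - i+1) else 0)" for i j :: nat
 define W where "W i j = (if i < n then if j < n then Y i j else 0 else if j < n then 0 else X (i - n) (j - n))" for i j
 define J where "J = jordan_matrix (p # n_as)"
 have J: "J $$ (i, j) = (if i < n then if j < n then jordan_block n a $$ (i, j) else 0
   else if j < n then 0 else jordan_matrix n_as $$ (i - n, j - n))" if "i < n+s" "j < n+s" for i j
  using that unfolding J_def p jordan_matrix_Cons s_def by (subst index_mat_four_block) auto
 have split: "(\<Sum>k<n+s. f k) = (\<Sum>k<n. f k)+(\<Sum>k<s. f (n+k))" for f :: "nat => complex"
 proof -
  have "sum f {..<n+s} = sum f {..<n}+sum f {n..<n+s}" by (simp add: lessThan_atLeast0 sum.atLeastLessThan_concat)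
  also have "sum f {n..<n+s} = (\<Sum>k<s. f (n+k))" using sum.shift_bounds_nat_ivl[of f 0 n s] by (simp add: lessThan_atLeast0 add.commute)
  finally show ?thesis .
 qed
 have za: "n<=\<nu> & (n > 0 --> norm (z - a) >= d)" using Cons.prems[of n a] p by simp
 have main: "z * W i j - (\<Sum>k<n+s. J $$ (i, k) * W k j) = (if i = j then 1 else 0) & norm (W i j)<=B"
  if i: "i < n+s" and j: "j < n+s" for i j
 proof (cases "i < n")
  case True
  have e: "(\<Sum>k<n+s. J $$ (i, k) * W k j) = (\<Sum>k<n. jordan_block n a $$ (i, k) * W k j)" unfolding split using i True by (simp add: J)
  have zn: "z ~= a" using za True assms(2) by force
  show ?thesis
  proof (cases "j < n")
   case j: True
   have "z * Y i j - (\<Sum>k<n. jordan_block n a $$ (i, k) * Y k j) = (if i = j then 1 else 0)"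
    unfolding Y_def by (rule jordan_block_inverse[OF zn True j])
   moreover have "norm (Y i j)<=B"
   proof (cases "i<=j")
    case ij: True
    have "norm (Y i j) = (1 / norm (z - a)) ^ (j - i+1)" using ij by (simp add: Y_def norm_power norm_divide)
    also have "...<=(1 / d) ^ (j - i+1)" using za True assms(2) by (intro power_mono frac_le) auto
    also have "...<=B" using za j by (intro B) auto
    finally show ?thesis .
   qed (simp add: Y_def B)
   ultimately show ?thesis using True j unfolding e by (simp add: W_def)
  next
   case False
   then show ?thesis using True B unfolding e by (simp add: W_def)
  qed
 next
  case False
  have e: "(\<Sum>k<n+s. J $$ (i, k) * W k j) = (\<Sum>k<s. jordan_matrix n_as $$ (i - n, k) * W (n+k) j)"
   unfolding split using i False by (simp add: J)
  show ?thesis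
  proof (cases "j < n")
   case True
   then show ?thesis using False B unfolding e by (simp add: W_def)
  next
   case j': False
   have "i - n < s" "j - n < s" using False j' i j by auto
   from X[OF this] show ?thesis using False j' unfolding e by (auto simp: W_def)
  qed
 qed
 have sz: "sum_list (map fst (p # n_as)) = n+s" by (simp add: p s_def)
 show ?case unfolding sz J_def[symmetric] using main by blast
qed

lemma jordan_nf_resolvent:
 fixes A :: "complex Matrix.mat"
 assumes A: "A \<in> carrier_mat n n" and jnf: "jordan_nf A n_as"
 shows "EX K>=0. ALL z d B. d > 0 --> B >= 0 -->
  (ALL a. poly (char_poly A) a = 0 --> norm (z - a) >= d) -->
  (ALL k. 1<=k --> k<=Max (insert 0 (fst ` set n_as)) --> (1 / d) ^ k<=B) -->
  (EX Y. ALL i<n. ALL j<n. (\<Sum>k<n. A $$ (i, k) * Y k j) = z * Y i j - (if i = j then 1 else 0) & norm (Y i j)<=K * B)"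
proof -
 define J where "J = jordan_matrix n_as"
 obtain P Q where w: "similar_mat_wit A J P Q" using jnf by (auto simp: jordan_nf_def J_def similar_mat_def)
 note wit = similar_mat_witD2[OF A w]
 have s: "sum_list (map fst n_as) = n" using wit(5) unfolding J_def by (metis carrier_matD(1) jordan_matrix_dim(1))
 have cp: "char_poly A = (\<Prod>(n, a)\<leftarrow>n_as. [:- a, 1:] ^ n)" using jordan_nf_char_poly[OF jnf] .
 define K where "K = (\<Sum>i<n. \<Sum>j<n. \<Sum>k<n. \<Sum>m<n. norm (P $$ (i, k)) * norm (Q $$ (m, j)))"
 have K: "K >= 0" unfolding K_def by (intro sum_nonneg) auto
 show ?thesis
 proof (intro exI[of _ K] conjI allI impI K)
  fix z :: complex and d B :: real
  assume d: "d > 0" and B: "B >= 0" and za: "ALL a. poly (char_poly A) a = 0 --> norm (z - a) >= d"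
   and Bk: "ALL k. 1<=k --> k<=Max (insert 0 (fst ` set n_as)) --> (1 / d) ^ k<=B"
  have blk: "m<=Max (insert 0 (fst ` set n_as)) & (m > 0 --> norm (z - a) >= d)" if ma: "(m, a) \<in> set n_as" for m a
  proof
   show "m<=Max (insert 0 (fst ` set n_as))" using ma by (intro Max_ge) (auto intro: rev_image_eqI)
   show "m > 0 --> norm (z - a) >= d"
   proof
    assume "m > 0"
    with ma have "poly (char_poly A) a = 0" unfolding cp by (rule poly_prod_list_power_root)
    then show "norm (z - a) >= d" using za by blast
   qed
  qed
  have "EX X. ALL i<sum_list (map fst n_as). ALL j<sum_list (map fst n_as).
    z * X i j - (\<Sum>k<sum_list (map fst n_as). jordan_matrix n_as $$ (i, k) * X k j) = (if i = j then 1 else 0)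
    & norm (X i j)<=B" by (rule jordan_matrix_inverse[OF blk d _ B]) (use Bk in auto)
  then obtain X where
   X: "!!i j. i < n ==> j < n ==> z * X i j - (\<Sum>k<n. J $$ (i, k) * X k j) = (if i = j then 1 else 0) & norm (X i j)<=B"
   unfolding s J_def[symmetric] by blast
  define M where "M = Matrix.mat n n (%(i, j). X i j)"
  define Y where "Y = P * M * Q"
  have Mc: "M \<in> carrier_mat n n" by (simp add: M_def)
  have Yc: "Y \<in> carrier_mat n n" using wit Mc by (simp add: Y_def)
  have JM: "J * M = z \<cdot>\<^sub>m M+- 1\<^sub>m n"
  proof (rule eq_matI)
   fix i j assume "i < dim_row (z \<cdot>\<^sub>m M+- 1\<^sub>m n)" "j < dim_col (z \<cdot>\<^sub>m M+- 1\<^sub>m n)"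
   then have ij: "i < n" "j < n" using Mc by auto
   have "(J * M) $$ (i, j) = (\<Sum>k<n. J $$ (i, k) * X k j)" using mult_mat_index[OF wit(5) Mc ij] ij by (simp add: M_def)
   also have "... = z * X i j - (if i = j then 1 else 0)" using X[OF ij] by (simp add: algebra_simps)
   finally show "(J * M) $$ (i, j) = (z \<cdot>\<^sub>m M+- 1\<^sub>m n) $$ (i, j)" using ij by (simp add: M_def)
  qed (use wit Mc in auto)
  have "Q*(P*(M * Q)) = (Q * P)*(M * Q)" using wit(6,7) Mc by (intro assoc_mult_mat[symmetric]) auto
  then have QP: "Q*(P*(M * Q)) = M * Q" using wit Mc by simp
  have "A * Y = P*(J * M) * Q" unfolding Y_def wit(3) using wit(5-7) Mc by (simp add: assoc_mult_mat[of _ n n _ n _ n] QP)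
  also have "... = P*(z \<cdot>\<^sub>m M) * Q+P*(- 1\<^sub>m n) * Q"
   unfolding JM using wit Mc by (simp add: mult_add_distrib_mat[of _ n n _ n] add_mult_distrib_mat[of _ n n _ _ n])
  also have "P*(z \<cdot>\<^sub>m M) * Q = z \<cdot>\<^sub>m Y"
   unfolding Y_def using wit Mc by (simp add: mult_smult_distrib[of _ n n _ n] mult_smult_assoc_mat[of _ n n _ n])
  also have "P*(- 1\<^sub>m n) * Q = - 1\<^sub>m n" using wit by simp
  finally have AY: "A * Y = z \<cdot>\<^sub>m Y+- 1\<^sub>m n" .
  show "EX Y. ALL i<n. ALL j<n. (\<Sum>k<n. A $$ (i, k) * Y k j) = z * Y i j - (if i = j then 1 else 0) & norm (Y i j)<=K * B"
  proof (intro exI[of _ "%i j. Y $$ (i, j)"] allI impI conjI)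
   fix i j assume ij: "i < n" "j < n"
   show "(\<Sum>k<n. A $$ (i, k) * Y $$ (k, j)) = z * Y $$ (i, j) - (if i = j then 1 else 0)" using mult_mat_index[OF A Yc ij] AY ij Yc by simp
   have "Y $$ (i, j) = (\<Sum>m<n. (\<Sum>k<n. P $$ (i, k) * X k m) * Q $$ (m, j))"
    unfolding Y_def using mult_mat_index[of "P * M" n Q i j] mult_mat_index[of P n M i] wit Mc ij by (auto simp: M_def intro!: sum.cong)
   also have "norm ...<=(\<Sum>m<n. \<Sum>k<n. norm (P $$ (i, k)) * norm (Q $$ (m, j)) * B)"
   proof (intro sum_norm_le)
    fix m assume m: "m \<in> {..<n}"
    have "norm ((\<Sum>k<n. P $$ (i, k) * X k m) * Q $$ (m, j))<=(\<Sum>k<n. norm (P $$ (i, k)) * B) * norm (Q $$ (m, j))" unfolding norm_mult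
     by (intro mult_right_mono sum_norm_le) (use X m in \<open>auto simp: norm_mult intro!: mult_left_mono\<close>)
    also have "... = (\<Sum>k<n. norm (P $$ (i, k)) * norm (Q $$ (m, j)) * B)"
     unfolding sum_distrib_right by (intro sum.cong refl) (simp add: mult_ac)
    finally show "norm ((\<Sum>k<n. P $$ (i, k) * X k m) * Q $$ (m, j))<=(\<Sum>k<n. norm (P $$ (i, k)) * norm (Q $$ (m, j)) * B)" .
   qed
   also have "... = (\<Sum>k<n. \<Sum>m<n. norm (P $$ (i, k)) * norm (Q $$ (m, j))) * B" by (subst sum.swap) (simp add: sum_distrib_right)
   also have "...<=K * B"
   proof (rule mult_right_mono[OF _ B])
    have "(\<Sum>k<n. \<Sum>m<n. norm (P $$ (i, k)) * norm (Q $$ (m, j)))<=(\<Sum>j<n. \<Sum>k<n. \<Sum>m<n. norm (P $$ (i, k)) * norm (Q $$ (m, j)))"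
     using ij by (intro member_le_sum[of j "{..<n}" "%j. \<Sum>k<n. \<Sum>m<n. norm (P $$ (i, k)) * norm (Q $$ (m, j))"]) (auto intro!: sum_nonneg)
    also have "...<=K" unfolding K_def
     using ij by (intro member_le_sum[of i "{..<n}" "%i. \<Sum>j<n. \<Sum>k<n. \<Sum>m<n. norm (P $$ (i, k)) * norm (Q $$ (m, j))"]) (auto intro!: sum_nonneg)
    finally show "(\<Sum>k<n. \<Sum>m<n. norm (P $$ (i, k)) * norm (Q $$ (m, j)))<=K" .
   qed
   finally show "norm (Y $$ (i, j))<=K * B" .
  qed
 qed
qed

abbreviation mtx :: "(real ^ 'm => real ^ 'm) => 'm => 'm => complex" where
 "mtx F a c \<equiv> cor (vn (F (axis c 1)) a)"

lemma mtx_apply: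
 "linear F ==> cor (vn (F v) a) = (\<Sum>c\<in>UNIV. mtx F a c * cor (vn v c))" by (subst linear_component) auto

lemma resolvent_exists:
 fixes L P1 :: "real ^ 'm => real ^ 'm"
 assumes jb: "max_jordan_block_size E L \<nu>" and ev: "eigenvalues_on E L n ev" and L: "linear L" "L ` E \<subseteq> E"
  and P1: "linear P1" "!!u. P1 u \<in> E" "!!u. u \<in> E ==> P1 u = u"
 shows "EX K>=0. ALL z d B. d > 0 --> B >= 0 --> (ALL j<n. norm (z - ev j) >= d) -->
  (ALL k. 1<=k --> k<=\<nu> --> (1 / d) ^ k<=B) -->
  (EX M. ALL a b. (\<Sum>c\<in>UNIV. mtx L a c * M c b) = z * M a b - mtx P1 a b &
    (\<Sum>c\<in>UNIV. mtx P1 a c * M c b) = M a b & norm (M a b)<=K * B)"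
proof -
 obtain bs n_as where b: "basis_list E bs" and jnf: "jordan_nf (complex_matrix L bs) n_as"
  and nu: "\<nu> = Max (insert 0 (fst ` set n_as))" using jb by (auto simp: max_jordan_block_size_def)
 define A where "A = complex_matrix L bs"
 define k where "k = length bs"
 have Ac: "A \<in> carrier_mat k k" by (simp add: A_def k_def complex_matrix_carrier)
 have jnf': "jordan_nf A n_as" using jnf by (simp add: A_def)
 obtain K where KR: "K >= 0 & (ALL z d B. d > 0 --> B >= 0 --> (ALL a. poly (char_poly A) a = 0 --> norm (z - a) >= d) -->
  (ALL k. 1<=k --> k<=\<nu> --> (1 / d) ^ k<=B) -->
  (EX Y. ALL i<k. ALL j<k. (\<Sum>m<k. A $$ (i, m) * Y m j) = z * Y i j - (if i = j then 1 else 0) & norm (Y i j)<=K * B))"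
  using jordan_nf_resolvent[OF Ac jnf', folded nu] by (elim exE) (rule that)
 have K: "K >= 0" using KR by simp
 note res = KR[THEN conjunct2, THEN spec, THEN spec, THEN spec, THEN mp, THEN mp, THEN mp, THEN mp]
 define \<beta> where "\<beta> i a = cor (vn (bs ! i) a)" for i a
 define ka where "ka j c = cor (coord bs (P1 (axis c 1)) j)" for j c
 define K' where "K' = K*(\<Sum>a\<in>UNIV. \<Sum>c\<in>UNIV. \<Sum>i<k. \<Sum>j<k. norm (\<beta> i a) * norm (ka j c))"
 have S0: "(\<Sum>a\<in>UNIV. \<Sum>c\<in>UNIV. \<Sum>i<k. \<Sum>j<k. norm (\<beta> i a) * norm (ka j c)) >= 0" by (intro sum_nonneg) auto
 have bE: "bs ! i \<in> E" if "i < k" for i using basis_list_mem[OF b] that k_def by auto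
 have Lb: "(\<Sum>c\<in>UNIV. mtx L a c * \<beta> i c) = (\<Sum>m<k. A $$ (m, i) * \<beta> m a)" if i: "i < k" for a i
 proof -
  have "(\<Sum>c\<in>UNIV. mtx L a c * \<beta> i c) = of_real (vn (L (bs ! i)) a)" using mtx_apply[OF L(1), of "bs ! i" a] by (simp add: \<beta>_def)
  also have "L (bs ! i) = (\<Sum>m<k. coord bs (L (bs ! i)) m *\<^sub>R bs ! m)"
   by (rule coord_expand[OF b, folded k_def]) (use L(2) bE[OF i] in auto)
  finally show ?thesis using i by (simp add: \<beta>_def A_def complex_matrix_def k_def)
 qed
 have P1b: "(\<Sum>c\<in>UNIV. mtx P1 a c * \<beta> i c) = \<beta> i a" if i: "i < k" for a i
  using mtx_apply[OF P1(1), of "bs ! i" a] P1(3)[OF bE[OF i]] by (simp add: \<beta>_def)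
 have P1e: "mtx P1 a c = (\<Sum>i<k. \<beta> i a * ka i c)" for a c
 proof -
  have "P1 (axis c 1) = (\<Sum>i<k. coord bs (P1 (axis c 1)) i *\<^sub>R bs ! i)" by (rule coord_expand[OF b P1(2), folded k_def])
  then have "mtx P1 a c = of_real (vn (\<Sum>i<k. coord bs (P1 (axis c 1)) i *\<^sub>R bs ! i) a)" by simp
  then show ?thesis by (simp add: \<beta>_def ka_def mult.commute)
 qed
 show ?thesis
 proof (intro exI[of _ K'] conjI allI impI)
  show "K' >= 0" using K S0 by (simp add: K'_def)
  fix z :: complex and d B :: real
  assume d: "d > 0" and B: "B >= 0" and zj: "ALL j<n. norm (z - ev j) >= d"
   and Bk: "ALL k. 1<=k --> k<=\<nu> --> (1 / d) ^ k<=B"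
  have "ALL a. poly (char_poly A) a = 0 --> norm (z - a) >= d" unfolding A_def char_poly_root_eigenvalue[OF ev b L] using zj by auto
  from res[OF d B this Bk] obtain Y where
   Y: "!!i j. i < k ==> j < k ==> (\<Sum>m<k. A $$ (i, m) * Y m j) = z * Y i j - (if i = j then 1 else 0)"
    "!!i j. i < k ==> j < k ==> norm (Y i j)<=K * B" by blast
  define M where "M a c = (\<Sum>i<k. \<Sum>j<k. \<beta> i a * Y i j * ka j c)" for a c
  show "EX M. ALL a b. (\<Sum>c\<in>UNIV. mtx L a c * M c b) = z * M a b - mtx P1 a b &
    (\<Sum>c\<in>UNIV. mtx P1 a c * M c b) = M a b & norm (M a b)<=K' * B"
  proof (intro exI[of _ M] allI conjI)
   fix a c
   have "(\<Sum>b\<in>UNIV. mtx L a b * M b c) = (\<Sum>b\<in>UNIV. \<Sum>i<k. \<Sum>j<k. mtx L a b * \<beta> i b * Y i j * ka j c)"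
    by (simp add: M_def sum_distrib_left mult.assoc)
   also have "... = (\<Sum>i<k. \<Sum>b\<in>UNIV. \<Sum>j<k. mtx L a b * \<beta> i b * Y i j * ka j c)" by (rule sum.swap)
   also have "... = (\<Sum>i<k. \<Sum>j<k. \<Sum>b\<in>UNIV. mtx L a b * \<beta> i b * Y i j * ka j c)" by (rule sum.cong[OF refl], rule sum.swap)
   also have "... = (\<Sum>i<k. \<Sum>j<k. (\<Sum>b\<in>UNIV. mtx L a b * \<beta> i b) * Y i j * ka j c)" by (simp add: sum_distrib_right)
   also have "... = (\<Sum>i<k. \<Sum>j<k. (\<Sum>m<k. A $$ (m, i) * \<beta> m a) * Y i j * ka j c)" by (intro sum.cong refl) (simp add: Lb)
   also have "... = (\<Sum>i<k. \<Sum>j<k. \<Sum>m<k. \<beta> m a*(A $$ (m, i) * Y i j) * ka j c)"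
    unfolding sum_distrib_right by (intro sum.cong refl) (simp add: mult_ac)
   also have "... = (\<Sum>j<k. \<Sum>i<k. \<Sum>m<k. \<beta> m a*(A $$ (m, i) * Y i j) * ka j c)" by (rule sum.swap)
   also have "... = (\<Sum>j<k. \<Sum>m<k. \<beta> m a*(\<Sum>i<k. A $$ (m, i) * Y i j) * ka j c)"
    unfolding sum_distrib_right sum_distrib_left by (rule sum.cong[OF refl], rule sum.swap)
   also have "... = (\<Sum>j<k. \<Sum>m<k. z*(\<beta> m a * Y m j * ka j c) - (if m = j then \<beta> m a * ka j c else 0))"
    by (intro sum.cong refl, subst Y(1)) (auto simp: algebra_simps)
   also have "... = z*(\<Sum>j<k. \<Sum>m<k. \<beta> m a * Y m j * ka j c) - (\<Sum>j<k. \<beta> j a * ka j c)"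
    by (simp add: sum_subtractf sum_distrib_left)
   also have "(\<Sum>j<k. \<Sum>m<k. \<beta> m a * Y m j * ka j c) = M a c" unfolding M_def by (rule sum.swap)
   finally show "(\<Sum>b\<in>UNIV. mtx L a b * M b c) = z * M a c - mtx P1 a c" by (simp add: P1e)
   have "(\<Sum>b\<in>UNIV. mtx P1 a b * M b c) = (\<Sum>b\<in>UNIV. \<Sum>i<k. \<Sum>j<k. mtx P1 a b * \<beta> i b * Y i j * ka j c)"
    by (simp add: M_def sum_distrib_left mult.assoc)
   also have "... = (\<Sum>i<k. \<Sum>b\<in>UNIV. \<Sum>j<k. mtx P1 a b * \<beta> i b * Y i j * ka j c)" by (rule sum.swap)
   also have "... = (\<Sum>i<k. \<Sum>j<k. \<Sum>b\<in>UNIV. mtx P1 a b * \<beta> i b * Y i j * ka j c)" by (rule sum.cong[OF refl], rule sum.swap)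
   also have "... = (\<Sum>i<k. \<Sum>j<k. (\<Sum>b\<in>UNIV. mtx P1 a b * \<beta> i b) * Y i j * ka j c)" by (simp add: sum_distrib_right)
   also have "... = M a c" unfolding M_def by (intro sum.cong refl) (simp add: P1b)
   finally show "(\<Sum>b\<in>UNIV. mtx P1 a b * M b c) = M a c" .
   have "norm (M a c)<=(\<Sum>i<k. \<Sum>j<k. norm (\<beta> i a) * norm (ka j c)*(K * B))" unfolding M_def
   proof (intro sum_norm_le)
    fix i j assume ij: "i \<in> {..<k}" "j \<in> {..<k}"
    have "norm (\<beta> i a * Y i j * ka j c) = (norm (\<beta> i a) * norm (ka j c)) * norm (Y i j)" by (simp add: norm_mult)
    also have "...<=(norm (\<beta> i a) * norm (ka j c))*(K * B)" using Y(2) ij by (intro mult_left_mono) auto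
    finally show "norm (\<beta> i a * Y i j * ka j c)<=norm (\<beta> i a) * norm (ka j c)*(K * B)" .
   qed
   also have "... = (\<Sum>i<k. \<Sum>j<k. norm (\<beta> i a) * norm (ka j c))*(K * B)" by (simp add: sum_distrib_right)
   also have "...<=(\<Sum>a\<in>UNIV. \<Sum>c\<in>UNIV. \<Sum>i<k. \<Sum>j<k. norm (\<beta> i a) * norm (ka j c))*(K * B)"
   proof (rule mult_right_mono)
    have "(\<Sum>i<k. \<Sum>j<k. norm (\<beta> i a) * norm (ka j c))<=(\<Sum>c\<in>UNIV. \<Sum>i<k. \<Sum>j<k. norm (\<beta> i a) * norm (ka j c))"
     by (rule member_le_sum[of c UNIV "%c. \<Sum>i<k. \<Sum>j<k. norm (\<beta> i a) * norm (ka j c)"]) (auto intro!: sum_nonneg)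
    also have "...<=(\<Sum>a\<in>UNIV. \<Sum>c\<in>UNIV. \<Sum>i<k. \<Sum>j<k. norm (\<beta> i a) * norm (ka j c))"
     by (rule member_le_sum[of a UNIV "%a. \<Sum>c\<in>UNIV. \<Sum>i<k. \<Sum>j<k. norm (\<beta> i a) * norm (ka j c)"]) (auto intro!: sum_nonneg)
    finally show "(\<Sum>i<k. \<Sum>j<k. norm (\<beta> i a) * norm (ka j c))<=(\<Sum>a\<in>UNIV. \<Sum>c\<in>UNIV. \<Sum>i<k. \<Sum>j<k. norm (\<beta> i a) * norm (ka j c))" .
   qed (use K B in auto)
   finally show "norm (M a c)<=K' * B" by (simp add: K'_def mult_ac)
  qed
 qed
qed

lemma sum_list_update_Suc:
 "i < length a ==> sum_list (a[i := Suc (a ! i)]) = Suc (sum_list a)" by (induction a arbitrary: i) (auto split: nat.split)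

lemma eigenvalue_word_multi_index:
 fixes \<mu> ev0 :: "nat => complex"
 assumes "!!i. i < N ==> \<mu> i = 0 \<or> \<mu> i \<in> ev0 ` {..<m0}" "set w \<subseteq> {..<N}"
 shows "EX a. length a = m0 & sum_list a<=length w &
  sum_list (map \<mu> w) = (\<Sum>i<m0. of_nat (a ! i) * ev0 i)" using assms(2)
proof (induction w)
 case Nil
 show ?case by (rule exI[of _ "replicate m0 0"]) (simp add: sum_list_replicate)
next
 case (Cons i w)
 then obtain a where a: "length a = m0" "sum_list a<=length w"
  "sum_list (map \<mu> w) = (\<Sum>i<m0. of_nat (a ! i) * ev0 i)" by auto
 consider "\<mu> i = 0" | j where "j < m0" "\<mu> i = ev0 j" using assms(1)[of i] Cons.prems by auto
 then show ?case
 proof cases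
  case 1 then show ?thesis using a by (intro exI[of _ a]) auto
 next
  case 2
  have "(\<Sum>i<m0. of_nat (a[j := Suc (a ! j)] ! i) * ev0 i)
   = (\<Sum>i<m0. of_nat (a ! i) * ev0 i+(if i = j then ev0 j else 0))" using a(1) 2 by (intro sum.cong) (auto simp: nth_list_update algebra_simps)
  also have "... = (\<Sum>i<m0. of_nat (a ! i) * ev0 i)+ev0 j" using 2 by (simp add: sum.distrib)
  finally show ?thesis using a 2 sum_list_update_Suc[of j a] by (intro exI[of _ "a[j := Suc (a ! j)]"]) auto
 qed
qed

lemma small_divisors:
 fixes \<mu> ev0 ev1 :: "nat => complex"
 assumes T: "T > 0" and nr: "nonresonant T m0 m1 ev0 ev1 \<gamma> \<tau>" and \<gamma>: "\<gamma> > 0" and \<tau>: "\<tau> > 0"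
  and \<mu>: "!!i. i < N ==> \<mu> i = 0 \<or> \<mu> i \<in> ev0 ` {..<m0}"
 obtains C C1 where "C >= 1" "C1 >= 1"
  "!!w k j. set w \<subseteq> {..<N} ==> w ~= [] ==> j < m1 ==> \<bar>real_of_int k\<bar><=C1 * real (length w) ==>
   norm (\<i> * of_real (of_int k*(2 * pi / T))+sum_list (map \<mu> w) - ev1 j) >= 1 / (C * real (length w) powr \<tau>)"
  "!!w k j. set w \<subseteq> {..<N} ==> w ~= [] ==> j < m1 ==> \<bar>real_of_int k\<bar> > C1 * real (length w) ==>
   norm (\<i> * of_real (of_int k*(2 * pi / T))+sum_list (map \<mu> w) - ev1 j) >= \<bar>real_of_int k\<bar>*(pi / T)"
proof -
 define \<omega> where "\<omega> = 2 * pi / T"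
 have \<omega>: "\<omega> > 0" using T by (simp add: \<omega>_def)
 define \<Lambda> where "\<Lambda> = (\<Sum>i<N. norm (\<mu> i))+(\<Sum>j<m1. norm (ev1 j))"
 have \<Lambda>0: "\<Lambda> >= 0" by (auto simp: \<Lambda>_def intro!: add_nonneg_nonneg sum_nonneg)
 define C1 where "C1 = max 1 (2 * \<Lambda> / \<omega>)"
 define e0 where "e0 = Min (insert 1 ((%j. norm (ev1 j)) ` {..<m1}))"
 have nz: "ev1 j ~= 0" if "j < m1" for j
  using nr[unfolded nonresonant_def, rule_format, of j "replicate m0 0" 0] that by (simp add: sum_list_replicate)
 have e0: "e0 > 0" unfolding e0_def using nz by (subst Min_gr_iff) auto
 have e0le: "e0<=norm (ev1 j)" if "j < m1" for j unfolding e0_def using that by (intro Min_le) auto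
 define C where "C = max 1 (max (1 / e0) ((1+C1) powr \<tau> / \<gamma>))"
 have C1: "C1 >= 1" by (simp add: C1_def)
 have C: "C >= 1" "C >= 1 / e0" "C >= (1+C1) powr \<tau> / \<gamma>" by (simp_all add: C_def)
 have mu_le: "norm (sum_list (map \<mu> w) - ev1 j)<=real (length w) * \<Lambda>" if w: "set w \<subseteq> {..<N}" "w ~= []" and j: "j < m1" for w j
 proof -
  have mi: "norm (\<mu> i)<=(\<Sum>i<N. norm (\<mu> i))" if "i < N" for i using that by (intro member_le_sum) auto
  have "norm (sum_list (map \<mu> w))<=real (length w)*(\<Sum>i<N. norm (\<mu> i))" using w(1)
  proof (induction w)
   case (Cons i w)
   have "norm (\<mu> i+sum_list (map \<mu> w))<=norm (\<mu> i)+norm (sum_list (map \<mu> w))" by (rule norm_triangle_ineq)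
   then show ?case using Cons mi[of i] by (simp add: algebra_simps)
  qed simp
  moreover have "norm (ev1 j)<=(\<Sum>j<m1. norm (ev1 j))" using j by (intro member_le_sum) auto
  moreover have "1*(\<Sum>j<m1. norm (ev1 j))<=real (length w)*(\<Sum>j<m1. norm (ev1 j))"
   using w(2) by (intro mult_right_mono) (auto simp: Suc_le_eq intro!: sum_nonneg)
  moreover have "norm (sum_list (map \<mu> w) - ev1 j)<=norm (sum_list (map \<mu> w))+norm (ev1 j)" by (rule norm_triangle_ineq4)
  ultimately show ?thesis by (simp add: \<Lambda>_def distrib_left)
 qed
 show thesis
 proof (rule that[OF C(1) C1])
  fix w k j assume w: "set w \<subseteq> {..<N}" "w ~= []" and j: "j < m1" and k: "\<bar>real_of_int k\<bar><=C1 * real (length w)"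
  let ?z = "\<i> * of_real (of_int k*(2 * pi / T))+sum_list (map \<mu> w) - ev1 j"
  obtain a where a: "length a = m0" "sum_list a<=length w"
   "sum_list (map \<mu> w) = (\<Sum>i<m0. of_nat (a ! i) * ev0 i)" using eigenvalue_word_multi_index[where \<mu>=\<mu> and ?ev0.0=ev0 and N=N, OF \<mu> w(1)] by blast
  have n1: "real (length w) >= 1" using w(2) by (simp add: Suc_le_eq)
  have np: "real (length w) powr \<tau> >= 1" using n1 \<tau> by (intro ge_one_powr_ge_zero) auto
  show "norm ?z >= 1 / (C * real (length w) powr \<tau>)"
  proof (cases "sum_list a = 0 & k = 0")
   case True
   then have "a ! i = 0" if "i < m0" for i using a(1) that by auto
   then have "?z = - ev1 j" using a(3) True by simp
   then have "norm ?z >= e0" using e0le[OF j] by simp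
   moreover have "1 / (C * real (length w) powr \<tau>)<=e0"
   proof -
    have "1<=C * e0" using C(2) e0 by (simp add: field_simps)
    also have "...<=C * e0 * real (length w) powr \<tau>" using np C(1) e0 mult_left_mono[OF np, of "C * e0"] by simp
    finally have "1<=e0*(C * real (length w) powr \<tau>)" by (simp add: mult_ac)
    moreover have "C * real (length w) powr \<tau> > 0" using C(1) np by (intro mult_pos_pos) auto
    ultimately show ?thesis by (simp add: divide_le_eq)
   qed
   ultimately show ?thesis by linarith
  next
   case False
   have "if sum_list a = 0 & k = 0 then ev1 j ~= 0
    else \<gamma> / (real (sum_list a)+\<bar>real_of_int k\<bar>) powr \<tau>
    <=norm ((\<Sum>i<m0. of_nat (a ! i) * ev0 i)+\<i> * of_int k * of_real (2 * pi / T) - ev1 j)"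
    by (rule nr[unfolded nonresonant_def, THEN spec, THEN spec, THEN spec, THEN mp, THEN mp, OF j a(1)])
   then have "\<gamma> / (real (sum_list a)+\<bar>real_of_int k\<bar>) powr \<tau>
    <=norm ((\<Sum>i<m0. of_nat (a ! i) * ev0 i)+\<i> * of_int k * of_real (2 * pi / T) - ev1 j)" unfolding if_not_P[OF False] .
   then have 1: "norm ?z >= \<gamma> / (real (sum_list a)+\<bar>real_of_int k\<bar>) powr \<tau>" using a(3) by (simp add: algebra_simps)
   have pos: "real (sum_list a)+\<bar>real_of_int k\<bar> > 0"
   proof (cases "k = 0")
    case True
    then have "sum_list a > 0" using False by (metis gr0I)
    then have "real (sum_list a) > 0" by (simp only: of_nat_0_less_iff)
    then show ?thesis by linarith
   next
    case False
    then have "\<bar>real_of_int k\<bar> > 0" by simp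
    then show ?thesis using of_nat_0_le_iff[of "sum_list a", where 'a=real] by linarith
   qed
   have "(real (sum_list a)+\<bar>real_of_int k\<bar>) powr \<tau><=((1+C1) * real (length w)) powr \<tau>"
    using pos a(2) k \<tau> by (intro powr_mono2) (auto simp: algebra_simps)
   also have "... = (1+C1) powr \<tau> * real (length w) powr \<tau>" by (rule powr_mult)
   also have "...<=(C * \<gamma>) * real (length w) powr \<tau>" using C(3) \<gamma> by (intro mult_right_mono) (auto simp: field_simps)
   finally have 2: "(real (sum_list a)+\<bar>real_of_int k\<bar>) powr \<tau><=\<gamma>*(C * real (length w) powr \<tau>)" by (simp add: mult_ac)
   have p1: "(real (sum_list a)+\<bar>real_of_int k\<bar>) powr \<tau> > 0" using pos by simp
   have p2: "C * real (length w) powr \<tau> > 0" using C(1) np by (intro mult_pos_pos) auto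
   have "1 / (C * real (length w) powr \<tau>)<=\<gamma> / (real (sum_list a)+\<bar>real_of_int k\<bar>) powr \<tau>"
    using 2 p1 p2 by (simp add: frac_le_eq divide_simps mult_ac)
   with 1 show ?thesis by linarith
  qed
 next
  fix w k j assume w: "set w \<subseteq> {..<N}" "w ~= []" and j: "j < m1" and k: "\<bar>real_of_int k\<bar> > C1 * real (length w)"
  have "2 * \<Lambda> / \<omega> * real (length w)<=C1 * real (length w)" by (intro mult_right_mono) (auto simp: C1_def)
  also have "...<=\<bar>real_of_int k\<bar>" using k by simp
  finally have kk: "real (length w) * \<Lambda><=\<bar>real_of_int k\<bar> * \<omega> / 2" using \<omega> by (simp add: field_simps)
  have "norm (\<i> * cor (of_int k*(2 * pi / T))) = \<bar>real_of_int k\<bar> * \<omega>"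
   using T unfolding norm_mult norm_of_real by (simp add: abs_mult \<omega>_def)
  moreover have "norm (\<i> * cor (of_int k*(2 * pi / T))) - norm (- (sum_list (map \<mu> w) - ev1 j))
   <=norm (\<i> * cor (of_int k*(2 * pi / T)) - - (sum_list (map \<mu> w) - ev1 j))" by (rule norm_triangle_ineq2)
  ultimately have "\<bar>real_of_int k\<bar> * \<omega> - norm (sum_list (map \<mu> w) - ev1 j)
   <=norm (\<i> * cor (of_int k*(2 * pi / T))+(sum_list (map \<mu> w) - ev1 j))" by (simp only: norm_minus_cancel minus_minus diff_minus_eq_add)
  then have "\<bar>real_of_int k\<bar> * \<omega> - \<bar>real_of_int k\<bar> * \<omega> / 2<=norm (\<i> * of_real (of_int k*(2 * pi / T))+sum_list (map \<mu> w) - ev1 j)"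
   using mu_le[OF w j] kk by (simp only: add_diff_eq)
  then show "norm (\<i> * of_real (of_int k*(2 * pi / T))+sum_list (map \<mu> w) - ev1 j) >= \<bar>real_of_int k\<bar>*(pi / T)"
   by (simp add: \<omega>_def mult.commute)
 qed
qed

lemma homological_multipliers:
 fixes L P1 :: "real ^ 'm => real ^ 'm" and \<mu> ev0 ev1 :: "nat => complex"
 assumes jb: "max_jordan_block_size E L \<nu>" and ev: "eigenvalues_on E L m1 ev1" and L: "linear L" "L ` E \<subseteq> E"
  and P1: "linear P1" "!!u. P1 u \<in> E" "!!u. u \<in> E ==> P1 u = u"
  and T: "T > 0" and nr: "nonresonant T m0 m1 ev0 ev1 \<gamma> \<tau>" and \<gamma>: "\<gamma> > 0" and \<tau>: "\<tau> > 0"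
  and \<mu>: "!!i. i < N ==> \<mu> i = 0 \<or> \<mu> i \<in> ev0 ` {..<m0}"
 obtains K where "K >= 0"
  "!!w. set w \<subseteq> {..<N} ==> w ~= [] ==> EX M C. ALL k :: int. ALL a b.
    (\<Sum>c\<in>UNIV. mtx L a c * M k c b) = (\<i> * of_real (of_int k*(2 * pi / T))+sum_list (map \<mu> w)) * M k a b - mtx P1 a b &
    (\<Sum>c\<in>UNIV. mtx P1 a c * M k c b) = M k a b &
    norm (M k a b)<=K * real (length w) powr (\<tau> * real \<nu>) &
    sqrt (1+(real_of_int k)\<^sup>2) * norm (M k a b)<=C"
proof -
 obtain K where KR: "K >= 0 & (ALL z d B. d > 0 --> B >= 0 --> (ALL j<m1. norm (z - ev1 j) >= d) -->
  (ALL k. 1<=k --> k<=\<nu> --> (1 / d) ^ k<=B) -->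
  (EX M. ALL a b. (\<Sum>c\<in>UNIV. mtx L a c * M c b) = z * M a b - mtx P1 a b &
    (\<Sum>c\<in>UNIV. mtx P1 a c * M c b) = M a b & norm (M a b)<=K * B))"
 proof (rule exE[OF resolvent_exists[where ?P1.0=P1, OF jb ev L P1(1,2)]])
  show "u \<in> E ==> P1 u = u" for u by (rule P1(3))
 qed (rule that)
 have K: "K >= 0" using KR by simp
 note res = KR[THEN conjunct2, THEN spec, THEN spec, THEN spec, THEN mp, THEN mp, THEN mp, THEN mp]
 obtain C C1 where C: "C >= 1" "C1 >= 1" and
  low: "!!w k j. set w \<subseteq> {..<N} ==> w ~= [] ==> j < m1 ==> \<bar>real_of_int k\<bar><=C1 * real (length w) ==>
   norm (\<i> * of_real (of_int k*(2 * pi / T))+sum_list (map \<mu> w) - ev1 j) >= 1 / (C * real (length w) powr \<tau>)" and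
  high: "!!w k j. set w \<subseteq> {..<N} ==> w ~= [] ==> j < m1 ==> \<bar>real_of_int k\<bar> > C1 * real (length w) ==>
   norm (\<i> * of_real (of_int k*(2 * pi / T))+sum_list (map \<mu> w) - ev1 j) >= \<bar>real_of_int k\<bar>*(pi / T)"
  by (rule small_divisors[where \<mu>=\<mu> and N=N, OF T nr \<gamma> \<tau>]) (erule \<mu>, rule that)
 define D where "D = (max 1 (T / pi)) ^ \<nu>"
 have D: "D >= 1" by (simp add: D_def one_le_power)
 show thesis
 proof (rule that[of "K*(C ^ \<nu> * D)"])
  show "K*(C ^ \<nu> * D) >= 0" using K C D by simp
  fix w assume w: "set w \<subseteq> {..<N}" "w ~= []"
  define n where "n = real (length w)"
  have n1: "n >= 1" using w(2) by (simp add: n_def Suc_le_eq)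
  have np: "n powr \<tau> >= 1" using n1 \<tau> by (intro ge_one_powr_ge_zero) auto
  have np': "n powr (\<tau> * real \<nu>) >= 1" using n1 \<tau> by (intro ge_one_powr_ge_zero) auto
  have pw: "(n powr \<tau>) ^ \<nu> = n powr (\<tau> * real \<nu>)" using n1 by (simp add: powr_realpow[symmetric] powr_powr)
  define C' where "C' = max ((1+C1 * n)*(K*(C ^ \<nu> * D) * n powr (\<tau> * real \<nu>))) (2*(K * D))"
  have ex: "EX M. ALL a b. (\<Sum>c\<in>UNIV. mtx L a c * M c b) = (\<i> * of_real (of_int k*(2 * pi / T))+sum_list (map \<mu> w)) * M a b - mtx P1 a b &
    (\<Sum>c\<in>UNIV. mtx P1 a c * M c b) = M a b &
    norm (M a b)<=K*(C ^ \<nu> * D) * n powr (\<tau> * real \<nu>) &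
    sqrt (1+(real_of_int k)\<^sup>2) * norm (M a b)<=C'" for k :: int
  proof -
   have sq: "sqrt (1+(real_of_int k)\<^sup>2)<=1+\<bar>real_of_int k\<bar>" by (rule real_le_lsqrt) (auto simp: power2_eq_square algebra_simps)
   show ?thesis
   proof (cases "\<bar>real_of_int k\<bar><=C1 * real (length w)")
    case True
    define B where "B = C ^ \<nu> * n powr (\<tau> * real \<nu>)"
    have B0: "B >= 0" using C by (simp add: B_def)
    have Cn: "C * n powr \<tau> >= 1" using C(1) np mult_mono[of 1 C 1 "n powr \<tau>"] by simp
    have powB: "(1 / (1 / (C * n powr \<tau>))) ^ i<=B" if "i<=\<nu>" for i
    proof -
     have "(C * n powr \<tau>) ^ i<=(C * n powr \<tau>) ^ \<nu>" using Cn that by (intro power_increasing) auto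
     then show ?thesis by (simp add: B_def power_mult_distrib pw)
    qed
    have "EX M. ALL a b. (\<Sum>c\<in>UNIV. mtx L a c * M c b) = (\<i> * of_real (of_int k*(2 * pi / T))+sum_list (map \<mu> w)) * M a b - mtx P1 a b &
     (\<Sum>c\<in>UNIV. mtx P1 a c * M c b) = M a b & norm (M a b)<=K * B"
    proof (rule res)
     show "0 < 1 / (C * n powr \<tau>)" using Cn by simp
     show "ALL j<m1. 1 / (C * n powr \<tau>)<=norm (\<i> * of_real (of_int k*(2 * pi / T))+sum_list (map \<mu> w) - ev1 j)"
      using low[OF w _ True] unfolding n_def by blast
     show "ALL i. 1<=i --> i<=\<nu> --> (1 / (1 / (C * n powr \<tau>))) ^ i<=B" using powB by blast
    qed (rule B0)
    then obtain M where M: "!!a b. (\<Sum>c\<in>UNIV. mtx L a c * M c b) = (\<i> * of_real (of_int k*(2 * pi / T))+sum_list (map \<mu> w)) * M a b - mtx P1 a b &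
     (\<Sum>c\<in>UNIV. mtx P1 a c * M c b) = M a b & norm (M a b)<=K * B" by blast
    have "K * B<=K*(C ^ \<nu> * D) * n powr (\<tau> * real \<nu>)"
     using mult_left_mono[OF mult_right_mono[OF D B0] K] by (simp add: B_def mult_ac)
    then have M1: "norm (M a b)<=K*(C ^ \<nu> * D) * n powr (\<tau> * real \<nu>)" for a b using M[of a b] by linarith
    have "sqrt (1+(real_of_int k)\<^sup>2) * norm (M a b)<=C'" for a b
    proof -
     have "sqrt (1+(real_of_int k)\<^sup>2) * norm (M a b)<=(1+C1 * n)*(K*(C ^ \<nu> * D) * n powr (\<tau> * real \<nu>))"
      using sq True C n1 by (intro mult_mono M1) (auto simp: n_def)
     then show ?thesis by (simp add: C'_def)
    qed
    with M M1 show ?thesis by blast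
   next
    case False
    then have k: "\<bar>real_of_int k\<bar> > C1 * real (length w)" by simp
    have k1: "\<bar>real_of_int k\<bar> >= 1" using k mult_mono[of 1 C1 1 n] C n1 by (simp add: n_def)
    define B where "B = D / \<bar>real_of_int k\<bar>"
    have B0: "B >= 0" using D by (simp add: B_def)
    have powB: "(1 / (\<bar>real_of_int k\<bar>*(pi / T))) ^ i<=B" if i: "1<=i" "i<=\<nu>" for i
    proof -
     have "(1 / (\<bar>real_of_int k\<bar>*(pi / T))) ^ i = (T / pi) ^ i*(1 / \<bar>real_of_int k\<bar>) ^ i"
      by (simp add: power_mult_distrib[symmetric] mult.commute)
     also have "...<=D*(1 / \<bar>real_of_int k\<bar>)"
     proof (rule mult_mono)
      have "(T / pi) ^ i<=(max 1 (T / pi)) ^ i" using T by (intro power_mono) auto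
      also have "...<=D" unfolding D_def using i by (intro power_increasing) auto
      finally show "(T / pi) ^ i<=D" .
      show "(1 / \<bar>real_of_int k\<bar>) ^ i<=1 / \<bar>real_of_int k\<bar>"
       using power_decreasing[OF i(1), of "1 / \<bar>real_of_int k\<bar>"] k1 by simp
     qed (use D in auto)
     finally show ?thesis by (simp add: B_def)
    qed
    have "EX M. ALL a b. (\<Sum>c\<in>UNIV. mtx L a c * M c b) = (\<i> * of_real (of_int k*(2 * pi / T))+sum_list (map \<mu> w)) * M a b - mtx P1 a b &
     (\<Sum>c\<in>UNIV. mtx P1 a c * M c b) = M a b & norm (M a b)<=K * B"
    proof (rule res)
     show "0 < \<bar>real_of_int k\<bar>*(pi / T)" using k1 T by simp
     show "ALL j<m1. \<bar>real_of_int k\<bar>*(pi / T)<=norm (\<i> * of_real (of_int k*(2 * pi / T))+sum_list (map \<mu> w) - ev1 j)"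
      using high[OF w _ k] by blast
     show "ALL i. 1<=i --> i<=\<nu> --> (1 / (\<bar>real_of_int k\<bar>*(pi / T))) ^ i<=B" using powB by blast
    qed (rule B0)
    then obtain M where M: "!!a b. (\<Sum>c\<in>UNIV. mtx L a c * M c b) = (\<i> * of_real (of_int k*(2 * pi / T))+sum_list (map \<mu> w)) * M a b - mtx P1 a b &
     (\<Sum>c\<in>UNIV. mtx P1 a c * M c b) = M a b & norm (M a b)<=K * B" by blast
    have "B<=D" using D k1 by (simp add: B_def divide_le_eq mult_left_mono[of 1 "\<bar>real_of_int k\<bar>" D, simplified])
    also have "D<=C ^ \<nu> * D" using mult_right_mono[of 1 "C ^ \<nu>" D] C D by (simp add: one_le_power)
    also have "...<=C ^ \<nu> * D * n powr (\<tau> * real \<nu>)" using mult_left_mono[OF np', of "C ^ \<nu> * D"] C D by simp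
    finally have "K * B<=K*(C ^ \<nu> * D * n powr (\<tau> * real \<nu>))" using K by (rule mult_left_mono)
    then have M1: "norm (M a b)<=K*(C ^ \<nu> * D) * n powr (\<tau> * real \<nu>)" for a b using M[of a b] by (simp add: mult.assoc)
    have "sqrt (1+(real_of_int k)\<^sup>2) * norm (M a b)<=C'" for a b
    proof -
     have "sqrt (1+(real_of_int k)\<^sup>2) * norm (M a b)<=(2 * \<bar>real_of_int k\<bar>)*(K * B)"
      using sq k1 M[of a b] by (intro mult_mono) auto
     also have "... = 2*(K * D)" using k1 by (simp add: B_def)
     finally show ?thesis by (simp add: C'_def)
    qed
    with M M1 show ?thesis by blast
   qed
  qed
  define Q where "Q k M \<longleftrightarrow> (ALL a b. (\<Sum>c\<in>UNIV. mtx L a c * M c b) = (\<i> * of_real (of_int k*(2 * pi / T))+sum_list (map \<mu> w)) * M a b - mtx P1 a b &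
    (\<Sum>c\<in>UNIV. mtx P1 a c * M c b) = M a b &
    norm (M a b)<=K*(C ^ \<nu> * D) * n powr (\<tau> * real \<nu>) &
    sqrt (1+(real_of_int k)\<^sup>2) * norm (M a b)<=C')" for k :: int and M :: "'m => 'm => complex"
  have "ALL k. EX M. Q k M" unfolding Q_def by (intro allI ex)
  from choice[OF this] obtain M where M: "ALL k. Q k (M k)" ..
  show "EX M C'. ALL k :: int. ALL a b.
    (\<Sum>c\<in>UNIV. mtx L a c * M k c b) = (\<i> * of_real (of_int k*(2 * pi / T))+sum_list (map \<mu> w)) * M k a b - mtx P1 a b &
    (\<Sum>c\<in>UNIV. mtx P1 a c * M k c b) = M k a b &
    norm (M k a b)<=K*(C ^ \<nu> * D) * real (length w) powr (\<tau> * real \<nu>) &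
    sqrt (1+(real_of_int k)\<^sup>2) * norm (M k a b)<=C'" using M unfolding Q_def n_def by (intro exI[of _ M] exI[of _ C'])
 qed
qed

section \<open>The homological equation\<close>

lemma has_sum_sum:
 fixes f :: "'i => 'a => 'b :: {comm_monoid_add, topological_comm_monoid_add}"
 assumes "finite A" "!!i. i \<in> A ==> (f i has_sum s i) X"
 shows "((%x. \<Sum>i\<in>A. f i x) has_sum (\<Sum>i\<in>A. s i)) X" using assms by (induction A rule: finite_induct) (auto intro: has_sum_add)

locale normal_form = sobolev_words T l N \<zeta>
 for T :: real and l N :: nat and \<zeta> :: "nat => (real ^ 'm) \<times> real => complex" +
 fixes L P0 P1 :: "real ^ 'm => real ^ 'm" and \<mu> :: "nat => complex" and \<sigma> :: "nat => nat"
  and iE :: nat and cP :: "'m => nat => complex" and K s :: real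
 assumes linL: "linear L" and linP0: "linear P0" and linP1: "linear P1"
  and P0_P1: "P0 u+P1 u = u" and P0_idem: "P0 (P0 u) = P0 u" and P1_idem: "P1 (P1 u) = P1 u"
  and P0_L: "P0 (L u) = L (P0 u)" and P1_L: "P1 (L u) = L (P1 u)"
  and conj: "i < N ==> \<sigma> i < N & \<zeta> (\<sigma> i) x = cnj (\<zeta> i x)"
  and eig: "i < N ==> \<zeta> i (L (fst x), 0) = \<mu> i * \<zeta> i x"
  and bnd: "i < N ==> norm (\<zeta> i x)<=norm x"
  and proj: "i < N ==> \<zeta> i (P0 u, r) = \<zeta> i (u, r)"
  and iE: "iE < N" "\<zeta> iE x = cor (snd x)"
  and noE: "i < N ==> i ~= iE ==> \<zeta> i (u, r) = \<zeta> i (u, 0)"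
  and coordP0: "cor (vn (P0 (fst x)) a) = (\<Sum>i<N. cP a i * \<zeta> i x)"
  and K: "K >= 0" and s: "s >= 0"
  and multipliers: "set w \<subseteq> {..<N} ==> w ~= [] ==> EX M C. ALL k :: int. ALL a b.
    (\<Sum>c\<in>UNIV. mtx L a c * M k c b) = (\<i> * of_real (of_int k*(2 * pi / T))+sum_list (map \<mu> w)) * M k a b - mtx P1 a b &
    (\<Sum>c\<in>UNIV. mtx P1 a c * M k c b) = M k a b &
    norm (M k a b)<=K * real (length w) powr s &
    sqrt (1+(real_of_int k)\<^sup>2) * norm (M k a b)<=C"
begin

lemma dmono_L: "set w \<subseteq> {..<N} ==> dmono w x (L (fst x), 0) = sum_list (map \<mu> w) * mon w x"
 by (induction w) (auto simp: eig algebra_simps)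

lemma mon_conj: "set w \<subseteq> {..<N} ==> mon (map \<sigma> w) x = cnj (mon w x)" by (induction w) (auto simp: conj)

lemma dmono_conj: "set w \<subseteq> {..<N} ==> dmono (map \<sigma> w) x y = cnj (dmono w x y)" by (induction w) (auto simp: conj mon_conj)

lemma mon_noE: "set w \<subseteq> {..<N} ==> iE \<notin> set w ==> mon w (u, r) = mon w (u, 0)"
proof (induction w)
 case (Cons i w)
 then show ?case using noE[of i u r] by auto
qed simp

lemma mon_E: "iE \<in> set w ==> mon w (u, 0) = 0" by (induction w) (auto simp: iE)

lemma dert_unique: "HS T (Suc l) f ==> (f has_vector_derivative d) (at t) ==> dert f t = d" using dert(2)[OF l] by (rule vector_derivative_unique_at)

lemma dert_cmult: "HS T (Suc l) f ==> dert (%t. c * f t) t = c * dert f t" using dert(2)[OF l, of f t] HS_cmult(1)[of "Suc l" f c]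
 by (intro dert_unique has_vector_derivative_mult_right) auto

lemma dert_cnj: "HS T (Suc l) f ==> dert (%t. cnj (f t)) t = cnj (dert f t)" using dert(2)[OF l, of f t] HS_cnj(1)[of "Suc l" f]
 by (intro dert_unique bounded_linear.has_vector_derivative[OF bounded_linear_cnj]) auto

text \<open>The average of a polynomial with its formal conjugate, whose value is the real part.\<close>

definition re_terms :: "terms => terms" where
 "re_terms ps = map (%(w, c). (w, %t. (1/2) * c t)) ps @ map (%(w, c). (map \<sigma> w, %t. (1/2) * cnj (c t))) ps"

lemma re_terms:
 assumes ps: "hom n ps" and S: "!!w c. (w, c) \<in> set ps ==> HS T (Suc l) c"
 shows "hom n (re_terms ps)" and "nrm (re_terms ps)<=nrm ps"
  and "!!w c. (w, c) \<in> set (re_terms ps) ==> HS T (Suc l) c"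
  and "ev (re_terms ps) x t = of_real (Re (ev ps x t))"
  and "pd (re_terms ps) x y t = of_real (Re (pd ps x y t))"
  and "et (re_terms ps) x t = of_real (Re (et ps x t))"
proof -
 define A where "A = map (%(w, c). (w, %t. (1/2::complex) * c t)) ps"
 define B where "B = map (%(w, c). (map \<sigma> w, %t. (1/2::complex) * cnj (c t))) ps"
 have re: "re_terms ps = A @ B" by (simp add: re_terms_def A_def B_def)
 have half: "nm (%t. (1/2) * c t)<=nm c / 2" if "HSl c" for c using nm_cmult[OF that, of "1/2"] by simp
 have half': "nm (%t. (1/2) * cnj (c t))<=nm c / 2" if "HSl c" for c using half[OF HS_cnj(1)[OF that]] nm_cnj[OF that] by linarith
 have hc: "(1/2) * z+(1/2) * cnj z = of_real (Re z)" for z :: complex by (auto simp: complex_eq_iff)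
 have "hom n A"
 proof -
  have "length w = n & set w \<subseteq> {..<N} & HSl (%t. (1/2) * c t)" if "(w, c) \<in> set ps" for w c
   using that ps HS_cmult(1)[of l c "1/2"] unfolding hom_def by fastforce
  then show ?thesis unfolding A_def hom_def by auto
 qed
 moreover have "hom n B"
 proof -
  have "length (map \<sigma> w) = n & set (map \<sigma> w) \<subseteq> {..<N} & HSl (%t. (1/2) * cnj (c t))" if "(w, c) \<in> set ps" for w c
   using that ps conj HS_cmult(1)[OF HS_cnj(1), of l c "1/2"] unfolding hom_def by fastforce
  then show ?thesis unfolding B_def hom_def by fastforce
 qed
 ultimately show "hom n (re_terms ps)" by (simp add: re)
 have "nrm A<=nrm ps / 2" using ps unfolding A_def
 proof (induction ps)
  case (Cons p ps) then show ?case using half[of "snd p"] by (cases p) auto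
 qed simp
 moreover have "nrm B<=nrm ps / 2" using ps unfolding B_def
 proof (induction ps)
  case (Cons p ps) then show ?case using half'[of "snd p"] by (cases p) auto
 qed simp
 ultimately show "nrm (re_terms ps)<=nrm ps" by (simp add: re)
 have "HS T (Suc l) (%t. c t / 2)" if "HS T (Suc l) c" for c using HS_cmult(1)[OF that, of "1/2"] by simp
 then show "HS T (Suc l) c" if "(w, c) \<in> set (re_terms ps)" for w c using that S HS_cnj(1)[of "Suc l"] unfolding re A_def B_def by auto
 have evA: "ev A x t = (1/2) * ev ps x t" unfolding A_def by (induction ps) (auto simp: algebra_simps)
 moreover have evB: "ev B x t = (1/2) * cnj (ev ps x t)" using ps unfolding B_def by (induction ps) (auto simp: algebra_simps mon_conj)
 ultimately show "ev (re_terms ps) x t = of_real (Re (ev ps x t))" by (simp only: re ev_simps(3) evA evB hc)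
 have pdA: "pd A x y t = (1/2) * pd ps x y t" unfolding A_def by (induction ps) (auto simp: algebra_simps)
 moreover have pdB: "pd B x y t = (1/2) * cnj (pd ps x y t)" using ps unfolding B_def by (induction ps) (auto simp: algebra_simps dmono_conj)
 ultimately show "pd (re_terms ps) x y t = of_real (Re (pd ps x y t))" by (simp only: re pd_simps(3) pdA pdB hc)
 have etA: "et A x t = (1/2) * et ps x t" using S unfolding A_def
 proof (induction ps)
  case (Cons p ps)
  obtain w c where p: "p = (w, c)" by (cases p)
  have "HS T (Suc l) c" using Cons.prems[of w c] p by simp
  from dert_cmult[OF this, of "1/2" t] have d: "dert (%t. (1/2) * c t) t = (1/2) * dert c t" .
  have e: "et (map (%(w, c). (w, %t. (1/2::complex) * c t)) ps) x t = (1/2) * et ps x t" by (rule Cons.IH) (use Cons.prems in auto)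
  show ?case by (simp only: p list.map prod.case et_simps(2) d e) (simp add: algebra_simps)
 qed simp
 moreover have etB: "et B x t = (1/2) * cnj (et ps x t)" using S ps unfolding B_def
 proof (induction ps)
  case (Cons p ps)
  obtain w c where p: "p = (w, c)" by (cases p)
  have c: "HS T (Suc l) c" using Cons.prems(1)[of w c] p by simp
  have "dert (%t. (1/2) * cnj (c t)) t = (1/2) * cnj (dert c t)" using dert_cmult[OF HS_cnj(1)[OF c], of "1/2" t] dert_cnj[OF c, of t] by simp
  moreover have "et (map (%(w, c). (map \<sigma> w, %t. (1/2::complex) * cnj (c t))) ps) x t = (1/2) * cnj (et ps x t)"
   by (rule Cons.IH) (use Cons.prems p in auto)
  moreover have "mon (map \<sigma> w) x = cnj (mon w x)" using Cons.prems(2) p by (intro mon_conj) auto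
  ultimately show ?case by (simp only: p list.map prod.case et_simps(2)) (simp add: algebra_simps)
 qed simp
 ultimately show "et (re_terms ps) x t = of_real (Re (et ps x t))" by (simp only: re et_simps(3) etA etB hc)
qed

definition mean_terms :: "terms => terms" where
 "mean_terms ps = map (%(w, c). if iE \<in> set w then (w, c) else (w, %t. cfc T c 0)) ps"

lemma cfc_ev: "hom n ps ==> cfc T (ev ps x) k = (\<Sum>(w, c)\<leftarrow>ps. mon w x * cfc T c k)"
proof (induction ps)
 case Nil
 have "ev [] x = (%t. 0)" by (simp add: fun_eq_iff)
 then show ?case by (simp add: cfc_const)
next
 case (Cons p ps)
 obtain w c where p: "p = (w, c)" by (cases p)
 have c: "HSl c" and ps: "hom n ps" using Cons.prems p by auto
 have e: "ev (p # ps) x = (%t. mon w x * c t+ev ps x t)" by (simp add: p fun_eq_iff)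
 have "HSl (ev ps x)" using H_bound(1)[of n "nrm ps" "ev ps" x "norm x"] bnd ps unfolding H_def by fastforce
 then have "cfc T (ev (p # ps) x) k = cfc T (%t. mon w x * c t) k+cfc T (ev ps x) k"
  unfolding e by (intro cfc_add HS_continuous[of T l] HS_cmult(1) c)
 then have "cfc T (ev (p # ps) x) k = mon w x * cfc T c k+(\<Sum>(w, c)\<leftarrow>ps. mon w x * cfc T c k)" unfolding Cons.IH[OF ps] cfc_cmult .
 then show ?case by (simp add: p del: ev_simps)
qed

lemma mean_terms:
 assumes ps: "hom n ps" and ind: "!!u t. ev ps (u, 0) t = ev ps (u, 0) 0"
 shows "hom n (mean_terms ps)" and "nrm (mean_terms ps)<=nrm ps" and "ev (mean_terms ps) = ev ps"
  and "!!w c. (w, c) \<in> set (mean_terms ps) ==> iE \<notin> set w ==> EX d. c = (%t. d)"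
proof -
 have "length w = n & set w \<subseteq> {..<N} & HSl c" if "(w, c) \<in> set ps" for w c using that ps unfolding hom_def by fastforce
 then show "hom n (mean_terms ps)" using HS_const(1) unfolding hom_def mean_terms_def by (fastforce split: if_splits)
 show "nrm (mean_terms ps)<=nrm ps" using ps unfolding mean_terms_def
 proof (induction ps)
  case (Cons p ps)
  obtain w c where p: "p = (w, c)" by (cases p)
  have "HSl c" using Cons.prems p by simp
  from mult_left_mono[OF HS_0_mean[OF this], of "malg l"] malg_pos
  have "nm (%t. cfc T c 0)<=nm c" by (simp add: nm_def)
  then show ?case using Cons p by auto
 qed simp
 show "EX d. c = (%t. d)" if "(w, c) \<in> set (mean_terms ps)" "iE \<notin> set w" for w c
  using that unfolding mean_terms_def by (auto split: if_splits)
 show "ev (mean_terms ps) = ev ps"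
 proof (intro ext)
  fix x :: "(real ^ 'm) \<times> real" and t
  obtain u r where x: "x = (u, r)" by (cases x)
  define A where "A = filter (%(w, c). iE \<in> set w) ps"
  define B where "B = filter (%(w, c). iE \<notin> set w) ps"
  have B: "hom n B" using ps by (auto simp: B_def hom_def)
  have BN: "mon w (u, r) = mon w (u, 0)" if "(w, c) \<in> set B" for w c using that ps by (intro mon_noE) (auto simp: B_def hom_def)
  have evB: "ev B (u, r) t = ev B (u, 0) t" for t unfolding ev_def using BN by (intro arg_cong[where f=sum_list] map_cong) auto
  have ev0: "ev ps (u, 0) t = ev B (u, 0) t" for t unfolding B_def by (induction ps) (auto simp: mon_E)
  have c: "ev B (u, 0) = (%t. ev B (u, 0) 0)" using ind ev0 by (metis ext)
  have "cfc T (ev B (u, 0)) 0 = ev B (u, 0) t" using c cfc_const[of "ev B (u, 0) 0" 0] by metis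
  then have *: "(\<Sum>(w, c)\<leftarrow>B. mon w (u, 0) * cfc T c 0) = ev B (u, 0) t" using cfc_ev[OF B] by simp
  have "(\<Sum>(w, c)\<leftarrow>B. mon w (u, r) * cfc T c 0) = (\<Sum>(w, c)\<leftarrow>B. mon w (u, 0) * cfc T c 0)"
   using BN by (intro arg_cong[where f=sum_list] map_cong) auto
  moreover have "ev (mean_terms ps) x t = ev A x t+(\<Sum>(w, c)\<leftarrow>B. mon w x * cfc T c 0)"
   unfolding mean_terms_def A_def B_def by (induction ps) auto
  moreover have "ev ps x t = ev A x t+ev B x t" unfolding A_def B_def by (induction ps) auto
  ultimately show "ev (mean_terms ps) x t = ev ps x t" using * evB x by simp
 qed
qed

definition LL :: "('m => terms) => (real ^ 'm) \<times> real => real => 'm => complex" where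
 "LL pp x t a = et (pp a) x t+pd (pp a) x (L (fst x), 0) t - (\<Sum>c\<in>UNIV. mtx L a c * ev (pp c) x t)"

lemma homological_term:
 assumes w: "set w \<subseteq> {..<N}" "w ~= []"
 obtains f :: "(real => complex) => 'm => 'm => real => complex" where
  "!!c a b. HSl c ==> HS T (Suc l) (f c a b) & nm (f c a b)<=K * real (length w) powr s * nm c"
  "!!c a b t. HSl c ==> dert (f c a b) t+sum_list (map \<mu> w) * f c a b t - (\<Sum>d\<in>UNIV. mtx L a d * f c d b t) = mtx P1 a b * c t"
  "!!c a b t. HSl c ==> (\<Sum>d\<in>UNIV. mtx P1 a d * f c d b t) = f c a b t"
  "!!z a b. EX d. f (%t. z) a b = (%t. d)"
proof -
 obtain M C where M: "!!k a b.
    (\<Sum>c\<in>UNIV. mtx L a c * M k c b) = (\<i> * of_real (of_int k*(2 * pi / T))+sum_list (map \<mu> w)) * M k a b - mtx P1 a b"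
    "!!k a b. (\<Sum>c\<in>UNIV. mtx P1 a c * M k c b) = M k a b"
    "!!k a b. norm (M k a b)<=K * real (length w) powr s"
    "!!k a b. sqrt (1+(real_of_int k)\<^sup>2) * norm (M k a b)<=C" using multipliers[OF w] by blast
 define f where "f c a b = hmul (%k. M k a b) c" for c a b
 show thesis
 proof (rule that[of f])
  fix c a b assume c: "HSl c"
  show "HS T (Suc l) (f c a b) & nm (f c a b)<=K * real (length w) powr s * nm c"
   using hmul_Suc[OF l c M(4)[of _ a b]] mult_left_mono[OF hmul(2)[OF l c M(3)[of _ a b]], of "malg l"] malg_pos by (simp add: f_def nm_def mult_ac)
 next
  fix c a b t assume c: "HSl c"
  have h: "((%k. M k a b * cfc T c k * chr T k t) has_sum f c a b t) UNIV" for a b t unfolding f_def by (rule hmul(4)[OF l c M(3)[of _ a b]])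
  have 1: "((%k. \<i> * of_real (of_int k*(2 * pi / T)) * M k a b * cfc T c k * chr T k t +
     sum_list (map \<mu> w)*(M k a b * cfc T c k * chr T k t) +
     (-1)*(\<Sum>d\<in>UNIV. mtx L a d*(M k d b * cfc T c k * chr T k t)))
     has_sum (dert (f c a b) t+sum_list (map \<mu> w) * f c a b t+(-1)*(\<Sum>d\<in>UNIV. mtx L a d * f c d b t))) UNIV"
   by (intro has_sum_add has_sum_cmult_right has_sum_sum finite_class.finite_UNIV h dert_hmul[OF l c M(4)[of _ a b], folded f_def])
  have "(\<i> * of_real (of_int k*(2 * pi / T)) * M k a b * cfc T c k * chr T k t +
     sum_list (map \<mu> w)*(M k a b * cfc T c k * chr T k t) +
     (-1)*(\<Sum>d\<in>UNIV. mtx L a d*(M k d b * cfc T c k * chr T k t))) = mtx P1 a b*(cfc T c k * chr T k t)" for k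
  proof -
   have "(\<Sum>d\<in>UNIV. mtx L a d*(M k d b * cfc T c k * chr T k t)) = (\<Sum>d\<in>UNIV. mtx L a d * M k d b)*(cfc T c k * chr T k t)"
    by (simp add: sum_distrib_right mult.assoc)
   then show ?thesis unfolding M(1) by (simp add: algebra_simps)
  qed
  then have 2: "((%k. mtx P1 a b*(cfc T c k * chr T k t)) has_sum (dert (f c a b) t+sum_list (map \<mu> w) * f c a b t+(-1)*(\<Sum>d\<in>UNIV. mtx L a d * f c d b t))) UNIV"
   using 1 by simp
  have 3: "((%k. mtx P1 a b*(cfc T c k * chr T k t)) has_sum mtx P1 a b * c t) UNIV" by (intro has_sum_cmult_right HS_has_sum[OF c l])
  show "dert (f c a b) t+sum_list (map \<mu> w) * f c a b t - (\<Sum>d\<in>UNIV. mtx L a d * f c d b t) = mtx P1 a b * c t"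
   using has_sum_unique[OF 2 3] by simp
  have "((%k. \<Sum>d\<in>UNIV. mtx P1 a d*(M k d b * cfc T c k * chr T k t)) has_sum (\<Sum>d\<in>UNIV. mtx P1 a d * f c d b t)) UNIV"
   by (intro has_sum_sum finite_class.finite_UNIV has_sum_cmult_right h)
  moreover have "(\<Sum>d\<in>UNIV. mtx P1 a d*(M k d b * cfc T c k * chr T k t)) = M k a b * cfc T c k * chr T k t" for k
  proof -
   have "(\<Sum>d\<in>UNIV. mtx P1 a d*(M k d b * cfc T c k * chr T k t)) = (\<Sum>d\<in>UNIV. mtx P1 a d * M k d b)*(cfc T c k * chr T k t)"
    by (simp add: sum_distrib_right mult.assoc)
   then show ?thesis unfolding M(2) by (simp add: mult.assoc)
  qed
  ultimately show "(\<Sum>d\<in>UNIV. mtx P1 a d * f c d b t) = f c a b t" using has_sum_unique[OF _ h[of a b t]] by simp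
 next
  fix z a b
  have "((%k. M k a b * cfc T (%t. z) k * chr T k t) has_sum M 0 a b * z) UNIV" for t
  proof -
   have "((%k. M k a b * cfc T (%t. z) k * chr T k t) has_sum M 0 a b * z) {0}" by (rule has_sum_finiteI) (auto simp: cfc_const)
   then show ?thesis by (subst has_sum_cong_neutral[where S="UNIV" and T="{0}" and g="%k. M k a b * cfc T (%t. z) k * chr T k t"])
     (auto simp: cfc_const)
  qed
  then have "f (%t. z) a b = (%t. M 0 a b * z)" unfolding f_def hmul_def[abs_def] by (intro ext infsumI)
  then show "EX d. f (%t. z) a b = (%t. d)" by blast
 qed
qed

lemma concat_sums:
 assumes "distinct bl"
 shows "ev (concat (map g bl)) x t = (\<Sum>b\<in>set bl. ev (g b) x t)"
  and "pd (concat (map g bl)) x y t = (\<Sum>b\<in>set bl. pd (g b) x y t)"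
  and "et (concat (map g bl)) x t = (\<Sum>b\<in>set bl. et (g b) x t)"
  and "nrm (concat (map g bl)) = (\<Sum>b\<in>set bl. nrm (g b))" using assms by (induction bl) auto

lemma hom_mem: "hom n ps ==> (w, c) \<in> set ps ==> length w = n & set w \<subseteq> {..<N} & HSl c" by (auto simp: hom_def)

lemma homological:
 fixes G :: "(real ^ 'm) \<times> real => real => real ^ 'm"
 assumes n: "n >= 1" and G: "!!a. H n M (%x t. cor (vn (G x t) a))"
  and P1G: "!!x t. P1 (G x t) = G x t" and ind: "!!u t. G (u, 0) t = G (u, 0) 0"
 obtains pp :: "'m => terms" and \<Psi> :: "(real ^ 'm) \<times> real => real => real ^ 'm" where
  "!!a. hom n (pp a)" "!!a. nrm (pp a)<=real CARD('m)*(K * real n powr s * M)"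
  "!!a w c. (w, c) \<in> set (pp a) ==> HS T (Suc l) c"
  "!!x t a. ev (pp a) x t = cor (vn (\<Psi> x t) a)"
  "!!x t. P1 (\<Psi> x t) = \<Psi> x t" "!!u t. \<Psi> (u, 0) t = \<Psi> (u, 0) 0"
  "!!x t a. LL pp x t a = cor (vn (G x t) a)"
proof -
 have "ALL a. EX ps. hom n ps & nrm ps<=M & (%x t. cor (vn (G x t) a)) = ev ps" using G unfolding H_def by blast
 from choice[OF this] obtain ps0 where ps0: "!!a. hom n (ps0 a)" "!!a. nrm (ps0 a)<=M"
  "!!a. (%x t. cor (vn (G x t) a)) = ev (ps0 a)" by blast
 have evps0: "ev (ps0 a) x t = cor (vn (G x t) a)" for a x t using ps0(3)[of a] by metis
 define ps where "ps a = mean_terms (ps0 a)" for a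
 have ind0: "ev (ps0 a) (u, 0) t = ev (ps0 a) (u, 0) 0" for a u t unfolding evps0 using ind[of u t] by simp
 note mt = mean_terms[OF ps0(1) ind0]
 have ps: "hom n (ps a)" "nrm (ps a)<=M" "ev (ps a) x t = cor (vn (G x t) a)"
  and psc: "!!w c. (w, c) \<in> set (ps a) ==> iE \<notin> set w ==> EX d. c = (%t. d)" for a x t
  using mt(1)[of a] mt(2)[of a] mt(3)[of a] mt(4)[of _ _ a] ps0(2)[of a] evps0[of a x t] unfolding ps_def by auto
 define Q where "Q w f \<longleftrightarrow> (ALL c a b. HSl c --> HS T (Suc l) (f c a b) & nm (f c a b)<=K * real (length w) powr s * nm c) &
  (ALL c a b t. HSl c --> dert (f c a b) t+sum_list (map \<mu> w) * f c a b t - (\<Sum>d\<in>UNIV. mtx L a d * f c d b t) = mtx P1 a b * c t) &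
  (ALL c a b t. HSl c --> (\<Sum>d\<in>UNIV. mtx P1 a d * f c d b t) = f c a b t) &
  (ALL z a b. EX d. f (%t. z) a b = (%t. d))" for w and f :: "(real => complex) => 'm => 'm => real => complex"
 have "ALL w. EX f. set w \<subseteq> {..<N} & w ~= [] --> Q w f"
 proof
  fix w
  show "EX f. set w \<subseteq> {..<N} & w ~= [] --> Q w f"
  proof (cases "set w \<subseteq> {..<N} & w ~= []")
   case True
   obtain f :: "(real => complex) => 'm => 'm => real => complex" where
    "!!c a b. HSl c ==> HS T (Suc l) (f c a b) & nm (f c a b)<=K * real (length w) powr s * nm c"
    "!!c a b t. HSl c ==> dert (f c a b) t+sum_list (map \<mu> w) * f c a b t - (\<Sum>d\<in>UNIV. mtx L a d * f c d b t) = mtx P1 a b * c t"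
    "!!c a b t. HSl c ==> (\<Sum>d\<in>UNIV. mtx P1 a d * f c d b t) = f c a b t"
    "!!z a b. EX d. f (%t. z) a b = (%t. d)" by (rule homological_term[OF True[THEN conjunct1] True[THEN conjunct2]]) (rule that)
   then have "Q w f" unfolding Q_def by blast
   then show ?thesis by blast
  qed blast
 qed
 from choice[OF this] obtain F where F: "!!w. set w \<subseteq> {..<N} ==> w ~= [] ==> Q w (F w)" by blast
 obtain bl :: "'m list" where bl: "set bl = UNIV" "distinct bl" using finite_distinct_list[of "UNIV :: 'm set"] by auto
 define g where "g a qs b = map (%(w, c). (w, F w c a b)) qs" for a b and qs :: terms
 define \<eta> where "\<eta> a = concat (map (%b. g a (ps b) b) bl)" for a
 note cs = concat_sums[OF bl(2), unfolded bl(1)]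
 have QF: "Q w (F w)" "HSl c" "length w = n" "set w \<subseteq> {..<N}" if "hom n qs" "(w, c) \<in> set qs" for w c qs
 proof -
  show *: "HSl c" "length w = n" "set w \<subseteq> {..<N}" using hom_mem[OF that] by auto
  show "Q w (F w)" using * n by (intro F) auto
 qed
 have gF: "HS T (Suc l) (F w c a b)" "nm (F w c a b)<=K * real n powr s * nm c"
  if "hom n qs" "(w, c) \<in> set qs" for w c qs a b using QF[OF that] unfolding Q_def by auto
 have g1: "hom n (g a qs b)" "nrm (g a qs b)<=K * real n powr s * nrm qs" if "hom n qs" for a b qs
 proof -
  show "hom n (g a qs b)" unfolding hom_def g_def using QF(2-4)[OF that] gF(1)[OF that] HS_mono(1)[of T "Suc l" _ l] by fastforce
  show "nrm (g a qs b)<=K * real n powr s * nrm qs" using that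
  proof (induction qs)
   case (Cons p qs)
   obtain w c where p: "p = (w, c)" by (cases p)
   have "nm (F w c a b)<=K * real n powr s * nm c" using gF(2)[OF Cons.prems, of w c] p by simp
   moreover have "nrm (g a qs b)<=K * real n powr s * nrm qs" using Cons p by auto
   ultimately show ?case by (simp add: g_def p algebra_simps)
  qed (simp add: g_def)
 qed
 have gL: "et (g a qs b) x t+pd (g a qs b) x (L (fst x), 0) t - (\<Sum>d\<in>UNIV. mtx L a d * ev (g d qs b) x t)
   = mtx P1 a b * ev qs x t" if "hom n qs" for a b qs x t using that
 proof (induction qs)
  case Nil then show ?case by (simp add: g_def)
 next
  case (Cons p qs)
  obtain w c where p: "p = (w, c)" by (cases p)
  have q: "Q w (F w)" "HSl c" "set w \<subseteq> {..<N}" using QF[OF Cons.prems, of w c] p by auto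
  have IH: "et (g a qs b) x t+pd (g a qs b) x (L (fst x), 0) t - (\<Sum>d\<in>UNIV. mtx L a d * ev (g d qs b) x t)
   = mtx P1 a b * ev qs x t" using Cons p by auto
  have f: "dert (F w c a b) t+sum_list (map \<mu> w) * F w c a b t - (\<Sum>d\<in>UNIV. mtx L a d * F w c d b t) = mtx P1 a b * c t"
   using q unfolding Q_def by blast
  have gc: "g a (p # qs) b = (w, F w c a b) # g a qs b" for a by (simp add: g_def p)
  have "et (g a (p # qs) b) x t+pd (g a (p # qs) b) x (L (fst x), 0) t - (\<Sum>d\<in>UNIV. mtx L a d * ev (g d (p # qs) b) x t)
   = mon w x*(dert (F w c a b) t+sum_list (map \<mu> w) * F w c a b t - (\<Sum>d\<in>UNIV. mtx L a d * F w c d b t))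
   +(et (g a qs b) x t+pd (g a qs b) x (L (fst x), 0) t - (\<Sum>d\<in>UNIV. mtx L a d * ev (g d qs b) x t))"
   unfolding gc by (simp add: dmono_L[OF q(3)] algebra_simps sum.distrib sum_distrib_left)
  then show ?case unfolding f IH by (simp add: p algebra_simps)
 qed
 have gP: "(\<Sum>d\<in>UNIV. mtx P1 a d * ev (g d qs b) x t) = ev (g a qs b) x t" if "hom n qs" for a b qs x t using that
 proof (induction qs)
  case Nil then show ?case by (simp add: g_def)
 next
  case (Cons p qs)
  obtain w c where p: "p = (w, c)" by (cases p)
  have q: "Q w (F w)" "HSl c" using QF[OF Cons.prems, of w c] p by auto
  have f: "(\<Sum>d\<in>UNIV. mtx P1 a d * F w c d b t) = F w c a b t" using q unfolding Q_def by blast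
  have gc: "g a (p # qs) b = (w, F w c a b) # g a qs b" for a by (simp add: g_def p)
  have "(\<Sum>d\<in>UNIV. mtx P1 a d * ev (g d (p # qs) b) x t)
   = mon w x*(\<Sum>d\<in>UNIV. mtx P1 a d * F w c d b t)+(\<Sum>d\<in>UNIV. mtx P1 a d * ev (g d qs b) x t)"
   unfolding gc by (simp add: algebra_simps sum.distrib sum_distrib_left)
  moreover have "(\<Sum>d\<in>UNIV. mtx P1 a d * ev (g d qs b) x t) = ev (g a qs b) x t" using Cons p by auto
  ultimately show ?case unfolding f by (simp only: gc ev_simps(2))
 qed
 have gI: "ev (g a (ps b) b) (u, 0) t = ev (g a (ps b) b) (u, 0) 0" for a b u t
 proof -
  have "mon w (u, 0) * F w c a b t = mon w (u, 0) * F w c a b 0" if m: "(w, c) \<in> set (ps b)" for w c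
  proof (cases "iE \<in> set w")
   case True then show ?thesis by (simp add: mon_E)
  next
   case False
   then obtain d where "c = (%t. d)" using psc[OF m] by blast
   moreover have "Q w (F w)" using QF(1)[OF ps(1) m] .
   ultimately obtain d' where "F w c a b = (%t. d')" unfolding Q_def by blast
   then show ?thesis by simp
  qed
  then show ?thesis unfolding ev_def g_def by (intro arg_cong[where f=sum_list]) (auto simp: o_def)
 qed
 have LLchi: "LL \<eta> x t a = cor (vn (G x t) a)" for x t a
 proof -
  have "LL \<eta> x t a = (\<Sum>b\<in>UNIV. et (g a (ps b) b) x t)+(\<Sum>b\<in>UNIV. pd (g a (ps b) b) x (L (fst x), 0) t)
    - (\<Sum>d\<in>UNIV. \<Sum>b\<in>UNIV. mtx L a d * ev (g d (ps b) b) x t)" unfolding LL_def \<eta>_def cs by (simp add: sum_distrib_left)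
  also have "(\<Sum>d\<in>UNIV. \<Sum>b\<in>UNIV. mtx L a d * ev (g d (ps b) b) x t) = (\<Sum>b\<in>UNIV. \<Sum>d\<in>UNIV. mtx L a d * ev (g d (ps b) b) x t)"
   by (rule sum.swap)
  also have "(\<Sum>b\<in>UNIV. et (g a (ps b) b) x t)+(\<Sum>b\<in>UNIV. pd (g a (ps b) b) x (L (fst x), 0) t)
    - (\<Sum>b\<in>UNIV. \<Sum>d\<in>UNIV. mtx L a d * ev (g d (ps b) b) x t)
   = (\<Sum>b\<in>UNIV. et (g a (ps b) b) x t+pd (g a (ps b) b) x (L (fst x), 0) t - (\<Sum>d\<in>UNIV. mtx L a d * ev (g d (ps b) b) x t))"
   by (simp add: sum.distrib sum_subtractf)
  also have "... = (\<Sum>b\<in>UNIV. mtx P1 a b * cor (vn (G x t) b))" unfolding gL[OF ps(1)] ps(3) ..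
  also have "... = cor (vn (P1 (G x t)) a)" by (rule mtx_apply[OF linP1, symmetric])
  finally show ?thesis unfolding P1G .
 qed
 have Pchi: "(\<Sum>d\<in>UNIV. mtx P1 a d * ev (\<eta> d) x t) = ev (\<eta> a) x t" for a x t
 proof -
  have "(\<Sum>d\<in>UNIV. mtx P1 a d * ev (\<eta> d) x t) = (\<Sum>b\<in>UNIV. \<Sum>d\<in>UNIV. mtx P1 a d * ev (g d (ps b) b) x t)"
   unfolding \<eta>_def cs sum_distrib_left by (rule sum.swap)
  then show ?thesis unfolding gP[OF ps(1)] \<eta>_def cs .
 qed
 have chi: "hom n (\<eta> a)" "!!w c. (w, c) \<in> set (\<eta> a) ==> HS T (Suc l) c" for a
 proof -
  show "hom n (\<eta> a)" using g1(1)[OF ps(1)] unfolding \<eta>_def hom_def by auto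
  show "HS T (Suc l) c" if wc: "(w, c) \<in> set (\<eta> a)" for w c
  proof -
   from wc obtain b c0 where "(w, c0) \<in> set (ps b)" "c = F w c0 a b" unfolding \<eta>_def g_def by auto
   then show ?thesis using gF(1)[OF ps(1)] by simp
  qed
 qed
 have nrmchi: "nrm (\<eta> a)<=real CARD('m)*(K * real n powr s * M)" for a
 proof -
  have "nrm (\<eta> a)<=(\<Sum>b\<in>(UNIV::'m set). K * real n powr s * M)" unfolding \<eta>_def cs
  proof (rule sum_mono)
   fix b
   have "nrm (g a (ps b) b)<=K * real n powr s * nrm (ps b)" by (rule g1(2)[OF ps(1)])
   also have "...<=K * real n powr s * M" using K by (intro mult_left_mono ps(2)) auto
   finally show "nrm (g a (ps b) b)<=K * real n powr s * M" .
  qed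
  then show ?thesis by simp
 qed
 define \<Psi> where "\<Psi> x t = (\<chi> a. Re (ev (\<eta> a) x t))" for x t
 have re1: "hom n (re_terms (\<eta> a))" for a by (rule re_terms(1)[OF chi(1)], erule chi(2))
 have re2: "nrm (re_terms (\<eta> a))<=nrm (\<eta> a)" for a by (rule re_terms(2)[OF chi(1)], erule chi(2))
 have re3: "HS T (Suc l) c" if "(w, c) \<in> set (re_terms (\<eta> a))" for a w c by (rule re_terms(3)[OF chi(1) _ that], erule chi(2))
 have re4: "ev (re_terms (\<eta> a)) x t = of_real (Re (ev (\<eta> a) x t))" for a x t by (rule re_terms(4)[OF chi(1)], erule chi(2))
 have re5: "pd (re_terms (\<eta> a)) x y t = of_real (Re (pd (\<eta> a) x y t))" for a x y t by (rule re_terms(5)[OF chi(1)], erule chi(2))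
 have re6: "et (re_terms (\<eta> a)) x t = of_real (Re (et (\<eta> a) x t))" for a x t by (rule re_terms(6)[OF chi(1)], erule chi(2))
 show thesis
 proof (rule that[of "%a. re_terms (\<eta> a)" \<Psi>])
  show "hom n (re_terms (\<eta> a))" for a by (rule re1)
  show "nrm (re_terms (\<eta> a))<=real CARD('m)*(K * real n powr s * M)" for a using re2[of a] nrmchi[of a] by linarith
  show "HS T (Suc l) c" if "(w, c) \<in> set (re_terms (\<eta> a))" for a w c using re3[OF that] .
  show "ev (re_terms (\<eta> a)) x t = cor (vn (\<Psi> x t) a)" for x t a unfolding re4 by (simp add: \<Psi>_def)
  show "P1 (\<Psi> x t) = \<Psi> x t" for x t
  proof (rule vec_eq_iff[THEN iffD2], rule allI)
   fix a
   have "vn (P1 (\<Psi> x t)) a = (\<Sum>c\<in>UNIV. vn (P1 (axis c 1)) a * Re (ev (\<eta> c) x t))"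
    by (subst linear_component[OF linP1]) (simp add: \<Psi>_def)
   also have "... = Re (\<Sum>c\<in>UNIV. mtx P1 a c * ev (\<eta> c) x t)" by simp
   also have "... = vn (\<Psi> x t) a" unfolding Pchi by (simp add: \<Psi>_def)
   finally show "vn (P1 (\<Psi> x t)) a = vn (\<Psi> x t) a" .
  qed
  show "\<Psi> (u, 0) t = \<Psi> (u, 0) 0" for u t
  proof -
   have "ev (\<eta> a) (u, 0) t = ev (\<eta> a) (u, 0) 0" for a unfolding \<eta>_def cs using gI by (intro sum.cong) auto
   then show ?thesis unfolding \<Psi>_def by (simp add: vec_eq_iff)
  qed
  show "LL (%a. re_terms (\<eta> a)) x t a = cor (vn (G x t) a)" for x t a
  proof -
   have "LL (%a. re_terms (\<eta> a)) x t a = cor (Re (LL \<eta> x t a))" unfolding LL_def re4 re5 re6 by simp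
   then show ?thesis unfolding LLchi by simp
  qed
 qed
qed

end

section \<open>Majorants\<close>

lemma fps_prod_list_cong:
 fixes F G :: "'i => 'a :: comm_ring_1 fps"
 assumes "!!i k. k<=n ==> fps_nth (F i) k = fps_nth (G i) k" "k<=n"
 shows "fps_nth (prod_list (map F w)) k = fps_nth (prod_list (map G w)) k" using assms(2)
proof (induction w arbitrary: k)
 case (Cons i w)
 then show ?case by (simp add: fps_mult_nth assms(1))
qed simp

lemma fps_prod_list_0:
 fixes F :: "'i => 'a :: comm_ring_1 fps"
 assumes "!!i. fps_nth (F i) 0 = 0" "k < length w"
 shows "fps_nth (prod_list (map F w)) k = 0" using assms(2)
proof (induction w arbitrary: k)
 case (Cons i w)
 show ?case unfolding list.map prod_list.Cons fps_mult_nth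
 proof (rule sum.neutral, rule ballI)
  fix j assume j: "j \<in> {0..k}"
  show "fps_nth (F i) j * fps_nth (prod_list (map F w)) (k - j) = 0" using Cons.IH[of "k - j"] Cons.prems j assms(1)[of i] by (cases "j = 0") auto
 qed
qed simp

lemma fps_prod_list_cong_strict:
 fixes F G :: "'i => 'a :: comm_ring_1 fps"
 assumes eq: "!!i k. k < n ==> fps_nth (F i) k = fps_nth (G i) k"
  and z: "!!i. fps_nth (F i) 0 = 0" "!!i. fps_nth (G i) 0 = 0" and w: "length w >= 2"
 shows "fps_nth (prod_list (map F w)) n = fps_nth (prod_list (map G w)) n"
proof -
 obtain i v where wv1: "w = i # v" using w by (cases w) auto
 then have wv: "w = i # v" "v ~= []" using w by auto
 show ?thesis unfolding wv list.map prod_list.Cons fps_mult_nth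
 proof (rule sum.cong[OF refl])
  fix j assume j: "j \<in> {0..n}"
  show "fps_nth (F i) j * fps_nth (prod_list (map F v)) (n - j) = fps_nth (G i) j * fps_nth (prod_list (map G v)) (n - j)"
  proof (cases "j = 0 \<or> j = n")
   case True
   then show ?thesis using z fps_prod_list_0[of F 0 v] fps_prod_list_0[of G 0 v] wv(2) by auto
  next
   case False
   then have "n - j < n" "j < n" using j by auto
   then have "fps_nth (prod_list (map F v)) (n - j) = fps_nth (prod_list (map G v)) (n - j)" by (intro fps_prod_list_cong[where n="n - 1"] eq) auto
   then show ?thesis using eq[OF \<open>j < n\<close>, of i] by simp
  qed
 qed
qed

lemma prod_list_map_const: "prod_list (map (%_. c) w) = c ^ length w" by (induction w) auto

lemma fps_power_nonneg:
 fixes F :: "real fps"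
 assumes "!!n. fps_nth F n >= 0" shows "fps_nth (F ^ q) n >= 0"
proof (induction q arbitrary: n)
 case (Suc q) then show ?case using assms by (auto simp: fps_mult_nth intro!: sum_nonneg)
qed simp

lemma sum_cauchy_le:
 fixes a b :: "nat => real"
 assumes "!!n. a n >= 0" "!!n. b n >= 0"
 shows "(\<Sum>n\<le>J. \<Sum>i\<le>n. a i * b (n - i))<=(\<Sum>i\<le>J. a i)*(\<Sum>j\<le>J. b j)"
proof -
 have "(\<Sum>n\<le>J. \<Sum>i\<le>n. a i * b (n - i)) = (\<Sum>(n, i)\<in>(SIGMA n:{..J}. {..n}). a i * b (n - i))" by (subst sum.Sigma) auto
 also have "... = (\<Sum>(i, j)\<in>(%(n, i). (i, n - i)) ` (SIGMA n:{..J}. {..n}). a i * b j)"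
  by (subst sum.reindex) (auto simp: inj_on_def intro!: sum.cong)
 also have "...<=(\<Sum>(i, j)\<in>{..J} \<times> {..J}. a i * b j)" by (rule sum_mono2) (auto intro!: mult_nonneg_nonneg assms)
 also have "... = (\<Sum>i\<le>J. a i)*(\<Sum>j\<le>J. b j)" by (simp add: sum_product sum.cartesian_product)
 finally show ?thesis .
qed

lemma fps_power_sum_le:
 fixes F :: "real fps" and r :: real
 assumes F: "!!n. fps_nth F n >= 0" and r: "r >= 0"
 shows "(\<Sum>n\<le>J. r ^ n * fps_nth (F ^ q) n)<=(\<Sum>n\<le>J. r ^ n * fps_nth F n) ^ q"
proof (induction q)
 case 0
 have "(\<Sum>n\<le>J. r ^ n * fps_nth (F ^ 0) n) = (\<Sum>n\<le>J. if n = 0 then 1 else 0)" by (intro sum.cong) auto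
 then show ?case by simp
next
 case (Suc q)
 have "(\<Sum>n\<le>J. r ^ n * fps_nth (F ^ Suc q) n) = (\<Sum>n\<le>J. \<Sum>i\<le>n. (r ^ i * fps_nth F i)*(r ^ (n - i) * fps_nth (F ^ q) (n - i)))"
 proof (rule sum.cong[OF refl])
  fix n
  have "r ^ n * fps_nth (F ^ Suc q) n = (\<Sum>i\<le>n. r ^ n*(fps_nth F i * fps_nth (F ^ q) (n - i)))"
   by (simp add: fps_mult_nth sum_distrib_left atMost_atLeast0)
  also have "... = (\<Sum>i\<le>n. (r ^ i * fps_nth F i)*(r ^ (n - i) * fps_nth (F ^ q) (n - i)))"
  proof (rule sum.cong[OF refl])
   fix i assume "i \<in> {..n}"
   then have "r ^ n = r ^ i * r ^ (n - i)" by (simp flip: power_add)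
   then show "r ^ n*(fps_nth F i * fps_nth (F ^ q) (n - i)) = (r ^ i * fps_nth F i)*(r ^ (n - i) * fps_nth (F ^ q) (n - i))" by simp
  qed
  finally show "r ^ n * fps_nth (F ^ Suc q) n = (\<Sum>i\<le>n. (r ^ i * fps_nth F i)*(r ^ (n - i) * fps_nth (F ^ q) (n - i)))" .
 qed
 also have "...<=(\<Sum>n\<le>J. r ^ n * fps_nth F n)*(\<Sum>n\<le>J. r ^ n * fps_nth (F ^ q) n)"
  using r F fps_power_nonneg[OF F] by (intro sum_cauchy_le) auto
 also have "...<=(\<Sum>n\<le>J. r ^ n * fps_nth F n)*(\<Sum>n\<le>J. r ^ n * fps_nth F n) ^ q"
  using Suc r F by (intro mult_left_mono sum_nonneg) auto
 finally show ?case by simp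
qed

lemma geometric_tail_le:
 fixes x :: real
 assumes "0<=x" "x<=1/2"
 shows "(\<Sum>q\<in>{2..J}. x ^ q)<=2 * x\<^sup>2"
proof -
 have "(\<Sum>q\<in>{2..J}. x ^ q) = (\<Sum>q\<in>{2..J}. x\<^sup>2 * x ^ (q - 2))"
 proof (rule sum.cong[OF refl])
  fix q assume "q \<in> {2..J}"
  then show "x ^ q = x\<^sup>2 * x ^ (q - 2)" using power_add[of x 2 "q - 2"] by (metis atLeastAtMost_iff le_add_diff_inverse)
 qed
 also have "... = x\<^sup>2*(\<Sum>q\<in>(%q. q - 2) ` {2..J}. x ^ q)" by (subst sum.reindex) (auto simp: inj_on_def sum_distrib_left)
 finally have e: "(\<Sum>q\<in>{2..J}. x ^ q) = x\<^sup>2*(\<Sum>q\<in>(%q. q - 2) ` {2..J}. x ^ q)" .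
 have "(\<Sum>q\<in>(%q. q - 2) ` {2..J}. x ^ q)<=(\<Sum>q. x ^ q)" using assms by (intro sum_le_suminf summable_geometric) auto
 also have "(\<Sum>q. x ^ q) = 1 / (1 - x)" using assms by (intro suminf_geometric) auto
 also have "...<=2" using assms by (simp add: field_simps)
 finally have "x\<^sup>2*(\<Sum>q\<in>(%q. q - 2) ` {2..J}. x ^ q)<=x\<^sup>2*2" by (rule mult_left_mono) simp
 then show ?thesis by (simp only: e mult.commute)
qed

locale majorant =
 fixes cv k2 c1 m A C0 s :: real
 assumes pos: "cv >= 0" "k2 > 0" "c1 >= 0" "m >= 0" "A >= 0" "C0 > 0" "s >= 0"
begin

definition uu :: "(nat => real) => nat => real" where
 "uu ph n = (if n = 1 then C0 else 0)+ph n"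

definition gg :: "(nat => real) => nat => real" where
 "gg ph n = (\<Sum>q\<in>{2..n}. cv * k2 ^ q * fps_nth (Abs_fps (uu ph) ^ q) n)"

definition hh :: "(nat => real) => nat => real" where
 "hh ph n = c1 * gg ph n+(\<Sum>i\<in>{2..<n}. real i * ph i*(m * gg ph (n+1 - i)))"

context
 fixes ph :: "nat => real"
 assumes ph: "!!n. ph n >= 0" and ph0: "!!n. n < 2 ==> ph n = 0"
begin

lemma uu_nonneg: "uu ph n >= 0" using ph[of n] pos by (simp add: uu_def)

lemma uu_0: "uu ph 0 = 0" using ph0[of 0] by (simp add: uu_def)

lemma gg_nonneg: "gg ph n >= 0" unfolding gg_def using pos fps_power_nonneg[of "Abs_fps (uu ph)"] uu_nonneg
 by (intro sum_nonneg mult_nonneg_nonneg) auto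

lemma gg_sum_le:
 assumes r: "r >= 0" and J: "J >= 1" and S: "(\<Sum>n\<le>J - 1. r ^ n * uu ph n)<=S" and kS: "k2 * S<=1/2"
 shows "(\<Sum>n\<le>J. r ^ n * gg ph n)<=2 * cv * k2\<^sup>2 * S\<^sup>2"
proof -
 define F where "F = Abs_fps (uu ph)"
 define F' where "F' = Abs_fps (%n. if n<=J - 1 then uu ph n else 0)"
 have S0: "S >= 0" using S order_trans[OF sum_nonneg S] r uu_nonneg by auto
 have FF: "fps_nth (F ^ q) n = fps_nth (F' ^ q) n" if "q >= 2" "n<=J" for q n
 proof -
  have "fps_nth (prod_list (map (%_. F) (replicate q ()))) n = fps_nth (prod_list (map (%_. F') (replicate q ()))) n"
   using that J uu_0 by (intro fps_prod_list_cong_strict) (auto simp: F_def F'_def)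
  then show ?thesis by (simp add: prod_list_map_const)
 qed
 have "(\<Sum>n\<le>J. r ^ n * gg ph n) = (\<Sum>n\<le>J. \<Sum>q\<in>{2..J}. if q<=n then cv * k2 ^ q*(r ^ n * fps_nth (F ^ q) n) else 0)"
 proof (rule sum.cong[OF refl])
  fix n assume n: "n \<in> {..J}"
  have "r ^ n * gg ph n = (\<Sum>q\<in>{2..n}. cv * k2 ^ q*(r ^ n * fps_nth (F ^ q) n))" by (simp add: gg_def F_def sum_distrib_left mult_ac)
  also have "... = (\<Sum>q\<in>{2..J}. if q<=n then cv * k2 ^ q*(r ^ n * fps_nth (F ^ q) n) else 0)"
   using n by (intro sum.mono_neutral_cong_left) auto
  finally show "r ^ n * gg ph n = (\<Sum>q\<in>{2..J}. if q<=n then cv * k2 ^ q*(r ^ n * fps_nth (F ^ q) n) else 0)" .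
 qed
 also have "... = (\<Sum>q\<in>{2..J}. \<Sum>n\<le>J. if q<=n then cv * k2 ^ q*(r ^ n * fps_nth (F ^ q) n) else 0)" by (rule sum.swap)
 also have "...<=(\<Sum>q\<in>{2..J}. cv * (k2 * S) ^ q)"
 proof (rule sum_mono)
  fix q assume q: "q \<in> {2..J}"
  have F'0: "fps_nth F' n >= 0" for n using uu_nonneg by (simp add: F'_def)
  have "(\<Sum>n\<le>J. if q<=n then cv * k2 ^ q*(r ^ n * fps_nth (F ^ q) n) else 0)
   <=(\<Sum>n\<le>J. cv * k2 ^ q*(r ^ n * fps_nth (F' ^ q) n))" using FF q r pos fps_power_nonneg[OF F'0] by (intro sum_mono) auto
  also have "... = cv * k2 ^ q*(\<Sum>n\<le>J. r ^ n * fps_nth (F' ^ q) n)" by (simp add: sum_distrib_left)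
  also have "...<=cv * k2 ^ q*(\<Sum>n\<le>J. r ^ n * fps_nth F' n) ^ q" using pos by (intro mult_left_mono fps_power_sum_le F'0 r) auto
  also have "(\<Sum>n\<le>J. r ^ n * fps_nth F' n) = (\<Sum>n\<le>J - 1. r ^ n * uu ph n)"
   using J by (intro sum.mono_neutral_cong_right) (auto simp: F'_def)
  also have "cv * k2 ^ q * ... ^ q<=cv * k2 ^ q * S ^ q" using pos S r uu_nonneg by (intro mult_left_mono power_mono sum_nonneg) auto
  finally show "(\<Sum>n\<le>J. if q<=n then cv * k2 ^ q*(r ^ n * fps_nth (F ^ q) n) else 0)<=cv * (k2 * S) ^ q"
   by (simp add: power_mult_distrib mult.assoc)
 qed
 also have "... = cv * (\<Sum>q\<in>{2..J}. (k2 * S) ^ q)" by (simp add: sum_distrib_left)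
 also have "...<=cv * (2*(k2 * S)\<^sup>2)" using pos S0 kS by (intro mult_left_mono geometric_tail_le) auto
 finally show ?thesis by (simp add: power_mult_distrib mult_ac)
qed

lemma hh_sum_le:
 assumes r: "r > 0" and J: "J >= 1" and S: "(\<Sum>n\<le>J - 1. r ^ n * uu ph n)<=S" and kS: "k2 * S<=1/2"
  and p: "!!i. i < J ==> i > p ==> ph i = 0"
 shows "(\<Sum>n\<le>J. r ^ n * hh ph n)<=(c1+m * real p * S / r)*(2 * cv * k2\<^sup>2 * S\<^sup>2)"
proof -
 define \<Gamma> where "\<Gamma> = (\<Sum>n\<le>J. r ^ n * gg ph n)"
 have \<Gamma>: "\<Gamma><=2 * cv * k2\<^sup>2 * S\<^sup>2" unfolding \<Gamma>_def using r by (intro gg_sum_le J S kS) auto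
 have \<Gamma>0: "\<Gamma> >= 0" unfolding \<Gamma>_def using r gg_nonneg by (intro sum_nonneg) auto
 have S0: "S >= 0" using S order_trans[OF sum_nonneg S] r uu_nonneg by auto
 have "(\<Sum>n\<le>J. r ^ n*(\<Sum>i\<in>{2..<n}. real i * ph i*(m * gg ph (n+1 - i))))
   = (\<Sum>(n, i)\<in>(SIGMA n:{..J}. {2..<n}). (m / r)*((real i*(r ^ i * ph i))*(r ^ (n+1 - i) * gg ph (n+1 - i))))"
  unfolding sum_distrib_left
 proof (subst sum.Sigma, simp, simp, intro sum.cong refl, clarsimp)
  fix n i assume "n<=J" "2<=i" "i < n"
  then have "r ^ n * r = r ^ i * r ^ (n+1 - i)" by (simp flip: power_add power_Suc2)
  then show "r ^ n*(real i * ph i*(m * gg ph (Suc n - i))) = m*(real i*(r ^ i * ph i)*(r ^ (Suc n - i) * gg ph (Suc n - i))) / r"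
   using r by (simp add: field_simps)
 qed
 also have "... = (m / r)*(\<Sum>(i, k)\<in>(%(n, i). (i, n+1 - i)) ` (SIGMA n:{..J}. {2..<n}). (real i*(r ^ i * ph i))*(r ^ k * gg ph k))"
  by (subst sum.reindex) (auto simp: inj_on_def sum_distrib_left intro!: sum.cong)
 also have "...<=(m / r)*(\<Sum>(i, k)\<in>{..J - 1} \<times> {..J}. (real i*(r ^ i * ph i))*(r ^ k * gg ph k))"
  using r pos ph gg_nonneg by (intro mult_left_mono sum_mono2) auto
 also have "... = (m / r)*((\<Sum>i\<le>J - 1. real i*(r ^ i * ph i)) * \<Gamma>)" by (simp add: sum_product sum.cartesian_product \<Gamma>_def)
 also have "...<=(m / r)*((real p * S) * \<Gamma>)"
 proof (intro mult_left_mono mult_right_mono \<Gamma>0)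
  have "(\<Sum>i\<le>J - 1. real i*(r ^ i * ph i))<=(\<Sum>i\<le>J - 1. real p*(r ^ i * uu ph i))"
  proof (rule sum_mono)
   fix i assume i: "i \<in> {..J - 1}"
   show "real i*(r ^ i * ph i)<=real p*(r ^ i * uu ph i)"
   proof (cases "i<=p")
    case True
    then show ?thesis using r ph pos by (intro mult_mono) (auto simp: uu_def)
   next
    case False
    then show ?thesis using p[of i] i J r uu_nonneg by auto
   qed
  qed
  also have "... = real p*(\<Sum>i\<le>J - 1. r ^ i * uu ph i)" by (simp add: sum_distrib_left)
  also have "...<=real p * S" by (intro mult_left_mono S) auto
  finally show "(\<Sum>i\<le>J - 1. real i*(r ^ i * ph i))<=real p * S" .
 qed (use r pos in auto)
 finally have 2: "(\<Sum>n\<le>J. r ^ n*(\<Sum>i\<in>{2..<n}. real i * ph i*(m * gg ph (n+1 - i))))<=(m * real p * S / r) * \<Gamma>"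
  by (simp add: mult_ac)
 have "(\<Sum>n\<le>J. r ^ n * hh ph n) = c1 * \<Gamma>+(\<Sum>n\<le>J. r ^ n*(\<Sum>i\<in>{2..<n}. real i * ph i*(m * gg ph (n+1 - i))))"
  by (simp add: hh_def distrib_left sum.distrib \<Gamma>_def sum_distrib_left mult_ac)
 also have "...<=(c1+m * real p * S / r) * \<Gamma>" using 2 by (simp add: distrib_right)
 also have "...<=(c1+m * real p * S / r)*(2 * cv * k2\<^sup>2 * S\<^sup>2)" using pos S0 r by (intro mult_left_mono \<Gamma>) auto
 finally show ?thesis .
qed

lemma hh_nonneg: "hh ph n >= 0" unfolding hh_def using pos gg_nonneg ph by (auto intro!: add_nonneg_nonneg sum_nonneg)

lemma hh_rec_bound:
 assumes rec: "!!n. 2<=n ==> n<=p ==> ph n<=A * real n powr s * hh ph n"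
  and r: "r > 0" "4 * k2 * C0 * r<=1" and small: "A * real p powr s*((c1+2 * m * C0 * real p)*(8 * cv * k2\<^sup>2 * C0)) * r<=1"
  and p: "p >= 1"
 shows "J<=p ==> (\<Sum>n\<le>J. r ^ n * uu ph n)<=2 * C0 * r"
proof (induction J)
 case 0 then show ?case using pos r by (simp add: uu_0)
next
 case (Suc J)
 show ?case
 proof (cases "J = 0")
  case True
  then show ?thesis using pos r ph0[of 0] ph0[of 1] by (simp add: uu_def)
 next
  case False
  have IH: "(\<Sum>n\<le>Suc J - 1. r ^ n * uu ph n)<=2 * C0 * r" using Suc by simp
  have "(\<Sum>n\<le>Suc J. r ^ n * hh ph n)<=(c1+m * real p*(2 * C0 * r) / r)*(2 * cv * k2\<^sup>2*(2 * C0 * r)\<^sup>2)"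
   using r Suc.prems by (intro hh_sum_le IH) auto
  also have "... = (c1+2 * m * C0 * real p)*(8 * cv * k2\<^sup>2 * C0)*(C0 * r * r)" using r by (simp add: power2_eq_square field_simps)
  finally have h: "(\<Sum>n\<le>Suc J. r ^ n * hh ph n)<=(c1+2 * m * C0 * real p)*(8 * cv * k2\<^sup>2 * C0)*(C0 * r * r)" .
  have "(\<Sum>n\<le>Suc J. r ^ n * uu ph n) = (\<Sum>n\<le>Suc J. (if n = 1 then C0 * r else 0)+r ^ n * ph n)"
   by (intro sum.cong) (auto simp: uu_def distrib_left)
  also have "... = C0 * r+(\<Sum>n\<le>Suc J. r ^ n * ph n)" by (simp add: sum.distrib)
  also have "(\<Sum>n\<le>Suc J. r ^ n * ph n)<=(\<Sum>n\<le>Suc J. A * real p powr s*(r ^ n * hh ph n))"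
  proof (rule sum_mono)
   fix n assume n: "n \<in> {..Suc J}"
   show "r ^ n * ph n<=A * real p powr s*(r ^ n * hh ph n)"
   proof (cases "n < 2")
    case True then show ?thesis using ph0 pos r hh_nonneg by auto
   next
    case False
    have "ph n<=A * real n powr s * hh ph n" using n Suc.prems False by (intro rec) auto
    also have "...<=A * real p powr s * hh ph n" using n Suc.prems pos hh_nonneg by (intro mult_right_mono mult_left_mono powr_mono2) auto
    finally show ?thesis using r by (simp add: mult_ac mult_left_mono)
   qed
  qed
  also have "... = A * real p powr s*(\<Sum>n\<le>Suc J. r ^ n * hh ph n)" by (rule sum_distrib_left[symmetric])
  also have "...<=A * real p powr s*((c1+2 * m * C0 * real p)*(8 * cv * k2\<^sup>2 * C0)*(C0 * r * r))"
   using pos by (intro mult_left_mono h) auto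
  also have "... = (A * real p powr s*((c1+2 * m * C0 * real p)*(8 * cv * k2\<^sup>2 * C0)) * r)*(C0 * r)" by (simp add: mult_ac)
  also have "...<=1*(C0 * r)" using pos r by (intro mult_right_mono small) auto
  finally show ?thesis by simp
 qed
qed

end

end

section \<open>The formal invariant graph\<close>

definition words :: "nat => 'i list set" where "words q = {w. length w = q}"

lemma finite_words [simp]: "finite (words q :: 'i :: finite list set)" using finite_lists_length_eq[of "UNIV :: 'i set" q] by (simp add: words_def)

lemma card_words: "card (words q :: 'i :: finite list set) = CARD('i) ^ q" using card_lists_length_eq[of "UNIV :: 'i set" q] by (simp add: words_def)

lemma vec_expand: "(\<Sum>a\<in>UNIV. vn u a *\<^sub>R axis a (1::real)) = (u :: real ^ 'm)"
 using basis_expansion[of u] by (simp add: scalar_mult_eq_scaleR)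

lemma has_vector_derivative_vec:
 fixes f :: "real => real ^ 'm"
 assumes "!!a. ((%r. vn (f r) a) has_vector_derivative vn f' a) F"
 shows "(f has_vector_derivative f') F"
proof -
 have "((%r. \<Sum>a\<in>UNIV. vn (f r) a *\<^sub>R axis a (1::real)) has_vector_derivative (\<Sum>a\<in>UNIV. vn f' a *\<^sub>R axis a (1::real))) F"
  by (intro has_vector_derivative_sum bounded_linear.has_vector_derivative[OF bounded_linear_scaleR_left assms])
 then show ?thesis by (simp only: vec_expand)
qed

locale nf_vector = normal_form T l N \<zeta> L P0 P1 \<mu> \<sigma> iE cP K s
 for T :: real and l N :: nat and \<zeta> :: "nat => (real ^ 'm) \<times> real => complex"
  and L P0 P1 :: "real ^ 'm => real ^ 'm" and \<mu> :: "nat => complex" and \<sigma> :: "nat => nat"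
  and iE :: nat and cP :: "'m => nat => complex" and K s :: real +
 fixes v :: "'m option list => real => real ^ 'm" and cv ka :: real
 assumes v_HS: "HS T l (%t. cor (vn (v w t) a))"
  and v_le: "malg l * hn T l (%t. cor (vn (v w t) a))<=cv * ka ^ length w"
  and cv: "cv >= 0" and ka: "ka > 0"
  and v_const: "None \<notin> set w ==> v w t = v w 0"
begin

definition cP1 :: real where "cP1 = (\<Sum>a\<in>UNIV. \<Sum>c\<in>UNIV. norm (mtx P1 a c))"

definition cU :: real where "cU = malg l*(1+(\<Sum>a\<in>UNIV. \<Sum>i<N. norm (cP a i)))"

lemma cP1_nonneg: "cP1 >= 0" unfolding cP1_def by (intro sum_nonneg) auto

lemma cU_pos: "cU > 0" unfolding cU_def using malg_pos by (intro mult_pos_pos add_pos_nonneg sum_nonneg) auto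

sublocale maj: majorant cv "ka*(real CARD('m)+1)" cP1 "real CARD('m)" "real CARD('m) * K" cU s
 using cv ka cP1_nonneg cU_pos K s by unfold_locales (auto simp: add_nonneg_pos)

definition Uc :: "(nat => (real ^ 'm) \<times> real => real => real ^ 'm) => nat => (real ^ 'm) \<times> real => real => 'm option => real" where
 "Uc Ph n x t i = (case i of None => if n = 1 then snd x else 0
  | Some a => (if n = 1 then vn (P0 (fst x)) a else 0)+vn (Ph n x t) a)"

definition uf :: "(nat => (real ^ 'm) \<times> real => real => real ^ 'm) => (real ^ 'm) \<times> real => real => 'm option => real fps" where
 "uf Ph x t i = Abs_fps (%n. Uc Ph n x t i)"

lemma uf_nth [simp]: "fps_nth (uf Ph x t i) n = Uc Ph n x t i" by (simp add: uf_def)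

definition VN :: "(nat => (real ^ 'm) \<times> real => real => real ^ 'm) => nat => (real ^ 'm) \<times> real => real => real ^ 'm" where
 "VN Ph n x t = (\<Sum>q\<in>{2..n}. \<Sum>w\<in>words q. fps_nth (prod_list (map (uf Ph x t) w)) n *\<^sub>R v w t)"

definition PD :: "('m => terms) => (real ^ 'm) \<times> real => real ^ 'm => real => real ^ 'm" where
 "PD pp x y t = (\<chi> a. Re (pd (pp a) x (y, 0) t))"

definition NN :: "(nat => 'm => terms) => (nat => (real ^ 'm) \<times> real => real => real ^ 'm) => nat => (real ^ 'm) \<times> real => real => real ^ 'm" where
 "NN pp Ph n x t = P1 (VN Ph n x t) - (\<Sum>i\<in>{2..<n}. PD (pp i) x (P0 (VN Ph (n+1 - i) x t)) t)"

definition good :: "nat => ('m => terms) => ((real ^ 'm) \<times> real => real => real ^ 'm) => real => bool" where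
 "good n pp Ph ph \<longleftrightarrow> (ALL a. hom n (pp a) & nrm (pp a)<=ph & (ALL w c. (w, c) \<in> set (pp a) --> HS T (Suc l) c) &
  (ALL x t. ev (pp a) x t = cor (vn (Ph x t) a))) &
  (ALL x t. P1 (Ph x t) = Ph x t) & (ALL u t. Ph (u, 0) t = Ph (u, 0) 0)"

lemma good_zero: "good n (%_. []) (%_ _. 0) 0" by (auto simp: good_def linear_0[OF linP1])

lemma goodD:
 assumes "good n pp Ph ph"
 shows "hom n (pp a)" "nrm (pp a)<=ph" "(w, c) \<in> set (pp a) ==> HS T (Suc l) c"
  "ev (pp a) x t = cor (vn (Ph x t) a)" "P1 (Ph x t) = Ph x t" "Ph (u, 0) t = Ph (u, 0) 0"
  "ph >= 0" "H n ph (%x t. cor (vn (Ph x t) a))"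
proof -
 show *: "hom n (pp a)" "nrm (pp a)<=ph" "(w, c) \<in> set (pp a) ==> HS T (Suc l) c"
  "P1 (Ph x t) = Ph x t" "Ph (u, 0) t = Ph (u, 0) 0"
  "ev (pp a) x t = cor (vn (Ph x t) a)" for a x t using assms unfolding good_def by blast+
 show "ph >= 0" using *(2) nrm_nonneg order_trans by blast
 have "(%x t. cor (vn (Ph x t) a)) = ev (pp a)" by (intro ext) (simp add: *(6))
 then show "H n ph (%x t. cor (vn (Ph x t) a))" unfolding H_def using *(1,2) by blast
qed

lemma pd_directional: "((%r. ev ps (x+r *\<^sub>R y) t) has_vector_derivative pd ps x y t) (at 0)"
proof -
 have u: "((%r. x+r *\<^sub>R y) has_vector_derivative y) (at 0)" by (auto intro!: derivative_eq_intros)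
 show ?thesis
 proof (induction ps)
  case (Cons p ps)
  obtain w c where p: "p = (w, c)" by (cases p)
  have "((%r. mon w (x+r *\<^sub>R y) * c t) has_vector_derivative dmono w (x+0 *\<^sub>R y) y * c t) (at 0)"
   by (rule has_vector_derivative_mult_left) (rule mon_has_vector_derivative[OF u])
  from has_vector_derivative_add[OF this Cons] show ?case by (simp add: p)
 qed simp
qed

lemma PD_eq:
 assumes "good n pp Ph ph"
 shows "pd (pp a) x (y, 0) t = cor (vn (PD pp x y t) a)"
  and "((%r. Ph (x+r *\<^sub>R (y, 0)) t) has_vector_derivative PD pp x y t) (at 0)"
proof -
 note d = pd_directional[of "pp _" x "(y, 0)" t, unfolded goodD(4)[OF assms]]
 have re: "((%r. vn (Ph (x+r *\<^sub>R (y, 0)) t) a) has_vector_derivative Re (pd (pp a) x (y, 0) t)) (at 0)" for a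
  using bounded_linear.has_vector_derivative[OF bounded_linear_Re d[of a]] by simp
 have "((%r. cor (vn (Ph (x+r *\<^sub>R (y, 0)) t) a)) has_vector_derivative cor (Re (pd (pp a) x (y, 0) t))) (at 0)"
  using bounded_linear.has_vector_derivative[OF bounded_linear_of_real re[of a]] by simp
 from vector_derivative_unique_at[OF d[of a] this]
 show "pd (pp a) x (y, 0) t = cor (vn (PD pp x y t) a)" by (simp add: PD_def)
 show "((%r. Ph (x+r *\<^sub>R (y, 0)) t) has_vector_derivative PD pp x y t) (at 0)"
  by (rule has_vector_derivative_vec) (simp only: PD_def vec_lambda_beta re)
qed

lemma PD_facts:
 assumes g: "good n pp Ph ph"
 shows "P1 (PD pp x y t) = PD pp x y t" and "PD pp (u, 0) y t = PD pp (u, 0) y 0"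
proof -
 note d = PD_eq(2)[OF g]
 have bl: "bounded_linear P1" using linP1 by (simp add: linear_conv_bounded_linear)
 have "((%r. Ph (x+r *\<^sub>R (y, 0)) t) has_vector_derivative P1 (PD pp x y t)) (at 0)"
  using bounded_linear.has_vector_derivative[OF bl d[of x y t]] by (simp add: goodD(5)[OF g])
 from vector_derivative_unique_at[OF this d] show "P1 (PD pp x y t) = PD pp x y t" .
 have "Ph ((u, 0)+r *\<^sub>R (y, 0)) t = Ph ((u, 0)+r *\<^sub>R (y, 0)) 0" for r using goodD(6)[OF g, of "u+r *\<^sub>R y" t] by simp
 then have "((%r. Ph ((u, 0)+r *\<^sub>R (y, 0)) 0) has_vector_derivative PD pp (u, 0) y t) (at 0)" using d[of "(u, 0)" y t] by simp
 from vector_derivative_unique_at[OF this d] show "PD pp (u, 0) y t = PD pp (u, 0) y 0" .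
qed

lemma linear_PD: "linear (%y. PD pp x y t)"
proof (rule linearI)
 note lp = linear_pd[of _ x t]
 fix y z :: "real ^ 'm" and r :: real
 have "pd ps x (y+z, 0) t = pd ps x (y, 0) t+pd ps x (z, 0) t" for ps using linear_add[OF lp, of ps "(y, 0)" "(z, 0)"] by simp
 then show "PD pp x (y+z) t = PD pp x y t+PD pp x z t" by (simp add: PD_def vec_eq_iff)
 have "pd ps x (r *\<^sub>R y, 0) t = r *\<^sub>R pd ps x (y, 0) t" for ps using linear_scale[OF lp, of ps r "(y, 0)"] by simp
 then show "PD pp x (r *\<^sub>R y) t = r *\<^sub>R PD pp x y t" by (simp add: PD_def vec_eq_iff)
qed

definition fam :: "(nat => 'm => terms) => (nat => (real ^ 'm) \<times> real => real => real ^ 'm) => (nat => real) => bool" where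
 "fam pp Ph ph \<longleftrightarrow> (ALL i. good i (pp i) (Ph i) (ph i)) & (ALL i<2. Ph i = (%_ _. 0) & ph i = 0)"

context
 fixes pp :: "nat => 'm => terms" and Ph :: "nat => (real ^ 'm) \<times> real => real => real ^ 'm" and ph :: "nat => real"
 assumes fam: "fam pp Ph ph"
begin

lemma fam_good: "good i (pp i) (Ph i) (ph i)" using fam by (simp add: fam_def)

lemma fam_low: "i < 2 ==> Ph i = (%_ _. 0)" "i < 2 ==> ph i = 0" using fam by (auto simp: fam_def)

lemma fam_nonneg: "ph n >= 0" using goodD(7)[OF fam_good] .

lemma H_Uc: "H n (maj.uu ph n) (%x t. cor (Uc Ph n x t i))"
proof (cases i)
 case None
 show ?thesis
 proof (cases "n = 1")
  case True
  have "H 1 (malg l * norm (1::complex)) (%x t. \<zeta> iE x*1)" unfolding One_nat_def by (rule H_letter[OF H_const iE(1)])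
  then have "H 1 (maj.uu ph n) (%x t. \<zeta> iE x*1)"
  proof (rule H_mono)
   have "malg l*1<=cU" unfolding cU_def using malg_pos by (intro mult_left_mono) (auto intro!: sum_nonneg)
   then show "malg l * norm (1::complex)<=maj.uu ph n" using fam_nonneg[of n] True by (simp add: maj.uu_def)
  qed
  then show ?thesis using None True by (simp add: Uc_def iE(2))
 next
  case False
  then show ?thesis using None by (simp add: Uc_def H_zero maj.uu_def fam_nonneg)
 qed
next
 case (Some a)
 show ?thesis
 proof (cases "n = 1")
  case True
  have "H 1 (malg l*(\<Sum>i<N. norm (cP a i))) (%x t. \<Sum>i<N. cP a i * \<zeta> i x)" by (rule H_functional)
  then have "H 1 (maj.uu ph n) (%x t. \<Sum>i<N. cP a i * \<zeta> i x)"
  proof (rule H_mono)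
   have "(\<Sum>i<N. norm (cP a i))<=(\<Sum>a\<in>UNIV. \<Sum>i<N. norm (cP a i))"
    by (rule member_le_sum[of a UNIV "%a. \<Sum>i<N. norm (cP a i)"]) (auto intro!: sum_nonneg)
   then have "malg l*(\<Sum>i<N. norm (cP a i))<=cU" unfolding cU_def using malg_pos by (intro mult_left_mono) auto
   then show "malg l*(\<Sum>i<N. norm (cP a i))<=maj.uu ph n" using fam_nonneg[of n] True by (simp add: maj.uu_def)
  qed
  then show ?thesis using Some True fam_low(1)[of 1] by (simp add: Uc_def coordP0)
 next
  case False
  then show ?thesis using Some goodD(8)[OF fam_good, of n a] by (simp add: Uc_def maj.uu_def)
 qed
qed

lemma Uc_0: "Uc Ph 0 x t i = 0" using fam_low(1)[of 0] by (simp add: Uc_def split: option.split)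

lemma H_prod:
 "w ~= [] ==> H n (fps_nth (Abs_fps (maj.uu ph) ^ length w) n) (%x t. cor (fps_nth (prod_list (map (uf Ph x t) w)) n))"
proof (induction w arbitrary: n)
 case (Cons i w)
 show ?case
 proof (cases "w = []")
  case True
  then show ?thesis using H_Uc[of n i] by simp
 next
  case False
  have "H n (\<Sum>j\<in>{0..n}. maj.uu ph j * fps_nth (Abs_fps (maj.uu ph) ^ length w) (n - j))
   (%x t. \<Sum>j\<in>{0..n}. cor (Uc Ph j x t i) * cor (fps_nth (prod_list (map (uf Ph x t) w)) (n - j)))"
  proof (rule H_sum)
   fix j assume "j \<in> {0..n}"
   then show "H n (maj.uu ph j * fps_nth (Abs_fps (maj.uu ph) ^ length w) (n - j))
    (%x t. cor (Uc Ph j x t i) * cor (fps_nth (prod_list (map (uf Ph x t) w)) (n - j)))"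
    using H_mult[OF H_Uc[of j i] Cons.IH[OF False, of "n - j"]] by simp
  qed
  then show ?thesis by (simp add: fps_mult_nth)
 qed
qed simp

lemma H_VN: "H n (maj.gg ph n) (%x t. cor (vn (VN Ph n x t) a))"
proof -
 have "H n (\<Sum>q\<in>{2..n}. \<Sum>w\<in>(words q :: 'm option list set). (cv * ka ^ q) * fps_nth (Abs_fps (maj.uu ph) ^ q) n)
  (%x t. \<Sum>q\<in>{2..n}. \<Sum>w\<in>words q. cor (vn (v w t) a) * cor (fps_nth (prod_list (map (uf Ph x t) w)) n))"
 proof (intro H_sum)
  fix q and w :: "'m option list" assume q: "q \<in> {2..n}" and w: "w \<in> words q"
  have wl: "length w = q" "w ~= []" using q w by (auto simp: words_def)
  have p: "fps_nth (Abs_fps (maj.uu ph) ^ q) n >= 0" using H_nonneg[OF H_prod[OF wl(2), of n]] wl by simp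
  show "H n ((cv * ka ^ q) * fps_nth (Abs_fps (maj.uu ph) ^ q) n)
   (%x t. cor (vn (v w t) a) * cor (fps_nth (prod_list (map (uf Ph x t) w)) n))"
  proof (rule H_mono[OF H_coef_mult[OF H_prod[OF wl(2)] v_HS]])
   show "nm (%t. cor (vn (v w t) a)) * fps_nth (Abs_fps (maj.uu ph) ^ length w) n
   <=cv * ka ^ q * fps_nth (Abs_fps (maj.uu ph) ^ q) n" using v_le[of w a] p wl by (auto simp: nm_def intro!: mult_right_mono)
  qed
 qed
 also have "(\<Sum>q\<in>{2..n}. \<Sum>w\<in>(words q :: 'm option list set). (cv * ka ^ q) * fps_nth (Abs_fps (maj.uu ph) ^ q) n) = maj.gg ph n"
  unfolding maj.gg_def by (intro sum.cong refl) (simp add: card_words card_UNIV_option power_mult_distrib ac_simps)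
 finally show ?thesis by (simp add: VN_def mult.commute)
qed

lemma H_linear_image:
 assumes F: "linear F" and H: "!!c. H n M (%x t. cor (vn (W x t) c))"
  and C: "(\<Sum>c\<in>UNIV. norm (mtx F a c))<=C"
 shows "H n (C * M) (%x t. cor (vn (F (W x t)) a))"
proof -
 have M: "M >= 0" using H_nonneg[OF H] .
 have "H n (\<Sum>c\<in>UNIV. norm (mtx F a c) * M) (%x t. \<Sum>c\<in>UNIV. mtx F a c * cor (vn (W x t) c))" by (intro H_sum H_cmult H)
 then have "H n ((\<Sum>c\<in>UNIV. norm (mtx F a c)) * M) (%x t. cor (vn (F (W x t)) a))"
  by (simp add: sum_distrib_right mtx_apply[OF F, of "W _ _" a] del: of_real_eq_iff)
 then show ?thesis by (rule H_mono) (intro mult_right_mono C M)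
qed

lemma H_zeta_image:
 assumes i: "i < N" and H: "!!c. H n M (%x t. cor (vn (W x t) c))"
 shows "H n (real CARD('m) * M) (%x t. \<zeta> i (P0 (W x t), 0))"
proof -
 have M: "M >= 0" using H_nonneg[OF H] .
 have e: "\<zeta> i (P0 V, 0) = (\<Sum>c\<in>UNIV. \<zeta> i (axis c 1, 0) * cor (vn V c))" for V
 proof -
  have "\<zeta> i (P0 V, 0) = \<zeta> i (V, 0)" by (rule proj[OF i])
  also have "(V, 0::real) = (\<Sum>c\<in>UNIV. vn V c *\<^sub>R (axis c 1, 0))"
  proof -
   have "(\<Sum>c\<in>UNIV. vn V c *\<^sub>R (axis c (1::real), 0::real)) = ((\<Sum>c\<in>UNIV. vn V c *\<^sub>R axis c 1), 0)"
    by (simp add: prod_eq_iff fst_sum snd_sum)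
   then show ?thesis by (simp only: vec_expand)
  qed
  finally show ?thesis by (simp only: linear_sum[OF lin] linear_scale[OF lin] scaleR_conv_of_real mult.commute)
 qed
 have "H n (\<Sum>c\<in>(UNIV :: 'm set). 1 * M) (%x t. \<Sum>c\<in>UNIV. \<zeta> i (axis c 1, 0) * cor (vn (W x t) c))"
 proof (rule H_sum)
  fix c :: 'm
  have "norm (\<zeta> i (axis c 1, 0))<=1" using bnd[OF i, of "(axis c 1, 0)"] by (simp add: norm_axis_1)
  then show "H n (1 * M) (%x t. \<zeta> i (axis c 1, 0) * cor (vn (W x t) c))" using M by (intro H_mono[OF H_cmult[OF H]] mult_right_mono)
 qed
 then show ?thesis by (simp add: e)
qed

lemma H_NN: "H n (maj.hh ph n) (%x t. cor (vn (NN pp Ph n x t) a))"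
proof -
 have 1: "H n (cP1 * maj.gg ph n) (%x t. cor (vn (P1 (VN Ph n x t)) a))"
 proof (rule H_linear_image[OF linP1 H_VN])
  show "(\<Sum>c\<in>UNIV. norm (mtx P1 a c))<=cP1" unfolding cP1_def
   by (rule member_le_sum[of a UNIV "%a. \<Sum>c\<in>UNIV. norm (mtx P1 a c)"]) (auto intro!: sum_nonneg)
 qed
 have 2: "H n (\<Sum>i\<in>{2..<n}. real i * ph i*(real CARD('m) * maj.gg ph (n+1 - i)))
  (%x t. \<Sum>i\<in>{2..<n}. pd (pp i a) x (P0 (VN Ph (n+1 - i) x t), 0) t)"
 proof (rule H_sum)
  fix i assume i: "i \<in> {2..<n}"
  define k where "k = n+1 - i"
  have g: "maj.gg ph k >= 0" using H_nonneg[OF H_VN] .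
  have "H (i - 1+k) (real i * nrm (pp i a)*(real CARD('m) * maj.gg ph k)) (%x t. pd (pp i a) x (P0 (VN Ph k x t), 0) t)"
   using g by (intro H_pd goodD(1)[OF fam_good] H_zeta_image H_VN) auto
  moreover have "i - 1+k = n" using i by (auto simp: k_def)
  ultimately have "H n (real i * nrm (pp i a)*(real CARD('m) * maj.gg ph k)) (%x t. pd (pp i a) x (P0 (VN Ph k x t), 0) t)" by simp
  then show "H n (real i * ph i*(real CARD('m) * maj.gg ph (n+1 - i))) (%x t. pd (pp i a) x (P0 (VN Ph (n+1 - i) x t), 0) t)"
   unfolding k_def[symmetric] by (rule H_mono) (use g goodD(2)[OF fam_good, of i a] in \<open>auto intro!: mult_right_mono mult_left_mono\<close>)
 qed
 have "cor (vn (NN pp Ph n x t) a) = cor (vn (P1 (VN Ph n x t)) a)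
  - (\<Sum>i\<in>{2..<n}. pd (pp i a) x (P0 (VN Ph (n+1 - i) x t), 0) t)" for x t by (simp add: NN_def PD_eq(1)[OF fam_good])
 then show ?thesis using H_diff[OF 1 2] by (simp add: maj.hh_def)
qed

lemma P1_NN: "P1 (NN pp Ph n x t) = NN pp Ph n x t"
 unfolding NN_def by (simp add: linear_diff[OF linP1] linear_sum[OF linP1] P1_idem PD_facts(1)[OF fam_good])

lemma VN_ind: "VN Ph n (u, 0) t = VN Ph n (u, 0) 0"
proof -
 have uft: "uf Ph (u, 0) t = uf Ph (u, 0) 0" using goodD(6)[OF fam_good, of _ u t] by (intro ext fps_ext) (auto simp: Uc_def split: option.split)
 have "fps_nth (prod_list (map (uf Ph (u, 0) t) w)) n *\<^sub>R v w t = fps_nth (prod_list (map (uf Ph (u, 0) 0) w)) n *\<^sub>R v w 0" for w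
 proof (cases "None \<in> set w")
  case True
  have "uf Ph (u, 0) 0 None = 0" by (rule fps_ext) (simp add: uf_def Uc_def)
  then have z: "prod_list (map (uf Ph (u, 0) 0) w) = 0" using True by (auto simp: prod_list_zero_iff image_iff intro!: bexI[of _ None])
  show ?thesis by (simp only: uft z fps_zero_nth scaleR_zero_left)
 next
  case False
  then show ?thesis by (simp only: uft v_const[OF False, of t])
 qed
 then show ?thesis unfolding VN_def by (intro sum.cong refl)
qed

lemma NN_ind: "NN pp Ph n (u, 0) t = NN pp Ph n (u, 0) 0"
proof -
 have "PD (pp i) (u, 0) (P0 (VN Ph k (u, 0) t)) t = PD (pp i) (u, 0) (P0 (VN Ph k (u, 0) 0)) 0" for i k
  using PD_facts(2)[OF fam_good[of i], of u "P0 (VN Ph k (u, 0) 0)" t] VN_ind[of k u t] by simp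
 then show ?thesis unfolding NN_def using VN_ind[of n u t] by simp
qed

end

lemma VN_cong:
 assumes "!!i. i < n ==> Ph i = Ph' i" "Ph 0 = (%_ _. 0)" "Ph' 0 = (%_ _. 0)"
 shows "VN Ph n = VN Ph' n"
proof (intro ext)
 fix x t
 have "fps_nth (prod_list (map (uf Ph x t) w)) n = fps_nth (prod_list (map (uf Ph' x t) w)) n" if "length w >= 2" for w
  using assms that by (intro fps_prod_list_cong_strict) (auto simp: uf_def Uc_def split: option.split)
 then show "VN Ph n x t = VN Ph' n x t" unfolding VN_def by (intro sum.cong refl) (auto simp: words_def)
qed

lemma NN_cong:
 assumes "!!i. i < n ==> Ph i = Ph' i & pp i = pp' i" "Ph 0 = (%_ _. 0)" "Ph' 0 = (%_ _. 0)"
 shows "NN pp Ph n = NN pp' Ph' n"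
proof (intro ext)
 fix x t
 have "VN Ph k = VN Ph' k" if "k<=n" for k using assms that by (intro VN_cong) auto
 then show "NN pp Ph n x t = NN pp' Ph' n x t" unfolding NN_def using assms(1) by (auto intro!: arg_cong2[where f="(-)"] sum.cong)
qed

lemma gg_cong:
 assumes "!!i. i < n ==> ph i = ph' i" "ph 0 = 0" "ph' 0 = 0"
 shows "maj.gg ph n = maj.gg ph' n"
proof -
 have "fps_nth (Abs_fps (maj.uu ph) ^ q) n = fps_nth (Abs_fps (maj.uu ph') ^ q) n" if "q >= 2" for q
 proof -
  have "fps_nth (prod_list (map (%_. Abs_fps (maj.uu ph)) (replicate q ()))) n
   = fps_nth (prod_list (map (%_. Abs_fps (maj.uu ph')) (replicate q ()))) n"
   using assms that by (intro fps_prod_list_cong_strict) (auto simp: maj.uu_def)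
  then show ?thesis by (simp add: prod_list_map_const)
 qed
 then show ?thesis unfolding maj.gg_def by (intro sum.cong refl) auto
qed

lemma hh_cong:
 assumes "!!i. i < n ==> ph i = ph' i" "ph 0 = 0" "ph' 0 = 0"
 shows "maj.hh ph n = maj.hh ph' n"
proof -
 have "maj.gg ph k = maj.gg ph' k" if "k<=n" for k using assms that by (intro gg_cong) auto
 then show ?thesis unfolding maj.hh_def using assms(1) by (auto intro!: arg_cong2[where f="(+)"] sum.cong)
qed

theorem formal_graph:
 obtains pp Ph ph where "fam pp Ph ph"
  "!!n. n >= 2 ==> ph n = (real CARD('m) * K) * real n powr s * maj.hh ph n"
  "!!n x t a. n >= 2 ==> LL (pp n) x t a = cor (vn (NN pp Ph n x t) a)"
proof -
 define Z :: "('m => terms) \<times> ((real ^ 'm) \<times> real => real => real ^ 'm) \<times> real"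
  where "Z = (%_. [], %_ _. 0, 0)"
 define p1 where "p1 f n i = fst (if i < n then f i else Z)" for f n and i :: nat
 define p2 where "p2 f n i = fst (snd (if i < n then f i else Z))" for f n and i :: nat
 define p3 where "p3 f n i = snd (snd (if i < n then f i else Z))" for f n and i :: nat
 define P where "P f n r \<longleftrightarrow> (if n < 2 then r = Z else
  good n (fst r) (fst (snd r)) (snd (snd r)) &
  snd (snd r) = (real CARD('m) * K) * real n powr s * maj.hh (p3 f n) n &
  (ALL x t a. LL (fst r) x t a = cor (vn (NN (p1 f n) (p2 f n) n x t) a)))" for f n r
 have "EX f. ALL n. P f n (f n)"
 proof (rule dependent_wf_choice[OF wf_less])
  fix f g :: "nat => ('m => terms) \<times> ((real ^ 'm) \<times> real => real => real ^ 'm) \<times> real" and n r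
  assume "!!z. (z, n) \<in> {(x, y). x < y} ==> f z = g z"
  then have "p1 f n = p1 g n" "p2 f n = p2 g n" "p3 f n = p3 g n" by (auto simp: p1_def p2_def p3_def fun_eq_iff)
  then show "P f n r = P g n r" by (simp add: P_def)
 next
  fix n :: nat and f
  assume IH: "!!y. (y, n) \<in> {(x, y). x < y} ==> P f y (f y)"
  show "EX r. P f n r"
  proof (cases "n < 2")
   case True then show ?thesis by (simp add: P_def)
  next
   case False
   have fam: "fam (p1 f n) (p2 f n) (p3 f n)" unfolding fam_def
   proof (intro conjI allI impI)
    fix i
    show "good i (p1 f n i) (p2 f n i) (p3 f n i)"
    proof (cases "i < n & i >= 2")
     case True
     then show ?thesis using IH[of i] by (auto simp: P_def p1_def p2_def p3_def)
    next
     case False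
     then have "(if i < n then f i else Z) = Z" using IH[of i] by (auto simp: P_def)
     then show ?thesis using good_zero[of i] by (simp add: p1_def p2_def p3_def Z_def)
    qed
    assume "i < 2"
    then have "(if i < n then f i else Z) = Z" using IH[of i] by (auto simp: P_def)
    then show "p2 f n i = (%_ _. 0)" "p3 f n i = 0" by (simp_all add: p2_def p3_def Z_def)
   qed
   obtain pp \<Psi> where h:
    "!!a. hom n (pp a)" "!!a. nrm (pp a)<=real CARD('m)*(K * real n powr s * maj.hh (p3 f n) n)"
    "!!a w c. (w, c) \<in> set (pp a) ==> HS T (Suc l) c"
    "!!x t a. ev (pp a) x t = cor (vn (\<Psi> x t) a)"
    "!!x t. P1 (\<Psi> x t) = \<Psi> x t" "!!u t. \<Psi> (u, 0) t = \<Psi> (u, 0) 0"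
    "!!x t a. LL pp x t a = cor (vn (NN (p1 f n) (p2 f n) n x t) a)" by (rule homological[of n "maj.hh (p3 f n) n" "NN (p1 f n) (p2 f n) n"])
     (use False H_NN[OF fam] P1_NN[OF fam] NN_ind[OF fam] in auto)
   have "P f n (pp, \<Psi>, (real CARD('m) * K) * real n powr s * maj.hh (p3 f n) n)" using False h by (auto simp: P_def good_def mult.assoc)
   then show ?thesis by blast
  qed
 qed
 then obtain f where f: "!!n. P f n (f n)" by blast
 define pp where "pp i = fst (f i)" for i
 define Ph where "Ph i = fst (snd (f i))" for i
 define ph where "ph i = snd (snd (f i))" for i
 have low: "f i = Z" if "i < 2" for i using f[of i] that by (simp add: P_def)
 have fam: "fam pp Ph ph" unfolding fam_def
 proof (intro conjI allI impI)
  fix i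
  show "good i (pp i) (Ph i) (ph i)" using f[of i] low[of i] good_zero[of i] by (cases "i < 2") (auto simp: P_def pp_def Ph_def ph_def Z_def)
  assume "i < 2"
  then show "Ph i = (%_ _. 0)" "ph i = 0" using low[of i] by (simp_all add: Ph_def ph_def Z_def)
 qed
 show thesis
 proof (rule that[OF fam])
  fix n :: nat assume n: "n >= 2"
  have P: "snd (snd (f n)) = (real CARD('m) * K) * real n powr s * maj.hh (p3 f n) n"
   "!!x t a. LL (fst (f n)) x t a = cor (vn (NN (p1 f n) (p2 f n) n x t) a)" using f[of n] n by (auto simp: P_def)
  have "maj.hh (p3 f n) n = maj.hh ph n" using n fam_low(2)[OF fam, of 0] by (intro hh_cong) (auto simp: p3_def ph_def)
  then show "ph n = (real CARD('m) * K) * real n powr s * maj.hh ph n" using P(1) by (simp add: ph_def)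
  have "NN (p1 f n) (p2 f n) n = NN pp Ph n" using n fam_low(1)[OF fam, of 0] by (intro NN_cong) (auto simp: p1_def p2_def pp_def Ph_def)
  then show "LL (pp n) x t a = cor (vn (NN pp Ph n x t) a)" for x t a using P(2) by (simp add: pp_def)
 qed
qed

end

section \<open>Analytic maps into the Sobolev algebra\<close>

lemma sums_swap:
 fixes a :: "nat => nat => 'b :: {real_normed_algebra, banach}"
 assumes le: "!!q J. (\<Sum>n<J. norm (a n q))<=M q" and M: "summable M"
 shows "(%n. \<Sum>q. a n q) sums (\<Sum>q. \<Sum>n. a n q)" and "summable (%n. norm (a n q))"
  and "summable (%q. norm (a n q))" and "summable (%q. norm (\<Sum>n. a n q))"
proof -
 have sn: "summable (%n. norm (a n q))" for q by (rule summableI_nonneg_bounded[OF _ le]) simp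
 then show "summable (%n. norm (a n q))" .
 have leq: "norm (a n q)<=M q" for n q
 proof -
  have "norm (a n q)<=(\<Sum>k<Suc n. norm (a k q))" by (rule member_le_sum[of n "{..<Suc n}" "%k. norm (a k q)"]) auto
  then show ?thesis using le[where J="Suc n" and q=q] by linarith
 qed
 have sq: "summable (%q. norm (a n q))" for n by (rule summable_comparison_test'[OF M, of 0]) (use leq in auto)
 then show "summable (%q. norm (a n q))" .
 have t: "eventually (%J. summable (%q. norm (\<Sum>n<J. a n q))) sequentially & summable (%q. norm (\<Sum>n. a n q)) &
  ((%J. suminf (%q. \<Sum>n<J. a n q)) \<longlongrightarrow> suminf (%q. \<Sum>n. a n q)) sequentially"
 proof (rule tannerys_theorem[where M=M])
  show "((%J. \<Sum>n<J. a n q) \<longlonglongrightarrow> (\<Sum>n. a n q))" for q by (rule summable_LIMSEQ) (rule summable_norm_cancel[OF sn])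
  show "\<forall>\<^sub>F (q, J) in sequentially \<times>\<^sub>F sequentially. norm (\<Sum>n<J. a n q)<=M q"
   by (intro always_eventually) (auto intro: order_trans[OF norm_sum le])
 qed (use M in auto)
 then show "summable (%q. norm (\<Sum>n. a n q))" by blast
 have "(\<Sum>q. \<Sum>n<J. a n q) = (\<Sum>n<J. \<Sum>q. a n q)" for J by (rule suminf_sum) (rule summable_norm_cancel[OF sq])
 with t show "(%n. \<Sum>q. a n q) sums (\<Sum>q. \<Sum>n. a n q)" by (simp add: sums_def)
qed

context sobolev_words
begin

lemma HS_suminf:
 assumes f: "!!n. HSl (f n)" and le: "!!J. (\<Sum>n<J. nm (f n))<=M"
 shows "HSl (%t. \<Sum>n. f n t)" and "nm (%t. \<Sum>n. f n t)<=M" and "summable (%n. norm (f n t))"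
proof -
 have "summable (%n. nm (f n))" by (rule summableI_nonneg_bounded[OF _ le]) simp
 then have nmS: "(%n. nm (f n)) summable_on UNIV" "(\<Sum>\<^sub>\<infinity>n. nm (f n)) = (\<Sum>n. nm (f n))"
  using sums_nonneg_imp_has_sum[of "%n. nm (f n)" "\<Sum>n. nm (f n)"] by (auto simp: summable_sums has_sum_iff)
 have hnS: "(%n. hn T l (f n)) summable_on UNIV" by (rule summable_on_comparison_test[OF nmS(1)]) (use hn_le_nm in auto)
 note h = HS_infsum[OF l f order_refl hnS]
 have "(%n. f n t) summable_on UNIV" "summable (%n. norm (f n t))" for t
 proof -
  show "(%n. f n t) summable_on UNIV" by (rule abs_summable_summable[OF h(3)])
  show "summable (%n. norm (f n t))" using h(3)[of t] by (rule summable_on_imp_summable)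
 qed
 then have e: "(\<Sum>\<^sub>\<infinity>n. f n t) = (\<Sum>n. f n t)" and "summable (%n. norm (f n t))" for t
  by (auto intro!: sums_unique has_sum_imp_sums has_sum_infsum)
 then show "summable (%n. norm (f n t))" by blast
 show "HSl (%t. \<Sum>n. f n t)" using h(1) by (simp add: e)
 have "nm (%t. \<Sum>n. f n t)<=malg l*(\<Sum>\<^sub>\<infinity>n. hn T l (f n))" unfolding nm_def using h(2) malg_pos by (simp add: e)
 also have "... = (\<Sum>\<^sub>\<infinity>n. nm (f n))" unfolding nm_def by (rule infsum_cmult_right'[symmetric])
 also have "... = (\<Sum>n. nm (f n))" by (rule nmS)
 also have "...<=M" using \<open>summable (%n. nm (f n))\<close> le by (rule suminf_le_const)
 finally show "nm (%t. \<Sum>n. f n t)<=M" .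
qed

definition AN :: "real => real => ('a::real_normed_vector => real => complex) => bool" where
 "AN s M W \<longleftrightarrow> (EX D d. (ALL us t i. i < length us --> linear (%x. D (us[i := x]) t)) &
  (ALL us. HSl (D us) & nm (D us)<=d (length us) * prod_list (map norm us)) &
  (ALL q. d q >= 0) & (ALL Q. (\<Sum>q<Q. s ^ q * d q)<=M) &
  (ALL h t. norm h<=s --> (%q. D (replicate q h) t) sums W h t))"

lemma AN_E:
 fixes W :: "'a::real_normed_vector => real => complex"
 assumes "AN s M W"
 obtains D :: "'a list => real => complex" and d where
  "!!us t i. i < length us ==> linear (%x. D (us[i := x]) t)"
  "!!us. HSl (D us)" "!!us. nm (D us)<=d (length us) * prod_list (map norm us)"
  "!!q. d q >= 0" "!!Q. (\<Sum>q<Q. s ^ q * d q)<=M"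
  "!!h t. norm h<=s ==> (%q. D (replicate q h) t) sums W h t" using assms unfolding AN_def by blast

lemma AN_I:
 fixes D :: "'a::real_normed_vector list => real => complex"
 assumes "!!us t i. i < length us ==> linear (%x. D (us[i := x]) t)"
  "!!us. HSl (D us)" "!!us. nm (D us)<=d (length us) * prod_list (map norm us)"
  "!!q. d q >= 0" "!!Q. (\<Sum>q<Q. s ^ q * d q)<=M"
  "!!h t. norm h<=s ==> (%q. D (replicate q h) t) sums W h t"
 shows "AN s M W" unfolding AN_def using assms by (intro exI[of _ D] exI[of _ d]) auto

lemma prod_norm_nonneg: "prod_list (map norm us) >= 0" by (induction us) auto

lemma prod_norm_replicate: "prod_list (map norm (replicate q h)) = norm h ^ q" by (induction q) auto

lemma AN_transfer:
 assumes "AN s M W" "M<=M'" "!!h t. norm h<=s ==> W h t = W' h t"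
 shows "AN s M' W'"
proof -
 from assms(1) obtain D d where D:
  "!!us t i. i < length us ==> linear (%x. D (us[i := x]) t)"
  "!!us. HSl (D us)" "!!us. nm (D us)<=d (length us) * prod_list (map norm us)"
  "!!q. d q >= 0" "!!Q. (\<Sum>q<Q. s ^ q * d q)<=M"
  "!!h t. norm h<=s ==> (%q. D (replicate q h) t) sums W h t" by (rule AN_E) (rule that)
 have "(\<Sum>q<Q. s ^ q * d q)<=M'" for Q using D(5)[of Q] assms(2) by linarith
 then show ?thesis by (intro AN_I[where D=D and d=d]) (use D assms(3) in auto)
qed

lemma AN_mono: "AN s M W ==> M<=M' ==> AN s M' W" by (rule AN_transfer) auto

lemma AN_cong: "AN s M W ==> (!!h t. norm h<=s ==> W h t = W' h t) ==> AN s M W'" by (rule AN_transfer[OF _ order_refl])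

lemma AN_const:
 assumes "HSl f" "s >= 0" shows "AN s (nm f) (%h t. f t)"
proof (rule AN_I[where D="%us. if us = [] then f else (%t. 0)" and d="%q. if q = 0 then nm f else 0"])
 fix us :: "'a list" and t and i
 assume "i < length us"
 then have "us[i := x] ~= []" for x by auto
 then show "linear (%x. (if us[i := x] = [] then f else (%t. 0)) t)" by (simp add: linear_iff)
next
 fix Q
 have "(\<Sum>q<Q. s ^ q*(if q = 0 then nm f else 0)) = (\<Sum>q<Q. if q = 0 then nm f else 0)" by (intro sum.cong) auto
 then show "(\<Sum>q<Q. s ^ q*(if q = 0 then nm f else 0))<=nm f" by simp
next
 fix h :: 'a and t
 have "(%q. if q = 0 then f t else 0) sums f t" using sums_single[of 0 "%_. f t"] by simp
 moreover have "(if replicate q h = [] then f else (%t. 0)) t = (if q = 0 then f t else 0)" for q by (cases q) auto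
 ultimately show "(%q. (if replicate q h = [] then f else (%t. 0)) t) sums f t" by simp
next
 fix us :: "'a list"
 show "HSl (if us = [] then f else (%t. 0))" using assms HS_const(1)[of l 0] by simp
 show "nm (if us = [] then f else (%t. 0))<=(if length us = 0 then nm f else 0) * prod_list (map norm us)" using nm_const[of 0] by simp
qed simp

lemma AN_linear:
 fixes f :: "'a::real_normed_vector => complex"
 assumes f: "linear f" "!!h. norm (f h)<=k * norm h" and k: "k >= 0" and s: "s >= 0"
 shows "AN s (malg l * k * s) (%h t. f h)"
proof (rule AN_I[where D="%us t. if length us = 1 then f (hd us) else 0" and d="%q. if q = 1 then malg l * k else 0"])
 fix us :: "'a list" and t and i
 assume i: "i < length us"
 have "linear (%x. f (hd (us[i := x])))" if len: "length us = 1"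
 proof -
  obtain u where "us = [u]" using len by (auto simp: length_Suc_conv)
  then show ?thesis using i f(1) by simp
 qed
 then show "linear (%x. if length (us[i := x]) = 1 then f (hd (us[i := x])) else 0)" by (auto simp: linear_iff)
next
 fix us :: "'a list"
 show "HSl (%t. if length us = 1 then f (hd us) else 0)" by (rule HS_const(1))
 show "nm (%t. if length us = 1 then f (hd us) else 0)<=(if length us = 1 then malg l * k else 0) * prod_list (map norm us)"
 proof (cases "length us = 1")
  case True
  then obtain u where "us = [u]" by (auto simp: length_Suc_conv)
  then show ?thesis using order_trans[OF nm_const[of "f u"] mult_left_mono[OF f(2)[of u], of "malg l"]] malg_pos by (simp add: mult.assoc)
 qed (use nm_const[of 0] in auto)
next
 fix Q
 have "(\<Sum>q<Q. s ^ q*(if q = 1 then malg l * k else 0)) = (\<Sum>q<Q. if q = 1 then malg l * k * s else 0)" by (intro sum.cong) auto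
 also have "...<=malg l * k * s" using malg_pos k s by simp
 finally show "(\<Sum>q<Q. s ^ q*(if q = 1 then malg l * k else 0))<=malg l * k * s" .
next
 fix h :: 'a and t
 have "(%q. if q = 1 then f h else 0) sums f h" using sums_single[of 1 "%_. f h"] by simp
 moreover have "(if length (replicate q h) = 1 then f (hd (replicate q h)) else 0) = (if q = 1 then f h else 0)" for q by auto
 ultimately show "(%q. if length (replicate q h) = 1 then f (hd (replicate q h)) else 0) sums f h" by simp
qed (use malg_pos k in auto)

lemma AN_add:
 assumes "AN s M W" "AN s M' W'" "s >= 0" shows "AN s (M+M') (%h t. W h t+W' h t)"
proof -
 from assms(1) obtain D d where D:
  "!!us t i. i < length us ==> linear (%x. D (us[i := x]) t)"
  "!!us. HSl (D us)" "!!us. nm (D us)<=d (length us) * prod_list (map norm us)"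
  "!!q. d q >= 0" "!!Q. (\<Sum>q<Q. s ^ q * d q)<=M"
  "!!h t. norm h<=s ==> (%q. D (replicate q h) t) sums W h t" by (rule AN_E) (rule that)
 from assms(2) obtain E e where E:
  "!!us t i. i < length us ==> linear (%x. E (us[i := x]) t)"
  "!!us. HSl (E us)" "!!us. nm (E us)<=e (length us) * prod_list (map norm us)"
  "!!q. e q >= 0" "!!Q. (\<Sum>q<Q. s ^ q * e q)<=M'"
  "!!h t. norm h<=s ==> (%q. E (replicate q h) t) sums W' h t" by (rule AN_E) (rule that)
 show ?thesis
 proof (rule AN_I[where D="%us t. D us t+E us t" and d="%q. d q+e q"])
  show "linear (%x. D (us[i := x]) t+E (us[i := x]) t)" if "i < length us" for us t i by (rule linear_compose_add[OF D(1)[OF that] E(1)[OF that]])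
  show "HSl (%t. D us t+E us t)" for us by (rule HS_add(1)[OF D(2) E(2)])
  show "nm (%t. D us t+E us t)<=(d (length us)+e (length us)) * prod_list (map norm us)" for us
   using nm_add[OF D(2) E(2), of us us] D(3)[of us] E(3)[of us] by (simp add: distrib_right)
  show "(\<Sum>q<Q. s ^ q*(d q+e q))<=M+M'" for Q using D(5)[of Q] E(5)[of Q] by (simp add: distrib_left sum.distrib)
  show "(%q. D (replicate q h) t+E (replicate q h) t) sums (W h t+W' h t)" if "norm h<=s" for h t
   by (rule sums_add[OF D(6)[OF that] E(6)[OF that]])
 qed (use D(4) E(4) in auto)
qed

lemma AN_D_norm_summable:
 assumes D: "!!us. HSl (D us)" "!!us. nm (D us)<=d (length us) * prod_list (map norm us)"
  "!!q. d q >= 0" "!!Q. (\<Sum>q<Q. s ^ q * d q)<=M" and h: "norm h<=s"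
 shows "(\<Sum>q<Q. nm (D (replicate q h)))<=M" and "summable (%q. norm (D (replicate q h) t))"
  and "(\<Sum>q<Q. norm (D (replicate q h) t))<=M"
proof -
 have le: "nm (D (replicate q h))<=s ^ q * d q" for q
 proof -
  have "nm (D (replicate q h))<=d q * norm h ^ q" using D(2)[of "replicate q h"] by (simp add: prod_norm_replicate)
  also have "...<=d q * s ^ q" using h D(3) by (intro mult_left_mono power_mono) auto
  finally show ?thesis by (simp add: mult.commute)
 qed
 show 1: "(\<Sum>q<Q. nm (D (replicate q h)))<=M" for Q by (rule order_trans[OF sum_mono[OF le] D(4)])
 have "(\<Sum>q<Q. norm (D (replicate q h) t))<=(\<Sum>q<Q. nm (D (replicate q h)))" for Q by (intro sum_mono sup_le_nm D)
 then show 3: "(\<Sum>q<Q. norm (D (replicate q h) t))<=M" for Q using 1 order_trans by blast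
 show "summable (%q. norm (D (replicate q h) t))" by (rule summableI_nonneg_bounded[OF _ 3]) simp
qed

lemma AN_mult:
 fixes W W' :: "'a::real_normed_vector => real => complex"
 assumes "AN s M W" "AN s M' W'" and s: "s >= 0"
 shows "AN s (M * M') (%h t. W h t * W' h t)"
proof -
 from assms(1) obtain D d where D:
  "!!us t i. i < length us ==> linear (%x. D (us[i := x]) t)"
  "!!us. HSl (D us)" "!!us. nm (D us)<=d (length us) * prod_list (map norm us)"
  "!!q. d q >= 0" "!!Q. (\<Sum>q<Q. s ^ q * d q)<=M"
  "!!h t. norm h<=s ==> (%q. D (replicate q h) t) sums W h t" by (rule AN_E) (rule that)
 from assms(2) obtain E e where E:
  "!!us t i. i < length us ==> linear (%x. E (us[i := x]) t)"
  "!!us. HSl (E us)" "!!us. nm (E us)<=e (length us) * prod_list (map norm us)"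
  "!!q. e q >= 0" "!!Q. (\<Sum>q<Q. s ^ q * e q)<=M'"
  "!!h t. norm h<=s ==> (%q. E (replicate q h) t) sums W' h t" by (rule AN_E) (rule that)
 have M': "M' >= 0" using E(5)[of 0] by simp
 show ?thesis
 proof (rule AN_I[where D="%us t. \<Sum>j\<le>length us. D (take j us) t * E (drop j us) t"
    and d="%q. \<Sum>j\<le>q. d j * e (q - j)"])
  fix us :: "'a list" and t i assume i: "i < length us"
  have "linear (%x. D (take j (us[i := x])) t * E (drop j (us[i := x])) t)" if j: "j<=length us" for j
  proof (cases "i < j")
   case True
   have "linear (%x. D ((take j us)[i := x]) t)" using True i j by (intro D(1)) auto
   then have "linear (%x. D ((take j us)[i := x]) t * E (drop j us) t)" by (simp add: linear_iff distrib_right)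
   then show ?thesis using True by (simp add: take_update_swap)
  next
   case False
   have "linear (%x. E ((drop j us)[i - j := x]) t)" using False i by (intro E(1)) auto
   then have "linear (%x. D (take j us) t * E ((drop j us)[i - j := x]) t)" by (simp add: linear_iff distrib_left)
   then show ?thesis using False by (simp add: drop_update_swap)
  qed
  then show "linear (%x. \<Sum>j\<le>length (us[i := x]). D (take j (us[i := x])) t * E (drop j (us[i := x])) t)" by (simp add: linear_compose_sum)
 next
  fix us :: "'a list"
  have hs: "HSl (%t. D (take j us) t * E (drop j us) t)" for j by (intro HS_mult(1)[OF l] D E)
  show "HSl (%t. \<Sum>j\<le>length us. D (take j us) t * E (drop j us) t)" by (intro HS_sum(1) hs)
  have "nm (%t. \<Sum>j\<le>length us. D (take j us) t * E (drop j us) t)<=(\<Sum>j\<le>length us. nm (%t. D (take j us) t * E (drop j us) t))"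
   by (intro HS_sum(2) hs)
  also have "...<=(\<Sum>j\<le>length us. d j * e (length us - j) * prod_list (map norm us))"
  proof (rule sum_mono)
   fix j assume j: "j \<in> {..length us}"
   have "nm (%t. D (take j us) t * E (drop j us) t)<=nm (D (take j us)) * nm (E (drop j us))" by (intro nm_mult D E)
   also have "...<=(d j * prod_list (map norm (take j us)))*(e (length us - j) * prod_list (map norm (drop j us)))"
    using D(3)[of "take j us"] E(3)[of "drop j us"] j D(4) prod_norm_nonneg[of "take j us"]
    by (intro mult_mono) (auto simp: min_def intro!: mult_nonneg_nonneg split: if_splits)
   also have "... = d j * e (length us - j)*(prod_list (map norm (take j us)) * prod_list (map norm (drop j us)))" by (simp add: mult_ac)
   also have "prod_list (map norm (take j us)) * prod_list (map norm (drop j us)) = prod_list (map norm us)"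
    by (metis append_take_drop_id map_append prod_list.append)
   finally show "nm (%t. D (take j us) t * E (drop j us) t)<=d j * e (length us - j) * prod_list (map norm us)" .
  qed
  finally show "nm (%t. \<Sum>j\<le>length us. D (take j us) t * E (drop j us) t)<=(\<Sum>j\<le>length us. d j * e (length us - j)) * prod_list (map norm us)"
   by (simp add: sum_distrib_right)
 next
  show "(\<Sum>j\<le>q. d j * e (q - j)) >= 0" for q using D(4) E(4) by (intro sum_nonneg mult_nonneg_nonneg) auto
 next
  fix Q
  show "(\<Sum>q<Q. s ^ q*(\<Sum>j\<le>q. d j * e (q - j)))<=M * M'"
  proof (cases Q)
   case (Suc J)
   have "(\<Sum>q<Q. s ^ q*(\<Sum>j\<le>q. d j * e (q - j))) = (\<Sum>q\<le>J. \<Sum>j\<le>q. (s ^ j * d j)*(s ^ (q - j) * e (q - j)))"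
    unfolding Suc lessThan_Suc_atMost sum_distrib_left
   proof (intro sum.cong refl)
    fix q j :: nat assume "j \<in> {..q}"
    then have "s ^ q = s ^ j * s ^ (q - j)" by (simp flip: power_add)
    then show "s ^ q*(d j * e (q - j)) = (s ^ j * d j)*(s ^ (q - j) * e (q - j))" by simp
   qed
   also have "...<=(\<Sum>q\<le>J. s ^ q * d q)*(\<Sum>q\<le>J. s ^ q * e q)" using s D(4) E(4) by (intro sum_cauchy_le) auto
   also have "...<=M * M'"
   proof (rule mult_mono)
    show "(\<Sum>q\<le>J. s ^ q * d q)<=M" using D(5)[of "Suc J"] by (simp only: lessThan_Suc_atMost)
    show "(\<Sum>q\<le>J. s ^ q * e q)<=M'" using E(5)[of "Suc J"] by (simp only: lessThan_Suc_atMost)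
    show "M >= 0" using D(5)[of 0] by simp
    show "(\<Sum>q\<le>J. s ^ q * e q) >= 0" using s E(4) by (intro sum_nonneg) auto
   qed
   finally show ?thesis .
  qed (use D(5)[of 0] M' in simp)
 next
  fix h :: 'a and t assume h: "norm h<=s"
  note sD = AN_D_norm_summable(2)[OF D(2-5) h, of t]
  note sE = AN_D_norm_summable(2)[OF E(2-5) h, of t]
  have "(%q. \<Sum>j\<le>q. D (replicate j h) t * E (replicate (q - j) h) t) sums ((\<Sum>q. D (replicate q h) t)*(\<Sum>q. E (replicate q h) t))"
   by (rule Cauchy_product_sums[OF sD sE])
  moreover have "(\<Sum>j\<le>length (replicate q h). D (take j (replicate q h)) t * E (drop j (replicate q h)) t)
   = (\<Sum>j\<le>q. D (replicate j h) t * E (replicate (q - j) h) t)" for q by (intro sum.cong) (auto simp: min_def)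
  ultimately show "(%q. \<Sum>j\<le>length (replicate q h). D (take j (replicate q h)) t * E (drop j (replicate q h)) t) sums (W h t * W' h t)"
   using sums_unique[OF D(6)[OF h, of t]] sums_unique[OF E(6)[OF h, of t]] by simp
 qed
qed

lemma AN_suminf:
 fixes W :: "nat => 'a::real_normed_vector => real => complex"
 assumes W: "!!n. AN s (M n) (W n)" and M: "summable M" and s: "s > 0"
 shows "AN s (\<Sum>n. M n) (%h t. \<Sum>n. W n h t)"
proof -
 have "ALL n. EX De. (ALL us t i. i < length us --> linear (%x. fst De (us[i := x]) t)) &
  (ALL us. HSl (fst De us) & nm (fst De us)<=snd De (length us) * prod_list (map norm us)) &
  (ALL q. snd De q >= 0) & (ALL Q. (\<Sum>q<Q. s ^ q * snd De q)<=M n) &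
  (ALL h t. norm h<=s --> (%q. fst De (replicate q h) t) sums W n h t)"
 proof
  fix n
  from W[of n] obtain D d where "(ALL us t i. i < length us --> linear (%x. D (us[i := x]) t)) &
  (ALL us. HSl (D us) & nm (D us)<=d (length us) * prod_list (map norm us)) &
  (ALL q. d q >= 0) & (ALL Q. (\<Sum>q<Q. s ^ q * d q)<=M n) &
  (ALL h t. norm h<=s --> (%q. D (replicate q h) t) sums W n h t)" unfolding AN_def by (elim exE)
  then show "EX De. (ALL us t i. i < length us --> linear (%x. fst De (us[i := x]) t)) &
  (ALL us. HSl (fst De us) & nm (fst De us)<=snd De (length us) * prod_list (map norm us)) &
  (ALL q. snd De q >= 0) & (ALL Q. (\<Sum>q<Q. s ^ q * snd De q)<=M n) &
  (ALL h t. norm h<=s --> (%q. fst De (replicate q h) t) sums W n h t)" by (intro exI[of _ "(D, d)"]) simp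
 qed
 from choice[OF this] obtain De where De: "!!n. (ALL us t i. i < length us --> linear (%x. fst (De n) (us[i := x]) t)) &
  (ALL us. HSl (fst (De n) us) & nm (fst (De n) us)<=snd (De n) (length us) * prod_list (map norm us)) &
  (ALL q. snd (De n) q >= 0) & (ALL Q. (\<Sum>q<Q. s ^ q * snd (De n) q)<=M n) &
  (ALL h t. norm h<=s --> (%q. fst (De n) (replicate q h) t) sums W n h t)" by blast
 define D where "D n = fst (De n)" for n
 define d where "d n = snd (De n)" for n
 have D: "!!n us t i. i < length us ==> linear (%x. D n (us[i := x]) t)"
  "!!n us. HSl (D n us)" "!!n us. nm (D n us)<=d n (length us) * prod_list (map norm us)"
  "!!n q. d n q >= 0" "!!n Q. (\<Sum>q<Q. s ^ q * d n q)<=M n"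
  "!!n h t. norm h<=s ==> (%q. D n (replicate q h) t) sums W n h t" using De unfolding D_def d_def by blast+
 have M0: "M n >= 0" for n using D(5)[of n 0] by simp
 have dle: "s ^ q * d n q<=M n" for n q
 proof -
  have "s ^ q * d n q<=(\<Sum>q<Suc q. s ^ q * d n q)" using s D(4) by (intro member_le_sum) auto
  then show ?thesis using D(5)[of n "Suc q"] by linarith
 qed
 have sd: "summable (%n. s ^ q * d n q)" for q by (rule summable_comparison_test'[OF M, of 0]) (use dle s D(4) in auto)
 have sd': "summable (%n. d n q)" for q using summable_mult[OF sd[of q], of "inverse (s ^ q)"] s by (simp add: mult.assoc[symmetric])
 have nmD: "(\<Sum>n<J. nm (D n us))<=(\<Sum>n. d n (length us)) * prod_list (map norm us)" for us J
 proof -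
  have "(\<Sum>n<J. nm (D n us))<=(\<Sum>n<J. d n (length us)) * prod_list (map norm us)" unfolding sum_distrib_right by (intro sum_mono D(3))
  also have "...<=(\<Sum>n. d n (length us)) * prod_list (map norm us)"
   using D(4) by (intro mult_right_mono sum_le_suminf sd' prod_norm_nonneg) auto
  finally show ?thesis .
 qed
 note hs = HS_suminf[of "%n. D n us" for us, OF D(2) nmD]
 show ?thesis
 proof (rule AN_I[where D="%us t. \<Sum>n. D n us t" and d="%q. \<Sum>n. d n q"])
  fix us :: "'a list" and t i assume i: "i < length us"
  have sm: "summable (%n. D n (us[i := x]) t)" for x by (rule summable_norm_cancel[OF hs(3)])
  show "linear (%x. \<Sum>n. D n (us[i := x]) t)"
  proof (rule linearI)
   show "(\<Sum>n. D n (us[i := x+y]) t) = (\<Sum>n. D n (us[i := x]) t)+(\<Sum>n. D n (us[i := y]) t)" for x y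
    using linear_add[OF D(1)[OF i]] suminf_add[OF sm sm] by simp
   show "(\<Sum>n. D n (us[i := r *\<^sub>R x]) t) = r *\<^sub>R (\<Sum>n. D n (us[i := x]) t)" for r x
    using linear_scale[OF D(1)[OF i]] suminf_scaleR_right[OF sm] by simp
  qed
 next
  show "HSl (%t. \<Sum>n. D n us t)" "nm (%t. \<Sum>n. D n us t)<=(\<Sum>n. d n (length us)) * prod_list (map norm us)" for us by (rule hs)+
  show "(\<Sum>n. d n q) >= 0" for q by (intro suminf_nonneg sd' D)
  show "(\<Sum>q<Q. s ^ q*(\<Sum>n. d n q))<=(\<Sum>n. M n)" for Q
  proof -
   have "(\<Sum>q<Q. s ^ q*(\<Sum>n. d n q)) = (\<Sum>q<Q. \<Sum>n. s ^ q * d n q)" by (intro sum.cong refl suminf_mult[symmetric] sd')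
   also have "... = (\<Sum>n. \<Sum>q<Q. s ^ q * d n q)" by (rule suminf_sum[symmetric, OF sd])
   also have "...<=(\<Sum>n. M n)" by (intro suminf_le D(5) summable_sum sd M)
   finally show ?thesis .
  qed
  fix h :: 'a and t assume h: "norm h<=s"
  have "(\<Sum>q<J. norm (D n (replicate q h) t))<=M n" for n J by (rule AN_D_norm_summable(3)[OF D(2-5) h])
  from sums_swap(1)[OF this M]
  show "(%q. \<Sum>n. D n (replicate q h) t) sums (\<Sum>n. W n h t)" using sums_unique[OF D(6)[OF h, of _ t]] by simp
 qed
qed

lemma AN_value:
 assumes W: "AN s M W" and h: "norm h<=s"
 shows "HSl (W h)" and "nm (W h)<=M"
  and "s > 0 ==> nm (%t. W h t - W 0 t)<=M*(norm h / s)"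
proof -
 from W obtain D d where D:
  "!!us t i. i < length us ==> linear (%x. D (us[i := x]) t)"
  "!!us. HSl (D us)" "!!us. nm (D us)<=d (length us) * prod_list (map norm us)"
  "!!q. d q >= 0" "!!Q. (\<Sum>q<Q. s ^ q * d q)<=M"
  "!!h t. norm h<=s ==> (%q. D (replicate q h) t) sums W h t" by (rule AN_E) (rule that)
 note a = AN_D_norm_summable[OF D(2-5) h]
 note hs = HS_suminf[of "%q. D (replicate q h)", OF D(2) a(1)]
 have Wh: "W h = (%t. \<Sum>q. D (replicate q h) t)" using sums_unique[OF D(6)[OF h]] by (intro ext)
 show "HSl (W h)" and "nm (W h)<=M" using hs unfolding Wh by auto
 assume s: "s > 0"
 have z0: "D (replicate (Suc q) 0) t = 0" for q t using linear_0[OF D(1)[of 0 "replicate (Suc q) 0" t]] by simp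
 have W0: "W 0 t = D [] t" for t
 proof -
  have "(%q. D (replicate q 0) t) sums D [] t" using sums_single[of 0 "%q. D (replicate q 0) t"] z0
   by (rule_tac sums_cong[THEN iffD1, OF _ sums_single[of 0 "%q. D (replicate q 0) t", simplified]])
    (metis not0_implies_Suc)
  from sums_unique2[OF D(6)[of 0 t] this] s show ?thesis by simp
 qed
 have "(\<Sum>q<J. nm (D (replicate (Suc q) h)))<=M*(norm h / s)" for J
 proof -
  have "(\<Sum>q<J. nm (D (replicate (Suc q) h)))<=(\<Sum>q<J. (norm h / s)*(s ^ Suc q * d (Suc q)))"
  proof (rule sum_mono)
   fix q
   have "nm (D (replicate (Suc q) h))<=d (Suc q) * norm h ^ Suc q"
    using D(3)[of "replicate (Suc q) h"] by (simp only: length_replicate prod_norm_replicate)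
   also have "norm h ^ Suc q<=norm h * s ^ q" using h by (simp add: mult_left_mono power_mono)
   finally have "nm (D (replicate (Suc q) h))<=d (Suc q)*(norm h * s ^ q)" using D(4) by (simp add: mult_left_mono)
   then show "nm (D (replicate (Suc q) h))<=(norm h / s)*(s ^ Suc q * d (Suc q))" using s by (simp add: mult_ac)
  qed
  also have "... = (norm h / s)*(\<Sum>q<J. s ^ Suc q * d (Suc q))" by (simp only: sum_distrib_left)
  also have "...<=(norm h / s)*(\<Sum>q<Suc J. s ^ q * d q)"
  proof (rule mult_left_mono)
   show "(\<Sum>q<J. s ^ Suc q * d (Suc q))<=(\<Sum>q<Suc J. s ^ q * d q)" by (subst sum.lessThan_Suc_shift) (use D(4)[of 0] in simp)
  qed (use s in auto)
  also have "...<=(norm h / s) * M" using s by (intro mult_left_mono D(5)) auto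
  finally show ?thesis by (simp add: mult.commute)
 qed
 note hs2 = HS_suminf[of "%q. D (replicate (Suc q) h)", OF D(2) this]
 have "W h t - W 0 t = (\<Sum>q. D (replicate (Suc q) h) t)" for t
  using suminf_split_head[OF summable_norm_cancel[OF hs(3)], of t] by (simp add: Wh W0)
 then show "nm (%t. W h t - W 0 t)<=M*(norm h / s)" using hs2(2) by simp
qed

lemma AN_cmult: "AN s M W ==> s >= 0 ==> AN s (malg l * norm c * M) (%h t. c * W h t)"
proof -
 assume W: "AN s M W" and s: "s >= 0"
 have "nm (W 0)<=M" using AN_value(2)[OF W, of 0] s by simp
 then have M: "M >= 0" using nm_nonneg order_trans by blast
 show ?thesis by (rule AN_mono[OF AN_mult[OF AN_const[OF HS_const(1)[of l c] s] W s]])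
   (intro mult_right_mono nm_const M)
qed

lemma AN_sum:
 assumes "!!i. i \<in> A ==> AN s (M i) (W i)" "s >= 0"
 shows "AN s (\<Sum>i\<in>A. M i) (%h t. \<Sum>i\<in>A. W i h t)"
proof -
 have z: "AN s 0 (%h t. 0)" by (rule AN_mono[OF AN_const[OF HS_const(1)[of l 0] assms(2)]]) (use nm_const[of 0] in simp)
 show ?thesis using assms(1) by (induction A rule: infinite_finite_induct) (auto intro: z AN_add assms(2))
qed

lemma AN_prod:
 assumes "!!i. AN s M (W i)" "s >= 0" "w ~= []"
 shows "AN s (M ^ length w) (%h t. prod_list (map (%i. W i h t) w))" using assms(3)
proof (induction w)
 case (Cons i w)
 show ?case
 proof (cases "w = []")
  case True then show ?thesis using assms(1)[of i] by simp
 next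
  case False
  then show ?thesis using AN_mult[OF assms(1)[of i] Cons.IH[OF False] assms(2)] by simp
 qed
qed simp

end

context sobolev_words
begin

lemma sobolev_iff:
 fixes f :: "real => real ^ 'n"
 shows "f \<in> sobolev T l F \<longleftrightarrow> range f \<subseteq> F & (ALL a. HSl (%t. cor (vn (f t) a)))"
proof -
 have fc: "vn (fourier_coeff T f k) a = cfc T (%t. cor (vn (f t) a)) k" for k a by (simp add: fourier_coeff_def cfc_def)
 have n2: "(norm (fourier_coeff T f k))\<^sup>2 = (\<Sum>a\<in>UNIV. (norm (cfc T (%t. cor (vn (f t) a)) k))\<^sup>2)" for k
  by (simp add: norm_vec_def L2_set_def sum_nonneg fc)
 show ?thesis
 proof
  assume f: "f \<in> sobolev T l F"
  have s: "(%k::int. (1+(real_of_int k)\<^sup>2) ^ l*(norm (fourier_coeff T f k))\<^sup>2) summable_on UNIV" using f by (simp add: sobolev_def)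
  have "(%k::int. (1+(real_of_int k)\<^sup>2) ^ l*(norm (cfc T (%t. cor (vn (f t) a)) k))\<^sup>2) summable_on UNIV" for a
   by (rule summable_on_comparison_test[OF s])
    (auto simp: n2 intro!: mult_left_mono member_le_sum[where f="%a. (norm (cfc T (%t. cor (vn (f t) a)) _))\<^sup>2"])
  moreover have "continuous_on UNIV (%t. cor (vn (f t) a))" for a
  proof -
   have c: "continuous_on UNIV f" using f by (simp add: sobolev_def)
   show ?thesis by (intro continuous_on_of_real continuous_on_component c)
  qed
  ultimately show "range f \<subseteq> F & (ALL a. HSl (%t. cor (vn (f t) a)))" using f by (simp add: sobolev_def HS_def)
 next
  assume f: "range f \<subseteq> F & (ALL a. HSl (%t. cor (vn (f t) a)))"
  have "f (t+T) = f t" for t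
  proof -
   have "cor (vn (f (t+T)) a) = cor (vn (f t) a)" for a using f HS_periodic[of T l "%t. cor (vn (f t) a)" t] by blast
   then show ?thesis by (simp add: vec_eq_iff)
  qed
  moreover have "continuous_on UNIV f"
  proof -
   have "continuous_on UNIV (%t. Re (cor (vn (f t) a)))" for a by (intro continuous_on_Re) (use f in \<open>simp add: HS_def\<close>)
   then have "continuous_on UNIV (%t. \<chi> a. vn (f t) a)" by (intro continuous_on_vec_lambda) simp
   then show ?thesis by simp
  qed
  moreover have "(%k::int. (1+(real_of_int k)\<^sup>2) ^ l*(norm (fourier_coeff T f k))\<^sup>2) summable_on UNIV"
  proof -
   have "((%k::int. \<Sum>a\<in>UNIV. (1+(real_of_int k)\<^sup>2) ^ l*(norm (cfc T (%t. cor (vn (f t) a)) k))\<^sup>2)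
    has_sum (\<Sum>a\<in>UNIV. \<Sum>\<^sub>\<infinity>k::int. (1+(real_of_int k)\<^sup>2) ^ l*(norm (cfc T (%t. cor (vn (f t) a)) k))\<^sup>2)) UNIV"
    by (intro has_sum_sum has_sum_infsum) (use f in \<open>auto simp: HS_def\<close>)
   then show ?thesis unfolding n2 sum_distrib_left by (rule has_sum_imp_summable)
  qed
  ultimately show "f \<in> sobolev T l F" using f by (simp add: sobolev_def)
 qed
qed

lemma sobolev_norm_bounds:
 fixes f :: "real => real ^ 'n"
 assumes f: "!!a. HSl (%t. cor (vn (f t) a))"
 shows "sobolev_norm T l f<=(\<Sum>a\<in>UNIV. hn T l (%t. cor (vn (f t) a)))"
  and "hn T l (%t. cor (vn (f t) a))<=sobolev_norm T l f"
proof -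
 define c where "c a k = (1+(real_of_int k)\<^sup>2) ^ l*(norm (cfc T (%t. cor (vn (f t) a)) k))\<^sup>2" for a k
 have n2: "(1+(real_of_int k)\<^sup>2) ^ l*(norm (fourier_coeff T f k))\<^sup>2 = (\<Sum>a\<in>UNIV. c a k)" for k
  by (simp add: norm_vec_def L2_set_def sum_nonneg fourier_coeff_def cfc_def c_def sum_distrib_left)
 have "((%k. \<Sum>a\<in>UNIV. c a k) has_sum (\<Sum>a\<in>UNIV. \<Sum>\<^sub>\<infinity>k. c a k)) UNIV"
  by (intro has_sum_sum has_sum_infsum) (use f in \<open>auto simp: HS_def c_def\<close>)
 then have e: "sobolev_norm T l f = sqrt (\<Sum>a\<in>UNIV. (hn T l (%t. cor (vn (f t) a)))\<^sup>2)"
  unfolding sobolev_norm_def n2 by (simp add: infsumI hn_sq[OF f] c_def)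
 then show "sobolev_norm T l f<=(\<Sum>a\<in>UNIV. hn T l (%t. cor (vn (f t) a)))"
  using L2_set_le_sum[of UNIV "%a. hn T l (%t. cor (vn (f t) a))"] by (simp add: L2_set_def)
 have "hn T l (%t. cor (vn (f t) a))<=L2_set (%a. hn T l (%t. cor (vn (f t) a))) UNIV" by (rule member_le_L2_set) auto
 then show "hn T l (%t. cor (vn (f t) a))<=sobolev_norm T l f" unfolding e L2_set_def .
qed

lemma HS_Re:
 assumes "HSl f" shows "HSl (%t. cor (Re (f t)))" and "nm (%t. cor (Re (f t)))<=nm f"
proof -
 have e: "cor (Re (f t)) = (1/2)*(f t+cnj (f t))" for t by (simp add: complex_eq_iff)
 show "HSl (%t. cor (Re (f t)))" unfolding e by (intro HS_cmult(1) HS_add(1) HS_cnj(1) assms)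
 have "nm (%t. (1/2)*(f t+cnj (f t)))<=norm (1/2::complex) * nm (%t. f t+cnj (f t))" by (intro nm_cmult HS_add(1) HS_cnj(1) assms)
 also have "...<=(1/2)*(nm f+nm (%t. cnj (f t)))" using nm_add[OF assms HS_cnj(1)[OF assms]] by simp
 also have "...<=nm f" using nm_cnj[OF assms] by simp
 finally show "nm (%t. cor (Re (f t)))<=nm f" unfolding e .
qed

lemma HS_linear_image:
 fixes P :: "real ^ 'n => real ^ 'n"
 assumes P: "linear P" and f: "!!c. HSl (%t. cor (vn (f t) c))"
  and le: "!!c. nm (%t. cor (vn (f t) c))<=B"
 shows "HSl (%t. cor (vn (P (f t)) a))"
  and "nm (%t. cor (vn (P (f t)) a))<=(\<Sum>c\<in>UNIV. norm (mtx P a c)) * B"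
proof -
 have e: "(%t. cor (vn (P (f t)) a)) = (%t. \<Sum>c\<in>UNIV. mtx P a c * cor (vn (f t) c))" by (rule ext) (rule mtx_apply[OF P])
 show "HSl (%t. cor (vn (P (f t)) a))" unfolding e by (intro HS_sum(1) HS_cmult(1) f)
 have "nm (%t. \<Sum>c\<in>UNIV. mtx P a c * cor (vn (f t) c))<=(\<Sum>c\<in>UNIV. nm (%t. mtx P a c * cor (vn (f t) c)))"
  by (intro HS_sum(2) HS_cmult(1) f)
 also have "...<=(\<Sum>c\<in>UNIV. norm (mtx P a c) * B)" by (intro sum_mono order_trans[OF nm_cmult[OF f]] mult_left_mono le) auto
 finally show "nm (%t. cor (vn (P (f t)) a))<=(\<Sum>c\<in>UNIV. norm (mtx P a c)) * B" unfolding e by (simp add: sum_distrib_right)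
qed

lemma linear_permute_update:
 assumes D: "!!us i. length us = q ==> i < q ==> linear (%x. D (us[i := x]))"
  and \<pi>: "\<pi> permutes {..<q}" and us: "length us = q" and i: "i < q"
 shows "linear (%x. D (permute_list \<pi> (us[i := x])))"
proof -
 define j where "j = inv_into UNIV \<pi> i"
 have j: "j < q" "\<pi> j = i" using permutes_in_image[OF permutes_inv[OF \<pi>], of i] permutes_inverses[OF \<pi>] i by (auto simp: j_def)
 have "permute_list \<pi> (us[i := x]) = (permute_list \<pi> us)[j := x]" for x
 proof (rule nth_equalityI)
  fix k assume "k < length (permute_list \<pi> (us[i := x]))"
  then have k: "k < q" using us by simp
  have pk: "\<pi> k < q" using permutes_in_image[OF \<pi>, of k] k by simp
  have "\<pi> k = i \<longleftrightarrow> k = j" using j permutes_inj[OF \<pi>] by (auto dest: injD)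
  then show "permute_list \<pi> (us[i := x]) ! k = (permute_list \<pi> us)[j := x] ! k"
   using k pk us \<pi> by (auto simp: permute_list_nth nth_list_update)
 qed simp
 then show ?thesis using D[of "permute_list \<pi> us" j] us j by simp
qed

theorem AN_sobolev_analytic:
 fixes W :: "'a::real_normed_vector => real => real ^ 'n"
 assumes W: "!!a. EX M. AN s M (%h t. cor (vn (W h t) a))" and s: "s > 0"
  and P: "linear P" "!!u. P u \<in> F" "!!u. u \<in> F ==> P u = u"
  and WF: "!!h t. h \<in> D ==> norm h<=s ==> W h t \<in> F"
 shows "W \<in> sobolev_analytic T l D F"
proof -
 have "ALL a. EX M. AN s M (%h t. cor (vn (W h t) a))" by (intro allI W)
 from choice[OF this] obtain M where M: "!!a. AN s (M a) (%h t. cor (vn (W h t) a))" by blast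
 have "ALL a. EX De. (ALL us t i. i < length us --> linear (%x. fst De (us[i := x]) t)) &
  (ALL us. HSl (fst De us) & nm (fst De us)<=snd De (length us) * prod_list (map norm us)) &
  (ALL q. snd De q >= 0) & (ALL Q. (\<Sum>q<Q. s ^ q * snd De q)<=M a) &
  (ALL h t. norm h<=s --> (%q. fst De (replicate q h) t) sums cor (vn (W h t) a))"
 proof
  fix a
  from M[of a] obtain E e where "(ALL us t i. i < length us --> linear (%x. E (us[i := x]) t)) &
  (ALL us. HSl (E us) & nm (E us)<=e (length us) * prod_list (map norm us)) &
  (ALL q. e q >= 0) & (ALL Q. (\<Sum>q<Q. s ^ q * e q)<=M a) &
  (ALL h t. norm h<=s --> (%q. E (replicate q h) t) sums cor (vn (W h t) a))" unfolding AN_def by (elim exE)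
  then show "EX De. (ALL us t i. i < length us --> linear (%x. fst De (us[i := x]) t)) &
  (ALL us. HSl (fst De us) & nm (fst De us)<=snd De (length us) * prod_list (map norm us)) &
  (ALL q. snd De q >= 0) & (ALL Q. (\<Sum>q<Q. s ^ q * snd De q)<=M a) &
  (ALL h t. norm h<=s --> (%q. fst De (replicate q h) t) sums cor (vn (W h t) a))" by (intro exI[of _ "(E, e)"]) simp
 qed
 from choice[OF this] obtain De where De: "!!a. (ALL us t i. i < length us --> linear (%x. fst (De a) (us[i := x]) t)) &
  (ALL us. HSl (fst (De a) us) & nm (fst (De a) us)<=snd (De a) (length us) * prod_list (map norm us)) &
  (ALL q. snd (De a) q >= 0) & (ALL Q. (\<Sum>q<Q. s ^ q * snd (De a) q)<=M a) &
  (ALL h t. norm h<=s --> (%q. fst (De a) (replicate q h) t) sums cor (vn (W h t) a))" by blast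
 define E where "E a = fst (De a)" for a
 define e where "e a = snd (De a)" for a
 have E: "!!a us t i. i < length us ==> linear (%x. E a (us[i := x]) t)"
  "!!a us. HSl (E a us)" "!!a us. nm (E a us)<=e a (length us) * prod_list (map norm us)"
  "!!a q. e a q >= 0" "!!a Q. (\<Sum>q<Q. s ^ q * e a q)<=M a"
  "!!a h t. norm h<=s ==> (%q. E a (replicate q h) t) sums cor (vn (W h t) a)" using De unfolding E_def e_def by blast+
 define C where "C = (\<Sum>a\<in>UNIV. \<bar>M a\<bar>)"
 have C0: "C >= 0" unfolding C_def by (intro sum_nonneg) auto
 have e_le: "e a q<=C / s ^ q" for a q
 proof -
  have "s ^ q * e a q<=(\<Sum>q<Suc q. s ^ q * e a q)" using s E(4) by (intro member_le_sum[of q "{..<Suc q}" "%q. s ^ q * e a q"]) auto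
  also have "...<=\<bar>M a\<bar>" using E(5)[of a "Suc q"] by linarith
  also have "...<=C" unfolding C_def by (rule member_le_sum) auto
  finally show ?thesis using s by (simp add: field_simps)
 qed
 define Y where "Y q t us = (\<chi> a. (\<Sum>\<pi>\<in>{\<pi>. \<pi> permutes {..<q}}. Re (E a (permute_list \<pi> us) t)) / fact q)" for q :: nat and t us
 define w where "w q t us = P (Y q t us)" for q :: nat and t us
 have per: "finite {\<pi>. \<pi> permutes {..<q}}" "card {\<pi>. \<pi> permutes {..<q}} = fact q" for q :: nat
  by (auto simp: finite_permutations card_permutations)
 have sym: "symmetric_multilinear q (w q t)" for q t unfolding symmetric_multilinear_def
 proof (intro conjI allI impI)
  fix us :: "'a list" and i assume us: "length us = q" and i: "i < q"
  have "linear (%x. Re (E a (permute_list \<pi> (us[i := x])) t))" if \<pi>: "\<pi> permutes {..<q}" for a \<pi>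
  proof -
   have "linear (%x. E a (permute_list \<pi> (us[i := x])) t)" using linear_permute_update[of q "%us. E a us t" \<pi> us i] E(1) \<pi> us i by simp
   then show ?thesis by (simp add: linear_iff)
  qed
  then have "linear (%x. (\<Sum>\<pi>\<in>{\<pi>. \<pi> permutes {..<q}}. Re (E a (permute_list \<pi> (us[i := x])) t)))" for a
   by (intro linear_compose_sum) auto
  then have "linear (%x. Y q t (us[i := x]))" unfolding Y_def linear_iff by (auto simp: vec_eq_iff add_divide_distrib)
  then show "linear (%x. w q t (us[i := x]))" unfolding w_def using linear_compose[OF _ P(1)] by (simp add: o_def)
 next
  fix us vs :: "'a list" assume us: "length us = q" and m: "mset us = mset vs"
  obtain p where p: "p permutes {..<length vs}" "permute_list p vs = us" using mset_eq_permutation[OF m] .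
  have lv: "length vs = q" using us m by (metis size_mset)
  have "(\<Sum>\<pi>\<in>{\<pi>. \<pi> permutes {..<q}}. Re (E a (permute_list \<pi> us) t))
    = (\<Sum>\<pi>\<in>{\<pi>. \<pi> permutes {..<q}}. Re (E a (permute_list \<pi> vs) t))" for a
  proof -
   have "(\<Sum>\<pi>\<in>{\<pi>. \<pi> permutes {..<q}}. Re (E a (permute_list \<pi> us) t))
     = (\<Sum>\<pi>\<in>{\<pi>. \<pi> permutes {..<q}}. Re (E a (permute_list (p \<circ> \<pi>) vs) t))"
    using p lv by (intro sum.cong) (auto simp: permute_list_compose)
   then show ?thesis using setum_permutations_compose_left[of p "{..<q}" "%\<pi>. Re (E a (permute_list \<pi> vs) t)"] p lv by simp
  qed
  then show "w q t us = w q t vs" by (simp add: w_def Y_def)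
 qed
 have Yc: "HSl (%t. cor (vn (Y q t us) a)) &
   nm (%t. cor (vn (Y q t us) a))<=C / s ^ q * prod_list (map norm us)" if us: "length us = q" for q us a
 proof -
  have eq: "(%t. cor (vn (Y q t us) a)) = (%t. (1 / fact q)*(\<Sum>\<pi>\<in>{\<pi>. \<pi> permutes {..<q}}. cor (Re (E a (permute_list \<pi> us) t))))"
   by (simp add: Y_def fun_eq_iff)
  have h1: "HSl (%t. \<Sum>\<pi>\<in>{\<pi>. \<pi> permutes {..<q}}. cor (Re (E a (permute_list \<pi> us) t)))" by (intro HS_sum(1) HS_Re(1) E)
  have "nm (%t. (1 / fact q)*(\<Sum>\<pi>\<in>{\<pi>. \<pi> permutes {..<q}}. cor (Re (E a (permute_list \<pi> us) t))))
  <=norm (1 / fact q :: complex) * nm (%t. \<Sum>\<pi>\<in>{\<pi>. \<pi> permutes {..<q}}. cor (Re (E a (permute_list \<pi> us) t)))"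
   by (rule nm_cmult[OF h1])
  also have "nm (%t. \<Sum>\<pi>\<in>{\<pi>. \<pi> permutes {..<q}}. cor (Re (E a (permute_list \<pi> us) t)))
  <=(\<Sum>\<pi>\<in>{\<pi>. \<pi> permutes {..<q}}. nm (%t. cor (Re (E a (permute_list \<pi> us) t))))" by (intro HS_sum(2) HS_Re(1) E)
  also have "...<=(\<Sum>\<pi>\<in>{\<pi>. \<pi> permutes {..<q}}. C / s ^ q * prod_list (map norm us))"
  proof (rule sum_mono)
   fix \<pi> assume \<pi>: "\<pi> \<in> {\<pi>. \<pi> permutes {..<q}}"
   have "mset (permute_list \<pi> us) = mset us" using \<pi> us by (intro mset_permute_list) auto
   then have pn: "prod_list (map norm (permute_list \<pi> us)) = prod_list (map norm us)" by (metis mset_map prod_mset_prod_list)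
   have "nm (%t. cor (Re (E a (permute_list \<pi> us) t)))<=nm (E a (permute_list \<pi> us))" by (rule HS_Re(2)[OF E(2)])
   also have "...<=e a q * prod_list (map norm us)" using E(3)[of a "permute_list \<pi> us"] us pn by simp
   also have "...<=C / s ^ q * prod_list (map norm us)" by (intro mult_right_mono e_le prod_norm_nonneg)
   finally show "nm (%t. cor (Re (E a (permute_list \<pi> us) t)))<=C / s ^ q * prod_list (map norm us)" .
  qed
  also have "... = fact q*(C / s ^ q * prod_list (map norm us))" by (simp add: per)
  finally have "nm (%t. cor (vn (Y q t us) a))<=norm (1 / fact q :: complex)*(fact q*(C / s ^ q * prod_list (map norm us)))"
   unfolding eq by (simp add: mult_left_mono)
  also have "... = C / s ^ q * prod_list (map norm us)" by (simp add: norm_divide)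
  finally show ?thesis using HS_cmult(1)[OF h1] unfolding eq by blast
 qed
 define C2 where "C2 = (\<Sum>a\<in>UNIV. \<Sum>c\<in>UNIV. norm (mtx P a c)) * C+1"
 have S0: "(\<Sum>a\<in>UNIV. \<Sum>c\<in>UNIV. norm (mtx P a c)) >= 0" by (intro sum_nonneg) auto
 have C2: "C2 > 0" using S0 C0 by (simp add: C2_def add_nonneg_pos)
 have wS: "(%t. w q t us) \<in> sobolev T l F & sobolev_norm T l (%t. w q t us)<=C2 / s ^ q * prod_list (map norm us)"
  if us: "length us = q" for q us
 proof -
  have hs: "HSl (%t. cor (vn (w q t us) a))"
   "nm (%t. cor (vn (w q t us) a))<=(\<Sum>c\<in>UNIV. norm (mtx P a c))*(C / s ^ q * prod_list (map norm us))" for a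
   unfolding w_def using Yc[OF us] by (intro HS_linear_image[OF P(1)]; blast)+
  have "sobolev_norm T l (%t. w q t us)<=(\<Sum>a\<in>UNIV. hn T l (%t. cor (vn (w q t us) a)))" by (rule sobolev_norm_bounds(1)[OF hs(1)])
  also have "...<=(\<Sum>a\<in>UNIV. (\<Sum>c\<in>UNIV. norm (mtx P a c))*(C / s ^ q * prod_list (map norm us)))"
   by (intro sum_mono order_trans[OF hn_le_nm hs(2)])
  also have "... = (\<Sum>a\<in>UNIV. \<Sum>c\<in>UNIV. norm (mtx P a c))*(C / s ^ q * prod_list (map norm us))"
   by (rule sum_distrib_right[symmetric])
  also have "... = (\<Sum>a\<in>UNIV. \<Sum>c\<in>UNIV. norm (mtx P a c)) * C*(prod_list (map norm us) / s ^ q)" by simp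
  also have "...<=C2*(prod_list (map norm us) / s ^ q)" using s prod_norm_nonneg[of us] by (intro mult_right_mono) (auto simp: C2_def)
  finally have "sobolev_norm T l (%t. w q t us)<=C2 / s ^ q * prod_list (map norm us)" by simp
  moreover have "(%t. w q t us) \<in> sobolev T l F" unfolding sobolev_iff using hs(1) P(2) by (auto simp: w_def)
  ultimately show ?thesis by blast
 qed
 have sums: "(%q. w q t (replicate q h)) sums W h t" if h: "h \<in> D" "norm h < s" for h t
 proof -
  have Yr: "Y q t (replicate q h) = (\<chi> a. Re (E a (replicate q h) t))" for q
  proof -
   have "permute_list \<pi> (replicate q h) = replicate q h" if "\<pi> permutes {..<q}" for \<pi>
    using that permutes_in_image[OF that] by (intro nth_equalityI) (auto simp: permute_list_nth)
   then have "(\<Sum>\<pi>\<in>{\<pi>. \<pi> permutes {..<q}}. Re (E a (permute_list \<pi> (replicate q h)) t)) = fact q * Re (E a (replicate q h) t)" for a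
    by (simp add: per)
   then show ?thesis by (simp add: Y_def)
  qed
  have "(%q. Re (E a (replicate q h) t)) sums vn (W h t) a" for a using bounded_linear.sums[OF bounded_linear_Re E(6)[of h a t]] h by simp
  then have "(%q. \<Sum>a\<in>UNIV. Re (E a (replicate q h) t) *\<^sub>R axis a (1::real)) sums (\<Sum>a\<in>UNIV. vn (W h t) a *\<^sub>R axis a 1)"
   by (intro sums_sum bounded_linear.sums[OF bounded_linear_scaleR_left])
  moreover have "(\<Sum>a\<in>UNIV. Re (E a (replicate q h) t) *\<^sub>R axis a (1::real)) = Y q t (replicate q h)" for q
   unfolding Yr using vec_expand[of "\<chi> a. Re (E a (replicate q h) t)"] by simp
  ultimately have "(%q. Y q t (replicate q h)) sums W h t" by (simp only: vec_expand)
  moreover have "bounded_linear P" using P(1) by (simp add: linear_conv_bounded_linear)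
  ultimately have "(%q. P (Y q t (replicate q h))) sums P (W h t)" by (rule bounded_linear.sums[rotated])
  then show ?thesis using WF[of h t] h P(3) by (simp add: w_def)
 qed
 have f1: "ALL q t. symmetric_multilinear q (w q t)" by (intro allI sym)
 have f2: "ALL q us. length us = q --> (%t. w q t us) \<in> sobolev T l F &
    sobolev_norm T l (%t. w q t us)<=C2 / s ^ q * prod_list (map norm us)" by (intro allI impI wS)
 have f3: "\<forall>U\<in>D. norm U < s --> (ALL t. (%q. w q t (replicate q U)) sums W U t)" by (intro ballI impI allI sums)
 show ?thesis unfolding sobolev_analytic_def by (intro CollectI exI[of _ w] exI[of _ s] exI[of _ C2] conjI s C2 f1 f2 f3)
qed

lemma sobolev_analytic_imp_analytic:
 fixes W :: "'a::real_normed_vector => real ^ 'n"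
 assumes W: "(%U t. W U) \<in> sobolev_analytic T l D F"
 shows "W \<in> analytic_maps D F"
proof -
 from W obtain w rh c where w0: "rh > 0 & c > 0 & (ALL q t. symmetric_multilinear q (w q t)) &
  (ALL q us. length us = q --> (%t. w q t us) \<in> sobolev T l F &
    sobolev_norm T l (%t. w q t us)<=c / rh ^ q * prod_list (map norm us)) &
  (\<forall>U\<in>D. norm U < rh --> (ALL t. (%q. w q t (replicate q U)) sums W U))"
  unfolding sobolev_analytic_def mem_Collect_eq by (elim exE) (rule that)
 note w1 = w0[THEN conjunct2, THEN conjunct2, THEN conjunct2]
 have w: "rh > 0" "c > 0" "!!q t. symmetric_multilinear q (w q t)" using w0 by simp_all
 have w4: "(%t. w q t us) \<in> sobolev T l F &
    sobolev_norm T l (%t. w q t us)<=c / rh ^ q * prod_list (map norm us)" if "length us = q" for q us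
  by (rule w1[THEN conjunct1, THEN spec, THEN spec, THEN mp, OF that])
 have w5: "!!U t. U \<in> D ==> norm U < rh ==> (%q. w q t (replicate q U)) sums W U" using w1 by simp
 define C where "C = real CARD('n) * sqrt isum * c"
 have C: "C > 0" using w(2) isum_ge_1 by (simp add: C_def)
 have "w q 0 us \<in> F & norm (w q 0 us)<=C / rh ^ q * prod_list (map norm us)" if us: "length us = q" for q us
 proof
  have S: "range (%t. w q t us) \<subseteq> F" "!!a. HSl (%t. cor (vn (w q t us) a))" using w4[OF us] unfolding sobolev_iff by blast+
  then show "w q 0 us \<in> F" by blast
  have "norm (w q 0 us)<=(\<Sum>a\<in>UNIV. \<bar>vn (w q 0 us) a\<bar>)" by (rule norm_le_l1_cart)
  also have "...<=(\<Sum>a\<in>(UNIV::'n set). sqrt isum*(c / rh ^ q * prod_list (map norm us)))"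
  proof (rule sum_mono)
   fix a
   have "\<bar>vn (w q 0 us) a\<bar> = norm (cor (vn (w q 0 us) a))" by simp
   also have "...<=sqrt isum * hn T l (%t. cor (vn (w q t us) a))" by (rule HS_sup[OF S(2) l])
   also have "...<=sqrt isum*(c / rh ^ q * prod_list (map norm us))"
    using isum_ge_1 sobolev_norm_bounds(2)[OF S(2), of a] w4[OF us] by (intro mult_left_mono) auto
   finally show "\<bar>vn (w q 0 us) a\<bar><=sqrt isum*(c / rh ^ q * prod_list (map norm us))" .
  qed
  finally show "norm (w q 0 us)<=C / rh ^ q * prod_list (map norm us)" by (simp add: C_def mult_ac)
 qed
 then have f2: "ALL q us. length us = q --> w q 0 us \<in> F & norm (w q 0 us)<=C / rh ^ q * prod_list (map norm us)" by (intro allI impI)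
 have f1: "ALL q. symmetric_multilinear q (w q 0)" by (intro allI w(3))
 have f3: "\<forall>U\<in>D. norm U < rh --> (%q. w q 0 (replicate q U)) sums W U" by (intro ballI impI w5)
 show ?thesis unfolding analytic_maps_def by (intro CollectI exI[of _ "%q. w q 0"] exI[of _ rh] exI[of _ C] conjI w(1) C f1 f2 f3)
qed

end

section \<open>The truncated graph and its remainder\<close>

lemma fps_prod_list_sums:
 fixes f :: "'i => real fps"
 assumes f: "!!i J. (\<Sum>n<J. \<bar>fps_nth (f i) n\<bar>)<=B"
 shows "(\<Sum>n<J. \<bar>fps_nth (prod_list (map f w)) n\<bar>)<=B ^ length w"
  and "(%n. fps_nth (prod_list (map f w)) n) sums prod_list (map (%i. \<Sum>n. fps_nth (f i) n) w)"
proof -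
 have B: "B >= 0" using f[where J=0] by simp
 have "(ALL J. (\<Sum>n<J. \<bar>fps_nth (prod_list (map f w)) n\<bar>)<=B ^ length w) &
  (%n. fps_nth (prod_list (map f w)) n) sums prod_list (map (%i. \<Sum>n. fps_nth (f i) n) w)"
 proof (induction w)
  case Nil
  have "(\<Sum>n<J. \<bar>fps_nth (1 :: real fps) n\<bar>) = (\<Sum>n<J. if n = 0 then 1 else 0)" for J by (intro sum.cong) auto
  then have "(\<Sum>n<J. \<bar>fps_nth (1 :: real fps) n\<bar>)<=1" for J by simp
  moreover have "(%n. fps_nth (1 :: real fps) n) sums 1" using sums_single[of 0 "%_. 1::real"] by simp
  ultimately show ?case by simp
 next
  case (Cons i w)
  define a where "a n = fps_nth (f i) n" for n
  define c where "c n = fps_nth (prod_list (map f w)) n" for n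
  have sa: "summable (%n. norm (a n))" and sa': "(\<Sum>n. \<bar>a n\<bar>)<=B"
  proof -
   show "summable (%n. norm (a n))" by (rule summableI_nonneg_bounded[where x=B]) (use f[where i=i] in \<open>auto simp: a_def\<close>)
   then show "(\<Sum>n. \<bar>a n\<bar>)<=B" using f[where i=i] by (intro suminf_le_const) (auto simp: a_def)
  qed
  have sc: "summable (%n. norm (c n))" and sc': "(\<Sum>n. \<bar>c n\<bar>)<=B ^ length w"
  proof -
   show "summable (%n. norm (c n))" by (rule summableI_nonneg_bounded[where x="B ^ length w"]) (use Cons in \<open>auto simp: c_def\<close>)
   then show "(\<Sum>n. \<bar>c n\<bar>)<=B ^ length w" using Cons by (intro suminf_le_const) (auto simp: c_def)
  qed
  have nth: "fps_nth (prod_list (map f (i # w))) n = (\<Sum>j\<le>n. a j * c (n - j))" for n by (simp add: fps_mult_nth a_def c_def atMost_atLeast0)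
  have s1: "(%n. \<Sum>j\<le>n. \<bar>a j\<bar> * \<bar>c (n - j)\<bar>) sums ((\<Sum>n. \<bar>a n\<bar>)*(\<Sum>n. \<bar>c n\<bar>))"
   by (rule Cauchy_product_sums) (use sa sc in auto)
  have "(\<Sum>n<J. \<bar>fps_nth (prod_list (map f (i # w))) n\<bar>)<=B ^ length (i # w)" for J
  proof -
   have "(\<Sum>n<J. \<bar>fps_nth (prod_list (map f (i # w))) n\<bar>)<=(\<Sum>n<J. \<Sum>j\<le>n. \<bar>a j\<bar> * \<bar>c (n - j)\<bar>)"
    unfolding nth by (intro sum_mono order_trans[OF sum_abs]) (simp add: abs_mult)
   also have "...<=(\<Sum>n. \<bar>a n\<bar>)*(\<Sum>n. \<bar>c n\<bar>)"
    unfolding sums_unique[OF s1] by (intro sum_le_suminf sums_summable[OF s1]) (auto intro!: sum_nonneg)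
   also have "...<=B * B ^ length w"
   proof (intro mult_mono sa' sc' B)
    show "0<=(\<Sum>n. \<bar>c n\<bar>)" by (rule suminf_nonneg) (use sc in simp_all)
   qed
   finally show ?thesis by simp
  qed
  moreover have "(%n. fps_nth (prod_list (map f (i # w))) n) sums ((\<Sum>n. a n)*(\<Sum>n. c n))"
   unfolding nth by (rule Cauchy_product_sums[OF sa sc])
  moreover have "(\<Sum>n. c n) = prod_list (map (%i. \<Sum>n. fps_nth (f i) n) w)" using Cons by (simp add: c_def sums_iff)
  ultimately show ?case by (simp add: a_def)
 qed
 then show "(\<Sum>n<J. \<bar>fps_nth (prod_list (map f w)) n\<bar>)<=B ^ length w"
  and "(%n. fps_nth (prod_list (map f w)) n) sums prod_list (map (%i. \<Sum>n. fps_nth (f i) n) w)" by blast+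
qed

lemma sums_vec:
 fixes f :: "nat => real ^ 'm"
 assumes "!!a. (%n. vn (f n) a) sums vn y a" shows "f sums y"
 unfolding sums_def by (rule vec_tendstoI) (use assms in \<open>simp add: sums_def\<close>)

lemma vec_sum_expand:
 "linear F ==> F y = (\<Sum>c\<in>UNIV. vn y c *\<^sub>R F (axis c (1::real)))" for F :: "real ^ 'm => 'b::real_vector"
 using vec_expand[of y] linear_sum[of F "%c. vn y c *\<^sub>R axis c 1" UNIV] by (simp add: linear_scale)

lemma (in normal_form) AN_H:
 fixes X :: "'a::real_normed_vector => (real ^ 'm) \<times> real"
 assumes H: "H n M P" and X: "linear X" "!!h. norm (X h)<=kx * norm h" and k: "kx >= 0" "t0 >= 0"
 shows "AN t0 (M*(malg l*(norm x0+kx * t0)) ^ n) (%h t. P (x0+X h) t)"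
proof -
 define rh where "rh = malg l*(norm x0+kx * t0)"
 have rh: "rh >= 0" using malg_pos k by (simp add: rh_def)
 obtain ps where ps: "hom n ps" "nrm ps<=M" "P = ev ps" using H unfolding H_def by blast
 have letter: "AN t0 rh (%h t. \<zeta> i (x0+X h))" if i: "i < N" for i
 proof -
  have "AN t0 (nm (%t. \<zeta> i x0)+malg l * kx * t0) (%h t. \<zeta> i x0+\<zeta> i (X h))"
  proof (intro AN_add AN_const HS_const(1) AN_linear k)
   show "linear (%h. \<zeta> i (X h))" using linear_compose[OF X(1) lin] by (simp add: o_def)
   show "norm (\<zeta> i (X h))<=kx * norm h" for h using bnd[OF i] X(2) order_trans by blast
  qed
  then have "AN t0 rh (%h t. \<zeta> i x0+\<zeta> i (X h))"
  proof (rule AN_mono)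
   have "nm (%t. \<zeta> i x0)<=malg l * norm x0" using malg_pos bnd[OF i, of x0] by (intro order_trans[OF nm_const] mult_left_mono) auto
   then show "nm (%t. \<zeta> i x0)+malg l * kx * t0<=rh" by (simp add: rh_def distrib_left)
  qed
  then show ?thesis by (simp add: linear_add[OF lin])
 qed
 have tm: "AN t0 (nm c * rh ^ length w) (%h t. mon w (x0+X h) * c t)" if "HSl c" "set w \<subseteq> {..<N}" for w c using that(2)
 proof (induction w)
  case Nil then show ?case using AN_const[OF that(1) k(2)] by simp
 next
  case (Cons i w)
  then have "AN t0 (rh*(nm c * rh ^ length w)) (%h t. \<zeta> i (x0+X h)*(mon w (x0+X h) * c t))"
   using AN_mult[OF letter[of i] Cons.IH k(2)] by simp
  then show ?case by (simp add: mult_ac)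
 qed
 have "AN t0 (nrm ps * rh ^ n) (%h t. ev ps (x0+X h) t)" using ps(1)
 proof (induction ps)
  case Nil
  show ?case using AN_mono[OF AN_const[OF HS_const(1)[of l 0] k(2)], of 0] nm_const[of 0] by simp
 next
  case (Cons p ps)
  obtain w c where p: "p = (w, c)" by (cases p)
  show ?case using AN_add[OF tm[of c w] Cons.IH k(2)] Cons.prems p by (simp add: distrib_right)
 qed
 then show ?thesis unfolding ps(3) rh_def[symmetric] by (rule AN_mono) (intro mult_right_mono ps(2) zero_le_power rh)
qed

locale nf_graph = nf_vector T l N \<zeta> L P0 P1 \<mu> \<sigma> iE cP K s v cv ka
 for T :: real and l N :: nat and \<zeta> :: "nat => (real ^ 'm) \<times> real => complex"
  and L P0 P1 :: "real ^ 'm => real ^ 'm" and \<mu> :: "nat => complex" and \<sigma> :: "nat => nat"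
  and iE :: nat and cP :: "'m => nat => complex" and K s :: real
  and v :: "'m option list => real => real ^ 'm" and cv ka :: real +
 assumes v_low: "length w < 2 ==> v w t = 0"
begin

lemma kk_pos: "(ka*(real CARD('m)+1)) > 0" using ka by (simp add: add_nonneg_pos)

definition cvec :: "(real ^ 'm) \<times> real => 'm option => real" where
 "cvec U i = (case i of None => snd U | Some a => vn (fst U) a)"

definition VS :: "(real ^ 'm) \<times> real => real => real ^ 'm" where
 "VS U t = (\<chi> a. \<Sum>q. \<Sum>w\<in>words q. prod_list (map (cvec U) w) * vn (v w t) a)"

lemma of_real_prod_list: "cor (prod_list (map f w)) = prod_list (map (%i. cor (f i)) w)" by (induction w) auto

lemma AN_VS:
 fixes U :: "'a::real_normed_vector => real => (real ^ 'm) \<times> real"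
 assumes U: "!!i. AN t0 M (%h t. cor (cvec (U h t) i))" and t0: "t0 > 0" and M: "(ka*(real CARD('m)+1)) * M<=1/2"
 shows "AN t0 (2 * cv * ((ka*(real CARD('m)+1)) * M)\<^sup>2) (%h t. cor (vn (VS (U h t) t) a))"
  and "norm h<=t0 ==> (%q. \<Sum>w\<in>words q. prod_list (map (cvec (U h t)) w) * vn (v w t) a) sums vn (VS (U h t) t) a"
proof -
 have M0: "M >= 0" using order_trans[OF nm_nonneg AN_value(2)[OF U[of None], of 0]] t0 by simp
 define Mq where "Mq q = (if q < 2 then 0 else cv * ((ka*(real CARD('m)+1)) * M) ^ q)" for q :: nat
 define W where "W q h t = (\<Sum>w\<in>words q. prod_list (map (%i. cor (cvec (U h t) i)) w) * cor (vn (v w t) a))" for q h t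
 have W: "AN t0 (Mq q) (W q)" for q
 proof (cases "q < 2")
  case True
  then have "W q = (%h t. 0)" by (intro ext) (auto simp: W_def words_def v_low)
  moreover have "AN t0 0 (%(h::'a) t. 0)" using AN_mono[OF AN_const[OF HS_const(1)[of l 0], of t0], of 0] nm_const[of 0] t0 by simp
  ultimately show ?thesis using True by (simp add: Mq_def)
 next
  case False
  have "AN t0 (\<Sum>w\<in>(words q :: 'm option list set). M ^ q*(cv * ka ^ q)) (W q)" unfolding W_def
  proof (rule AN_sum)
   fix w :: "'m option list" assume w: "w \<in> words q"
   then have wl: "length w = q" "w ~= []" using False by (auto simp: words_def)
   have "AN t0 (M ^ length w * nm (%t. cor (vn (v w t) a)))
    (%h t. prod_list (map (%i. cor (cvec (U h t) i)) w) * cor (vn (v w t) a))"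
    by (rule AN_mult[OF AN_prod[OF U] AN_const[OF v_HS]]) (use t0 wl in auto)
   then show "AN t0 (M ^ q*(cv * ka ^ q)) (%h t. prod_list (map (%i. cor (cvec (U h t) i)) w) * cor (vn (v w t) a))"
    by (rule AN_mono) (use v_le[of w a] M0 wl in \<open>auto simp: nm_def intro!: mult_left_mono\<close>)
  qed (use t0 in simp)
  then show ?thesis using False by (simp add: Mq_def card_words card_UNIV_option power_mult_distrib mult_ac add.commute[of 1])
 qed
 have k0: "(ka*(real CARD('m)+1)) * M >= 0" using kk_pos M0 by simp
 have Mq0: "Mq q >= 0" for q unfolding Mq_def using k0 cv by simp
 have partial: "(\<Sum>q<J. Mq q)<=2 * cv * ((ka*(real CARD('m)+1)) * M)\<^sup>2" for J
 proof -
  have "(\<Sum>q<J. Mq q)<=(\<Sum>q\<in>{2..J}. cv * ((ka*(real CARD('m)+1)) * M) ^ q)"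
  proof -
   have "(\<Sum>q<J. Mq q) = (\<Sum>q\<in>{2..<J}. cv * ((ka*(real CARD('m)+1)) * M) ^ q)"
    by (rule sum.mono_neutral_cong_right) (auto simp: Mq_def)
   also have "...<=(\<Sum>q\<in>{2..J}. cv * ((ka*(real CARD('m)+1)) * M) ^ q)" using cv k0 by (intro sum_mono2) auto
   finally show ?thesis .
  qed
  also have "... = cv * (\<Sum>q\<in>{2..J}. ((ka*(real CARD('m)+1)) * M) ^ q)" by (simp add: sum_distrib_left)
  also have "...<=cv * (2*((ka*(real CARD('m)+1)) * M)\<^sup>2)" by (intro mult_left_mono geometric_tail_le k0 M cv)
  finally show ?thesis by simp
 qed
 have sM: "summable Mq" by (rule summableI_nonneg_bounded[OF Mq0 partial])
 have Wr: "W q h t = cor (\<Sum>w\<in>words q. prod_list (map (cvec (U h t)) w) * vn (v w t) a)" for q h t by (simp add: W_def of_real_prod_list)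
 have sr: "summable (%q. \<Sum>w\<in>words q. prod_list (map (cvec (U h t)) w) * vn (v w t) a)" if h: "norm h<=t0" for h t
 proof (rule summable_comparison_test'[OF sM, of 0])
  fix q
  have "norm (W q h t)<=nm (W q h)" by (rule sup_le_nm[OF AN_value(1)[OF W h]])
  also have "...<=Mq q" by (rule AN_value(2)[OF W h])
  finally show "norm (\<Sum>w\<in>words q. prod_list (map (cvec (U h t)) w) * vn (v w t) a)<=Mq q" by (simp only: Wr norm_of_real real_norm_def)
 qed
 show "(%q. \<Sum>w\<in>words q. prod_list (map (cvec (U h t)) w) * vn (v w t) a) sums vn (VS (U h t) t) a"
  if h: "norm h<=t0" for h t using summable_sums[OF sr[OF h, of t]] by (simp add: VS_def)
 have "AN t0 (\<Sum>q. Mq q) (%h t. \<Sum>q. W q h t)" by (rule AN_suminf[OF W sM t0])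
 then show "AN t0 (2 * cv * ((ka*(real CARD('m)+1)) * M)\<^sup>2) (%h t. cor (vn (VS (U h t) t) a))"
 proof (rule AN_transfer)
  show "(\<Sum>q. Mq q)<=2 * cv * ((ka*(real CARD('m)+1)) * M)\<^sup>2" by (rule suminf_le_const[OF sM partial])
  fix h :: 'a and t assume h: "norm h<=t0"
  show "(\<Sum>q. W q h t) = cor (vn (VS (U h t) t) a)" unfolding Wr VS_def vec_lambda_beta
   by (rule bounded_linear.suminf[OF bounded_linear_of_real sr[OF h], symmetric])
 qed
qed

lemma AN_linear_image:
 fixes F :: "real ^ 'm => real ^ 'm" and Y :: "'a::real_normed_vector => real => real ^ 'm"
 assumes F: "linear F" and Y: "!!c. AN t0 M (%h t. cor (vn (Y h t) c))" and t0: "t0 >= 0"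
 shows "AN t0 (malg l*(\<Sum>a\<in>UNIV. \<Sum>c\<in>UNIV. norm (mtx F a c)) * M) (%h t. cor (vn (F (Y h t)) a))"
proof -
 have M: "M >= 0" using order_trans[OF nm_nonneg AN_value(2)[OF Y[of undefined], of 0]] t0 by simp
 have "AN t0 (\<Sum>c\<in>UNIV. malg l * norm (mtx F a c) * M) (%h t. \<Sum>c\<in>UNIV. mtx F a c * cor (vn (Y h t) c))"
  by (intro AN_sum AN_cmult Y t0)
 moreover have "(\<Sum>c\<in>UNIV. malg l * norm (mtx F a c) * M)<=malg l*(\<Sum>a\<in>UNIV. \<Sum>c\<in>UNIV. norm (mtx F a c)) * M"
 proof -
  have "(\<Sum>c\<in>UNIV. norm (mtx F a c))<=(\<Sum>a\<in>UNIV. \<Sum>c\<in>UNIV. norm (mtx F a c))"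
   by (rule member_le_sum[of a UNIV "%a. \<Sum>c\<in>UNIV. norm (mtx F a c)"]) (auto intro!: sum_nonneg)
  then have "malg l*(\<Sum>c\<in>UNIV. norm (mtx F a c)) * M<=malg l*(\<Sum>a\<in>UNIV. \<Sum>c\<in>UNIV. norm (mtx F a c)) * M"
   using malg_pos M by (intro mult_right_mono mult_left_mono) auto
  then show ?thesis by (simp only: sum_distrib_left sum_distrib_right)
 qed
 ultimately have "AN t0 (malg l*(\<Sum>a\<in>UNIV. \<Sum>c\<in>UNIV. norm (mtx F a c)) * M) (%h t. \<Sum>c\<in>UNIV. mtx F a c * cor (vn (Y h t) c))"
  by (rule AN_mono)
 then show ?thesis by (simp only: mtx_apply[OF F, symmetric])
qed

definition Phis :: "nat => (nat => (real ^ 'm) \<times> real => real => real ^ 'm) => (real ^ 'm) \<times> real => real => real ^ 'm" where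
 "Phis p Ph x t = (\<Sum>i\<in>{2..p}. Ph i x t)"

definition PDs :: "nat => (nat => 'm => terms) => (real ^ 'm) \<times> real => real ^ 'm => real => real ^ 'm" where
 "PDs p pp x y t = (\<Sum>i\<in>{2..p}. PD (pp i) x y t)"

definition Ub :: "nat => (nat => (real ^ 'm) \<times> real => real => real ^ 'm) => (real ^ 'm) \<times> real => real ^ 'm => real => (real ^ 'm) \<times> real" where
 "Ub p Ph x y t = (P0 (fst x)+Phis p Ph x t+y, snd x)"

definition Ls :: "nat => (nat => 'm => terms) => (real ^ 'm) \<times> real => real => real ^ 'm" where
 "Ls p pp x t = (\<Sum>i\<in>{2..p}. \<chi> a. Re (LL (pp i) x t a))"

lemma linear_PDs: "linear (%y. PDs p pp x y t)" unfolding PDs_def by (intro linear_compose_sum ballI linear_PD)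

context
 fixes pp :: "nat => 'm => terms" and Ph :: "nat => (real ^ 'm) \<times> real => real => real ^ 'm" and ph :: "nat => real"
  and p :: nat and r :: real
 assumes fam: "fam pp Ph ph" and trunc0: "ALL i>p. pp i = (%_. []) & Ph i = (%_ _. 0) & ph i = 0"
  and p: "p >= 1" and r: "r > 0" and uuS: "!!J. (\<Sum>n\<le>J. r ^ n * maj.uu ph n)<=2 * cU * r"
begin

lemma trunc: "i > p ==> pp i = (%_. []) & Ph i = (%_ _. 0) & ph i = 0" using trunc0 by blast

lemma low0: "ph n >= 0" "n < 2 ==> ph n = 0" using fam_nonneg[OF fam] fam_low[OF fam] by auto

lemmas uu0 = maj.uu_nonneg[of ph, OF low0] maj.uu_0[of ph, OF low0]

lemma uu_weighted:
 assumes "0<=rh" "rh<=r"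
 shows "(\<Sum>n\<le>p. maj.uu ph n * rh ^ n)<=2 * cU * rh"
proof -
 have "(\<Sum>n\<le>p. maj.uu ph n * rh ^ n)<=(\<Sum>n\<le>p. (rh / r)*(r ^ n * maj.uu ph n))"
 proof (rule sum_mono)
  fix n
  show "maj.uu ph n * rh ^ n<=(rh / r)*(r ^ n * maj.uu ph n)"
  proof (cases n)
   case (Suc k)
   have "maj.uu ph n*(rh * rh ^ k)<=maj.uu ph n*(rh * r ^ k)" using assms uu0 by (intro mult_left_mono power_mono) auto
   then show ?thesis using Suc r by (simp add: mult_ac)
  qed (simp add: uu0)
 qed
 also have "... = (rh / r)*(\<Sum>n\<le>p. r ^ n * maj.uu ph n)" by (simp only: sum_distrib_left)
 also have "...<=(rh / r)*(2 * cU * r)" using assms r by (intro mult_left_mono uuS) auto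
 finally show ?thesis using r by (simp add: mult_ac)
qed

lemma deriv_weighted:
 assumes "0<=rh" "rh<=r / 2"
 shows "(\<Sum>i\<in>{2..p}. real i * ph i * rh ^ (i - 1))<=2 * cU"
proof -
 have "(\<Sum>i\<in>{2..p}. real i * ph i * rh ^ (i - 1))<=(\<Sum>i\<in>{2..p}. (r ^ i * maj.uu ph i) / r)"
 proof (rule sum_mono)
  fix i assume i: "i \<in> {2..p}"
  then obtain k where k: "i = Suc k" by (cases i) auto
  have "real i<=2 ^ k" using less_exp[of k] k by (metis Suc_leI of_nat_le_iff of_nat_power of_nat_numeral)
  moreover have "rh ^ k<=(r / 2) ^ k" using assms by (intro power_mono)
  ultimately have "real i * rh ^ k<=2 ^ k*(r / 2) ^ k" using assms by (intro mult_mono) auto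
  then have 1: "real i * rh ^ k<=r ^ k" by (simp flip: power_mult_distrib)
  have "ph i<=maj.uu ph i" using cU_pos by (simp add: maj.uu_def)
  then have "real i * rh ^ k * ph i<=r ^ k * maj.uu ph i" using 1 low0 r by (intro mult_mono) auto
  then show "real i * ph i * rh ^ (i - 1)<=(r ^ i * maj.uu ph i) / r" using k r by (simp add: mult_ac)
 qed
 also have "... = (\<Sum>i\<in>{2..p}. r ^ i * maj.uu ph i) / r" by (simp only: sum_divide_distrib)
 also have "(\<Sum>i\<in>{2..p}. r ^ i * maj.uu ph i)<=(\<Sum>i\<le>p. r ^ i * maj.uu ph i)" using r uu0 by (intro sum_mono2) auto
 also have "...<=2 * cU * r" by (rule uuS)
 finally show ?thesis using r by (simp add: divide_right_mono)
qed

lemma Uc_sum: "(\<Sum>n\<le>p. Uc Ph n x t i) = cvec (Ub p Ph x 0 t) i"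
proof (cases i)
 case None
 then show ?thesis using p by (simp add: Uc_def cvec_def Ub_def)
next
 case (Some a)
 have "(\<Sum>n\<le>p. vn (Ph n x t) a) = (\<Sum>n\<in>{2..p}. vn (Ph n x t) a)" by (rule sum.mono_neutral_right) (auto simp: fam_low[OF fam])
 moreover have "(\<Sum>n\<le>p. if n = 1 then vn (P0 (fst x)) a else 0) = vn (P0 (fst x)) a" using p by simp
 ultimately show ?thesis using Some by (simp only: Uc_def cvec_def Ub_def Phis_def) (simp add: sum.distrib)
qed

lemma AN_Ub:
 fixes X :: "'a::real_normed_vector => (real ^ 'm) \<times> real" and Y :: "'a => real ^ 'm"
 assumes X: "linear X" "!!h. norm (X h)<=kx * norm h" and Y: "linear Y" "!!h. norm (Y h)<=ky * norm h"
  and k: "kx >= 0" "ky >= 0" "t0 >= 0" and small: "malg l*(norm x0+kx * t0)<=r"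
 shows "AN t0 (malg l*(2 * cU+1)*(norm x0+kx * t0+norm y0+ky * t0))
  (%h t. cor (cvec (Ub p Ph (x0+X h) (y0+Y h) t) i))"
proof -
 define rh where "rh = malg l*(norm x0+kx * t0)"
 have rh: "0<=rh" "rh<=r" using malg_pos k small by (auto simp: rh_def)
 have "AN t0 (\<Sum>n\<le>p. maj.uu ph n * rh ^ n) (%h t. \<Sum>n\<le>p. cor (Uc Ph n (x0+X h) t i))"
  unfolding rh_def by (intro AN_sum AN_H[OF H_Uc[OF fam]] X k)
 then have 1: "AN t0 (2 * cU * rh) (%h t. \<Sum>n\<le>p. cor (Uc Ph n (x0+X h) t i))" by (rule AN_mono) (rule uu_weighted[OF rh])
 define g where "g y = cor (case i of None => 0 | Some a => vn y a)" for y :: "real ^ 'm"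
 have g: "linear g" "norm (g y)<=norm y" for y by (auto simp: g_def linear_iff complex_eq_iff component_le_norm_cart split: option.split)
 have "AN t0 (nm (%t. g y0)+malg l * ky * t0) (%h t. g y0+g (Y h))"
 proof (intro AN_add AN_const HS_const(1) AN_linear k)
  show "linear (%h. g (Y h))" using linear_compose[OF Y(1) g(1)] by (simp add: o_def)
  show "norm (g (Y h))<=ky * norm h" for h using g(2) Y(2) order_trans by blast
 qed
 then have 2: "AN t0 (malg l*(norm y0+ky * t0)) (%h t. g y0+g (Y h))"
 proof (rule AN_mono)
  have "nm (%t. g y0)<=malg l * norm y0" using malg_pos g(2)[of y0] by (intro order_trans[OF nm_const] mult_left_mono) auto
  then show "nm (%t. g y0)+malg l * ky * t0<=malg l*(norm y0+ky * t0)" by (simp add: distrib_left)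
 qed
 have 3: "2 * cU * rh+malg l*(norm y0+ky * t0)<=malg l*(2 * cU+1)*(norm x0+kx * t0+norm y0+ky * t0)"
 proof -
  have "0<=norm x0+kx * t0" "0<=norm y0+ky * t0" using k by auto
  then have "0<=malg l*(norm x0+kx * t0)" "0<=(2 * cU)*(malg l*(norm y0+ky * t0))"
   using malg_pos cU_pos by (simp_all only: mult_nonneg_nonneg less_imp_le zero_le_numeral)
  moreover have e: "malg l*(2 * cU+1)*(X+norm y0+ky * t0)
    = 2 * cU*(malg l * X)+malg l*(norm y0+ky * t0)+malg l * X+(2 * cU)*(malg l*(norm y0+ky * t0))" for X
   by (simp add: algebra_simps)
  ultimately show ?thesis unfolding rh_def e by linarith
 qed
 have "cor (cvec (Ub p Ph (x0+X h) (y0+Y h) t) i)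
   = (\<Sum>n\<le>p. cor (Uc Ph n (x0+X h) t i))+(g y0+g (Y h))" for h t
 proof -
  have cv: "cvec (Ub p Ph x y t) i = cvec (Ub p Ph x 0 t) i+(case i of None => 0 | Some a => vn y a)" for x y
   by (simp add: cvec_def Ub_def split: option.split)
  have "cor (cvec (Ub p Ph x y t) i) = cor (\<Sum>n\<le>p. Uc Ph n x t i)+g y" for x y unfolding cv[of x y] g_def Uc_sum by (rule of_real_add)
  then show ?thesis by (simp only: of_real_sum linear_add[OF g(1)])
 qed
 then show ?thesis using AN_mono[OF AN_add[OF 1 2 k(3)] 3] by (simp only:)
qed

lemma AN_PDs:
 fixes X :: "'a::real_normed_vector => (real ^ 'm) \<times> real" and Y :: "'a => real => real ^ 'm"
 assumes X: "linear X" "!!h. norm (X h)<=kx * norm h" and Y: "!!c. AN t0 M (%h t. cor (vn (Y h t) c))"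
  and k: "kx >= 0" "t0 >= 0" and small: "malg l*(norm x0+kx * t0)<=r / 2"
 shows "AN t0 (real CARD('m) * malg l*(2 * cU) * M) (%h t. cor (vn (PDs p pp (x0+X h) (Y h t) t) a))"
proof -
 define rh where "rh = malg l*(norm x0+kx * t0)"
 have rh: "0<=rh" "rh<=r / 2" using malg_pos k small by (auto simp: rh_def)
 have M: "M >= 0" using order_trans[OF nm_nonneg AN_value(2)[OF Y[of undefined], of 0]] k by simp
 have pdH: "H (i - 1+0) (real i * nrm (pp i a) * malg l) (%x t. pd (pp i a) x (axis c 1, 0) t)" for i c
 proof (rule H_pd[OF goodD(1)[OF fam_good[OF fam]]])
  fix j assume j: "j < N"
  have "norm (\<zeta> j (axis c 1, 0))<=1" using bnd[OF j, of "(axis c 1, 0)"] by (simp add: norm_axis_1)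
  then show "H 0 (malg l) (%x t. \<zeta> j (axis c 1, 0))" using malg_pos by (intro H_mono[OF H_const]) auto
 qed (use malg_pos in simp)
 have "AN t0 (\<Sum>i\<in>{2..p}. \<Sum>c\<in>(UNIV::'m set). (real i * ph i * malg l * rh ^ (i - 1)) * M)
  (%h t. \<Sum>i\<in>{2..p}. \<Sum>c\<in>UNIV. pd (pp i a) (x0+X h) (axis c 1, 0) t * cor (vn (Y h t) c))"
 proof (intro AN_sum AN_mult Y k)
  fix i and c :: 'm
  have "AN t0 (real i * nrm (pp i a) * malg l * rh ^ (i - 1+0)) (%h t. pd (pp i a) (x0+X h) (axis c 1, 0) t)"
   unfolding rh_def by (rule AN_H[OF pdH X k])
  then show "AN t0 (real i * ph i * malg l * rh ^ (i - 1)) (%h t. pd (pp i a) (x0+X h) (axis c 1, 0) t)"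
   by (rule AN_mono) (use goodD(2)[OF fam_good[OF fam], of i a] rh malg_pos in \<open>auto intro!: mult_right_mono mult_left_mono\<close>)
 qed
 moreover have "(\<Sum>i\<in>{2..p}. \<Sum>c\<in>(UNIV::'m set). (real i * ph i * malg l * rh ^ (i - 1)) * M)<=real CARD('m) * malg l*(2 * cU) * M"
 proof -
  have "(\<Sum>i\<in>{2..p}. \<Sum>c\<in>(UNIV::'m set). (real i * ph i * malg l * rh ^ (i - 1)) * M) =
   real CARD('m) * malg l*(\<Sum>i\<in>{2..p}. real i * ph i * rh ^ (i - 1)) * M" by (simp add: sum_distrib_left sum_distrib_right mult_ac)
  also have "...<=real CARD('m) * malg l*(2 * cU) * M" using malg_pos M by (intro mult_right_mono mult_left_mono deriv_weighted rh) auto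
  finally show ?thesis .
 qed
 moreover have "(\<Sum>i\<in>{2..p}. \<Sum>c\<in>UNIV. pd (pp i a) x (axis c 1, 0) t * cor (vn y c))
  = cor (vn (PDs p pp x y t) a)" for x t y
 proof -
  have "vn (PD (pp i) x y t) a = (\<Sum>c\<in>UNIV. vn (PD (pp i) x (axis c 1) t) a * vn y c)" for i
   using vec_sum_expand[OF linear_PD[of "pp i" x t], of y] by (simp add: mult.commute)
  then show ?thesis by (simp add: PDs_def PD_eq(1)[OF fam_good[OF fam]])
 qed
 ultimately show ?thesis using AN_mono by (simp only:) blast
qed

lemma VN_low: "n < 2 ==> VN Ph n x t = 0" by (simp add: VN_def)

lemma VN_sums:
 assumes x: "norm x<=r" "(ka*(real CARD('m)+1))*(2 * cU * norm x)<=1/2"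
 shows "(%n. VN Ph n x t) sums VS (Ub p Ph x 0 t) t"
proof (rule sums_vec)
 fix a
 define B where "B = 2 * cU * norm x"
 have Uc0: "Uc Ph n x t i = 0" if "n > p" for n i using trunc[OF that] that p by (simp add: Uc_def split: option.split)
 have B: "(\<Sum>n<J. \<bar>fps_nth (uf Ph x t i) n\<bar>)<=B" for i J
 proof -
  have "(\<Sum>n<J. \<bar>fps_nth (uf Ph x t i) n\<bar>)<=(\<Sum>n\<in>{..<J} \<union> {..p}. \<bar>Uc Ph n x t i\<bar>)"
   unfolding uf_nth by (rule sum_mono2) auto
  also have "... = (\<Sum>n\<le>p. \<bar>Uc Ph n x t i\<bar>)" by (rule sum.mono_neutral_right) (auto simp: Uc0)
  also have "...<=(\<Sum>n\<le>p. maj.uu ph n * norm x ^ n)"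
  proof (rule sum_mono)
   fix n
   note b = H_bound[OF H_Uc[OF fam, of n i], of x "norm x", OF bnd]
   have "\<bar>Uc Ph n x t i\<bar> = norm (cor (Uc Ph n x t i))" by simp
   also have "...<=nm (%t. cor (Uc Ph n x t i))" by (rule sup_le_nm) (rule b(1); simp)
   also have "...<=maj.uu ph n * norm x ^ n" by (rule b(2)) simp_all
   finally show "\<bar>Uc Ph n x t i\<bar><=maj.uu ph n * norm x ^ n" .
  qed
  also have "...<=B" unfolding B_def by (rule uu_weighted) (use x in auto)
  finally show ?thesis .
 qed
 have B0: "B >= 0" using cU_pos by (simp add: B_def)
 have U: "(\<Sum>n. fps_nth (uf Ph x t i) n) = cvec (Ub p Ph x 0 t) i" for i
  unfolding Uc_sum[symmetric] uf_nth by (rule suminf_finite) (auto simp: Uc0 not_le)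
 note f = fps_prod_list_sums[of "uf Ph x t", OF B]
 define c where "c n q = (\<Sum>w\<in>words q. fps_nth (prod_list (map (uf Ph x t) w)) n * vn (v w t) a)" for n q
 have vb: "\<bar>vn (v w t) a\<bar><=cv * ka ^ length w" for w using sup_le_nm[OF v_HS[of w a], of t] v_le[of w a] by (simp add: nm_def)
 have le: "(\<Sum>n<J. norm (c n q))<=cv * ((ka*(real CARD('m)+1)) * B) ^ q" for J q
 proof -
  have "(\<Sum>n<J. norm (c n q))<=(\<Sum>n<J. \<Sum>w\<in>(words q :: 'm option list set). \<bar>fps_nth (prod_list (map (uf Ph x t) w)) n\<bar>*(cv * ka ^ q))"
  proof (rule sum_mono)
   fix n
   show "norm (c n q)<=(\<Sum>w\<in>(words q :: 'm option list set). \<bar>fps_nth (prod_list (map (uf Ph x t) w)) n\<bar>*(cv * ka ^ q))"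
    unfolding c_def real_norm_def
   proof (intro order_trans[OF sum_abs] sum_mono)
    fix w :: "'m option list" assume "w \<in> words q"
    then show "\<bar>fps_nth (prod_list (map (uf Ph x t) w)) n * vn (v w t) a\<bar>
    <=\<bar>fps_nth (prod_list (map (uf Ph x t) w)) n\<bar>*(cv * ka ^ q)"
     using vb[of w] by (auto simp: abs_mult words_def intro!: mult_left_mono)
   qed
  qed
  also have "... = (\<Sum>w\<in>(words q :: 'm option list set). (\<Sum>n<J. \<bar>fps_nth (prod_list (map (uf Ph x t) w)) n\<bar>)*(cv * ka ^ q))"
   unfolding sum_distrib_right by (rule sum.swap)
  also have "...<=(\<Sum>w\<in>(words q :: 'm option list set). B ^ q*(cv * ka ^ q))"
  proof (intro sum_mono mult_right_mono)
   fix w :: "'m option list" assume "w \<in> words q"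
   then show "(\<Sum>n<J. \<bar>fps_nth (prod_list (map (uf Ph x t) w)) n\<bar>)<=B ^ q" using f(1)[where w=w and J=J] by (simp add: words_def)
  qed (use cv ka in auto)
  also have "... = cv * ((ka*(real CARD('m)+1)) * B) ^ q" by (simp add: card_words card_UNIV_option power_mult_distrib mult_ac add.commute[of 1])
  finally show ?thesis .
 qed
 have k0: "0<=(ka*(real CARD('m)+1)) * B" using B0 kk_pos by simp
 have sm: "summable (%q. cv * ((ka*(real CARD('m)+1)) * B) ^ q)"
  by (intro summable_mult summable_geometric) (use x k0 in \<open>simp only: B_def[symmetric]; simp\<close>)
 have "(\<Sum>q. c n q) = vn (VN Ph n x t) a" for n
 proof -
  have "c n q = 0" if "q \<notin> {2..n}" for q
  proof (cases "q < 2")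
   case True then show ?thesis by (auto simp: c_def words_def v_low)
  next
   case False
   then have "fps_nth (prod_list (map (uf Ph x t) w)) n = 0" if "length w = q" for w
    using that \<open>q \<notin> {2..n}\<close> by (intro fps_prod_list_0) (auto simp: Uc_0[OF fam])
   then show ?thesis by (auto simp: c_def words_def)
  qed
  then have "(\<Sum>q. c n q) = (\<Sum>q\<in>{2..n}. c n q)" by (intro suminf_finite) auto
  then show ?thesis by (simp add: VN_def c_def)
 qed
 moreover have "(\<Sum>n. c n q) = (\<Sum>w\<in>words q. prod_list (map (cvec (Ub p Ph x 0 t)) w) * vn (v w t) a)" for q
 proof -
  have "(%n. c n q) sums (\<Sum>w\<in>words q. prod_list (map (cvec (Ub p Ph x 0 t)) w) * vn (v w t) a)"
   unfolding c_def using f(2) unfolding U by (intro sums_sum sums_mult2)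
  then show ?thesis by (simp add: sums_iff)
 qed
 ultimately show "(%n. vn (VN Ph n x t) a) sums vn (VS (Ub p Ph x 0 t) t) a" using sums_swap(1)[OF le sm] by (simp add: VS_def)
qed

lemma NN_sums:
 assumes x: "norm x<=r" "(ka*(real CARD('m)+1))*(2 * cU * norm x)<=1/2"
 shows "(%n. NN pp Ph n x t) sums (P1 (VS (Ub p Ph x 0 t) t) - PDs p pp x (P0 (VS (Ub p Ph x 0 t) t)) t)"
proof -
 define V where "V = VS (Ub p Ph x 0 t) t"
 note VN = VN_sums[OF x, of t, folded V_def]
 have s1: "(%n. P1 (VN Ph n x t)) sums P1 V" using linP1 by (intro bounded_linear.sums[OF _ VN]) (simp add: linear_conv_bounded_linear)
 have s2: "(%n. if i < n then PD (pp i) x (P0 (VN Ph (n+1 - i) x t)) t else 0) sums PD (pp i) x (P0 V) t"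
  if i: "i \<in> {2..p}" for i
 proof -
  define g where "g y = PD (pp i) x (P0 y) t" for y
  have lg: "linear g" using linear_compose[OF linP0 linear_PD[of "pp i" x t]] by (simp add: g_def[abs_def] o_def)
  have g0: "g 0 = 0" by (rule linear_0[OF lg])
  have "(%n. g (VN Ph n x t)) sums g V" using lg by (intro bounded_linear.sums[OF _ VN]) (simp add: linear_conv_bounded_linear)
  moreover have "(if i < n+(i - 1) then g (VN Ph (n+(i - 1)+1 - i) x t) else 0) = g (VN Ph n x t)" for n
   using i g0 VN_low[of n] by (cases "n < 2") auto
  ultimately have "(%n. if i < n+(i - 1) then g (VN Ph (n+(i - 1)+1 - i) x t) else 0) sums g V" by simp
  then have "(%n. if i < n then g (VN Ph (n+1 - i) x t) else 0) sums (g V+(\<Sum>n<i - 1. if i < n then g (VN Ph (n+1 - i) x t) else 0))"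
   by (subst (asm) sums_iff_shift)
  moreover have "(\<Sum>n<i - 1. if i < n then g (VN Ph (n+1 - i) x t) else 0) = 0" by (rule sum.neutral) auto
  ultimately show ?thesis by (simp only: g_def add_0_right)
 qed
 have "NN pp Ph n x t = P1 (VN Ph n x t) - (\<Sum>i\<in>{2..p}. if i < n then PD (pp i) x (P0 (VN Ph (n+1 - i) x t)) t else 0)" for n
 proof -
  have "PD (%_. []) x y t = 0" for y by (simp add: PD_def vec_eq_iff)
  then show ?thesis unfolding NN_def using trunc by (intro arg_cong2[where f="(-)"] refl sum.mono_neutral_cong) auto
 qed
 then show ?thesis unfolding V_def[symmetric] PDs_def using sums_diff[OF s1 sums_sum[of "{2..p}", OF s2]] by simp
qed

lemma remainder_tail:
 assumes LL: "!!n x t a. 2<=n ==> n<=p ==> LL (pp n) x t a = cor (vn (NN pp Ph n x t) a)"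
  and hhS: "!!J. (\<Sum>n\<le>J. r ^ n * maj.hh ph n)<=G"
  and x: "norm x<=r / 2" "(ka*(real CARD('m)+1))*(2 * cU * norm x)<=1/2"
 shows "nm (%t. cor (vn (P1 (VS (Ub p Ph x 0 t) t) - PDs p pp x (P0 (VS (Ub p Ph x 0 t) t)) t - Ls p pp x t) a))<=G / 2 ^ p"
  (is "nm (%t. cor (vn (?R t) a))<=_")
proof -
 have hh0: "maj.hh ph n >= 0" for n by (rule maj.hh_nonneg[OF low0])
 have xr: "norm x<=r" using x r by simp
 have R: "(%n. NN pp Ph (n+(p+1)) x t) sums ?R t" for t
 proof -
  have "NN pp Ph n x t = 0" if "n < 2" for n using that VN_low[of n] linear_0[OF linP1] by (simp add: NN_def)
  then have "(\<Sum>n<p+1. NN pp Ph n x t) = (\<Sum>n\<in>{2..p}. NN pp Ph n x t)" by (intro sum.mono_neutral_right) auto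
  also have "... = Ls p pp x t" unfolding Ls_def using LL by (intro sum.cong) (auto simp: vec_eq_iff)
  finally show ?thesis using NN_sums[OF xr x(2), of t] by (subst sums_iff_shift) simp
 qed
 define f where "f n t = cor (vn (NN pp Ph (n+(p+1)) x t) a)" for n t
 have b: "HSl (f n)" "nm (f n)<=maj.hh ph (n+(p+1)) * norm x ^ (n+(p+1))" for n unfolding f_def[abs_def]
  using H_bound[OF H_NN[OF fam, of "n+(p+1)" a], of x "norm x"] bnd by auto
 have "(\<Sum>n<J. nm (f n))<=G / 2 ^ p" for J
 proof -
  have "(\<Sum>n<J. nm (f n))<=(\<Sum>n<J. (1 / 2 ^ p)*(r ^ (n+(p+1)) * maj.hh ph (n+(p+1))))"
  proof (rule sum_mono)
   fix n
   have "norm x ^ (n+(p+1))<=(r / 2) ^ (n+(p+1))" using x by (intro power_mono) auto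
   also have "...<=r ^ (n+(p+1))*(1 / 2 ^ p)"
   proof -
    have "(1 / 2 :: real) ^ (n+(p+1))<=(1 / 2) ^ p" by (rule power_decreasing) auto
    then have "r ^ (n+(p+1))*(1 / 2) ^ (n+(p+1))<=r ^ (n+(p+1))*(1 / 2) ^ p" using r by (intro mult_left_mono) auto
    then show ?thesis by (simp add: power_divide)
   qed
   finally have "maj.hh ph (n+(p+1)) * norm x ^ (n+(p+1))<=maj.hh ph (n+(p+1))*(r ^ (n+(p+1))*(1 / 2 ^ p))"
    by (intro mult_left_mono hh0)
   then show "nm (f n)<=(1 / 2 ^ p)*(r ^ (n+(p+1)) * maj.hh ph (n+(p+1)))" using b(2)[of n] by (simp add: mult_ac)
  qed
  also have "... = (1 / 2 ^ p)*(\<Sum>n<J. r ^ (n+(p+1)) * maj.hh ph (n+(p+1)))" by (simp only: sum_distrib_left)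
  also have "(\<Sum>n<J. r ^ (n+(p+1)) * maj.hh ph (n+(p+1))) = (\<Sum>n\<in>(%n. n+(p+1)) ` {..<J}. r ^ n * maj.hh ph n)"
   by (subst sum.reindex) (auto simp: inj_on_def)
  also have "...<=(\<Sum>n\<le>J+p. r ^ n * maj.hh ph n)" using r hh0 by (intro sum_mono2) auto
  also have "...<=G" by (rule hhS)
  finally show ?thesis by (simp add: mult_left_mono divide_right_mono)
 qed
 note hs = HS_suminf[of f, OF b(1) this]
 have "(\<Sum>n. f n t) = cor (vn (?R t) a)" for t
 proof -
  have "(%n. vn (NN pp Ph (n+(p+1)) x t) a) sums vn (?R t) a" by (rule bounded_linear.sums[OF bounded_linear_vec_nth R])
  from bounded_linear.sums[OF bounded_linear_of_real this]
  show ?thesis unfolding f_def by (rule sums_unique[symmetric])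
 qed
 then show ?thesis using hs(2) by simp
qed

end

end

section \<open>The change of variables\<close>

lemma has_vector_derivative_transform_open:
 fixes f g :: "real => 'b::real_normed_vector"
 assumes "(f has_vector_derivative f') (at t)" "t \<in> {a<..<b}" "!!s. s \<in> {a<..<b} ==> f s = g s"
 shows "(g has_vector_derivative f') (at t)" by (rule has_vector_derivative_transform_within_open[OF assms(1), of "{a<..<b}"]) (use assms in auto)

context nf_graph
begin

context
 fixes pp :: "nat => 'm => terms" and Ph :: "nat => (real ^ 'm) \<times> real => real => real ^ 'm" and ph :: "nat => real"
 assumes fam: "fam pp Ph ph"
begin

lemma P1_Phis: "P1 (Phis p Ph x t) = Phis p Ph x t" unfolding Phis_def by (simp add: linear_sum[OF linP1] goodD(5)[OF fam_good[OF fam]])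

lemma P0_Phis: "P0 (Phis p Ph x t) = 0" using P0_P1[of "Phis p Ph x t"] P1_Phis[of p x t] by simp

lemma Phis_const: "Phis p Ph (u, 0) t = Phis p Ph (u, 0) 0" unfolding Phis_def by (intro sum.cong refl goodD(6)[OF fam_good[OF fam]])

lemma P1_PDs: "P1 (PDs p pp x y t) = PDs p pp x y t" unfolding PDs_def by (simp add: linear_sum[OF linP1] PD_facts(1)[OF fam_good[OF fam]])

lemma Phis_deriv:
 assumes u: "(u has_vector_derivative u') (at t)"
 shows "((%t. Phis p Ph (u t, eps) t) has_vector_derivative
  (PDs p pp (u t, eps) u' t+(Ls p pp (u t, eps) t - PDs p pp (u t, eps) (L (u t)) t+L (Phis p Ph (u t, eps) t)))) (at t)"
proof -
 note g = fam_good[OF fam]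
 have ux: "((%t. (u t, eps)) has_vector_derivative (u', 0)) (at t)" using has_vector_derivative_Pair[OF u has_vector_derivative_const[of eps]] by simp
 have 1: "((%t. Ph i (u t, eps) t) has_vector_derivative
  (PD (pp i) (u t, eps) u' t+((\<chi> a. Re (LL (pp i) (u t, eps) t a)) - PD (pp i) (u t, eps) (L (u t)) t+L (Ph i (u t, eps) t)))) (at t)" for i
 proof (rule has_vector_derivative_vec)
  fix a
  have "((%t. ev (pp i a) (u t, eps) t) has_vector_derivative pd (pp i a) (u t, eps) (u', 0) t+et (pp i a) (u t, eps) t) (at t)"
   by (rule ev_has_vector_derivative[OF ux goodD(3)[OF g]])
  then have "((%t. cor (vn (Ph i (u t, eps) t) a)) has_vector_derivative pd (pp i a) (u t, eps) (u', 0) t+et (pp i a) (u t, eps) t) (at t)"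
   by (simp only: goodD(4)[OF g])
  from bounded_linear.has_vector_derivative[OF bounded_linear_Re this]
  have d: "((%t. vn (Ph i (u t, eps) t) a) has_vector_derivative Re (pd (pp i a) (u t, eps) (u', 0) t)+Re (et (pp i a) (u t, eps) t)) (at t)"
   by simp
  have "(\<Sum>c\<in>UNIV. mtx L a c * ev (pp i c) (u t, eps) t) = cor (vn (L (Ph i (u t, eps) t)) a)"
   unfolding goodD(4)[OF g] by (rule mtx_apply[OF linL, symmetric])
  then have r: "Re (\<Sum>c\<in>UNIV. mtx L a c * ev (pp i c) (u t, eps) t) = vn (L (Ph i (u t, eps) t)) a" by (simp only: Re_complex_of_real)
  have "Re (LL (pp i) (u t, eps) t a) = Re (et (pp i a) (u t, eps) t)+Re (pd (pp i a) (u t, eps) (L (u t), 0) t) - vn (L (Ph i (u t, eps) t)) a"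
   unfolding LL_def r[symmetric] by (simp only: minus_complex.sel plus_complex.sel fst_conv)
  then have "vn (PD (pp i) (u t, eps) u' t+((\<chi> a. Re (LL (pp i) (u t, eps) t a)) - PD (pp i) (u t, eps) (L (u t)) t+L (Ph i (u t, eps) t))) a
   = Re (pd (pp i a) (u t, eps) (u', 0) t)+Re (et (pp i a) (u t, eps) t)"
   by (simp only: PD_def vector_add_component vector_minus_component vec_lambda_beta)
  with d show "((%t. vn (Ph i (u t, eps) t) a) has_vector_derivative
   vn (PD (pp i) (u t, eps) u' t+((\<chi> a. Re (LL (pp i) (u t, eps) t a)) - PD (pp i) (u t, eps) (L (u t)) t+L (Ph i (u t, eps) t))) a) (at t)"
   by (simp only:)
 qed
 show ?thesis using has_vector_derivative_sum[of "{2..p}", OF 1] by (simp add: Phis_def PDs_def Ls_def sum.distrib sum_subtractf linear_sum[OF linL])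
qed

lemma graph_transforms:
 assumes E0: "!!u. u \<in> E0 ==> P0 u = u" and E1: "!!u. u \<in> E1 ==> P1 u = u"
 shows "transforms_system E0 E1 L G (%u0 t. Phis p Ph (u0, eps) t) S
  (%u0 v1 t. P0 (G (u0+(v1+Phis p Ph (u0, eps) t)) t))
  (%u0 v1 t. P1 (G (u0+(v1+Phis p Ph (u0, eps) t)) t)
    - PDs p pp (u0, eps) (P0 (G (u0+(v1+Phis p Ph (u0, eps) t)) t)) t - Ls p pp (u0, eps) t)" unfolding transforms_system_def
proof (intro allI impI)
 fix a b :: real and u u0 v1 :: "real => real ^ 'm"
 assume h: "\<forall>t\<in>{a<..<b}. u0 t \<in> E0 & v1 t \<in> E1 & (u0 t, v1 t) \<in> S & u t = u0 t+(v1 t+Phis p Ph (u0 t, eps) t)"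
 define g where "g t = G (u0 t+(v1 t+Phis p Ph (u0 t, eps) t)) t" for t
 define D where "D u' t = PDs p pp (u0 t, eps) u' t+(Ls p pp (u0 t, eps) t - PDs p pp (u0 t, eps) (L (u0 t)) t+L (Phis p Ph (u0 t, eps) t))" for u' t
 have D: "((%t. Phis p Ph (u0 t, eps) t) has_vector_derivative D u' t) (at t)"
  if "(u0 has_vector_derivative u') (at t)" for u' t unfolding D_def by (rule Phis_deriv[OF that])
 have bl: "bounded_linear P0" using linP0 by (simp add: linear_conv_bounded_linear)
 have alg: "L (u t)+g t = (L (u0 t)+P0 (g t))+((L (v1 t)+(P1 (g t) - PDs p pp (u0 t, eps) (P0 (g t)) t - Ls p pp (u0 t, eps) t))+D (L (u0 t)+P0 (g t)) t)"
  if "t \<in> {a<..<b}" for t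
 proof -
  have "L (u t) = L (u0 t)+(L (v1 t)+L (Phis p Ph (u0 t, eps) t))" using h that by (simp add: linear_add[OF linL])
  moreover have "PDs p pp (u0 t, eps) (L (u0 t)+P0 (g t)) t = PDs p pp (u0 t, eps) (L (u0 t)) t+PDs p pp (u0 t, eps) (P0 (g t)) t"
   by (rule linear_add[OF linear_PDs])
  ultimately show ?thesis using P0_P1[of "g t"] by (simp add: D_def algebra_simps)
 qed
 have gG: "G (u t) t = g t" if "t \<in> {a<..<b}" for t using h that by (simp add: g_def)
 have P0v: "P0 w = 0" if "w \<in> E1" for w using P0_P1[of w] E1[OF that] by simp
 have P0u: "P0 (u t) = u0 t" if "t \<in> {a<..<b}" for t using h that P0v E0 by (simp add: linear_add[OF linP0] P0_Phis)
 show "(\<forall>t\<in>{a<..<b}. (u has_vector_derivative L (u t)+G (u t) t) (at t)) \<longleftrightarrow>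
  (\<forall>t\<in>{a<..<b}. (u0 has_vector_derivative L (u0 t)+P0 (G (u0 t+(v1 t+Phis p Ph (u0 t, eps) t)) t)) (at t) &
   (v1 has_vector_derivative L (v1 t)+(P1 (G (u0 t+(v1 t+Phis p Ph (u0 t, eps) t)) t)
    - PDs p pp (u0 t, eps) (P0 (G (u0 t+(v1 t+Phis p Ph (u0 t, eps) t)) t)) t - Ls p pp (u0 t, eps) t)) (at t))" unfolding g_def[symmetric]
 proof (intro iffI ballI conjI)
  fix t assume t: "t \<in> {a<..<b}"
   and du: "\<forall>t\<in>{a<..<b}. (u has_vector_derivative L (u t)+G (u t) t) (at t)"
  have du': "(u has_vector_derivative L (u t)+g t) (at t)" using du t gG by simp
  have "((%t. P0 (u t)) has_vector_derivative P0 (L (u t)+g t)) (at t)" by (rule bounded_linear.has_vector_derivative[OF bl du'])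
  moreover have "P0 (L (u t)+g t) = L (u0 t)+P0 (g t)" by (simp add: linear_add[OF linP0] P0_L P0u[OF t])
  ultimately show 1: "(u0 has_vector_derivative L (u0 t)+P0 (g t)) (at t)" using has_vector_derivative_transform_open[OF _ t P0u] by simp
  have "((%t. u t - u0 t - Phis p Ph (u0 t, eps) t) has_vector_derivative (L (u t)+g t - (L (u0 t)+P0 (g t)) - D (L (u0 t)+P0 (g t)) t)) (at t)"
   by (intro has_vector_derivative_diff du' 1 D)
  then have "(v1 has_vector_derivative (L (u t)+g t - (L (u0 t)+P0 (g t)) - D (L (u0 t)+P0 (g t)) t)) (at t)"
   by (rule has_vector_derivative_transform_open[OF _ t]) (use h in auto)
  then show "(v1 has_vector_derivative L (v1 t)+(P1 (g t) - PDs p pp (u0 t, eps) (P0 (g t)) t - Ls p pp (u0 t, eps) t)) (at t)"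
   by (simp add: alg[OF t])
 next
  fix t assume t: "t \<in> {a<..<b}"
   and d: "\<forall>t\<in>{a<..<b}. (u0 has_vector_derivative L (u0 t)+P0 (g t)) (at t) &
    (v1 has_vector_derivative L (v1 t)+(P1 (g t) - PDs p pp (u0 t, eps) (P0 (g t)) t - Ls p pp (u0 t, eps) t)) (at t)"
  have d1: "(u0 has_vector_derivative L (u0 t)+P0 (g t)) (at t)"
   and d2: "(v1 has_vector_derivative L (v1 t)+(P1 (g t) - PDs p pp (u0 t, eps) (P0 (g t)) t - Ls p pp (u0 t, eps) t)) (at t)" using d t by auto
  have "((%t. u0 t+(v1 t+Phis p Ph (u0 t, eps) t)) has_vector_derivative L (u t)+g t) (at t)"
   unfolding alg[OF t] by (intro has_vector_derivative_add d1 d2 D)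
  then show "(u has_vector_derivative L (u t)+G (u t) t) (at t)"
   unfolding gG[OF t] by (rule has_vector_derivative_transform_open[OF _ t]) (use h in auto)
 qed
qed

end

end

lemma transforms_system_cong:
 assumes "transforms_system E0 E1 L G Ph S G0 G1"
  and "!!u0 v1 t. u0 \<in> E0 ==> v1 \<in> E1 ==> (u0, v1) \<in> S ==> G0 u0 v1 t = G0' u0 v1 t & G1 u0 v1 t = G1' u0 v1 t"
 shows "transforms_system E0 E1 L G Ph S G0' G1'" unfolding transforms_system_def
proof (intro allI impI)
 fix a b u u0 v1
 assume h: "\<forall>t\<in>{a<..<b}. u0 t \<in> E0 & v1 t \<in> E1 & (u0 t, v1 t) \<in> S & u t = u0 t+(v1 t+Ph (u0 t) t)"
 have e: "G0 (u0 t) (v1 t) t = G0' (u0 t) (v1 t) t" "G1 (u0 t) (v1 t) t = G1' (u0 t) (v1 t) t" if "t \<in> {a<..<b}" for t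
  using h that assms(2)[of "u0 t" "v1 t" t] by auto
 have "(\<forall>t\<in>{a<..<b}. (u has_vector_derivative L (u t)+G (u t) t) (at t)) \<longleftrightarrow>
    (\<forall>t\<in>{a<..<b}.
      (u0 has_vector_derivative L (u0 t)+G0 (u0 t) (v1 t) t) (at t) &
      (v1 has_vector_derivative L (v1 t)+G1 (u0 t) (v1 t) t) (at t))"
  using assms(1)[unfolded transforms_system_def, rule_format, of a b u0 v1 u] h by blast
 then show "(\<forall>t\<in>{a<..<b}. (u has_vector_derivative L (u t)+G (u t) t) (at t)) \<longleftrightarrow>
    (\<forall>t\<in>{a<..<b}.
      (u0 has_vector_derivative L (u0 t)+G0' (u0 t) (v1 t) t) (at t) &
      (v1 has_vector_derivative L (v1 t)+G1' (u0 t) (v1 t) t) (at t))" using e by simp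
qed

section \<open>Polynomials with Sobolev coefficients\<close>

definition IX :: "nat => nat => (nat list \<times> nat) set" where
 "IX n q = {(a, j). length a = n & sum_list a+j<=q}"

lemma finite_IX [simp]: "finite (IX n q)" unfolding IX_def by (rule finite_multi_indices(2))

lemma monomial_update:
 assumes "i < length bs" "length a = length bs"
 shows "monomial bs (a[i := Suc (a ! i)]) u = coord bs u i * monomial bs a u"
proof -
 have "(\<Prod>k\<in>{..<length bs} - {i}. coord bs u k ^ (a[i := Suc (a ! i)] ! k)) = (\<Prod>k\<in>{..<length bs} - {i}. coord bs u k ^ (a ! k))"
  using assms by (intro prod.cong) auto
 then show ?thesis unfolding monomial_def using assms prod.remove[of "{..<length bs}" i "%k. coord bs u k ^ (a[i := Suc (a ! i)] ! k)"]
   prod.remove[of "{..<length bs}" i "%k. coord bs u k ^ (a ! k)"] by simp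
qed

context sobolev_words
begin

abbreviation (input) PS :: "(real ^ 'm) list => nat => (nat list => nat => real => complex) => real ^ 'm => real => real => complex" where
 "PS bs q c u eps t == (\<Sum>z\<in>IX (length bs) q. cor (monomial bs (fst z) u * eps ^ snd z) * c (fst z) (snd z) t)"

definition Pl :: "(real ^ 'm) list => nat => (real ^ 'm => real => real => complex) => bool" where
 "Pl bs q F \<longleftrightarrow> (EX c. (ALL a j. HS T (Suc l) (c a j)) & (\<forall>u\<in>span (set bs). ALL eps t.
  F u eps t = PS bs q c u eps t))"

lemma Pl_I:
 assumes "!!a j. HS T (Suc l) (c a j)"
  "!!u eps t. u \<in> span (set bs) ==> F u eps t = PS bs q c u eps t"
 shows "Pl bs q F" unfolding Pl_def using assms by (intro exI[of _ c] conjI allI ballI)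

lemma Pl_E:
 assumes "Pl bs q F"
 obtains c where "!!a j. HS T (Suc l) (c a j)"
  "!!u eps t. u \<in> span (set bs) ==> F u eps t = PS bs q c u eps t" using assms unfolding Pl_def by blast

lemma HSS_0: "HS T (Suc l) (%t. 0)" by (rule HS_const(1))

lemma Pl_const: "HS T (Suc l) f ==> Pl bs q (%u eps t. f t)"
proof (rule Pl_I[where c="%a j. if (a, j) = (replicate (length bs) 0, 0) then f else (%t. 0)"])
 fix u eps t
 let ?z = "(replicate (length bs) (0::nat), 0::nat)"
 have "(\<Sum>z\<in>IX (length bs) q. cor (monomial bs (fst z) u * eps ^ snd z)*(if (fst z, snd z) = ?z then f else (%t. 0)) t)
  = (\<Sum>z\<in>{?z}. cor (monomial bs (fst z) u * eps ^ snd z)*(if (fst z, snd z) = ?z then f else (%t. 0)) t)"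
  by (rule sum.mono_neutral_right) (auto simp: IX_def sum_list_replicate finite_IX[unfolded IX_def])
 also have "... = f t" by (simp add: monomial_def)
 finally show "f t = (\<Sum>z\<in>IX (length bs) q. cor (monomial bs (fst z) u * eps ^ snd z)*(if (fst z, snd z) = ?z then f else (%t. 0)) t)" ..
qed (use HSS_0 in auto)

lemma Pl_add:
 assumes "Pl bs q F" "Pl bs q G" shows "Pl bs q (%u eps t. F u eps t+G u eps t)"
proof -
 from assms(1) obtain c where c: "!!a j. HS T (Suc l) (c a j)"
  "!!u eps t. u \<in> span (set bs) ==> F u eps t = PS bs q c u eps t" by (rule Pl_E) (rule that)
 from assms(2) obtain d where d: "!!a j. HS T (Suc l) (d a j)"
  "!!u eps t. u \<in> span (set bs) ==> G u eps t = PS bs q d u eps t" by (rule Pl_E) (rule that)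
 show ?thesis by (rule Pl_I[where c="%a j t. c a j t+d a j t"])
   (simp_all only: HS_add(1)[OF c(1) d(1)] c(2) d(2) distrib_left sum.distrib)
qed

lemma Pl_cmult:
 assumes "Pl bs q F" shows "Pl bs q (%u eps t. e * F u eps t)"
proof -
 from assms(1) obtain c where c: "!!a j. HS T (Suc l) (c a j)"
  "!!u eps t. u \<in> span (set bs) ==> F u eps t = PS bs q c u eps t" by (rule Pl_E) (rule that)
 show ?thesis by (rule Pl_I[where c="%a j t. e * c a j t"])
   (simp_all only: HS_cmult(1)[OF c(1)] c(2) sum_distrib_left mult.left_commute)
qed

lemma Pl_sum: "(!!i. i \<in> I ==> Pl bs q (F i)) ==> Pl bs q (%u eps t. \<Sum>i\<in>I. F i u eps t)"
 by (induction I rule: infinite_finite_induct) (simp_all add: Pl_const[OF HSS_0] Pl_add)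

lemma Pl_eps:
 assumes "Pl bs q F" shows "Pl bs (Suc q) (%u eps t. cor eps * F u eps t)"
proof -
 from assms(1) obtain c where c: "!!a j. HS T (Suc l) (c a j)"
  "!!u eps t. u \<in> span (set bs) ==> F u eps t = PS bs q c u eps t" by (rule Pl_E) (rule that)
 define f where "f z = (fst z, Suc (snd z))" for z :: "nat list \<times> nat"
 define d where "d a j = (case j of 0 => (%t. 0) | Suc k => c a k)" for a j
 show ?thesis
 proof (rule Pl_I[where c=d])
  show "HS T (Suc l) (d a j)" for a j by (simp add: d_def c(1) HSS_0 split: nat.split)
  fix u eps t assume u: "u \<in> span (set bs)"
  have "PS bs (Suc q) d u eps t
   = (\<Sum>z\<in>f ` IX (length bs) q. cor (monomial bs (fst z) u * eps ^ snd z) * d (fst z) (snd z) t)"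
  proof (rule sum.mono_neutral_right)
   show "\<forall>z\<in>IX (length bs) (Suc q) - f ` IX (length bs) q. cor (monomial bs (fst z) u * eps ^ snd z) * d (fst z) (snd z) t = 0"
   proof
    fix z assume z: "z \<in> IX (length bs) (Suc q) - f ` IX (length bs) q"
    have "snd z = 0"
    proof (rule ccontr)
     assume "snd z ~= 0"
     then obtain k where k: "snd z = Suc k" using not0_implies_Suc by blast
     then have "z = f (fst z, k)" "(fst z, k) \<in> IX (length bs) q" using z by (auto simp: f_def IX_def prod_eq_iff)
     then show False using z by blast
    qed
    then show "cor (monomial bs (fst z) u * eps ^ snd z) * d (fst z) (snd z) t = 0" by (simp add: d_def)
   qed
  qed (auto simp: f_def IX_def finite_IX[unfolded IX_def])
  also have "... = (\<Sum>z\<in>IX (length bs) q. cor eps*(cor (monomial bs (fst z) u * eps ^ snd z) * c (fst z) (snd z) t))"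
   by (subst sum.reindex) (auto simp: inj_on_def f_def d_def prod_eq_iff mult_ac intro!: sum.cong)
  finally show "cor eps * F u eps t = PS bs (Suc q) d u eps t" by (simp only: c(2)[OF u] sum_distrib_left)
 qed
qed

lemma Pl_coord:
 assumes "Pl bs q F" "i < length bs" shows "Pl bs (Suc q) (%u eps t. cor (coord bs u i) * F u eps t)"
proof -
 from assms(1) obtain c where c: "!!a j. HS T (Suc l) (c a j)"
  "!!u eps t. u \<in> span (set bs) ==> F u eps t = PS bs q c u eps t" by (rule Pl_E) (rule that)
 define f where "f z = ((fst z)[i := Suc (fst z ! i)], snd z)" for z :: "nat list \<times> nat"
 define g where "g z = ((fst z)[i := fst z ! i - 1], snd z)" for z :: "nat list \<times> nat"
 define d where "d a j = (if a ! i = 0 then (%t. 0) else c (a[i := a ! i - 1]) j)" for a j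
 have gf: "g (f z) = z" if "length (fst z) = length bs" for z using that assms(2) by (simp add: f_def g_def)
 have fg: "f (g z) = z" if "length (fst z) = length bs" "fst z ! i ~= 0" for z using that assms(2) by (simp add: f_def g_def)
 have fIX: "f z \<in> IX (length bs) (Suc q)" if "z \<in> IX (length bs) q" for z
  using that assms(2) member_le_sum_list[of "fst z ! i" "fst z"] by (auto simp: f_def IX_def sum_list_update)
 have gIX: "g z \<in> IX (length bs) q" if "z \<in> IX (length bs) (Suc q)" "fst z ! i ~= 0" for z
  using that assms(2) member_le_sum_list[of "fst z ! i" "fst z"] by (auto simp: g_def IX_def sum_list_update)
 show ?thesis
 proof (rule Pl_I[where c=d])
  show "HS T (Suc l) (d a j)" for a j by (simp add: d_def c(1) HSS_0)
  fix u eps t assume u: "u \<in> span (set bs)"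
  have "PS bs (Suc q) d u eps t
   = (\<Sum>z\<in>f ` IX (length bs) q. cor (monomial bs (fst z) u * eps ^ snd z) * d (fst z) (snd z) t)"
  proof (rule sum.mono_neutral_right)
   show "\<forall>z\<in>IX (length bs) (Suc q) - f ` IX (length bs) q. cor (monomial bs (fst z) u * eps ^ snd z) * d (fst z) (snd z) t = 0"
   proof
    fix z assume z: "z \<in> IX (length bs) (Suc q) - f ` IX (length bs) q"
    have "fst z ! i = 0"
    proof (rule ccontr)
     assume nz: "fst z ! i ~= 0"
     have "length (fst z) = length bs" using z by (auto simp: IX_def)
     from fg[OF this nz] gIX[OF _ nz] z show False by (metis DiffD1 DiffD2 imageI)
    qed
    then show "cor (monomial bs (fst z) u * eps ^ snd z) * d (fst z) (snd z) t = 0" by (simp add: d_def)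
   qed
   show "f ` IX (length bs) q \<subseteq> IX (length bs) (Suc q)" using fIX by blast
  qed simp
  also have "... = (\<Sum>z\<in>IX (length bs) q. cor (monomial bs (fst (f z)) u * eps ^ snd (f z)) * d (fst (f z)) (snd (f z)) t)"
   by (rule sum.reindex_cong[of f]) (auto intro!: inj_on_inverseI[of _ g] gf simp: IX_def)
  also have "... = (\<Sum>z\<in>IX (length bs) q. cor (coord bs u i)*(cor (monomial bs (fst z) u * eps ^ snd z) * c (fst z) (snd z) t))"
  proof (rule sum.cong[OF refl])
   fix z assume z: "z \<in> IX (length bs) q"
   then have len: "length (fst z) = length bs" by (auto simp: IX_def)
   have "d (fst (f z)) (snd (f z)) = c (fst z) (snd z)" using len assms(2) by (simp add: d_def f_def)
   moreover have "monomial bs (fst (f z)) u = coord bs u i * monomial bs (fst z) u" "snd (f z) = snd z"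
    using monomial_update[OF assms(2) len] by (simp_all add: f_def)
   ultimately show "cor (monomial bs (fst (f z)) u * eps ^ snd (f z)) * d (fst (f z)) (snd (f z)) t =
    cor (coord bs u i)*(cor (monomial bs (fst z) u * eps ^ snd z) * c (fst z) (snd z) t)" by simp
  qed
  finally show "cor (coord bs u i) * F u eps t = PS bs (Suc q) d u eps t" by (simp only: c(2)[OF u] sum_distrib_left)
 qed
qed

lemma Pl_cong: "Pl bs q F ==> (!!u eps t. u \<in> span (set bs) ==> F u eps t = G u eps t) ==> Pl bs q G"
proof -
 assume F: "Pl bs q F" and e: "!!u eps t. u \<in> span (set bs) ==> F u eps t = G u eps t"
 from F obtain c where c: "!!a j. HS T (Suc l) (c a j)"
  "!!u eps t. u \<in> span (set bs) ==> F u eps t = PS bs q c u eps t" by (rule Pl_E) (rule that)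
 show "Pl bs q G" by (rule Pl_I[where c=c]) (simp_all only: c(1) e[symmetric] c(2))
qed

lemma Pl_sobolev_polys:
 fixes Ph :: "real ^ 'n => real => real => real ^ 'n"
 assumes bs: "basis_list E0 bs" and Pl: "!!a. Pl bs p (%u eps t. cor (vn (Ph u eps t) a))"
  and P: "linear P" "!!u. P u \<in> E1" "!!u eps t. P (Ph u eps t) = Ph u eps t"
 shows "Ph \<in> sobolev_polys T (Suc l) p E0 E1"
proof -
 interpret S: sobolev_words T "Suc l" N \<zeta> by unfold_locales (simp_all add: linear_add[OF lin] linear_scale[OF lin])
 have sp: "span (set bs) = E0" using bs by (simp add: basis_list_def)
 have "ALL b. EX c. (ALL a j. HS T (Suc l) (c a j)) & (\<forall>u\<in>E0. ALL eps t.
  cor (vn (Ph u eps t) b) = PS bs p c u eps t)" using Pl unfolding Pl_def sp by (intro allI)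
 from choice[OF this] obtain c where c0: "ALL b. (ALL a j. HS T (Suc l) (c b a j)) & (\<forall>u\<in>E0. ALL eps t.
  cor (vn (Ph u eps t) b) = (\<Sum>z\<in>IX (length bs) p. cor (monomial bs (fst z) u * eps ^ snd z) * c b (fst z) (snd z) t))"
  by (elim exE) (rule that)
 have c: "!!b a j. HS T (Suc l) (c b a j)"
  "!!b u eps t. u \<in> E0 ==> cor (vn (Ph u eps t) b) = (\<Sum>z\<in>IX (length bs) p. cor (monomial bs (fst z) u * eps ^ snd z) * c b (fst z) (snd z) t)"
  by (rule c0[THEN spec, THEN conjunct1, THEN spec, THEN spec])
   (rule c0[THEN spec, THEN conjunct2, THEN bspec, THEN spec, THEN spec])
 define C where "C a j t = P (\<chi> b. Re (c b a j t))" for a j t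
 have "C a j \<in> sobolev T (Suc l) E1" for a j
 proof -
  have h: "HS T (Suc l) (%t. cor (vn (\<chi> b. Re (c b a j t)) d))" for d using S.HS_Re(1)[OF c(1)] by simp
  define B where "B = (\<Sum>d\<in>UNIV. S.nm (%t. cor (vn (\<chi> b. Re (c b a j t)) d)))"
  have "S.nm (%t. cor (vn (\<chi> b. Re (c b a j t)) d))<=B" for d unfolding B_def by (rule member_le_sum) auto
  then have "HS T (Suc l) (%t. cor (vn (C a j t) d))" for d unfolding C_def by (rule S.HS_linear_image(1)[OF P(1) h])
  then show ?thesis unfolding S.sobolev_iff using P(2) by (auto simp: C_def)
 qed
 moreover have "Ph u eps t = (\<Sum>(a, j)\<in>{(a, j). length a = length bs & sum_list a+j<=p}. (monomial bs a u * eps ^ j) *\<^sub>R C a j t)"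
  if u: "u \<in> E0" for u eps t
 proof -
  have "vn (Ph u eps t) b = (\<Sum>z\<in>IX (length bs) p. (monomial bs (fst z) u * eps ^ snd z) * Re (c b (fst z) (snd z) t))" for b
   using arg_cong[OF c(2)[OF u, of eps t b], of Re] by (simp add: Re_sum)
  then have "Ph u eps t = (\<Sum>z\<in>IX (length bs) p. (monomial bs (fst z) u * eps ^ snd z) *\<^sub>R (\<chi> b. Re (c b (fst z) (snd z) t)))"
   by (simp add: vec_eq_iff)
  then have "P (Ph u eps t) = (\<Sum>z\<in>IX (length bs) p. (monomial bs (fst z) u * eps ^ snd z) *\<^sub>R C (fst z) (snd z) t)"
   by (simp only: linear_sum[OF P(1)] linear_scale[OF P(1)] C_def)
  then show ?thesis unfolding P(3) by (simp add: IX_def case_prod_unfold)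
 qed
 ultimately show ?thesis unfolding sobolev_polys_def using bs by (intro CollectI exI[of _ bs] exI[of _ C] conjI allI ballI)
qed

lemma sobolev_polys_split:
 fixes Ph :: "real ^ 'n => real => real => real ^ 'n"
 assumes Ph: "Ph \<in> sobolev_polys T (Suc l) p E0 E1" and E1: "subspace E1"
  and const: "!!u t. Ph u 0 t = Ph u 0 0"
 shows "(%u. Ph u 0 0) \<in> poly_maps p E0 E1"
  and "\<exists>PhBC\<in>sobolev_polys T (Suc l) p E0 E1. \<forall>u\<in>E0. ALL eps t. Ph u eps t = Ph u 0 0+eps *\<^sub>R PhBC u eps t"
proof -
 interpret S: sobolev_words T "Suc l" N \<zeta> by unfold_locales (simp_all add: linear_add[OF lin] linear_scale[OF lin])
 from Ph obtain bs c where bs: "basis_list E0 bs" and c0: "ALL a j. c a j \<in> sobolev T (Suc l) E1"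
  and e0: "\<forall>u\<in>E0. ALL eps t. Ph u eps t = (\<Sum>(a, j) \<in> {(a, j). length a = length bs & sum_list a+j<=p}.
     (monomial bs a u * eps ^ j) *\<^sub>R c a j t)" unfolding sobolev_polys_def by blast
 have e: "Ph u eps t = (\<Sum>z\<in>IX (length bs) p. (monomial bs (fst z) u * eps ^ snd z) *\<^sub>R c (fst z) (snd z) t)" if "u \<in> E0" for u eps t
  using e0 that by (simp add: IX_def case_prod_unfold)
 define A where "A = {a :: nat list. length a = length bs & sum_list a<=p}"
 have fA: "finite A" unfolding A_def by (rule finite_multi_indices(1))
 define B where "B = {z \<in> IX (length bs) p. sum_list (fst z)+snd z+1<=p}"
 have fB: "finite B" unfolding B_def by simp
 have IXs: "IX (length bs) p = (%a. (a, 0)) ` A \<union> (%z. (fst z, Suc (snd z))) ` B"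
 proof (intro equalityI subsetI)
  fix z assume z: "z \<in> IX (length bs) p"
  show "z \<in> (%a. (a, 0)) ` A \<union> (%z. (fst z, Suc (snd z))) ` B"
  proof (cases "snd z")
   case 0
   then have "z = (fst z, 0)" "fst z \<in> A" using z by (auto simp: prod_eq_iff A_def IX_def)
   then show ?thesis by blast
  next
   case (Suc k)
   then have "z = (fst (fst z, k), Suc (snd (fst z, k)))" "(fst z, k) \<in> B" using z by (auto simp: prod_eq_iff B_def IX_def)
   then show ?thesis by blast
  qed
 qed (auto simp: A_def B_def IX_def)
 have split: "Ph u eps t = (\<Sum>a\<in>A. monomial bs a u *\<^sub>R c a 0 t)+eps *\<^sub>R (\<Sum>z\<in>B. (monomial bs (fst z) u * eps ^ snd z) *\<^sub>R c (fst z) (Suc (snd z)) t)"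
  if u: "u \<in> E0" for u eps t
 proof -
  have "Ph u eps t = (\<Sum>z\<in>(%a. (a, 0)) ` A. (monomial bs (fst z) u * eps ^ snd z) *\<^sub>R c (fst z) (snd z) t)
  +(\<Sum>z\<in>(%z. (fst z, Suc (snd z))) ` B. (monomial bs (fst z) u * eps ^ snd z) *\<^sub>R c (fst z) (snd z) t)"
   unfolding e[OF u] IXs using fA fB by (intro sum.union_disjoint) auto
  also have "(\<Sum>z\<in>(%a. (a, 0)) ` A. (monomial bs (fst z) u * eps ^ snd z) *\<^sub>R c (fst z) (snd z) t) = (\<Sum>a\<in>A. monomial bs a u *\<^sub>R c a 0 t)"
   by (subst sum.reindex) (auto simp: inj_on_def)
  also have "(\<Sum>z\<in>(%z. (fst z, Suc (snd z))) ` B. (monomial bs (fst z) u * eps ^ snd z) *\<^sub>R c (fst z) (snd z) t)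
   = (\<Sum>z\<in>B. eps *\<^sub>R ((monomial bs (fst z) u * eps ^ snd z) *\<^sub>R c (fst z) (Suc (snd z)) t))"
   by (subst sum.reindex) (auto simp: inj_on_def prod_eq_iff mult_ac)
  finally show ?thesis by (simp only: scaleR_sum_right)
 qed
 have cA: "Ph u 0 0 = (\<Sum>a\<in>A. monomial bs a u *\<^sub>R c a 0 t)" if "u \<in> E0" for u t using split[OF that, of 0 t] const[of u t] by simp
 have "c a 0 0 \<in> E1" for a using c0 unfolding S.sobolev_iff by blast
 then show "(%u. Ph u 0 0) \<in> poly_maps p E0 E1" unfolding poly_maps_def using bs cA[of _ 0, unfolded A_def]
  by (intro CollectI exI[of _ bs] exI[of _ "%a. c a 0 0"] conjI allI ballI)
 define d where "d a j = (if sum_list a+j+1<=p then c a (Suc j) else (%t. 0))" for a j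
 have "(%t. 0) \<in> sobolev T (Suc l) E1" unfolding S.sobolev_iff using subspace_0[OF E1] HSS_0 by auto
 then have d: "d a j \<in> sobolev T (Suc l) E1" for a j using c0 by (simp add: d_def)
 define BC where "BC u eps t = (\<Sum>(a, j) \<in> {(a, j). length a = length bs & sum_list a+j<=p}. (monomial bs a u * eps ^ j) *\<^sub>R d a j t)" for u eps t
 have "BC \<in> sobolev_polys T (Suc l) p E0 E1" unfolding sobolev_polys_def using bs d BC_def
  by (intro CollectI exI[of _ bs] exI[of _ d] conjI allI ballI)
 moreover have bc: "BC u eps t = (\<Sum>z\<in>B. (monomial bs (fst z) u * eps ^ snd z) *\<^sub>R c (fst z) (Suc (snd z)) t)" for u eps t
 proof -
  have "BC u eps t = (\<Sum>z\<in>IX (length bs) p. (monomial bs (fst z) u * eps ^ snd z) *\<^sub>R d (fst z) (snd z) t)"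
   by (simp add: BC_def IX_def case_prod_unfold)
  also have "... = (\<Sum>z\<in>B. (monomial bs (fst z) u * eps ^ snd z) *\<^sub>R c (fst z) (Suc (snd z)) t)"
   by (rule sum.mono_neutral_cong_right) (auto simp: B_def d_def)
  finally show ?thesis .
 qed
 ultimately show "\<exists>PhBC\<in>sobolev_polys T (Suc l) p E0 E1. \<forall>u\<in>E0. ALL eps t. Ph u eps t = Ph u 0 0+eps *\<^sub>R PhBC u eps t"
 proof (intro bexI[of _ BC] ballI allI)
  fix u eps t assume u: "u \<in> E0"
  show "Ph u eps t = Ph u 0 0+eps *\<^sub>R BC u eps t" unfolding bc cA[OF u, of t] by (rule split[OF u])
 qed
qed

end

lemma (in nf_graph) Phis_sobolev_polys:
 assumes fam: "fam pp Ph ph" and bs: "basis_list E0 bs" and E1: "!!u. P1 u \<in> E1"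
 shows "(%u eps t. Phis p Ph (u, eps) t) \<in> sobolev_polys T (Suc l) p E0 E1"
proof (rule Pl_sobolev_polys[OF bs _ linP1 E1])
 note g = fam_good[OF fam]
 fix a
 have letter: "Pl bs (Suc q) (%u eps t. \<zeta> i (u, eps) * F u eps t)" if F: "Pl bs q F" for q i F
 proof -
  have "Pl bs (Suc q) (%u eps t. (\<Sum>k<length bs. \<zeta> i (bs ! k, 0)*(cor (coord bs u k) * F u eps t))+\<zeta> i (0, 1)*(cor eps * F u eps t))"
   by (intro Pl_add Pl_sum Pl_cmult Pl_coord Pl_eps F) auto
  then show ?thesis
  proof (rule Pl_cong)
   fix u eps t assume u: "u \<in> span (set bs)"
   have "(u, eps) = (\<Sum>k<length bs. coord bs u k *\<^sub>R (bs ! k, 0))+eps *\<^sub>R (0, 1)"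
   proof -
    have "(\<Sum>k<length bs. coord bs u k *\<^sub>R (bs ! k, 0::real)) = ((\<Sum>k<length bs. coord bs u k *\<^sub>R bs ! k), 0)"
     by (simp add: prod_eq_iff fst_sum snd_sum)
    moreover have "(\<Sum>k<length bs. coord bs u k *\<^sub>R bs ! k) = u" using coord_expand[OF bs, of u] bs u by (simp add: basis_list_def)
    ultimately show ?thesis by simp
   qed
   then have "\<zeta> i (u, eps) = \<zeta> i ((\<Sum>k<length bs. coord bs u k *\<^sub>R (bs ! k, 0))+eps *\<^sub>R (0, 1))" by (rule arg_cong)
   then have "\<zeta> i (u, eps) = (\<Sum>k<length bs. cor (coord bs u k) * \<zeta> i (bs ! k, 0))+cor eps * \<zeta> i (0, 1)"
    unfolding linear_add[OF lin] linear_sum[OF lin] linear_scale[OF lin] by (simp only: scaleR_conv_of_real)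
   then show "(\<Sum>k<length bs. \<zeta> i (bs ! k, 0)*(cor (coord bs u k) * F u eps t))+\<zeta> i (0, 1)*(cor eps * F u eps t) = \<zeta> i (u, eps) * F u eps t"
    by (simp add: distrib_left distrib_right sum_distrib_left sum_distrib_right mult_ac)
  qed
 qed
 have mon: "Pl bs (q+length w) (%u eps t. mon w (u, eps) * c t)" if c: "HS T (Suc l) c" for q w c
 proof (induction w)
  case Nil show ?case using Pl_const[OF c] by simp
 next
  case (Cons i w) show ?case using letter[OF Cons.IH, of i] by (simp add: mult.assoc)
 qed
 have evp: "Pl bs p (%u eps t. ev ps (u, eps) t)" if "!!w c. (w, c) \<in> set ps ==> HS T (Suc l) c & length w<=p" for ps using that
 proof (induction ps)
  case Nil show ?case using Pl_const[OF HSS_0] by simp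
 next
  case (Cons z ps)
  obtain w c where z: "z = (w, c)" by (cases z)
  have "HS T (Suc l) c" "length w<=p" using Cons.prems[of w c] z by auto
  then have "Pl bs p (%u eps t. mon w (u, eps) * c t)" using mon[of c "p - length w" w] by simp
  moreover have "Pl bs p (%u eps t. ev ps (u, eps) t)" by (rule Cons.IH, rule Cons.prems) simp
  ultimately have "Pl bs p (%u eps t. mon w (u, eps) * c t+ev ps (u, eps) t)" by (rule Pl_add)
  then show ?case by (simp add: z)
 qed
 have "Pl bs p (%u eps t. \<Sum>i\<in>{2..p}. ev (pp i a) (u, eps) t)"
 proof (intro Pl_sum evp)
  fix i w c assume i: "i \<in> {2..p}" and w: "(w, c) \<in> set (pp i a)"
  have "HS T (Suc l) c" by (rule goodD(3)[OF g w])
  moreover have "length w = i" using goodD(1)[OF g[of i], of a] w by (auto simp: hom_def)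
  ultimately show "HS T (Suc l) c & length w<=p" using i by simp
 qed
 then show "Pl bs p (%u eps t. cor (vn (Phis p Ph (u, eps) t) a))" by (simp add: Phis_def goodD(4)[OF g])
qed (rule P1_Phis[OF fam])

section \<open>Estimates for the truncated graph\<close>

lemma has_derivative_zero_quadratic:
 fixes f :: "'a::real_normed_vector => 'b::real_normed_vector"
 assumes f: "!!x. norm x<=1 ==> norm (f x)<=C*(norm x)\<^sup>2"
 shows "(f has_derivative (%_. 0)) (at 0 within S)"
proof (rule has_derivativeI_sandwich[where e=1 and H="%y. C * norm y"])
 have f0: "f 0 = 0" using f[of 0] by simp
 fix y :: 'a assume y: "y ~= 0" "dist y 0 < 1"
 then have "norm (f y)<=C*(norm y)\<^sup>2" using f by simp
 then show "norm (f y - f 0 - 0) / norm (y - 0)<=C * norm y" using y by (simp add: f0 divide_le_eq power2_eq_square mult.assoc)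
next
 have "((%y::'a. C * norm y) \<longlongrightarrow> C * norm (0::'a)) (at 0 within S)" by (intro tendsto_intros)
 then show "((%y::'a. C * norm y) \<longlongrightarrow> 0) (at 0 within S)" by simp
qed simp_all

lemma norm_vec_le:
 fixes y :: "real ^ 'n"
 assumes "!!a. \<bar>vn y a\<bar><=B" shows "norm y<=real CARD('n) * B"
 using order_trans[OF norm_le_l1_cart sum_mono[of UNIV "%a. \<bar>vn y a\<bar>" "%_. B"]] assms by simp

lemma (in sobolev_words) AN_diff:
 assumes "AN s M W" "AN s M' W'" "s >= 0"
 shows "EX M. AN s M (%h t. W h t - W' h t)" using AN_add[OF assms(1) AN_cmult[OF assms(2,3), of "-1"] assms(3)] by auto

context nf_graph
begin

lemma VS_const: "VS (u, 0) t = VS (u, 0) 0"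
proof -
 have e: "prod_list (map (cvec (u, 0)) w) * vn (v w t) a = prod_list (map (cvec (u, 0)) w) * vn (v w 0) a" for w a
 proof (cases "None \<in> set w")
  case True
  then have "prod_list (map (cvec (u, 0)) w) = 0" by (auto simp: prod_list_zero_iff image_iff cvec_def intro!: bexI[of _ None])
  then show ?thesis by simp
 qed (use v_const[of w t] in simp)
 show ?thesis unfolding VS_def by (simp only: e)
qed

definition cM :: real where "cM = malg l*(2 * cU+1)"

definition FF where "FF p pp Ph x y t = P1 (VS (Ub p Ph x y t) t) - PDs p pp x (P0 (VS (Ub p Ph x y t) t)) t"

definition V1x where "V1x p pp Ph dl x y t = (if norm x < 2 * dl then FF p pp Ph x y t - FF p pp Ph x 0 t else 0)"

definition Rx where "Rx p pp Ph x t = FF p pp Ph x 0 t - Ls p pp x t"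

definition cP0 :: real where "cP0 = (\<Sum>a\<in>UNIV. \<Sum>c\<in>UNIV. norm (mtx P0 a c))"

definition cV1 :: real where
 "cV1 = 4*(malg l * cP1+malg l*(real CARD('m) * malg l*(2 * cU)*(malg l * cP0)))*(2 * cv * (ka*(real CARD('m)+1))\<^sup>2 * cM\<^sup>2)"

lemma cM_pos: "cM > 0" using malg_pos cU_pos by (simp add: cM_def)

lemma cM_ge: "2 * cU<=cM" "malg l<=cM"
proof -
 have "1*(2 * cU)<=malg l*(2 * cU+1)" using malg_ge_1[of l] cU_pos by (intro mult_mono) auto
 then show "2 * cU<=cM" by (simp add: cM_def)
 show "malg l<=cM" using malg_pos cU_pos by (simp add: cM_def)
qed

lemma cP0_nonneg: "cP0 >= 0" unfolding cP0_def by (intro sum_nonneg) auto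

lemma cV1_nonneg: "cV1 >= 0" unfolding cV1_def using malg_pos cP1_nonneg cU_pos cP0_nonneg cv by (intro mult_nonneg_nonneg add_nonneg_nonneg) auto

context
 fixes pp :: "nat => 'm => terms" and Ph :: "nat => (real ^ 'm) \<times> real => real => real ^ 'm" and ph :: "nat => real"
  and p :: nat and r G dl dl0 :: real
 assumes fam: "fam pp Ph ph" and trunc0: "ALL i>p. pp i = (%_. []) & Ph i = (%_ _. 0) & ph i = 0"
  and p: "p >= 1" and r: "r > 0" and uuS: "!!J. (\<Sum>n\<le>J. r ^ n * maj.uu ph n)<=2 * cU * r"
  and LLN: "ALL n x t a. 2<=n --> n<=p --> LL (pp n) x t a = cor (vn (NN pp Ph n x t) a)"
  and hhS: "!!J. (\<Sum>n\<le>J. r ^ n * maj.hh ph n)<=G"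
  and dl: "0 < dl" "dl<=dl0" and dr: "16 * malg l * dl<=r"
  and kd: "ka*(real CARD('m)+1)*(cM*(8 * dl0))<=1 / 2"
begin

lemmas fam_ctx = fam trunc0 p r uuS

lemma P1_FF: "P1 (FF p pp Ph x y t) = FF p pp Ph x y t" unfolding FF_def by (simp add: linear_diff[OF linP1] P1_idem P1_PDs[OF fam])

lemma Ls_NN: "Ls p pp x t = (\<Sum>i\<in>{2..p}. NN pp Ph i x t)" unfolding Ls_def
proof (rule sum.cong[OF refl])
 fix i assume i: "i \<in> {2..p}"
 have "LL (pp i) x t a = cor (vn (NN pp Ph i x t) a)" for a using LLN[rule_format, of i x t a] i by simp
 then show "(\<chi> a. Re (LL (pp i) x t a)) = NN pp Ph i x t" by (simp add: vec_eq_iff)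
qed

lemma P1_Rx: "P1 (Rx p pp Ph x t) = Rx p pp Ph x t"
 unfolding Rx_def Ls_NN by (simp add: linear_diff[OF linP1] P1_FF linear_sum[OF linP1] P1_NN[OF fam])

lemma P1_V1x: "P1 (V1x p pp Ph dl x y t) = V1x p pp Ph dl x y t" unfolding V1x_def by (simp add: linear_diff[OF linP1] P1_FF linear_0[OF linP1])

lemma Ub_const: "Ub p Ph (u, 0) y t = Ub p Ph (u, 0) y 0" using Phis_const[OF fam, of p u t] by (simp add: Ub_def)

lemma VSUb_const: "VS (Ub p Ph (u, 0) y t) t = VS (Ub p Ph (u, 0) y 0) 0"
 using VS_const[of "fst (Ub p Ph (u, 0) y 0)" t] Ub_const[of u y t] by (simp add: Ub_def)

lemma FF_const: "FF p pp Ph (u, 0) y t = FF p pp Ph (u, 0) y 0"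
proof -
 have "PDs p pp (u, 0) z t = PDs p pp (u, 0) z 0" for z unfolding PDs_def by (intro sum.cong refl PD_facts(2)[OF fam_good[OF fam]])
 then show ?thesis unfolding FF_def VSUb_const[of u y t] by simp
qed

lemma V1x_const: "V1x p pp Ph dl (u, 0) y t = V1x p pp Ph dl (u, 0) y 0" unfolding V1x_def FF_const[of u y t] FF_const[of u 0 t] ..

lemma Rx_const: "Rx p pp Ph (u, 0) t = Rx p pp Ph (u, 0) 0"
proof -
 have "Ls p pp (u, 0) t = Ls p pp (u, 0) 0" unfolding Ls_NN by (intro sum.cong refl NN_ind[OF fam])
 then show ?thesis unfolding Rx_def FF_const[of u 0 t] by simp
qed

lemma dl0_pos: "dl0 > 0" using dl by simp

lemma kd': "z<=8 * dl0 ==> ka*(real CARD('m)+1)*(cM * z)<=1 / 2"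
proof -
 assume "z<=8 * dl0"
 then have "ka*(real CARD('m)+1)*(cM * z)<=ka*(real CARD('m)+1)*(cM*(8 * dl0))" using cM_pos kk_pos by (intro mult_left_mono) auto
 then show ?thesis using kd by linarith
qed

lemma small_r: "z<=4 * dl ==> malg l * z<=r / 2"
proof -
 assume "z<=4 * dl"
 then have "malg l * z<=malg l*(4 * dl)" using malg_pos by (intro mult_left_mono) auto
 also have "...<=r / 2" using dr malg_pos dl mult_pos_pos[OF malg_pos dl(1)] by linarith
 finally show ?thesis .
qed

lemma Ub_norm:
 assumes x: "norm x<=2 * dl"
 shows "norm (Ub p Ph x y t)<=(real CARD('m)+1)*(cM*(norm x+norm y))"
proof -
 have sm: "malg l*(norm x+0*0)<=r" using small_r[of "norm x"] x dl r by simp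
 have "AN 0 (malg l*(2 * cU+1)*(norm x+0*0+norm y+0*0))
  (%(h::real) t. cor (cvec (Ub p Ph (x+(0, 0)) (y+0) t) i))" for i
  by (rule AN_Ub[OF fam_ctx, where X="%_. (0, 0)" and Y="%_. 0"]) (use sm in \<open>auto simp: linear_iff zero_prod_def\<close>)
 from AN_value(1,2)[OF this, of "0::real"]
 have "HSl (%t. cor (cvec (Ub p Ph x y t) i))" "nm (%t. cor (cvec (Ub p Ph x y t) i))<=cM*(norm x+norm y)" for i
  by (simp_all add: cM_def flip: zero_prod_def)
 then have c: "\<bar>cvec (Ub p Ph x y t) i\<bar><=cM*(norm x+norm y)" for i
  using sup_le_nm[of "%t. cor (cvec (Ub p Ph x y t) i)" t] order_trans by fastforce
 have "norm (Ub p Ph x y t)<=norm (fst (Ub p Ph x y t))+norm (snd (Ub p Ph x y t))"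
  using norm_Pair_le[of "fst (Ub p Ph x y t)" "snd (Ub p Ph x y t)"] by simp
 also have "norm (fst (Ub p Ph x y t))<=real CARD('m)*(cM*(norm x+norm y))"
  by (rule norm_vec_le) (use c[of "Some _"] in \<open>simp add: cvec_def\<close>)
 also have "norm (snd (Ub p Ph x y t))<=cM*(norm x+norm y)" using c[of None] by (simp add: cvec_def)
 finally show ?thesis by (simp add: distrib_right)
qed

lemma AN_VSUb:
 fixes X :: "'a::real_normed_vector => (real ^ 'm) \<times> real" and Y :: "'a => real ^ 'm"
 assumes X: "linear X" "!!h. norm (X h)<=kx * norm h" and Y: "linear Y" "!!h. norm (Y h)<=ky * norm h"
  and k: "kx >= 0" "ky >= 0" "t0 > 0" and x: "norm x0+kx * t0<=4 * dl" and z: "norm x0+kx * t0+norm y0+ky * t0<=8 * dl0"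
 shows "AN t0 (2 * cv * (ka*(real CARD('m)+1)*(cM*(norm x0+kx * t0+norm y0+ky * t0)))\<^sup>2)
  (%h t. cor (vn (VS (Ub p Ph (x0+X h) (y0+Y h) t) t) a))"
proof (rule AN_VS(1))
 show "AN t0 (cM*(norm x0+kx * t0+norm y0+ky * t0)) (%h t. cor (cvec (Ub p Ph (x0+X h) (y0+Y h) t) i))" for i
  unfolding cM_def by (rule AN_Ub[OF fam_ctx X Y]) (use k small_r[OF x] r in auto)
qed (use k kd'[OF z] in auto)

lemma AN_FF:
 fixes X :: "'a::real_normed_vector => (real ^ 'm) \<times> real" and Y :: "'a => real ^ 'm"
 assumes X: "linear X" "!!h. norm (X h)<=norm h" and Y: "linear Y" "!!h. norm (Y h)<=norm h"
  and x: "norm x0<=dl" and y: "norm y0<=dl0"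
 shows "EX M. AN (dl / 2) M (%h t. cor (vn (FF p pp Ph (x0+X h) (y0+Y h) t) a))"
  and "EX M. AN (dl / 2) M (%h t. cor (vn (P0 (VS (Ub p Ph (x0+X h) (y0+Y h) t) t)) a))"
  and "EX M. AN (dl / 2) M (%h t. cor (vn (Ls p pp (x0+X h) t) a))"
proof -
 have X': "norm (X h)<=1 * norm h" and Y': "norm (Y h)<=1 * norm h" for h using X(2) Y(2) by simp_all
 have t0: "dl / 2 > 0" "dl / 2 >= 0" using dl by auto
 have x4: "norm x0+1*(dl / 2)<=4 * dl" using x dl by linarith
 have z8: "norm x0+1*(dl / 2)+norm y0+1*(dl / 2)<=8 * dl0" using x y dl by linarith
 note V = AN_VSUb[OF X(1) X' Y(1) Y' zero_le_one zero_le_one t0(1) x4 z8]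
 note P0V = AN_linear_image[OF linP0 V t0(2)]
 note P1V = AN_linear_image[OF linP1 V t0(2)]
 show "EX M. AN (dl / 2) M (%h t. cor (vn (P0 (VS (Ub p Ph (x0+X h) (y0+Y h) t) t)) a))" using P0V by blast
 note PDV = AN_PDs[OF fam_ctx X(1) X' P0V zero_le_one t0(2) small_r[OF x4]]
 show "EX M. AN (dl / 2) M (%h t. cor (vn (FF p pp Ph (x0+X h) (y0+Y h) t) a))" using AN_diff[OF P1V PDV t0(2)] by (simp add: FF_def)
 have "AN (dl / 2) (\<Sum>i\<in>{2..p}. maj.hh ph i*(malg l*(norm x0+1*(dl / 2))) ^ i)
  (%h t. \<Sum>i\<in>{2..p}. cor (vn (NN pp Ph i (x0+X h) t) a))" by (intro AN_sum AN_H[OF H_NN[OF fam]] X(1) X' zero_le_one t0(2))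
 then show "EX M. AN (dl / 2) M (%h t. cor (vn (Ls p pp (x0+X h) t) a))" unfolding Ls_NN by (auto simp: sum_component)
qed

lemma analytic_pieces:
 fixes X :: "'a::real_normed_vector => (real ^ 'm) \<times> real" and Y :: "'a => real ^ 'm"
 assumes X: "linear X" "!!h. norm (X h)<=norm h" and Y: "linear Y" "!!h. norm (Y h)<=norm h"
  and x: "norm x0<=dl" and y: "norm y0<=dl0"
  and E0: "!!u. P0 u \<in> E0" "!!u. u \<in> E0 ==> P0 u = u" and E1: "!!u. P1 u \<in> E1" "!!u. u \<in> E1 ==> P1 u = u"
 shows "(%h t. P0 (VS (Ub p Ph (x0+X h) (y0+Y h) t) t)) \<in> sobolev_analytic T l D E0"
  and "(%h t. V1x p pp Ph dl (x0+X h) (y0+Y h) t) \<in> sobolev_analytic T l D E1"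
  and "(%h t. Rx p pp Ph (x0+X h) t) \<in> sobolev_analytic T l D E1"
proof -
 have t0: "dl / 2 > 0" "dl / 2 >= 0" using dl by auto
 have Z: "linear (%h::'a. 0::real ^ 'm)" "norm (0::real ^ 'm)<=norm (h::'a)" for h by (simp_all add: linear_iff)
 have z0: "norm (0::real ^ 'm)<=dl0" using dl by simp
 note F0 = AN_FF(1)[OF X Z x z0, unfolded add_0_left]
 show "(%h t. P0 (VS (Ub p Ph (x0+X h) (y0+Y h) t) t)) \<in> sobolev_analytic T l D E0"
  by (rule AN_sobolev_analytic[OF AN_FF(2)[OF X Y x y] t0(1) linP0 E0 E0(1)])
 have V: "EX M. AN (dl / 2) M (%h t. cor (vn (V1x p pp Ph dl (x0+X h) (y0+Y h) t) a))" for a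
 proof -
  from AN_FF(1)[OF X Y x y, of a] obtain M where M: "AN (dl / 2) M (%h t. cor (vn (FF p pp Ph (x0+X h) (y0+Y h) t) a))" ..
  from F0[of a] obtain M' where M': "AN (dl / 2) M' (%h t. cor (vn (FF p pp Ph (x0+X h) 0 t) a))" ..
  from AN_diff[OF M M' t0(2)] obtain M'' where M'': "AN (dl / 2) M'' (%h t. cor (vn (FF p pp Ph (x0+X h) (y0+Y h) t) a)
   - cor (vn (FF p pp Ph (x0+X h) 0 t) a))" ..
  have "norm (x0+X h) < 2 * dl" if "norm h<=dl / 2" for h using norm_triangle_ineq[of x0 "X h"] X(2)[of h] that x dl by linarith
  then show ?thesis by (intro exI[of _ M''] AN_cong[OF M'']) (simp add: V1x_def)
 qed
 show "(%h t. V1x p pp Ph dl (x0+X h) (y0+Y h) t) \<in> sobolev_analytic T l D E1"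
  by (rule AN_sobolev_analytic[OF V t0(1) linP1 E1]) (assumption, subst P1_V1x[symmetric], rule E1(1))
 have R: "EX M. AN (dl / 2) M (%h t. cor (vn (Rx p pp Ph (x0+X h) t) a))" for a
 proof -
  from F0[of a] obtain M where M: "AN (dl / 2) M (%h t. cor (vn (FF p pp Ph (x0+X h) 0 t) a))" ..
  from AN_FF(3)[OF X Y x y, of a] obtain M' where M': "AN (dl / 2) M' (%h t. cor (vn (Ls p pp (x0+X h) t) a))" ..
  show ?thesis using AN_diff[OF M M' t0(2)] by (simp add: Rx_def)
 qed
 show "(%h t. Rx p pp Ph (x0+X h) t) \<in> sobolev_analytic T l D E1"
  by (rule AN_sobolev_analytic[OF R t0(1) linP1 E1]) (assumption, subst P1_Rx[symmetric], rule E1(1))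
qed

lemma AN_fixed:
 assumes "AN t0 M (%(h::real) t. f t)" "t0 >= 0" shows "HSl f" "nm f<=M" using AN_value(1,2)[OF assms(1), of 0] assms(2) by simp_all

lemma Rx_bound:
 assumes x: "norm x<=dl"
 shows "HSl (%t. cor (vn (Rx p pp Ph x t) a))"
  and "nm (%t. cor (vn (Rx p pp Ph x t) a))<=G / 2 ^ p"
proof -
 have X: "linear (%h::real. 0 :: (real ^ 'm) \<times> real)" "norm (0 :: (real ^ 'm) \<times> real)<=norm (h::real)" for h by (simp_all add: linear_iff)
 have Y: "linear (%h::real. 0 :: real ^ 'm)" "norm (0 :: real ^ 'm)<=norm (h::real)" for h by (simp_all add: linear_iff)
 have z0: "norm (0::real ^ 'm)<=dl0" using dl by simp
 have t0: "dl / 2 >= 0" using dl by auto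
 from AN_FF(1)[OF X Y x z0, of a] obtain M where M: "AN (dl / 2) M (%(h::real) t. cor (vn (FF p pp Ph (x+0) (0+0) t) a))" ..
 from AN_FF(3)[OF X Y x z0, of a] obtain M' where M': "AN (dl / 2) M' (%(h::real) t. cor (vn (Ls p pp (x+0) t) a))" ..
 from AN_diff[OF M M' t0] obtain M'' where "AN (dl / 2) M'' (%(h::real) t. cor (vn (Rx p pp Ph x t) a))" by (auto simp: Rx_def)
 then show "HSl (%t. cor (vn (Rx p pp Ph x t) a))" by (rule AN_fixed(1)) (rule t0)
 have "norm x*1<=norm x * malg l" using malg_ge_1[of l] by (intro mult_left_mono) auto
 then have n1: "norm x<=r / 2" using small_r[of "norm x"] x dl by (simp add: mult.commute)
 have n2: "ka*(real CARD('m)+1)*(2 * cU * norm x)<=1 / 2"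
 proof -
  have "ka*(real CARD('m)+1)*(2 * cU * norm x)<=ka*(real CARD('m)+1)*(cM * norm x)"
   using kk_pos cM_ge(1) by (intro mult_left_mono mult_right_mono) auto
  then show ?thesis using kd'[of "norm x"] x dl by linarith
 qed
 show "nm (%t. cor (vn (Rx p pp Ph x t) a))<=G / 2 ^ p" unfolding Rx_def FF_def by (rule remainder_tail[OF fam_ctx _ hhS n1 n2]) (use LLN in blast)
qed

lemma V1x_bound:
 assumes y: "norm y<=dl0"
 shows "HSl (%t. cor (vn (V1x p pp Ph dl x y t) a))"
  and "nm (%t. cor (vn (V1x p pp Ph dl x y t) a))<=cV1*(norm y*(norm x+norm y))"
proof -
 have "HSl (%t. cor (vn (V1x p pp Ph dl x y t) a)) &
  nm (%t. cor (vn (V1x p pp Ph dl x y t) a))<=cV1*(norm y*(norm x+norm y))"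
 proof (cases "norm x < 2 * dl & y ~= 0")
  case False
  then have "(%t. cor (vn (V1x p pp Ph dl x y t) a)) = (%t. 0)" by (auto simp: V1x_def)
  moreover have "0<=cV1*(norm y*(norm x+norm y))" using cV1_nonneg by simp
  ultimately show ?thesis using HS_const(1)[of l 0] nm_const[of 0] by simp
 next
  case True
  define t0 where "t0 = norm x+norm y"
  define z where "z = norm x+0 * t0+norm (0::real ^ 'm)+1 * t0"
  have t0: "t0 > 0" using True by (simp add: t0_def add_nonneg_pos)
  have z: "z<=2 * t0" "z >= 0" using t0 by (simp_all add: z_def t0_def)
  define BV where "BV = 2 * cv * (ka*(real CARD('m)+1)*(cM * z))\<^sup>2"
  have X: "linear (%h::real. 0 :: (real ^ 'm) \<times> real)" "norm (0 :: (real ^ 'm) \<times> real)<=0 * norm (h::real)" for h by (simp_all add: linear_iff)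
  have Y: "linear (%h::real. h *\<^sub>R ((1 / norm y) *\<^sub>R y))" "norm (h *\<^sub>R ((1 / norm y) *\<^sub>R y))<=1 * norm (h::real)" for h
   using True by (simp_all add: linear_iff scaleR_left_distrib add_divide_distrib)
  have W: "AN t0 BV (%h t. cor (vn (VS (Ub p Ph (x+0) (0+h *\<^sub>R ((1 / norm y) *\<^sub>R y)) t) t) c))" for c
   unfolding BV_def z_def by (rule AN_VSUb[OF X Y]) (use t0 True y dl in \<open>auto simp: t0_def\<close>)
  define Dv where "Dv t = VS (Ub p Ph x y t) t - VS (Ub p Ph x 0 t) t" for t
  have ny: "norm (norm y)<=t0" by (simp add: t0_def)
  have yy: "norm y *\<^sub>R ((1 / norm y) *\<^sub>R y) = y" using True by simp
  have "HSl (%t. cor (vn (Dv t) c)) & nm (%t. cor (vn (Dv t) c))<=BV*(norm y / t0)" for c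
  proof
   have e: "cor (vn (Dv t) c) = cor (vn (VS (Ub p Ph (x+0) (0+norm y *\<^sub>R ((1 / norm y) *\<^sub>R y)) t) t) c)
    - cor (vn (VS (Ub p Ph (x+0) (0+0 *\<^sub>R ((1 / norm y) *\<^sub>R y)) t) t) c)" for t unfolding yy by (simp add: Dv_def)
   show "nm (%t. cor (vn (Dv t) c))<=BV*(norm y / t0)" using AN_value(3)[OF W ny t0, of c] unfolding e by simp
   have "HSl (%t. cor (vn (VS (Ub p Ph (x+0) (0+norm y *\<^sub>R ((1 / norm y) *\<^sub>R y)) t) t) c)
   +(-1) * cor (vn (VS (Ub p Ph (x+0) (0+0 *\<^sub>R ((1 / norm y) *\<^sub>R y)) t) t) c))"
    by (intro HS_add(1) HS_cmult(1) AN_value(1)[OF W]) (use ny t0 in auto)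
   then show "HSl (%t. cor (vn (Dv t) c))" unfolding e by simp
  qed
  then have Dc: "AN 0 (BV*(norm y / t0)) (%(h::real) t. cor (vn (Dv t) c))" for c using AN_mono[OF AN_const[of "%t. cor (vn (Dv t) c)" 0]] by blast
  define N where "N = BV*(norm y / t0)"
  have N0: "N >= 0" using cv t0 by (simp add: N_def BV_def)
  note P0D = AN_linear_image[OF linP0 Dc order_refl, folded cP0_def N_def]
  note P1D = AN_linear_image[OF linP1 Dc order_refl, folded cP1_def N_def, of a]
  have PDD: "AN 0 (real CARD('m) * malg l*(2 * cU)*(malg l * cP0 * N)) (%(h::real) t. cor (vn (PDs p pp (x+0) (P0 (Dv t)) t) a))"
   by (rule AN_PDs[OF fam_ctx X P0D]) (use small_r[of "norm x"] True dl in auto)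
  have e: "FF p pp Ph x y t - FF p pp Ph x 0 t = P1 (Dv t) - PDs p pp (x+0) (P0 (Dv t)) t" for t
   unfolding FF_def Dv_def by (simp add: linear_diff[OF linP1] linear_diff[OF linP0] linear_diff[OF linear_PDs])
  have AD: "AN 0 (malg l * cP1 * N+malg l * norm (-1::complex)*(real CARD('m) * malg l*(2 * cU)*(malg l * cP0 * N)))
   (%(h::real) t. cor (vn (P1 (Dv t)) a)+(-1) * cor (vn (PDs p pp (x+0) (P0 (Dv t)) t) a))" by (intro AN_add P1D AN_cmult PDD order_refl)
  have "(%t. cor (vn (V1x p pp Ph dl x y t) a)) = (%t. cor (vn (P1 (Dv t)) a)+(-1) * cor (vn (PDs p pp (x+0) (P0 (Dv t)) t) a))"
   using True by (simp add: V1x_def e fun_eq_iff)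
  then have 1: "HSl (%t. cor (vn (V1x p pp Ph dl x y t) a))"
   and 2: "nm (%t. cor (vn (V1x p pp Ph dl x y t) a))<=malg l * cP1 * N+malg l * norm (-1::complex)*(real CARD('m) * malg l*(2 * cU)*(malg l * cP0 * N))"
   using AN_fixed[OF AD order_refl] by simp_all
  have "malg l * cP1 * N+malg l * norm (-1::complex)*(real CARD('m) * malg l*(2 * cU)*(malg l * cP0 * N))
   = (malg l * cP1+malg l*(real CARD('m) * malg l*(2 * cU)*(malg l * cP0))) * N" by (simp add: algebra_simps)
  also have "...<=(malg l * cP1+malg l*(real CARD('m) * malg l*(2 * cU)*(malg l * cP0)))*((2 * cv * (ka*(real CARD('m)+1))\<^sup>2 * cM\<^sup>2)*(4*(norm y * t0)))"
  proof (rule mult_left_mono)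
   have "z\<^sup>2<=(2 * t0)\<^sup>2" using z by (intro power_mono) auto
   have "BV = (2 * cv * (ka*(real CARD('m)+1))\<^sup>2 * cM\<^sup>2) * z\<^sup>2" by (simp add: BV_def power_mult_distrib mult_ac)
   also have "...<=(2 * cv * (ka*(real CARD('m)+1))\<^sup>2 * cM\<^sup>2)*(2 * t0)\<^sup>2"
    using cv \<open>z\<^sup>2<=(2 * t0)\<^sup>2\<close> by (intro mult_left_mono) auto
   finally have "N<=((2 * cv * (ka*(real CARD('m)+1))\<^sup>2 * cM\<^sup>2)*(2 * t0)\<^sup>2)*(norm y / t0)"
    unfolding N_def using t0 by (intro mult_right_mono) auto
   also have "... = (2 * cv * (ka*(real CARD('m)+1))\<^sup>2 * cM\<^sup>2)*(4*(norm y * t0))" using t0 by (simp add: power2_eq_square)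
   finally show "N<=(2 * cv * (ka*(real CARD('m)+1))\<^sup>2 * cM\<^sup>2)*(4*(norm y * t0))" .
  qed (use malg_pos cP1_nonneg cU_pos cP0_nonneg in \<open>intro add_nonneg_nonneg mult_nonneg_nonneg; simp\<close>)
  also have "... = cV1*(norm y*(norm x+norm y))" unfolding cV1_def t0_def by (simp only: mult_ac)
  finally show ?thesis using 1 2 by simp
 qed
 then show "HSl (%t. cor (vn (V1x p pp Ph dl x y t) a))"
  and "nm (%t. cor (vn (V1x p pp Ph dl x y t) a))<=cV1*(norm y*(norm x+norm y))" by blast+
qed

lemma Phis_quadratic:
 assumes x: "norm x<=1"
 shows "norm (Phis p Ph x t)<=(real CARD('m)*(\<Sum>i\<in>{2..p}. ph i))*(norm x)\<^sup>2"
proof -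
 have "\<bar>vn (Ph i x t) a\<bar><=ph i*(norm x)\<^sup>2" if i: "i \<in> {2..p}" for i a
 proof -
  note b = H_bound[OF goodD(8)[OF fam_good[OF fam, of i], of a], of x "norm x", OF bnd]
  have "\<bar>vn (Ph i x t) a\<bar> = norm (cor (vn (Ph i x t) a))" by simp
  also have "...<=nm (%t. cor (vn (Ph i x t) a))" by (rule sup_le_nm) (rule b(1); simp)
  also have "...<=ph i * norm x ^ i" by (rule b(2)) simp_all
  also have "...<=ph i * norm x ^ 2" using i x fam_nonneg[OF fam, of i] by (intro mult_left_mono power_decreasing) auto
  finally show ?thesis .
 qed
 then have "\<bar>vn (Phis p Ph x t) a\<bar><=(\<Sum>i\<in>{2..p}. ph i)*(norm x)\<^sup>2" for a
  unfolding Phis_def sum_component sum_distrib_right by (intro order_trans[OF sum_abs] sum_mono)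
 from norm_vec_le[OF this] show ?thesis by (simp add: mult.assoc)
qed

end

end

context nf_graph
begin

lemma truncated_graph:
 obtains Q G where "Q >= 1" "G >= 0"
  "!!p. p >= 1 ==> EX pp Ph ph. fam pp Ph ph & (ALL i>p. pp i = (%_. []) & Ph i = (%_ _. 0) & ph i = 0) &
   (ALL J. (\<Sum>n\<le>J. (1 / (Q * real p powr (s+1))) ^ n * maj.uu ph n)<=2 * cU*(1 / (Q * real p powr (s+1)))) &
   (ALL J. (\<Sum>n\<le>J. (1 / (Q * real p powr (s+1))) ^ n * maj.hh ph n)<=G) &
   (ALL n x t a. 2<=n --> n<=p --> LL (pp n) x t a = cor (vn (NN pp Ph n x t) a))"
proof -
 define kk where "kk = ka*(real CARD('m)+1)"
 define m where "m = real CARD('m)"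
 define A where "A = m * K"
 define B where "B = (cP1+2 * m * cU)*(8 * cv * kk\<^sup>2 * cU)"
 define Q where "Q = 1+4 * kk * cU+A * B"
 define G where "G = (cP1+2 * m * cU)*(8 * cv * kk\<^sup>2 * cU\<^sup>2)"
 have nn: "kk > 0" "m >= 0" "A >= 0" "cP1+2 * m * cU >= 0" "cP1 >= 0" "cU > 0" "cv >= 0"
  using kk_pos K cP1_nonneg cU_pos cv by (simp_all add: kk_def m_def A_def)
 have B0: "B >= 0" and G0: "G >= 0" using nn by (simp_all add: B_def G_def)
 have Q: "Q >= 1" "4 * kk * cU<=Q" "A * B<=Q" using nn B0 by (simp_all add: Q_def)
 obtain pp' Ph' ph' where fam': "fam pp' Ph' ph'"
  and rec': "!!n. n >= 2 ==> ph' n = (real CARD('m) * K) * real n powr s * maj.hh ph' n"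
  and LL': "!!n x t a. n >= 2 ==> LL (pp' n) x t a = cor (vn (NN pp' Ph' n x t) a)" by (rule formal_graph) (rule that)
 show thesis
 proof (rule that[OF Q(1) G0])
  fix p :: nat assume p: "p >= 1"
  define pp where "pp i = (if i<=p then pp' i else (%_. []))" for i
  define Ph where "Ph i = (if i<=p then Ph' i else (%_ _. 0))" for i
  define ph where "ph i = (if i<=p then ph' i else 0)" for i
  have fam: "fam pp Ph ph" using fam' good_zero by (auto simp: fam_def pp_def Ph_def ph_def)
  have z': "Ph' 0 = (%_ _. 0)" "ph' 0 = 0" "Ph 0 = (%_ _. 0)" "ph 0 = 0" using fam_low[OF fam', of 0] fam_low[OF fam, of 0] by auto
  have low: "!!n. ph n >= 0" "!!n. n < 2 ==> ph n = 0" using fam_nonneg[OF fam] fam_low[OF fam] by auto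
  have hh0: "maj.hh ph n >= 0" for n by (rule maj.hh_nonneg[OF low])
  define P where "P = real p powr s"
  have P: "P >= 1" "real p powr (s+1) = P * real p" "real p >= 1" using p s by (simp_all add: P_def powr_add ge_one_powr_ge_zero)
  define r where "r = 1 / (Q * real p powr (s+1))"
  have PP: "1*1<=P * real p" using P by (intro mult_mono) auto
  have QP: "1*1<=Q*(P * real p)" using PP Q P by (intro mult_mono) auto
  have r: "r > 0" "r = 1 / (Q*(P * real p))" using QP by (simp_all add: r_def P(2))
  have rQ: "r*(Q*(P * real p)) = 1" using P Q p by (simp add: r(2))
  have r1: "r<=1" using QP by (simp add: r(2) divide_le_eq)
  have "Q*1<=Q*(P * real p)" using PP Q by (intro mult_left_mono) auto
  then have rQ1: "r * Q<=1" using mult_left_mono[of "Q*1" "Q*(P * real p)" r] r(1) rQ by simp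
  have i: "4 * kk * cU * r<=1"
  proof -
   have "4 * kk * cU * r<=Q * r" using Q(2) r(1) by (intro mult_right_mono) auto
   then show ?thesis using rQ1 unfolding mult.commute[of r Q] by (rule order_trans)
  qed
  have Bp: "cP1+2 * m * cU * real p<=(cP1+2 * m * cU) * real p" using mult_left_mono[OF P(3) nn(5)] by (simp add: distrib_right)
  have ii: "A * P*((cP1+2 * m * cU * real p)*(8 * cv * kk\<^sup>2 * cU)) * r<=1"
  proof -
   have "A * P*((cP1+2 * m * cU * real p)*(8 * cv * kk\<^sup>2 * cU)) * r<=A * P*(((cP1+2 * m * cU) * real p)*(8 * cv * kk\<^sup>2 * cU)) * r"
    using nn P r(1) by (intro mult_right_mono mult_left_mono Bp) auto
   also have "... = (A * B)*(r*(P * real p))" by (simp add: B_def mult_ac)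
   also have "...<=Q*(r*(P * real p))" using Q r(1) P by (intro mult_right_mono) auto
   finally show ?thesis using rQ by (simp add: mult_ac)
  qed
  have rec: "ph n<=real CARD('m) * K * real n powr s * maj.hh ph n" if "2<=n" "n<=p" for n
  proof -
   have "maj.hh ph n = maj.hh ph' n" by (rule hh_cong) (use that z' in \<open>auto simp: ph_def\<close>)
   then show ?thesis using rec'[of n] that by (simp add: ph_def m_def)
  qed
  have ii': "real CARD('m) * K * real p powr s*((cP1+2 * real CARD('m) * cU * real p)*(8 * cv * (ka*(real CARD('m)+1))\<^sup>2 * cU)) * r<=1"
   using ii by (simp add: A_def P_def m_def kk_def)
  have i': "4*(ka*(real CARD('m)+1)) * cU * r<=1" using i by (simp add: kk_def)
  have up: "(\<Sum>n\<le>J. r ^ n * maj.uu ph n)<=2 * cU * r" if "J<=p" for J by (rule maj.hh_rec_bound[OF low rec r(1) i' ii' p that]) auto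
  have uuS: "(\<Sum>n\<le>J. r ^ n * maj.uu ph n)<=2 * cU * r" for J
  proof (cases "J<=p")
   case False
   have "(\<Sum>n\<le>J. r ^ n * maj.uu ph n) = (\<Sum>n\<le>p. r ^ n * maj.uu ph n)"
    using False p by (intro sum.mono_neutral_right) (auto simp: maj.uu_def ph_def)
   then show ?thesis using up[of p] by simp
  qed (rule up)
  have kS: "ka*(real CARD('m)+1)*(2 * cU * r)<=1 / 2" using i' by simp
  have hh1: "(\<Sum>n\<le>J. r ^ n * maj.hh ph n)<=G" if J: "J >= 1" for J
  proof -
   have "(\<Sum>n\<le>J. r ^ n * maj.hh ph n)<=(cP1+real CARD('m) * real p*(2 * cU * r) / r)*(2 * cv * (ka*(real CARD('m)+1))\<^sup>2*(2 * cU * r)\<^sup>2)"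
    by (rule maj.hh_sum_le[OF low r(1) J uuS kS]) (auto simp: ph_def)
   also have "... = (cP1+2 * m * cU * real p)*(8 * cv * kk\<^sup>2 * cU\<^sup>2)*(r * r)"
    using r(1) by (simp add: m_def kk_def power2_eq_square)
   also have "...<=((cP1+2 * m * cU) * real p)*(8 * cv * kk\<^sup>2 * cU\<^sup>2)*(r * r)" using nn r(1) by (intro mult_right_mono Bp) auto
   also have "... = G*((real p * r) * r)" by (simp add: G_def mult_ac)
   also have "...<=G*1"
   proof (rule mult_left_mono[OF _ G0])
    have "1*(1 * real p)<=Q*(P * real p)" using Q P by (intro mult_mono) auto
    then have "r * real p<=1" using mult_left_mono[of "real p" "Q*(P * real p)" r] r(1) rQ by simp
    then have "(real p * r) * r<=1*1" using r(1) r1 by (intro mult_mono) (auto simp: mult.commute)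
    then show "(real p * r) * r<=1" by simp
   qed
   finally show ?thesis by simp
  qed
  have hhS: "(\<Sum>n\<le>J. r ^ n * maj.hh ph n)<=G" for J
  proof (cases "J = 0")
   case True
   have "(\<Sum>n\<le>0. r ^ n * maj.hh ph n)<=(\<Sum>n\<le>1. r ^ n * maj.hh ph n)" using r(1) hh0 by (intro sum_mono2) auto
   then show ?thesis using hh1[of 1] True by simp
  qed (use hh1 in simp)
  have LLN: "LL (pp n) x t a = cor (vn (NN pp Ph n x t) a)" if "2<=n" "n<=p" for n x t a
  proof -
   have "NN pp Ph n = NN pp' Ph' n" by (rule NN_cong) (use that z' in \<open>auto simp: pp_def Ph_def\<close>)
   then show ?thesis using LL'[OF that(1)] that by (simp add: pp_def)
  qed
  show "EX pp Ph ph. fam pp Ph ph & (ALL i>p. pp i = (%_. []) & Ph i = (%_ _. 0) & ph i = 0) &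
   (ALL J. (\<Sum>n\<le>J. (1 / (Q * real p powr (s+1))) ^ n * maj.uu ph n)<=2 * cU*(1 / (Q * real p powr (s+1)))) &
   (ALL J. (\<Sum>n\<le>J. (1 / (Q * real p powr (s+1))) ^ n * maj.hh ph n)<=G) &
   (ALL n x t a. 2<=n --> n<=p --> LL (pp n) x t a = cor (vn (NN pp Ph n x t) a))" unfolding r_def[symmetric]
  proof (intro exI conjI)
   show "fam pp Ph ph" by (rule fam)
   show "ALL i>p. pp i = (%_. []) & Ph i = (%_ _. 0) & ph i = 0" by (simp add: pp_def Ph_def ph_def)
   show "ALL J. (\<Sum>n\<le>J. r ^ n * maj.uu ph n)<=2 * cU * r" by (intro allI uuS)
   show "ALL J. (\<Sum>n\<le>J. r ^ n * maj.hh ph n)<=G" by (intro allI hhS)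
   show "ALL n x t a. 2<=n --> n<=p --> LL (pp n) x t a = cor (vn (NN pp Ph n x t) a)" by (intro allI impI LLN)
  qed
 qed
qed

lemma sobolev_of_components:
 fixes f :: "real => real ^ 'm"
 assumes "!!a. HSl (%t. cor (vn (f t) a))" "!!a. nm (%t. cor (vn (f t) a))<=B" "!!t. f t \<in> F"
 shows "f \<in> sobolev T l F" "sobolev_norm T l f<=real CARD('m) * B" "norm (f t)<=real CARD('m) * B"
proof -
 show "f \<in> sobolev T l F" unfolding sobolev_iff using assms by auto
 have "sobolev_norm T l f<=(\<Sum>a\<in>UNIV. hn T l (%t. cor (vn (f t) a)))" by (rule sobolev_norm_bounds(1)[OF assms(1)])
 also have "...<=(\<Sum>a\<in>(UNIV::'m set). B)" by (intro sum_mono order_trans[OF hn_le_nm assms(2)])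
 finally show "sobolev_norm T l f<=real CARD('m) * B" by simp
 show "norm (f t)<=real CARD('m) * B"
 proof (rule norm_vec_le)
  fix a
  show "\<bar>vn (f t) a\<bar><=B" using order_trans[OF sup_le_nm[OF assms(1)[of a], of t] assms(2)[of a]] by simp
 qed
qed

theorem graph_theorem:
 fixes V :: "real => real ^ 'm => real => real ^ 'm" and A :: "real ^ 'm => real ^ 'm"
  and E0 E1 :: "(real ^ 'm) set" and b rh :: real
 assumes E0: "!!u. P0 u \<in> E0" "!!u. u \<in> E0 ==> P0 u = u" and E1: "!!u. P1 u \<in> E1" "!!u. u \<in> E1 ==> P1 u = u"
  and sE1: "subspace E1" and bs: "basis_list E0 bs"
  and rh: "rh > 0" and V: "!!u eps t. norm (u, eps) < rh ==> V eps u t = VS (u, eps) t" and A: "!!u t. A u = V 0 u t"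
  and b: "b > 0" "b*(s+1)<=1"
 shows "EX dl0>0. EX M>0. EX M0>0. EX \<omega>>0. EX p :: real => nat.
  (%dl. real (p dl)) \<in> O[at_right 0](%dl. dl powr (- b)) &
  (\<forall>dl\<in>{0<..<dl0}. \<exists>Ph\<in>sobolev_polys T (l+1) (p dl) E0 E1.
   (ALL t. Ph 0 0 t = 0 &
     ((%(u0, eps). Ph u0 eps t) has_derivative (%_. 0)) (at (0, 0) within E0 \<times> UNIV)) &
   (EX V0 V1 R.
    (ALL eps. transforms_system E0 E1 L (V eps) (%u0 t. Ph u0 eps t)
       {(u0, v1). norm (u0, eps)<=dl & norm v1<=dl0}
       (%u0 v1 t. V0 u0 eps v1 t) (%u0 v1 t. V1 u0 eps v1 t+R u0 eps t)) &
    sobolev_analytic_on T l (E0 \<times> UNIV \<times> E1) E0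
     {(u0, eps, v1). u0 \<in> E0 & v1 \<in> E1 & norm (u0, eps)<=dl & norm v1<=dl0}
     (%(u0, eps, v1). V0 u0 eps v1) &
    sobolev_analytic_on T l (E0 \<times> UNIV \<times> E1) E1
     {(u0, eps, v1). u0 \<in> E0 & v1 \<in> E1 & norm (u0, eps)<=dl & norm v1<=dl0}
     (%(u0, eps, v1). V1 u0 eps v1) &
    sobolev_analytic_on T l (E0 \<times> UNIV) E1
     {(u0, eps). u0 \<in> E0 & norm (u0, eps)<=dl}
     (%(u0, eps). R u0 eps) &
    (\<forall>u0\<in>E0. ALL eps. \<forall>v1\<in>E1. norm (u0, eps)<=dl0 --> norm v1<=dl0 -->
     V1 u0 eps v1 \<in> sobolev T l E1 &
     sobolev_norm T l (V1 u0 eps v1)<=M0 * norm v1*(norm (u0, eps)+norm v1)) &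
    (\<forall>u0\<in>E0. ALL eps. norm (u0, eps)<=dl -->
     R u0 eps \<in> sobolev T l E1 &
     sobolev_norm T l (R u0 eps)<=M * exp (- \<omega> / dl powr b))) &
   (\<exists>PhA\<in>poly_maps (p dl) E0 E1. \<exists>PhBC\<in>sobolev_polys T (l+1) (p dl) E0 E1.
    (\<forall>u0\<in>E0. ALL eps t. Ph u0 eps t = PhA u0+eps *\<^sub>R PhBC u0 eps t) &
    PhA 0 = 0 & (PhA has_derivative (%_. 0)) (at 0 within E0) &
    (EX VA0 VA1 RA.
     transforms_system E0 E1 L (%u t. A u) (%u0 t. PhA u0)
      {(u0, v1). norm u0<=dl & norm v1<=dl0}
      (%u0 v1 t. VA0 u0 v1) (%u0 v1 t. VA1 u0 v1+RA u0) &
     analytic_maps_on (E0 \<times> E1) E0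
      {(u0, v1). u0 \<in> E0 & v1 \<in> E1 & norm u0<=dl & norm v1<=dl0}
      (%(u0, v1). VA0 u0 v1) &
     analytic_maps_on (E0 \<times> E1) E1
      {(u0, v1). u0 \<in> E0 & v1 \<in> E1 & norm u0<=dl & norm v1<=dl0}
      (%(u0, v1). VA1 u0 v1) &
     analytic_maps_on E0 E1 {u0. u0 \<in> E0 & norm u0<=dl} RA &
     (\<forall>u0\<in>E0. \<forall>v1\<in>E1. norm u0<=dl0 --> norm v1<=dl0 -->
      norm (VA1 u0 v1)<=M0 * norm v1*(norm u0+norm v1)) &
     (\<forall>u0\<in>E0. norm u0<=dl --> norm (RA u0)<=M * exp (- \<omega> / dl powr b)))))"
proof -
 obtain Q G where Q: "Q >= 1" and G: "G >= 0" and tg: "!!p. p >= 1 ==> EX pp Ph ph. fam pp Ph ph & (ALL i>p. pp i = (%_. []) & Ph i = (%_ _. 0) & ph i = 0) &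
   (ALL J. (\<Sum>n\<le>J. (1 / (Q * real p powr (s+1))) ^ n * maj.uu ph n)<=2 * cU*(1 / (Q * real p powr (s+1)))) &
   (ALL J. (\<Sum>n\<le>J. (1 / (Q * real p powr (s+1))) ^ n * maj.hh ph n)<=G) &
   (ALL n x t a. 2<=n --> n<=p --> LL (pp n) x t a = cor (vn (NN pp Ph n x t) a))" by (rule truncated_graph) (rule that)
 define m where "m = real CARD('m)"
 define q where "q = 16 * malg l * Q"
 have q1: "q >= 1" using mult_mono[of 1 "16 * malg l" 1 Q] malg_ge_1[of l] Q by (simp add: q_def)
 have s1: "s+1 > 0" using s by simp
 define cc where "cc = (1 / q) powr (1 / (s+1))"
 have cc: "cc > 0" "cc<=1" "q * cc powr (s+1) = 1" using q1 s1 by (auto simp: cc_def powr_powr powr_le_one_le intro: powr_le1)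
 define d1 where "d1 = 1 / (2*(ka*(real CARD('m)+1))*(8 * cM))"
 define d2 where "d2 = rh / (2*(m+1)*(8 * cM))"
 define dl0 where "dl0 = min (min 1 (cc powr (1 / b))) (min d1 d2)"
 have m0: "m+1 > 0" by (simp add: m_def)
 have dl0: "dl0 > 0" "dl0<=1" "dl0<=cc powr (1 / b)" "dl0<=d1" "dl0<=d2"
 proof -
  have "d1 > 0" unfolding d1_def using ka cM_pos by (intro divide_pos_pos mult_pos_pos) auto
  moreover have "d2 > 0" unfolding d2_def using m0 cM_pos rh by (intro divide_pos_pos mult_pos_pos) auto
  ultimately show "dl0 > 0" "dl0<=1" "dl0<=cc powr (1 / b)" "dl0<=d1" "dl0<=d2" using cc(1) by (auto simp: dl0_def)
 qed
 have kd: "ka*(real CARD('m)+1)*(cM*(8 * dl0))<=1 / 2"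
 proof -
  have "ka*(real CARD('m)+1)*(cM*(8 * dl0))<=ka*(real CARD('m)+1)*(cM*(8 * d1))"
   using kk_pos cM_pos dl0 by (intro mult_left_mono) auto
  also have "... = 1 / 2"
  proof -
   have "Z*(cM*(8*(1 / (2 * Z*(8 * cM))))) = 1 / 2" if "Z > 0" for Z using that cM_pos by simp
   from this[OF kk_pos] show ?thesis by (simp only: d1_def)
  qed
  finally show ?thesis .
 qed
 have rd: "(m+1)*(cM*(8 * dl0)) < rh"
 proof -
  have "(m+1)*(cM*(8 * dl0))<=(m+1)*(cM*(8 * d2))" using m0 cM_pos dl0 by (intro mult_left_mono) auto
  also have "... = rh / 2"
  proof -
   have "Z*(cM*(8*(rh / (2 * Z*(8 * cM))))) = rh / 2" if "Z > 0" for Z using that cM_pos by simp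
   from this[OF m0] show ?thesis by (simp only: d2_def)
  qed
  finally show ?thesis using rh by linarith
 qed
 define p where "p dl = nat \<lfloor>cc * dl powr (- b)\<rfloor>" for dl :: real
 define \<omega> where "\<omega> = cc * ln 2"
 define M where "M = 2 * m * G+1"
 define M0 where "M0 = m * cV1+1"
 have pos: "M > 0" "M0 > 0" "\<omega> > 0" using G cV1_nonneg cc by (auto simp: M_def M0_def \<omega>_def m_def add_nonneg_pos)
 have pO: "(%dl. real (p dl)) \<in> O[at_right 0](%dl. dl powr (- b))"
 proof (rule bigoI[where c=cc])
  have "norm (real (p dl))<=cc * norm (dl powr (- b))" for dl :: real using cc(1) by (simp add: p_def of_nat_nat)
  then show "\<forall>\<^sub>F dl in at_right 0. norm (real (p dl))<=cc * norm (dl powr (- b))" by simp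
 qed
 show ?thesis
 proof (rule exI[of _ dl0], rule conjI[OF dl0(1)], rule exI[of _ M], rule conjI[OF pos(1)], rule exI[of _ M0], rule conjI[OF pos(2)],
   rule exI[of _ \<omega>], rule conjI[OF pos(3)], rule exI[of _ p], rule conjI[OF pO], rule ballI, goal_cases)
  case (1 dl)
  note dl = this
  have d: "0 < dl" "dl<=dl0" "dl < 1" using dl dl0 by auto
  define X where "X = cc * dl powr (- b)"
  have X1: "X >= 1"
  proof -
   have "dl powr b<=(cc powr (1 / b)) powr b" using d dl0 b by (intro powr_mono2) auto
   also have "... = cc" using b cc by (simp add: powr_powr)
   finally have "dl powr b<=cc" .
   then show ?thesis using d by (simp add: X_def powr_minus field_simps)
  qed
  define k where "k = p dl"
  have kX: "real k<=X" "real k > X - 1" "k >= 1" using X1 by (auto simp: k_def p_def X_def[symmetric] of_nat_nat) linarith+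
  define r where "r = 1 / (Q * real k powr (s+1))"
  have kp: "real k powr (s+1) > 0" using kX by simp
  have r: "r > 0" using Q kp by (simp add: r_def)
  have dr: "16 * malg l * dl<=r"
  proof -
   have "real k powr (s+1)<=X powr (s+1)" using kX s1 by (intro powr_mono2) auto
   also have "... = cc powr (s+1)*(dl powr (- b)) powr (s+1)" using cc d by (simp add: X_def powr_mult)
   also have "(dl powr (- b)) powr (s+1) = dl powr (- (b*(s+1)))" by (simp add: powr_powr)
   also have "...<=dl powr (-1)" using b d by (intro powr_mono') auto
   finally have "real k powr (s+1)<=cc powr (s+1)*(1 / dl)" using d by (simp add: powr_minus_divide mult_left_mono)
   then have "q*(dl * real k powr (s+1))<=q*(dl*(cc powr (s+1)*(1 / dl)))" using q1 d by (intro mult_left_mono) auto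
   also have "... = 1" using cc(3) d by simp
   finally have "16 * malg l * dl*(Q * real k powr (s+1))<=1" by (simp add: q_def mult_ac)
   then show ?thesis using Q kp by (simp add: r_def le_divide_eq)
  qed
  from tg[OF kX(3)] obtain pp Ph ph where W: "fam pp Ph ph & (ALL i>k. pp i = (%_. []) & Ph i = (%_ _. 0) & ph i = 0) &
   (ALL J. (\<Sum>n\<le>J. r ^ n * maj.uu ph n)<=2 * cU * r) & (ALL J. (\<Sum>n\<le>J. r ^ n * maj.hh ph n)<=G) &
   (ALL n x t a. 2<=n --> n<=k --> LL (pp n) x t a = cor (vn (NN pp Ph n x t) a))" unfolding r_def[symmetric] by (elim exE) (rule that)
  note fam = W[THEN conjunct1] and tr = W[THEN conjunct2, THEN conjunct1]
   and uuS = W[THEN conjunct2, THEN conjunct2, THEN conjunct1, THEN spec]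
   and hhS = W[THEN conjunct2, THEN conjunct2, THEN conjunct2, THEN conjunct1, THEN spec]
   and LLN = W[THEN conjunct2, THEN conjunct2, THEN conjunct2, THEN conjunct2]
  note ctx = fam tr kX(3) r uuS LLN hhS d(1,2) dr kd
  define F where "F u eps t = Phis k Ph (u, eps) t" for u eps t
  define V0 where "V0 u0 eps v1 t = P0 (VS (Ub k Ph (u0, eps) v1 t) t)" for u0 eps v1 t
  define V1 where "V1 u0 eps v1 t = V1x k pp Ph dl (u0, eps) v1 t" for u0 eps v1 t
  define R where "R u0 eps t = Rx k pp Ph (u0, eps) t" for u0 eps t
  have Fpoly: "F \<in> sobolev_polys T (Suc l) k E0 E1" using Phis_sobolev_polys[OF fam bs, of E1 k] E1(1) by (simp add: F_def[abs_def])
  have quad: "norm (F u eps t)<=(real CARD('m)*(\<Sum>i\<in>{2..k}. ph i))*(norm (u, eps))\<^sup>2" if "norm (u, eps)<=1" for u eps t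
   unfolding F_def by (rule Phis_quadratic[OF ctx that])
  have F0: "F 0 0 t = 0" for t using quad[of 0 0 t] by simp
  have dF: "((%(u0, eps). F u0 eps t) has_derivative (%_. 0)) (at (0, 0) within E0 \<times> UNIV)" for t
   unfolding zero_prod_def[symmetric] by (rule has_derivative_zero_quadratic) (use quad in auto)
  have dFA: "((%u0. F u0 0 0) has_derivative (%_. 0)) (at 0 within E0)" by (rule has_derivative_zero_quadratic) (use quad[of _ 0 0] in auto)
  have Fc: "F u 0 t = F u 0 0" for u t unfolding F_def by (rule Phis_const[OF fam])
  have G': "V eps (u0+(v1+F u0 eps t)) t = VS (Ub k Ph (u0, eps) v1 t) t"
   if "u0 \<in> E0" "norm (u0, eps)<=dl" "norm v1<=dl0" for u0 eps v1 t
  proof -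
   have e: "Ub k Ph (u0, eps) v1 t = (u0+(v1+F u0 eps t), eps)" using E0(2)[OF that(1)] by (simp add: Ub_def F_def)
   have "norm (Ub k Ph (u0, eps) v1 t)<=(m+1)*(cM*(norm (u0, eps)+norm v1))"
    unfolding m_def by (rule Ub_norm[OF ctx]) (use that d in linarith)
   also have "...<=(m+1)*(cM*(8 * dl0))" using m0 cM_pos that d by (intro mult_left_mono) auto
   finally show ?thesis using rd V[of "u0+(v1+F u0 eps t)" eps t] unfolding e by simp
  qed
  have trans: "transforms_system E0 E1 L (V eps) (%u0 t. F u0 eps t)
       {(u0, v1). norm (u0, eps)<=dl & norm v1<=dl0}
       (%u0 v1 t. V0 u0 eps v1 t) (%u0 v1 t. V1 u0 eps v1 t+R u0 eps t)" for eps
  proof (rule transforms_system_cong)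
   show "transforms_system E0 E1 L (V eps) (%u0 t. F u0 eps t) {(u0, v1). norm (u0, eps)<=dl & norm v1<=dl0}
    (%u0 v1 t. P0 (V eps (u0+(v1+F u0 eps t)) t))
    (%u0 v1 t. P1 (V eps (u0+(v1+F u0 eps t)) t) - PDs k pp (u0, eps) (P0 (V eps (u0+(v1+F u0 eps t)) t)) t - Ls k pp (u0, eps) t)"
    unfolding F_def by (rule graph_transforms[OF fam E0(2) E1(2)])
   fix u0 v1 t assume h: "u0 \<in> E0" "v1 \<in> E1" "(u0, v1) \<in> {(u0, v1). norm (u0, eps)<=dl & norm v1<=dl0}"
   then have g: "V eps (u0+(v1+F u0 eps t)) t = VS (Ub k Ph (u0, eps) v1 t) t" by (intro G') auto
   have "norm (u0, eps) < 2 * dl" using h d by auto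
   then show "P0 (V eps (u0+(v1+F u0 eps t)) t) = V0 u0 eps v1 t &
    P1 (V eps (u0+(v1+F u0 eps t)) t) - PDs k pp (u0, eps) (P0 (V eps (u0+(v1+F u0 eps t)) t)) t - Ls k pp (u0, eps) t = V1 u0 eps v1 t+R u0 eps t"
    unfolding g by (simp add: V0_def V1_def R_def V1x_def Rx_def FF_def)
  qed
  have exp_le: "m*(G / 2 ^ k)<=M * exp (- \<omega> / dl powr b)"
  proof -
   have "(2::real) ^ k = exp (real k * ln 2)" by (simp add: exp_of_nat_mult)
   then have "1 / (2::real) ^ k = exp (- (real k * ln 2))" by (simp add: exp_minus inverse_eq_divide)
   also have "...<=exp (ln 2+- \<omega> / dl powr b)"
   proof -
    have "(X - 1) * ln 2<=real k * ln 2" using kX by (intro mult_right_mono) auto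
    moreover have "X * ln 2 = \<omega> / dl powr b" by (simp add: X_def \<omega>_def powr_minus_divide)
    ultimately show ?thesis by (simp add: left_diff_distrib)
   qed
   also have "... = 2 * exp (- \<omega> / dl powr b)" unfolding exp_add by simp
   finally have "(m * G)*(1 / 2 ^ k)<=(m * G)*(2 * exp (- \<omega> / dl powr b))" using G by (intro mult_left_mono) (auto simp: m_def)
   also have "...<=M * exp (- \<omega> / dl powr b)" by (simp add: M_def distrib_right)
   finally show ?thesis by simp
  qed
  have P1V: "V1 u0 eps v1 t \<in> E1" and P1R: "R u0 eps t \<in> E1" for u0 eps v1 t
   using E1(1)[of "V1 u0 eps v1 t"] E1(1)[of "R u0 eps t"] P1_V1x[OF ctx] P1_Rx[OF ctx] by (simp_all add: V1_def R_def)
  have Rb: "R u0 eps \<in> sobolev T l E1" "sobolev_norm T l (R u0 eps)<=M * exp (- \<omega> / dl powr b)" "norm (R u0 eps t)<=M * exp (- \<omega> / dl powr b)"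
   if "norm (u0, eps)<=dl" for u0 eps t
  proof -
   note h = sobolev_of_components[where F=E1, OF Rx_bound[OF ctx that], folded R_def m_def, OF P1R]
   show "R u0 eps \<in> sobolev T l E1" using h(1) by (simp add: R_def[abs_def])
   show "sobolev_norm T l (R u0 eps)<=M * exp (- \<omega> / dl powr b)" using h(2) exp_le by (simp add: R_def[abs_def])
   show "norm (R u0 eps t)<=M * exp (- \<omega> / dl powr b)" using h(3)[of t] exp_le by simp
  qed
  have Vb: "V1 u0 eps v1 \<in> sobolev T l E1" "sobolev_norm T l (V1 u0 eps v1)<=M0 * norm v1*(norm (u0, eps)+norm v1)"
   "norm (V1 u0 eps v1 t)<=M0 * norm v1*(norm (u0, eps)+norm v1)"
   if "norm v1<=dl0" for u0 eps v1 t
  proof -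
   note h = sobolev_of_components[where F=E1, OF V1x_bound[OF ctx that, where x="(u0, eps)"], folded V1_def m_def, OF P1V]
   have le: "m*(cV1*(norm v1*(norm (u0, eps)+norm v1)))<=M0 * norm v1*(norm (u0, eps)+norm v1)"
    by (simp add: M0_def distrib_right mult.assoc)
   show "V1 u0 eps v1 \<in> sobolev T l E1" using h(1) by (simp add: V1_def[abs_def])
   show "sobolev_norm T l (V1 u0 eps v1)<=M0 * norm v1*(norm (u0, eps)+norm v1)" using h(2) le by (simp add: V1_def[abs_def])
   show "norm (V1 u0 eps v1 t)<=M0 * norm v1*(norm (u0, eps)+norm v1)" using h(3)[of t] le by simp
  qed
  note an = analytic_pieces[OF ctx _ _ _ _ _ _ E0 E1]
  have f3: "norm (fst h, fst (snd h))<=norm h" "norm (snd (snd h))<=norm h" for h :: "(real ^ 'm) \<times> real \<times> (real ^ 'm)"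
  proof -
   have "norm (x, y)<=norm (x, y, w)" for x w :: "real ^ 'm" and y :: real unfolding norm_Pair[of x y] norm_Pair[of x "(y, w)"]
    by (intro real_sqrt_le_mono add_left_mono power_mono norm_fst_le) simp
   from this[of "fst h" "fst (snd h)" "snd (snd h)"] show "norm (fst h, fst (snd h))<=norm h" by simp
   show "norm (snd (snd h))<=norm h"
    using order_trans[OF norm_snd_le[of "snd (snd h)" "fst (snd h)"] norm_snd_le[of "(fst (snd h), snd (snd h))" "fst h"]] by simp
  qed
  have l3: "linear (%h :: (real ^ 'm) \<times> real \<times> (real ^ 'm). (fst h, fst (snd h)))" "linear (%h :: (real ^ 'm) \<times> real \<times> (real ^ 'm). snd (snd h))"
   by (simp_all add: linear_iff)
  have f2: "norm (fst h, 0::real)<=norm h" "norm (snd h)<=norm h" for h :: "(real ^ 'm) \<times> (real ^ 'm)"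
   using norm_fst_le[of "fst h" "snd h"] norm_snd_le[of "snd h" "fst h"] by simp_all
  have l2: "linear (%h :: (real ^ 'm) \<times> (real ^ 'm). (fst h, 0::real))" "linear (%h :: (real ^ 'm) \<times> (real ^ 'm). snd h)"
   by (simp_all add: linear_iff)
  have f1: "norm (h, 0::real)<=norm h" "norm (0 :: real ^ 'm)<=norm h" for h :: "real ^ 'm" by simp_all
  have l1: "linear (%h :: real ^ 'm. (h, 0::real))" "linear (%h :: real ^ 'm. 0 :: real ^ 'm)" by (simp_all add: linear_iff)
  have fe: "norm h<=norm h" "norm (0 :: real ^ 'm)<=norm h" for h :: "(real ^ 'm) \<times> real" by simp_all
  have le: "linear (%h :: (real ^ 'm) \<times> real. h)" "linear (%h :: (real ^ 'm) \<times> real. 0 :: real ^ 'm)" by (simp_all add: linear_iff)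
  have zdl: "norm (0 :: real ^ 'm)<=dl0" using dl0 by simp
  have aV0: "sobolev_analytic_on T l (E0 \<times> UNIV \<times> E1) E0
     {(u0, eps, v1). u0 \<in> E0 & v1 \<in> E1 & norm (u0, eps)<=dl & norm v1<=dl0} (%(u0, eps, v1). V0 u0 eps v1)"
   unfolding sobolev_analytic_on_def
  proof clarify
   fix u0 eps v1 assume x: "norm (u0 :: real ^ 'm, eps :: real)<=dl" "norm (v1 :: real ^ 'm)<=dl0"
   show "(%h. case (u0, eps, v1)+h of (u0, eps, v1) => V0 u0 eps v1) \<in> sobolev_analytic T l (E0 \<times> UNIV \<times> E1) E0"
    using an(1)[OF l3(1) f3(1) l3(2) f3(2) x] by (simp add: V0_def[abs_def] case_prod_unfold)
  qed
  have aV1: "sobolev_analytic_on T l (E0 \<times> UNIV \<times> E1) E1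
     {(u0, eps, v1). u0 \<in> E0 & v1 \<in> E1 & norm (u0, eps)<=dl & norm v1<=dl0} (%(u0, eps, v1). V1 u0 eps v1)"
   unfolding sobolev_analytic_on_def
  proof clarify
   fix u0 eps v1 assume x: "norm (u0 :: real ^ 'm, eps :: real)<=dl" "norm (v1 :: real ^ 'm)<=dl0"
   show "(%h. case (u0, eps, v1)+h of (u0, eps, v1) => V1 u0 eps v1) \<in> sobolev_analytic T l (E0 \<times> UNIV \<times> E1) E1"
    using an(2)[OF l3(1) f3(1) l3(2) f3(2) x] by (simp add: V1_def[abs_def] case_prod_unfold)
  qed
  have aR: "sobolev_analytic_on T l (E0 \<times> UNIV) E1 {(u0, eps). u0 \<in> E0 & norm (u0, eps)<=dl} (%(u0, eps). R u0 eps)"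
   unfolding sobolev_analytic_on_def
  proof clarify
   fix u0 eps assume x: "norm (u0 :: real ^ 'm, eps :: real)<=dl"
   show "(%h. case (u0, eps)+h of (u0, eps) => R u0 eps) \<in> sobolev_analytic T l (E0 \<times> UNIV) E1"
    using an(3)[OF le(1) fe(1) le(2) fe(2) x zdl] by (simp add: R_def[abs_def] case_prod_unfold)
  qed
  have c0: "V0 u 0 v t = V0 u 0 v 0" "V1 u 0 v t = V1 u 0 v 0" "R u 0 t = R u 0 0" for u v t
   unfolding V0_def V1_def R_def VSUb_const[OF ctx, of u v t] V1x_const[OF ctx, of u v t] Rx_const[OF ctx, of u t] by simp_all
  have aA0: "analytic_maps_on (E0 \<times> E1) E0 {(u0, v1). u0 \<in> E0 & v1 \<in> E1 & norm u0<=dl & norm v1<=dl0} (%(u0, v1). V0 u0 0 v1 0)"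
   unfolding analytic_maps_on_def
  proof clarify
   fix u0 v1 assume x: "norm (u0 :: real ^ 'm)<=dl" "norm (v1 :: real ^ 'm)<=dl0"
   have x': "norm (u0, 0::real)<=dl" using x by simp
   have "(%h t. V0 (u0+fst h) 0 (v1+snd h) t) \<in> sobolev_analytic T l (E0 \<times> E1) E0"
    using an(1)[OF l2(1) f2(1) l2(2) f2(2) x' x(2)] by (simp add: V0_def[abs_def])
   moreover have "(%h t. V0 (u0+fst h) 0 (v1+snd h) t) = (%h t. V0 (u0+fst h) 0 (v1+snd h) 0)" by (intro ext, rule c0(1))
   ultimately have "(%h. V0 (u0+fst h) 0 (v1+snd h) 0) \<in> analytic_maps (E0 \<times> E1) E0" using sobolev_analytic_imp_analytic by simp
   then show "(%h. case (u0, v1)+h of (u0, v1) => V0 u0 0 v1 0) \<in> analytic_maps (E0 \<times> E1) E0" by (simp add: case_prod_unfold)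
  qed
  have aA1: "analytic_maps_on (E0 \<times> E1) E1 {(u0, v1). u0 \<in> E0 & v1 \<in> E1 & norm u0<=dl & norm v1<=dl0} (%(u0, v1). V1 u0 0 v1 0)"
   unfolding analytic_maps_on_def
  proof clarify
   fix u0 v1 assume x: "norm (u0 :: real ^ 'm)<=dl" "norm (v1 :: real ^ 'm)<=dl0"
   have x': "norm (u0, 0::real)<=dl" using x by simp
   have "(%h t. V1 (u0+fst h) 0 (v1+snd h) t) \<in> sobolev_analytic T l (E0 \<times> E1) E1"
    using an(2)[OF l2(1) f2(1) l2(2) f2(2) x' x(2)] by (simp add: V1_def[abs_def])
   moreover have "(%h t. V1 (u0+fst h) 0 (v1+snd h) t) = (%h t. V1 (u0+fst h) 0 (v1+snd h) 0)" by (intro ext, rule c0(2))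
   ultimately have "(%h. V1 (u0+fst h) 0 (v1+snd h) 0) \<in> analytic_maps (E0 \<times> E1) E1" using sobolev_analytic_imp_analytic by simp
   then show "(%h. case (u0, v1)+h of (u0, v1) => V1 u0 0 v1 0) \<in> analytic_maps (E0 \<times> E1) E1" by (simp add: case_prod_unfold)
  qed
  have aAR: "analytic_maps_on E0 E1 {u0. u0 \<in> E0 & norm u0<=dl} (%u0. R u0 0 0)" unfolding analytic_maps_on_def
  proof clarify
   fix u0 assume x: "norm (u0 :: real ^ 'm)<=dl"
   have x': "norm (u0, 0::real)<=dl" using x by simp
   have "(%h t. R (u0+h) 0 t) \<in> sobolev_analytic T l E0 E1" using an(3)[OF l1(1) f1(1) l1(2) f1(2) x' zdl] by (simp add: R_def[abs_def])
   moreover have "(%h t. R (u0+h) 0 t) = (%h t. R (u0+h) 0 0)" by (intro ext, rule c0(3))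
   ultimately show "(%h. R (u0+h) 0 0) \<in> analytic_maps E0 E1" using sobolev_analytic_imp_analytic by simp
  qed
  have tA: "transforms_system E0 E1 L (%u t. A u) (%u0 t. F u0 0 0)
      {(u0, v1). norm u0<=dl & norm v1<=dl0} (%u0 v1 t. V0 u0 0 v1 0) (%u0 v1 t. V1 u0 0 v1 0+R u0 0 0)"
  proof -
   have e1: "V 0 = (%u t. A u)" by (intro ext, rule A[symmetric])
   have e2: "(%u0 t. F u0 0 t) = (%u0 t. F u0 0 0)" by (intro ext, rule Fc)
   have e3: "(%u0 v1 t. V0 u0 0 v1 t) = (%u0 v1 t. V0 u0 0 v1 0)" by (intro ext, rule c0(1))
   have e4: "(%u0 v1 t. V1 u0 0 v1 t+R u0 0 t) = (%u0 v1 t. V1 u0 0 v1 0+R u0 0 0)"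
    by (intro ext arg_cong2[where f="(+)"], rule c0(2), rule c0(3))
   have e5: "norm (u, 0::real) = norm u" for u :: "real ^ 'm" by simp
   show ?thesis using trans[of 0] unfolding e1 e2 e3 e4 e5 .
  qed
  from sobolev_polys_split[OF Fpoly sE1 Fc] obtain BC where pA: "(%u. F u 0 0) \<in> poly_maps k E0 E1"
   and BC: "BC \<in> sobolev_polys T (Suc l) k E0 E1" "\<forall>u\<in>E0. ALL eps t. F u eps t = F u 0 0+eps *\<^sub>R BC u eps t" by blast
  have 1: "(ALL t. F 0 0 t = 0 & ((%(u0, eps). F u0 eps t) has_derivative (%_. 0)) (at (0, 0) within E0 \<times> UNIV))" using F0 dF by blast
  have 2: "\<forall>u0\<in>E0. ALL eps. \<forall>v1\<in>E1. norm (u0, eps)<=dl0 --> norm v1<=dl0 -->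
     V1 u0 eps v1 \<in> sobolev T l E1 & sobolev_norm T l (V1 u0 eps v1)<=M0 * norm v1*(norm (u0, eps)+norm v1)" using Vb(1,2) by blast
  have 3: "\<forall>u0\<in>E0. ALL eps. norm (u0, eps)<=dl --> R u0 eps \<in> sobolev T l E1 & sobolev_norm T l (R u0 eps)<=M * exp (- \<omega> / dl powr b)"
   using Rb(1,2) by blast
  have 4: "\<forall>u0\<in>E0. \<forall>v1\<in>E1. norm u0<=dl0 --> norm v1<=dl0 --> norm (V1 u0 0 v1 0)<=M0 * norm v1*(norm u0+norm v1)"
  proof (intro ballI impI)
   fix u0 v1 :: "real ^ 'm" assume "norm v1<=dl0"
   from Vb(3)[OF this, of u0 0 0] show "norm (V1 u0 0 v1 0)<=M0 * norm v1*(norm u0+norm v1)" by simp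
  qed
  have 5: "\<forall>u0\<in>E0. norm u0<=dl --> norm (R u0 0 0)<=M * exp (- \<omega> / dl powr b)"
  proof (intro ballI impI)
   fix u0 :: "real ^ 'm" assume "norm u0<=dl"
   then have "norm (u0, 0::real)<=dl" by simp
   from Rb(3)[OF this, of 0] show "norm (R u0 0 0)<=M * exp (- \<omega> / dl powr b)" .
  qed
  show ?case unfolding k_def[symmetric] Suc_eq_plus1[symmetric] by (rule bexI[OF _ Fpoly], rule conjI[OF 1], rule conjI)
    (rule exI[of _ V0], rule exI[of _ V1], rule exI[of _ R], intro conjI allI, rule trans, rule aV0, rule aV1, rule aR, rule 2, rule 3,
     rule bexI[OF _ pA], rule bexI[OF _ BC(1)], rule conjI[OF BC(2)], rule conjI[OF F0], rule conjI[OF dFA],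
     rule exI[of _ "%u0 v1. V0 u0 0 v1 0"], rule exI[of _ "%u0 v1. V1 u0 0 v1 0"], rule exI[of _ "%u0. R u0 0 0"],
     intro conjI, rule tA, rule aA0, rule aA1, rule aAR, rule 4, rule 5)
 qed
qed

end

section \<open>Reduction of the theorem to the normal form\<close>

lemma direct_sum_projections:
 fixes L :: "real ^ 'm => real ^ 'm"
 assumes ds: "direct_sum_decomp E0 E1" and L: "linear L" "L ` E0 \<subseteq> E0" "L ` E1 \<subseteq> E1"
 obtains P0 P1 :: "real ^ 'm => real ^ 'm" where "linear P0" "linear P1" "!!u. P0 u+P1 u = u"
  "!!u. P0 u \<in> E0" "!!u. P1 u \<in> E1" "!!u. u \<in> E0 ==> P0 u = u" "!!u. u \<in> E1 ==> P1 u = u"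
  "!!u. P0 (L u) = L (P0 u)" "!!u. P1 (L u) = L (P1 u)"
proof -
 have s: "subspace E0" "subspace E1" "E0 \<inter> E1 = {0}" "!!u. \<exists>u0\<in>E0. \<exists>u1\<in>E1. u = u0+u1"
  using ds by (auto simp: direct_sum_decomp_def)
 define P0 where "P0 u = (SOME a. a \<in> E0 & u - a \<in> E1)" for u
 have ex: "P0 u \<in> E0 & u - P0 u \<in> E1" for u unfolding P0_def by (rule someI_ex) (use s(4)[of u] in force)
 have uniq: "P0 u = a" if "a \<in> E0" "u - a \<in> E1" for u a
 proof -
  have "P0 u - a \<in> E0" using ex that s(1) by (simp add: subspace_diff)
  moreover have "P0 u - a = (u - a) - (u - P0 u)" by simp
  then have "P0 u - a \<in> E1" using ex that s(2) by (metis subspace_diff)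
  ultimately have "P0 u - a = 0" using s(3) by blast
  then show ?thesis by simp
 qed
 have lin0: "linear P0"
 proof (rule linearI)
  show "P0 (x+y) = P0 x+P0 y" for x y using ex[of x] ex[of y] s(1,2) by (intro uniq) (simp_all add: subspace_add add_diff_add)
  show "P0 (c *\<^sub>R x) = c *\<^sub>R P0 x" for c x using ex[of x] s(1,2) by (intro uniq) (simp_all add: subspace_scale flip: scaleR_diff_right)
 qed
 define P1 where "P1 u = u - P0 u" for u
 have lin1: "linear P1" unfolding P1_def by (intro linear_compose_sub linear_ident lin0)
 have PL: "P0 (L u) = L (P0 u)" for u
 proof (rule uniq)
  show "L (P0 u) \<in> E0" using ex L(2) by blast
  have "L (u - P0 u) \<in> E1" using ex L(3) by blast
  then show "L u - L (P0 u) \<in> E1" by (simp add: linear_diff[OF L(1)])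
 qed
 show thesis
 proof (rule that[OF lin0 lin1])
  show "P0 u = u" if "u \<in> E0" for u using that s(2) by (intro uniq) (simp_all add: subspace_0)
  show "P1 u = u" if "u \<in> E1" for u
  proof -
   have "P0 u = 0" using that s(1) by (intro uniq) (simp_all add: subspace_0)
   then show ?thesis by (simp add: P1_def)
  qed
  show "P1 (L u) = L (P1 u)" for u by (simp add: P1_def PL linear_diff[OF L(1)])
 qed (use ex PL in \<open>auto simp: P1_def\<close>)
qed

definition uvec :: "'m option => (real ^ 'm) \<times> real" where
 "uvec i = (case i of None => (0, 1) | Some a => (axis a 1, 0))"

definition vcoord :: "(real ^ 'm) \<times> real => 'm option => real" where
 "vcoord U i = (case i of None => snd U | Some a => vn (fst U) a)"

lemma norm_uvec: "norm (uvec i) = 1" by (cases i) (simp_all add: uvec_def norm_Pair norm_axis_1)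

lemma uvec_expand: "(\<Sum>i\<in>UNIV. vcoord U i *\<^sub>R uvec i) = U"
proof -
 have "(\<Sum>a\<in>UNIV. vn (fst U) a *\<^sub>R (axis a (1::real), 0::real)) = (fst U, 0)"
  using vec_expand[of "fst U"] by (simp add: prod_eq_iff fst_sum snd_sum)
 then show ?thesis by (simp add: UNIV_option_conv sum.reindex vcoord_def uvec_def prod_eq_iff)
qed

lemma words_Suc: "words (Suc q) = (%(i, w). i # w) ` (UNIV \<times> words q)" by (auto simp: words_def length_Suc_conv image_iff)

lemma sum_words_Suc:
 fixes f :: "'i::finite list => 'b::comm_monoid_add"
 shows "(\<Sum>w\<in>words (Suc q). f w) = (\<Sum>i\<in>UNIV. \<Sum>w\<in>words q. f (i # w))"
proof -
 have "inj_on (%(i, w). i # w) (UNIV \<times> (words q :: 'i list set))" by (auto simp: inj_on_def)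
 then show ?thesis unfolding words_Suc by (subst sum.reindex) (simp_all add: sum.cartesian_product case_prod_unfold)
qed

lemma multilinear_expand:
 fixes W :: "((real ^ 'm) \<times> real) list => real ^ 'm"
 assumes W: "symmetric_multilinear q W"
 shows "length pre+k = q ==> W (pre @ replicate k U) = (\<Sum>w\<in>words k. prod_list (map (vcoord U) w) *\<^sub>R W (pre @ map uvec w))"
proof (induction k arbitrary: pre)
 case 0
 have "words 0 = {[] :: 'm option list}" by (auto simp: words_def)
 then show ?case by simp
next
 case (Suc k)
 define us where "us = pre @ U # replicate k U"
 have "length us = q" "length pre < q" using Suc.prems by (auto simp: us_def)
 then have lin: "linear (%x. W (us[length pre := x]))" using W unfolding symmetric_multilinear_def by blast
 have upd: "us[length pre := x] = pre @ x # replicate k U" for x by (simp add: us_def)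
 have "W (pre @ replicate (Suc k) U) = W (us[length pre := (\<Sum>i\<in>UNIV. vcoord U i *\<^sub>R uvec i)])" unfolding uvec_expand upd by simp
 also have "... = (\<Sum>i\<in>UNIV. W (us[length pre := vcoord U i *\<^sub>R uvec i]))" by (rule linear_sum[OF lin])
 also have "... = (\<Sum>i\<in>UNIV. vcoord U i *\<^sub>R W (us[length pre := uvec i]))" by (rule sum.cong[OF refl]) (rule linear_scale[OF lin])
 also have "... = (\<Sum>i\<in>UNIV. vcoord U i *\<^sub>R W (pre @ uvec i # replicate k U))" by (simp only: upd)
 also have "... = (\<Sum>i\<in>UNIV. \<Sum>w\<in>words k. prod_list (map (vcoord U) (i # w)) *\<^sub>R W (pre @ map uvec (i # w)))"
 proof (rule sum.cong[OF refl])
  fix i :: "'m option"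
  have "W ((pre @ [uvec i]) @ replicate k U) = (\<Sum>w\<in>words k. prod_list (map (vcoord U) w) *\<^sub>R W ((pre @ [uvec i]) @ map uvec w))"
   using Suc.prems by (intro Suc.IH) simp
  then show "vcoord U i *\<^sub>R W (pre @ uvec i # replicate k U) = (\<Sum>w\<in>words k. prod_list (map (vcoord U) (i # w)) *\<^sub>R W (pre @ map uvec (i # w)))"
   by (simp add: scaleR_sum_right)
 qed
 finally show ?case by (simp only: sum_words_Suc)
qed

context sobolev_words
begin

definition word_series :: "((real ^ 'm) \<times> real => real => real ^ 'm) => ('m option list => real => real ^ 'm) => real => real => bool" where
 "word_series W w rh c \<longleftrightarrow> rh > 0 & c >= 0 & (ALL x a. HSl (%t. cor (vn (w x t) a)) &
   nm (%t. cor (vn (w x t) a))<=c*(1 / rh) ^ length x) &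
  (ALL U t a. norm U < rh --> (%q. \<Sum>x\<in>words q. prod_list (map (vcoord U) x) * vn (w x t) a) sums vn (W U t) a)"

lemma word_seriesD:
 assumes "word_series W w rh c"
 shows "rh > 0" "c >= 0" "HSl (%t. cor (vn (w x t) a))"
  "nm (%t. cor (vn (w x t) a))<=c*(1 / rh) ^ length x"
  "norm U < rh ==> (%q. \<Sum>x\<in>words q. prod_list (map (vcoord U) x) * vn (w x t) a) sums vn (W U t) a"
 using assms unfolding word_series_def by (simp, simp, simp, simp, rule_tac assms[unfolded word_series_def, THEN conjunct2, THEN conjunct2, THEN conjunct2, THEN spec, THEN spec, THEN spec, THEN mp])

lemma analytic_words:
 fixes W :: "(real ^ 'm) \<times> real => real => real ^ 'm"
 assumes "W \<in> sobolev_analytic T l UNIV UNIV"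
 shows "EX w rh c. word_series W w rh c"
proof -
 from assms obtain W' rh c where w0: "rh > 0 & c > 0 & (ALL q t. symmetric_multilinear q (W' q t)) &
  (ALL q us. length us = q --> (%t. W' q t us) \<in> sobolev T l UNIV &
    sobolev_norm T l (%t. W' q t us)<=c / rh ^ q * prod_list (map norm us)) &
  (\<forall>U\<in>UNIV. norm U < rh --> (ALL t. (%q. W' q t (replicate q U)) sums W U t))"
  unfolding sobolev_analytic_def mem_Collect_eq by (elim exE) (rule that)
 have rh: "rh > 0" "c > 0" and sm: "!!q t. symmetric_multilinear q (W' q t)" using w0 by simp_all
 note w1 = w0[THEN conjunct2, THEN conjunct2, THEN conjunct2]
 define w where "w x t = W' (length x) t (map uvec x)" for x and t :: real
 have S: "(%t. w x t) \<in> sobolev T l UNIV" "sobolev_norm T l (%t. w x t)<=c / rh ^ length x" for x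
 proof -
  have "prod_list (map norm (map uvec x)) = 1" by (induction x) (simp_all add: norm_uvec)
  moreover have "(%t. w x t) \<in> sobolev T l UNIV & sobolev_norm T l (%t. w x t)<=c / rh ^ length x * prod_list (map norm (map uvec x))"
   unfolding w_def by (rule w1[THEN conjunct1, THEN spec, THEN spec, THEN mp]) simp
  ultimately show "(%t. w x t) \<in> sobolev T l UNIV" "sobolev_norm T l (%t. w x t)<=c / rh ^ length x" by simp_all
 qed
 have HSw: "HSl (%t. cor (vn (w x t) a))" for x a using S(1) unfolding sobolev_iff by blast
 show ?thesis unfolding word_series_def
 proof (rule exI[of _ w], rule exI[of _ rh], rule exI[of _ "malg l * c"], intro conjI allI impI)
  show "nm (%t. cor (vn (w x t) a))<=malg l * c*(1 / rh) ^ length x" for x a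
  proof -
   have "hn T l (%t. cor (vn (w x t) a))<=c / rh ^ length x" by (rule order_trans[OF sobolev_norm_bounds(2)[OF HSw] S(2)])
   from mult_left_mono[OF this, of "malg l"] show ?thesis using malg_pos by (simp add: nm_def power_one_over)
  qed
  fix U :: "(real ^ 'm) \<times> real" and t a assume U: "norm U < rh"
  have "(%q. W' q t (replicate q U)) sums W U t" by (rule w1[THEN conjunct2, THEN bspec, OF UNIV_I, THEN mp, OF U, THEN spec])
  then have "(%q. vn (W' q t (replicate q U)) a) sums vn (W U t) a" by (rule bounded_linear.sums[OF bounded_linear_vec_nth])
  moreover have "vn (W' q t (replicate q U)) a = (\<Sum>x\<in>words q. prod_list (map (vcoord U) x) * vn (w x t) a)" for q
  proof -
   have "W' q t ([] @ replicate q U) = (\<Sum>x\<in>words q. prod_list (map (vcoord U) x) *\<^sub>R W' q t ([] @ map uvec x))"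
    by (rule multilinear_expand[OF sm]) simp
   also have "... = (\<Sum>x\<in>words q. prod_list (map (vcoord U) x) *\<^sub>R w x t)" by (intro sum.cong) (auto simp: w_def words_def)
   finally show ?thesis by (simp add: sum_component)
  qed
  ultimately show "(%q. \<Sum>x\<in>words q. prod_list (map (vcoord U) x) * vn (w x t) a) sums vn (W U t) a" by simp
 qed (use rh malg_pos HSw in auto)
qed

lemma sums_shift_eps:
 fixes f :: "'m::finite option list => real"
 assumes "(%q. \<Sum>x\<in>words q. prod_list (map (vcoord U) x) * f x) sums y"
 shows "(%q. \<Sum>x\<in>words q. prod_list (map (vcoord U) x)*(case x of [] => 0 | i # x' => if i = None then f x' else 0)) sums (snd U * y)"
proof -
 define g where "g q = (\<Sum>x\<in>words q. prod_list (map (vcoord U) x)*(case x of [] => 0 | i # x' => if i = None then f x' else 0))" for q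
 have g0: "g 0 = 0" by (auto simp: g_def words_def intro!: sum.neutral)
 have "g (Suc q) = snd U*(\<Sum>x\<in>words q. prod_list (map (vcoord U) x) * f x)" for q
 proof -
  have "g (Suc q) = (\<Sum>i\<in>(UNIV :: 'm option set). \<Sum>x\<in>words q. if i = None then snd U*(prod_list (map (vcoord U) x) * f x) else 0)"
   unfolding g_def sum_words_Suc by (rule sum.cong[OF refl], rule sum.cong[OF refl]) (simp add: vcoord_def)
  also have "... = (\<Sum>i\<in>(UNIV :: 'm option set). if i = None then (\<Sum>x\<in>words q. snd U*(prod_list (map (vcoord U) x) * f x)) else 0)"
   by (rule sum.cong[OF refl]) auto
  finally show ?thesis by (simp add: sum_distrib_left)
 qed
 then have "(%q. g (Suc q)) sums (snd U * y)" using sums_mult[OF assms, of "snd U"] by simp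
 from sums_Suc[OF this] have "g sums (snd U * y)" by (simp add: g0)
 then show ?thesis unfolding g_def .
qed

lemma linear_coefficient_zero:
 fixes f :: "real => real" and c :: "nat => real"
 assumes "rh > 0" "!!x. \<bar>x\<bar> < rh ==> (%q. c q * x ^ q) sums f x" "(f has_real_derivative 0) (at 0)"
 shows "c 1 = 0"
proof -
 have "summable (%n. c n*(rh / 2) ^ n)" using assms(2)[of "rh / 2"] assms(1) by (auto simp: sums_iff)
 then have "DERIV (%x. \<Sum>n. c n * x ^ n) 0 :> (\<Sum>n. diffs c n*0 ^ n)" using assms(1) by (intro termdiffs_strong) auto
 moreover have "(\<Sum>n. diffs c n*0 ^ n) = c 1" unfolding powser_zero by (simp add: diffs_def)
 ultimately have D: "DERIV (%x. \<Sum>n. c n * x ^ n) 0 :> c 1" by simp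
 have "DERIV f 0 :> c 1"
 proof (rule has_field_derivative_transform_within_open[OF D, of "ball 0 rh"])
  show "(\<Sum>n. c n * x ^ n) = f x" if "x \<in> ball 0 rh" for x using assms(2)[of x] that by (simp add: sums_iff dist_real_def)
 qed (use assms(1) in auto)
 then show ?thesis using assms(3) DERIV_unique by blast
qed

lemma field_words:
 fixes A :: "real ^ 'm => real ^ 'm" and B :: "real ^ 'm => real => real => real ^ 'm" and C :: "real => real => real ^ 'm"
 assumes A0: "A 0 = 0" and DA: "(A has_derivative (%_. 0)) (at 0)" and B0: "!!eps t. B 0 eps t = 0"
  and A: "(%(u, eps) t. A u) \<in> sobolev_analytic T l (UNIV :: ((real ^ 'm) \<times> real) set) UNIV"
  and B: "(%(u, eps) t. B u eps t) \<in> sobolev_analytic T l (UNIV :: ((real ^ 'm) \<times> real) set) UNIV"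
  and C: "(%(u, eps) t. C eps t) \<in> sobolev_analytic T l (UNIV :: ((real ^ 'm) \<times> real) set) UNIV"
 shows "EX (v :: 'm option list => real => real ^ 'm) cv ka rh.
  (ALL w a. HSl (%t. cor (vn (v w t) a)) & malg l * hn T l (%t. cor (vn (v w t) a))<=cv * ka ^ length w) &
  cv >= 0 & ka > 0 & (ALL w t. None \<notin> set w --> v w t = v w 0) & (ALL w t. length w < 2 --> v w t = 0) & rh > 0 &
  (ALL (u :: real ^ 'm) (eps :: real) t a. norm (u, eps) < rh --> (%q. \<Sum>w\<in>words q. prod_list (map (vcoord (u, eps)) w) * vn (v w t) a)
    sums vn (A u+eps *\<^sub>R B u eps t+eps\<^sup>2 *\<^sub>R C eps t) a)"
proof -
 from analytic_words[OF A] obtain wA rhA cA where kA: "word_series (%(u, eps) t. A u) wA rhA cA" by (elim exE) (rule that)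
 note wA = word_seriesD(1-4)[OF kA] and sA = word_seriesD(5)[OF kA]
 from analytic_words[OF B] obtain wB rhB cB where kB: "word_series (%(u, eps) t. B u eps t) wB rhB cB" by (elim exE) (rule that)
 note wB = word_seriesD(1-4)[OF kB] and sB = word_seriesD(5)[OF kB]
 from analytic_words[OF C] obtain wC rhC cC where kC: "word_series (%(u, eps) t. C eps t) wC rhC cC" by (elim exE) (rule that)
 note wC = word_seriesD(1-4)[OF kC] and sC = word_seriesD(5)[OF kC]
 have at0: "vn (w [] t) a = 0" if "(%q. \<Sum>x\<in>words q. prod_list (map (vcoord (0, 0)) x) * vn (w x t) a) sums 0"
  for w :: "'m option list => real => real ^ 'm" and t a
 proof -
  have "prod_list (map (vcoord (0, 0)) x) = 0" if "length x = Suc q" for x :: "'m option list" and q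
   using that by (cases x) (auto simp: vcoord_def split: option.split)
  then have "(\<Sum>x\<in>words (Suc q). prod_list (map (vcoord (0, 0)) x) * vn (w x t) a) = 0" for q by (intro sum.neutral) (auto simp: words_def)
  then have "(%q. \<Sum>x\<in>words q. prod_list (map (vcoord (0, 0)) x) * vn (w x t) a) sums (\<Sum>x\<in>words 0. prod_list (map (vcoord (0, 0)) x) * vn (w x t) a)"
   using sums_finite[of "{0}" "%q. \<Sum>x\<in>words q. prod_list (map (vcoord (0, 0)) x) * vn (w x t) a"]
   by (metis (no_types, lifting) finite.emptyI finite_insert not0_implies_Suc singletonI sum.empty sum.insert add_0_right empty_iff)
  moreover have "words 0 = {[] :: 'm option list}" by (auto simp: words_def)
  ultimately show ?thesis using that sums_unique2 by fastforce
 qed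
 have wA0: "vn (wA [] 0) a = 0" for a using sA[of "(0, 0)" 0 a] wA(1) A0 by (intro at0) simp
 have wB0: "vn (wB [] t) a = 0" for t a using sB[of "(0, 0)" t a] wB(1) B0 by (intro at0) simp
 have wA1: "vn (wA [Some d] 0) a = 0" for d a
 proof -
  define c where "c q = vn (wA (replicate q (Some d)) 0) a" for q
  have pr: "prod_list (map (vcoord (x *\<^sub>R axis d 1, 0)) w) = (if w = replicate (length w) (Some d) then x ^ length w else 0)" for x :: real and w :: "'m option list"
  proof (induction w)
   case (Cons i w)
   have "vcoord (x *\<^sub>R axis d 1, 0) i = (if i = Some d then x else 0)" by (auto simp: vcoord_def axis_def split: option.split)
   with Cons show ?case by auto
  qed simp
  have "(%q. c q * x ^ q) sums vn (A (x *\<^sub>R axis d 1)) a" if "\<bar>x\<bar> < rhA" for x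
  proof -
   have "(\<Sum>w\<in>words q. prod_list (map (vcoord (x *\<^sub>R axis d 1, 0)) w) * vn (wA w 0) a) = c q * x ^ q" for q
   proof -
    have "(\<Sum>w\<in>words q. prod_list (map (vcoord (x *\<^sub>R axis d 1, 0)) w) * vn (wA w 0) a)
     = (\<Sum>w\<in>words q. if w = replicate q (Some d) then c q * x ^ q else 0)" unfolding pr by (intro sum.cong refl) (auto simp: words_def c_def)
    also have "... = c q * x ^ q" by (simp add: words_def sum.delta[OF finite_words, unfolded words_def])
    finally show ?thesis .
   qed
   moreover have "norm (x *\<^sub>R axis d (1::real), 0::real) < rhA" using that by (simp add: norm_axis_1)
   ultimately show ?thesis using sA[of "(x *\<^sub>R axis d 1, 0)" 0 a] by simp
  qed
  moreover have "((%x. vn (A (x *\<^sub>R axis d 1)) a) has_real_derivative 0) (at 0)"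
  proof -
   have "((%x::real. x *\<^sub>R axis d (1::real)) has_derivative (%x. x *\<^sub>R axis d 1)) (at 0)" by (auto intro!: derivative_eq_intros)
   from has_derivative_compose[OF this, of A "%_. 0"] DA
   have "((%x::real. A (x *\<^sub>R axis d 1)) has_derivative (%_. 0)) (at 0)" by simp
   then have "((%x::real. vn (A (x *\<^sub>R axis d 1)) a) has_derivative (%_. 0)) (at 0)"
    using bounded_linear.has_derivative[OF bounded_linear_vec_nth, of "%x::real. A (x *\<^sub>R axis d 1)" "%_. 0" "at 0" a] by simp
   then show ?thesis unfolding has_field_derivative_def lambda_zero .
  qed
  ultimately have "c 1 = 0" using wA(1) by (intro linear_coefficient_zero) auto
  then show ?thesis by (simp add: c_def)
 qed
 define ka where "ka = 1+1 / rhA+1 / rhB+1 / rhC"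
 have ka: "ka >= 1" "1 / rhA<=ka" "1 / rhB<=ka" "1 / rhC<=ka" using wA(1) wB(1) wC(1) by (simp_all add: ka_def)
 define sh where "sh f x t = (case x of [] => 0 | i # x' => if i = None then f x' t else 0)"
  for f :: "'m option list => real => real ^ 'm" and x and t :: real
 define vA where "vA x t = (if None \<in> set x \<or> length x < 2 then 0 else wA x 0)" for x and t :: real
 define v where "v x t = vA x t+sh wB x t+sh (sh wC) x t" for x t
 have z: "HSl (%t. cor (vn (0::real ^ 'm) a))" "nm (%t. cor (vn (0::real ^ 'm) a))<=0" for a using HS_const(1)[of l 0] nm_const[of 0] by simp_all
 have shb: "HSl (%t. cor (vn (sh f x t) a)) & nm (%t. cor (vn (sh f x t) a))<=c * ka ^ length x"
  if f: "!!x a. HSl (%t. cor (vn (f x t) a)) & nm (%t. cor (vn (f x t) a))<=c * ka ^ length x" and c: "c >= 0"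
  for f x a c
 proof (cases "EX x'. x = None # x'")
  case True
  then obtain x' where x: "x = None # x'" by blast
  have "c * ka ^ length x'<=c * ka ^ length x" using ka(1) c x by (intro mult_left_mono power_increasing) auto
  then show ?thesis using f[of x' a] x by (auto simp: sh_def)
 next
  case False
  then have "sh f x t = 0" for t by (auto simp: sh_def split: list.split)
  moreover have "0<=c * ka ^ length x" using ka(1) c by simp
  ultimately show ?thesis using z[of a] by simp
 qed
 have pw: "c*(1 / r) ^ n<=c * ka ^ n" if "c >= 0" "r > 0" "1 / r<=ka" for c r n using that by (intro mult_left_mono power_mono) auto
 have bB: "HSl (%t. cor (vn (wB x t) a)) & nm (%t. cor (vn (wB x t) a))<=cB * ka ^ length x" for x a
  using wB(3) order_trans[OF wB(4) pw[OF wB(2,1) ka(3)]] by blast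
 have bC: "HSl (%t. cor (vn (wC x t) a)) & nm (%t. cor (vn (wC x t) a))<=cC * ka ^ length x" for x a
  using wC(3) order_trans[OF wC(4) pw[OF wC(2,1) ka(4)]] by blast
 have bA: "HSl (%t. cor (vn (vA x t) a)) & nm (%t. cor (vn (vA x t) a))<=(malg l * cA) * ka ^ length x" for x a
 proof (cases "None \<in> set x \<or> length x < 2")
  case True
  moreover have "0<=(malg l * cA) * ka ^ length x" using ka(1) wA(2) malg_pos by simp
  ultimately show ?thesis using z[of a] by (simp add: vA_def)
 next
  case False
  have "nm (%t. cor (vn (wA x 0) a))<=malg l * norm (cor (vn (wA x 0) a))" by (rule nm_const)
  also have "...<=malg l*(cA * ka ^ length x)"
   using malg_pos order_trans[OF sup_le_nm[OF wA(3)[of x a], of 0] order_trans[OF wA(4) pw[OF wA(2,1) ka(2)]]] by (intro mult_left_mono) auto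
  finally show ?thesis using False HS_const(1)[of l] by (simp add: vA_def mult.assoc)
 qed
 note bB' = shb[of wB cB, OF bB wB(2)]
 note bC' = shb[of "sh wC" cC, OF shb[of wC cC, OF bC wC(2)] wC(2)]
 have e: "(%t. cor (vn (v x t) a)) = (%t. (cor (vn (vA x t) a)+cor (vn (sh wB x t) a))+cor (vn (sh (sh wC) x t) a))" for x a
  by (simp add: v_def fun_eq_iff)
 show ?thesis unfolding nm_def[symmetric]
 proof (rule exI[of _ v], rule exI[of _ "malg l * cA+cB+cC"], rule exI[of _ ka], rule exI[of _ "min rhA (min rhB rhC)"], intro conjI allI impI)
  fix x a
  have h: "HSl (%t. cor (vn (vA x t) a)+cor (vn (sh wB x t) a))" using bA bB' by (intro HS_add(1)) blast+
  show "HSl (%t. cor (vn (v x t) a))" unfolding e by (rule HS_add(1)[OF h]) (rule bC'[THEN conjunct1])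
  have "nm (%t. cor (vn (v x t) a))<=nm (%t. cor (vn (vA x t) a))+nm (%t. cor (vn (sh wB x t) a))+nm (%t. cor (vn (sh (sh wC) x t) a))"
   unfolding e
   using nm_add[OF h, of "%t. cor (vn (sh (sh wC) x t) a)"] nm_add[of "%t. cor (vn (vA x t) a)" "%t. cor (vn (sh wB x t) a)"] bA[of x a] bB'[of x a] bC'[of x a] by linarith
  then show "nm (%t. cor (vn (v x t) a))<=(malg l * cA+cB+cC) * ka ^ length x"
   using bA[of x a] bB'[of x a] bC'[of x a] by (simp only: distrib_right) linarith
 next
  show "malg l * cA+cB+cC >= 0" using wA(2) wB(2) wC(2) malg_pos by simp
  show "ka > 0" using ka(1) by simp
  show "v x t = v x 0" if "None \<notin> set x" for x t using that by (auto simp: v_def vA_def sh_def split: list.split)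
  show "v x t = 0" if "length x < 2" for x t
  proof (cases x)
   case (Cons i x')
   then have "x' = []" using that by simp
   then show ?thesis using Cons wB0 by (auto simp: v_def vA_def sh_def vec_eq_iff)
  qed (simp add: v_def vA_def sh_def)
  show "min rhA (min rhB rhC) > 0" using wA(1) wB(1) wC(1) by simp
  fix u :: "real ^ 'm" and eps t :: real and a assume n: "norm (u, eps) < min rhA (min rhB rhC)"
  have n0: "norm (u, 0::real) < rhA" using n norm_fst_le[of u eps] by simp
  have 1: "(%q. \<Sum>x\<in>words q. prod_list (map (vcoord (u, eps)) x) * vn (vA x t) a) sums vn (A u) a"
  proof -
   have "prod_list (map (vcoord (u, eps)) x) * vn (vA x t) a = prod_list (map (vcoord (u, 0)) x) * vn (wA x 0) a" for x
   proof (cases "None \<in> set x")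
    case True
    then have "prod_list (map (vcoord (u, 0)) x) = 0" by (auto simp: prod_list_zero_iff image_iff vcoord_def intro!: bexI[of _ None])
    then show ?thesis using True by (simp add: vA_def)
   next
    case False
    have "map (vcoord (u, eps)) x = map (vcoord (u, 0)) x" using False by (auto simp: vcoord_def split: option.split)
    moreover have "vn (vA x t) a = vn (wA x 0) a"
    proof (cases "length x < 2")
     case True
     then consider "x = []" | i where "x = [i]" by (cases x) auto
     then show ?thesis
     proof cases
      case 2
      then obtain d where "x = [Some d]" using False by (cases i) auto
      then show ?thesis using wA1 by (simp add: vA_def)
     qed (use wA0 in \<open>simp add: vA_def\<close>)
    qed (use False in \<open>simp add: vA_def\<close>)
    ultimately show ?thesis by (simp only:)
   qed
   then show ?thesis using sA[OF n0, of 0 a] by simp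
  qed
  have shn: "vn (sh f x t) a = (case x of [] => 0 | i # x' => if i = None then vn (f x' t) a else 0)" for f x by (simp add: sh_def split: list.split)
  have 2: "(%q. \<Sum>x\<in>words q. prod_list (map (vcoord (u, eps)) x) * vn (sh wB x t) a) sums (eps * vn (B u eps t) a)"
   using sums_shift_eps[OF sB[of "(u, eps)" t a]] n by (simp add: shn)
  have 3: "(%q. \<Sum>x\<in>words q. prod_list (map (vcoord (u, eps)) x) * vn (sh wC x t) a) sums (eps * vn (C eps t) a)"
   using sums_shift_eps[OF sC[of "(u, eps)" t a]] n by (simp add: shn)
  have 4: "(%q. \<Sum>x\<in>words q. prod_list (map (vcoord (u, eps)) x) * vn (sh (sh wC) x t) a) sums (eps*(eps * vn (C eps t) a))"
   using sums_shift_eps[OF 3] by (simp add: shn[of "sh wC"])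
  show "(%q. \<Sum>w\<in>words q. prod_list (map (vcoord (u, eps)) w) * vn (v w t) a) sums vn (A u+eps *\<^sub>R B u eps t+eps\<^sup>2 *\<^sub>R C eps t) a"
   using sums_add[OF sums_add[OF 1 2] 4] by (simp add: v_def distrib_left sum.distrib power2_eq_square mult.assoc)
 qed
qed

end

theorem corollary2p1:
  fixes T \<gamma> \<tau> b :: real and m0 m1 l \<nu> :: nat
    and L :: "real ^ 'm \<Rightarrow> real ^ 'm" and E0 E1 :: "(real ^ 'm) set"
    and ev0 ev1 :: "nat \<Rightarrow> complex"
    and V :: "real \<Rightarrow> real ^ 'm \<Rightarrow> real \<Rightarrow> real ^ 'm"
    and A :: "real ^ 'm \<Rightarrow> real ^ 'm"
    and B :: "real ^ 'm \<Rightarrow> real \<Rightarrow> real \<Rightarrow> real ^ 'm"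
    and C :: "real \<Rightarrow> real \<Rightarrow> real ^ 'm"
  assumes "T > 0" and "l \<ge> 1"
    and "direct_sum_decomp E0 E1" and "dim E0 = m0" and "dim E1 = m1"
    and "linear L" and "L ` E0 \<subseteq> E0" and "L ` E1 \<subseteq> E1"
    and "diagonalizable_on E0 L"
    and "eigenvalues_on E0 L m0 ev0" and "eigenvalues_on E1 L m1 ev1"
    and "\<gamma> > 0" and "\<tau> > 0" and "nonresonant T m0 m1 ev0 ev1 \<gamma> \<tau>"
    and "max_jordan_block_size E1 L \<nu>" and "\<tau> * real \<nu> \<le> real l"
    and "\<And>\<epsilon> u t. V \<epsilon> u t = A u + \<epsilon> *\<^sub>R B u \<epsilon> t + \<epsilon>\<^sup>2 *\<^sub>R C \<epsilon> t"
    and "A 0 = 0" and "(A has_derivative (\<lambda>_. 0)) (at 0)"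
    and "\<And>\<epsilon> t. B 0 \<epsilon> t = 0"
    and "(\<lambda>(u, \<epsilon>) t. A u) \<in> sobolev_analytic T l (UNIV :: ((real ^ 'm) \<times> real) set) UNIV"
    and "(\<lambda>(u, \<epsilon>) t. B u \<epsilon> t) \<in> sobolev_analytic T l (UNIV :: ((real ^ 'm) \<times> real) set) UNIV"
    and "(\<lambda>(u, \<epsilon>) t. C \<epsilon> t) \<in> sobolev_analytic T l (UNIV :: ((real ^ 'm) \<times> real) set) UNIV"
    and "b = 1 / (real l + \<tau> * real \<nu> + 1)"
  shows "\<exists>\<delta>0>0. \<exists>M>0. \<exists>M0>0. \<exists>\<omega>>0. \<exists>p :: real \<Rightarrow> nat.
    (\<lambda>\<delta>. real (p \<delta>)) \<in> O[at_right 0](\<lambda>\<delta>. \<delta> powr (- b)) \<and>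
    (\<forall>\<delta>\<in>{0<..<\<delta>0}. \<exists>\<Phi>\<in>sobolev_polys T (l + 1) (p \<delta>) E0 E1.
      (\<forall>t. \<Phi> 0 0 t = 0 \<and>
           ((\<lambda>(u0, \<epsilon>). \<Phi> u0 \<epsilon> t) has_derivative (\<lambda>_. 0)) (at (0, 0) within E0 \<times> UNIV)) \<and>
      (\<exists>V0 V1 R.
        (\<forall>\<epsilon>. transforms_system E0 E1 L (V \<epsilon>) (\<lambda>u0 t. \<Phi> u0 \<epsilon> t)
               {(u0, v1). norm (u0, \<epsilon>) \<le> \<delta> \<and> norm v1 \<le> \<delta>0}
               (\<lambda>u0 v1 t. V0 u0 \<epsilon> v1 t) (\<lambda>u0 v1 t. V1 u0 \<epsilon> v1 t + R u0 \<epsilon> t)) \<and>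
        sobolev_analytic_on T l (E0 \<times> UNIV \<times> E1) E0
          {(u0, \<epsilon>, v1). u0 \<in> E0 \<and> v1 \<in> E1 \<and> norm (u0, \<epsilon>) \<le> \<delta> \<and> norm v1 \<le> \<delta>0}
          (\<lambda>(u0, \<epsilon>, v1). V0 u0 \<epsilon> v1) \<and>
        sobolev_analytic_on T l (E0 \<times> UNIV \<times> E1) E1
          {(u0, \<epsilon>, v1). u0 \<in> E0 \<and> v1 \<in> E1 \<and> norm (u0, \<epsilon>) \<le> \<delta> \<and> norm v1 \<le> \<delta>0}
          (\<lambda>(u0, \<epsilon>, v1). V1 u0 \<epsilon> v1) \<and>
        sobolev_analytic_on T l (E0 \<times> UNIV) E1
          {(u0, \<epsilon>). u0 \<in> E0 \<and> norm (u0, \<epsilon>) \<le> \<delta>}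
          (\<lambda>(u0, \<epsilon>). R u0 \<epsilon>) \<and>
        (\<forall>u0\<in>E0. \<forall>\<epsilon>. \<forall>v1\<in>E1. norm (u0, \<epsilon>) \<le> \<delta>0 \<longrightarrow> norm v1 \<le> \<delta>0 \<longrightarrow>
           V1 u0 \<epsilon> v1 \<in> sobolev T l E1 \<and>
           sobolev_norm T l (V1 u0 \<epsilon> v1) \<le> M0 * norm v1 * (norm (u0, \<epsilon>) + norm v1)) \<and>
        (\<forall>u0\<in>E0. \<forall>\<epsilon>. norm (u0, \<epsilon>) \<le> \<delta> \<longrightarrow>
           R u0 \<epsilon> \<in> sobolev T l E1 \<and>
           sobolev_norm T l (R u0 \<epsilon>) \<le> M * exp (- \<omega> / \<delta> powr b))) \<and>
      (\<exists>\<Phi>A\<in>poly_maps (p \<delta>) E0 E1. \<exists>\<Phi>BC\<in>sobolev_polys T (l + 1) (p \<delta>) E0 E1.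
        (\<forall>u0\<in>E0. \<forall>\<epsilon> t. \<Phi> u0 \<epsilon> t = \<Phi>A u0 + \<epsilon> *\<^sub>R \<Phi>BC u0 \<epsilon> t) \<and>
        \<Phi>A 0 = 0 \<and> (\<Phi>A has_derivative (\<lambda>_. 0)) (at 0 within E0) \<and>
        (\<exists>VA0 VA1 RA.
          transforms_system E0 E1 L (\<lambda>u t. A u) (\<lambda>u0 t. \<Phi>A u0)
            {(u0, v1). norm u0 \<le> \<delta> \<and> norm v1 \<le> \<delta>0}
            (\<lambda>u0 v1 t. VA0 u0 v1) (\<lambda>u0 v1 t. VA1 u0 v1 + RA u0) \<and>
          analytic_maps_on (E0 \<times> E1) E0
            {(u0, v1). u0 \<in> E0 \<and> v1 \<in> E1 \<and> norm u0 \<le> \<delta> \<and> norm v1 \<le> \<delta>0}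
            (\<lambda>(u0, v1). VA0 u0 v1) \<and>
          analytic_maps_on (E0 \<times> E1) E1
            {(u0, v1). u0 \<in> E0 \<and> v1 \<in> E1 \<and> norm u0 \<le> \<delta> \<and> norm v1 \<le> \<delta>0}
            (\<lambda>(u0, v1). VA1 u0 v1) \<and>
          analytic_maps_on E0 E1 {u0. u0 \<in> E0 \<and> norm u0 \<le> \<delta>} RA \<and>
          (\<forall>u0\<in>E0. \<forall>v1\<in>E1. norm u0 \<le> \<delta>0 \<longrightarrow> norm v1 \<le> \<delta>0 \<longrightarrow>
             norm (VA1 u0 v1) \<le> M0 * norm v1 * (norm u0 + norm v1)) \<and>
          (\<forall>u0\<in>E0. norm u0 \<le> \<delta> \<longrightarrow> norm (RA u0) \<le> M * exp (- \<omega> / \<delta> powr b)))))"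
proof -
 obtain P0 P1 :: "real ^ 'm => real ^ 'm" where P: "linear P0" "linear P1" "!!u. P0 u+P1 u = u"
  "!!u. P0 u \<in> E0" "!!u. P1 u \<in> E1" "!!u. u \<in> E0 ==> P0 u = u" "!!u. u \<in> E1 ==> P1 u = u"
  "!!u. P0 (L u) = L (P0 u)" "!!u. P1 (L u) = L (P1 u)" by (rule direct_sum_projections[OF assms(3,6,7,8)]) (rule that)
 obtain n :: nat and z :: "nat => real ^ 'm => complex" and \<mu>0 :: "nat => complex" and e :: "nat => 'm => complex"
  where zl: "!!i. linear (z i)" and zP: "!!i u. z i (P0 u) = z i u"
  and zL: "!!i u. i < n ==> z i (L u) = \<mu>0 i * z i u"
  and ze: "!!u a. cor (vn (P0 u) a) = (\<Sum>i<n. z i u * e i a)"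
  and \<mu>0: "!!i. i < n ==> \<mu>0 i \<in> ev0 ` {..<m0} & cnj (\<mu>0 i) \<in> ev0 ` {..<m0}"
  by (rule eigen_functionals[OF assms(9,10,6,7) P(1,4,6,8)], assumption, rule that)
 define Bz where "Bz = 1+(\<Sum>i<n. onorm (z i))"
 have bl: "bounded_linear (z i)" for i using zl by (simp add: linear_conv_bounded_linear)
 have Bz1: "Bz >= 1" unfolding Bz_def using onorm_pos_le[OF bl] by (simp add: sum_nonneg)
 have zb: "norm (z i u)<=Bz * norm u" if "i < n" for i u
 proof -
  have "onorm (z i)<=(\<Sum>i<n. onorm (z i))" using that onorm_pos_le[OF bl] by (intro member_le_sum) auto
  then have "onorm (z i) * norm u<=Bz * norm u" by (intro mult_right_mono) (auto simp: Bz_def)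
  then show ?thesis using onorm[OF bl, of i u] by linarith
 qed
 define \<zeta> :: "nat => (real ^ 'm) \<times> real => complex" where "\<zeta> i x = (if i < n then z i (fst x) / of_real Bz
  else if i < 2 * n then cnj (z (i - n) (fst x)) / of_real Bz else of_real (snd x))" for i x
 define \<mu> where "\<mu> i = (if i < n then \<mu>0 i else if i < 2 * n then cnj (\<mu>0 (i - n)) else 0)" for i
 define \<sigma> where "\<sigma> i = (if i < n then i+n else if i < 2 * n then i - n else i)" for i
 define cP where "cP a i = (if i < n then e i a * of_real Bz else 0)" for a i
 define s where "s = \<tau> * real \<nu>"
 have s0: "s >= 0" using assms(13) by (simp add: s_def)
 have \<zeta>l: "linear (\<zeta> i)" for i
 proof (rule linearI)
  fix x y :: "(real ^ 'm) \<times> real" and c :: real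
  show "\<zeta> i (x+y) = \<zeta> i x+\<zeta> i y" by (simp add: \<zeta>_def linear_add[OF zl] add_divide_distrib)
  show "\<zeta> i (c *\<^sub>R x) = c *\<^sub>R \<zeta> i x"
   unfolding \<zeta>_def fst_scaleR snd_scaleR linear_scale[OF zl] by (simp add: scaleR_conv_of_real)
 qed
 have \<mu>ev: "\<mu> i = 0 \<or> \<mu> i \<in> ev0 ` {..<m0}" if "i < 2 * n+1" for i
  using \<mu>0[of i] \<mu>0[of "i - n"] by (auto simp: \<mu>_def)
 have "EX K>=0. ALL w. set w \<subseteq> {..<2 * n+1} --> w ~= [] --> (EX M C. ALL k :: int. ALL a b.
    (\<Sum>c\<in>UNIV. mtx L a c * M k c b) = (\<i> * of_real (of_int k*(2 * pi / T))+sum_list (map \<mu> w)) * M k a b - mtx P1 a b &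
    (\<Sum>c\<in>UNIV. mtx P1 a c * M k c b) = M k a b &
    norm (M k a b)<=K * real (length w) powr s &
    sqrt (1+(real_of_int k)\<^sup>2) * norm (M k a b)<=C)" unfolding s_def
  by (rule homological_multipliers[OF assms(15,11,6,8) P(2,5,7) assms(1,14,12,13) \<mu>ev], assumption, assumption)
   (rule exI, rule conjI, assumption, intro allI impI)
 then obtain K where K: "K >= 0" and mult0: "ALL w. set w \<subseteq> {..<2 * n+1} --> w ~= [] --> (EX M C. ALL k :: int. ALL a b.
    (\<Sum>c\<in>UNIV. mtx L a c * M k c b) = (\<i> * of_real (of_int k*(2 * pi / T))+sum_list (map \<mu> w)) * M k a b - mtx P1 a b &
    (\<Sum>c\<in>UNIV. mtx P1 a c * M k c b) = M k a b &
    norm (M k a b)<=K * real (length w) powr s &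
    sqrt (1+(real_of_int k)\<^sup>2) * norm (M k a b)<=C)" by (elim exE conjE) (rule that)
 note mult = mult0[THEN spec, THEN mp, THEN mp]
 have W: "sobolev_words T l \<zeta>" by (intro sobolev_words.intro sobolev_words_axioms.intro period.intro assms(1,2) \<zeta>l)
 interpret W: sobolev_words T l "2 * n+1" \<zeta> by (rule W)
 from W.field_words[OF assms(18-23)] obtain v :: "'m option list => real => real ^ 'm" and cv ka rh where
  vv: "(ALL w a. HS T l (%t. cor (vn (v w t) a)) & W.malg l * hn T l (%t. cor (vn (v w t) a))<=cv * ka ^ length w) &
  cv >= 0 & ka > 0 & (ALL w t. None \<notin> set w --> v w t = v w 0) & (ALL w t. length w < 2 --> v w t = 0) & rh > 0 &
  (ALL (u :: real ^ 'm) (eps :: real) t a. norm (u, eps) < rh --> (%q. \<Sum>w\<in>words q. prod_list (map (vcoord (u, eps)) w) * vn (v w t) a)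
    sums vn (A u+eps *\<^sub>R B u eps t+eps\<^sup>2 *\<^sub>R C eps t) a)" by (elim exE) (rule that)
 have v1: "HS T l (%t. cor (vn (v w t) a))" "W.malg l * hn T l (%t. cor (vn (v w t) a))<=cv * ka ^ length w" for w a
  by (rule vv[THEN conjunct1, THEN spec, THEN spec, THEN conjunct1])
   (rule vv[THEN conjunct1, THEN spec, THEN spec, THEN conjunct2])
 have v2: "cv >= 0" "ka > 0" "rh > 0" using vv by simp_all
 have v3: "v w t = v w 0" if "None \<notin> set w" for w t
  by (rule vv[THEN conjunct2, THEN conjunct2, THEN conjunct2, THEN conjunct1, THEN spec, THEN spec, THEN mp, OF that])
 have v4: "v w t = 0" if "length w < 2" for w t
  by (rule vv[THEN conjunct2, THEN conjunct2, THEN conjunct2, THEN conjunct2, THEN conjunct1, THEN spec, THEN spec, THEN mp, OF that])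
 have v5: "(%q. \<Sum>w\<in>words q. prod_list (map (vcoord (u, eps)) w) * vn (v w t) a) sums vn (V eps u t) a"
  if "norm (u, eps) < rh" for u eps t a unfolding assms(17)
  by (rule vv[THEN conjunct2, THEN conjunct2, THEN conjunct2, THEN conjunct2, THEN conjunct2, THEN conjunct2, THEN spec, THEN spec, THEN spec, THEN spec, THEN mp, OF that])
 have g1: "P0 (P0 u) = P0 u" "P1 (P1 u) = P1 u" for u by (rule P(6)[OF P(4)], rule P(7)[OF P(5)])
 have g2: "\<sigma> i < 2 * n+1 & \<zeta> (\<sigma> i) x = cnj (\<zeta> i x)" if "i < 2 * n+1" for i x
  using that by (auto simp: \<sigma>_def \<zeta>_def)
 have g3: "\<zeta> i (L (fst x), 0) = \<mu> i * \<zeta> i x" if "i < 2 * n+1" for i x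
  using that zL[of i "fst x"] zL[of "i - n" "fst x"] by (auto simp: \<mu>_def \<zeta>_def)
 have g4: "norm (\<zeta> i x)<=norm x" if "i < 2 * n+1" for i x
 proof -
  have f: "norm (fst x)<=norm x" "norm (snd x)<=norm x" using norm_fst_le[of "fst x" "snd x"] norm_snd_le[of "snd x" "fst x"] by simp_all
  have "norm (z j (fst x)) / Bz<=norm x" if "j < n" for j
  proof -
   have "norm (z j (fst x))<=Bz * norm x" using zb[OF that, of "fst x"] mult_left_mono[OF f(1), of Bz] Bz1 by linarith
   then show ?thesis using Bz1 by (simp add: divide_le_eq mult.commute)
  qed
  from this[of i] this[of "i - n"] show ?thesis using f(2) Bz1 by (auto simp: \<zeta>_def norm_divide)
 qed
 have g5: "\<zeta> i (P0 u, r) = \<zeta> i (u, r)" if "i < 2 * n+1" for i u r by (simp add: \<zeta>_def zP)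
 have g6: "2 * n < 2 * n+1" "\<zeta> (2 * n) x = cor (snd x)" for x by (simp_all add: \<zeta>_def)
 have g7: "\<zeta> i (u, r) = \<zeta> i (u, 0)" if "i < 2 * n+1" "i ~= 2 * n" for i u r using that by (auto simp: \<zeta>_def)
 have g8: "cor (vn (P0 (fst x)) a) = (\<Sum>i<2 * n+1. cP a i * \<zeta> i x)" for x a
 proof -
  have "(\<Sum>i<2 * n+1. cP a i * \<zeta> i x) = (\<Sum>i<n. z i (fst x) * e i a)"
   by (rule sum.mono_neutral_cong_right) (use Bz1 in \<open>auto simp: cP_def \<zeta>_def\<close>)
  then show ?thesis by (simp add: ze)
 qed
 have NG: "nf_graph T l (2 * n+1) \<zeta> L P0 P1 \<mu> \<sigma> (2 * n) cP K s v cv ka"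
 proof (intro nf_graph.intro nf_graph_axioms.intro nf_vector.intro nf_vector_axioms.intro normal_form.intro normal_form_axioms.intro W)
 qed (fact assms P g1 g2 g3 g4 g5 g6 g7 g8 K s0 mult v1 v2 v3 v4)+
 interpret G: nf_graph T l "2 * n+1" \<zeta> L P0 P1 \<mu> \<sigma> "2 * n" cP K s v cv ka by (rule NG)
 have VV: "V eps u t = G.VS (u, eps) t" if "norm (u, eps) < rh" for u eps t
 proof -
  have c: "G.cvec U = vcoord U" for U by (rule ext) (simp add: G.cvec_def vcoord_def)
  show ?thesis using sums_unique[OF v5[OF that]] by (simp add: vec_eq_iff G.VS_def c)
 qed
 have AV: "A u = V 0 u t" for u t by (simp add: assms(17))
 have b0: "b > 0" "b*(s+1)<=1" using s0 assms(2,24) by (simp_all add: s_def)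
 obtain bs where bs: "basis_list E0 bs" using assms(10) unfolding eigenvalues_on_def by blast
 have sE1: "subspace E1" using assms(3) by (simp add: direct_sum_decomp_def)
 show ?thesis by (rule G.graph_theorem[where bs=bs and rh=rh]) (fact P sE1 bs v2 VV AV b0)+
qed

end
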